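(* Let $k$ be a positive integer, and let $A_k\supseteq P_k, T_k, S_k$ be the partition monoid and its submonoids of planar partitions, planar perfect matchings (Temperley-Lieb diagrams) and permutations. In the relations below the indices run over all values for which every generator occurring in the relation is defined. (a) The monoid $T_k$ is presented by generators $e_1,\ldots,e_{k-1}$ and relations $$e_i^2=e_i,\qquad e_ie_{i\pm1}e_i=e_i,\qquad e_ie_j=e_je_i\ \text{ for } |i-j|>1 .$$ (b) The monoid $P_k$ is presented by generators $p_1,p_{3/2},p_2,p_{5/2},\ldots,p_{k-1/2},p_k$ and relations $$p_i^2=p_i,\qquad p_ip_{i\pm\frac12}p_i=p_i,\qquad p_ip_j=p_jp_i\ \text{ for } |i-j|>\tfrac12 ,$$ where $i,j\in\{1,\tfrac32,2,\ldots,k\}$. (c) The group $S_k$ is presented by generators $s_1,\ldots,s_{k-1}$ and relations $$s_i^2=1,\qquad s_is_{i+1}s_i=s_{i+1}s_is_{i+1},\qquad s_is_j=s_js_i\ \text{ for } |i-j|>1 .$$ (d) The monoid $A_k$ is presented by generators $s_1,\ldots,s_{k-1}$ and $p_1,p_{3/2},p_2,\ldots,p_{k-1/2},p_k$, with the relations in (b) and (c) together with (here $i$ is an integer) $$s_ip_ip_{i+1}=p_ip_{i+1}s_i=p_ip_{i+1},\qquad s_ip_{i+\frac12}=p_{i+\frac12}s_i=p_{i+\frac12},\qquad s_ip_is_i=p_{i+1},$$ $$s_is_{i+1}p_{i+\frac12}s_{i+1}s_i=p_{i+\frac32},\qquad s_ip_j=p_js_i\ \text{ for } j\ne i-\tfrac12,\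 i,\ i+\tfrac12,\ i+1,\ i+\tfrac32 .$$
   Context: $A_k$ is the set of all set partitions of $\{1,\ldots,k,1',\ldots,k'\}$. A set partition $d$ is drawn as a graph with top vertices $1,\ldots,k$ and bottom vertices $1',\ldots,k'$ (each from left to right) whose connected components are the blocks of $d$. The product $d_1d_2=d_1\circ d_2$ is obtained by placing $d_1$ above $d_2$, identifying the bottom vertex $i'$ of $d_1$ with the top vertex $i$ of $d_2$, and recording the partition induced on the remaining top and bottom vertices, discarding components lying entirely in the middle row. This makes $A_k$ a monoid with identity $\{\{i,i'\}: 1\le i\le k\}$. The propagating number $pn(d)$ is the number of blocks of $d$ containing both an element of $\{1,\ldots,k\}$ and an element of $\{1',\ldots,k'\}$. Submonoids: $S_k=\{d\in A_k: pn(d)=k\}$; $P_k$ is the set of planar $d\in A_k$, i.e. those that can be drawn without edge crossings inside the rectangle formed by the $2k$ vertices; $B_k$ is the set of $d\in A_k$ all of whose blocks have size 2; $T_k=P_k\cap B_k$. Generators, for $1\le i\le k-1$ and $1\le j\le k$ (in each case all unmentioned vertices $r$ lie in blocks $\{r,r'\}$): $p_j$ has blocks $\{j\},\{j'\}$; $p_{i+\frac12}$ has the block $\{i,i+1,i',(i+1)'\}$; $e_i$ has the blocks $\{i,i+1\},\{i',(i+1)'\}$; $s_i$ has the blocks $\{i,(i+1)'\},\{i+1,i'\}$. *)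

theory Defs
  imports
    "HOL-Analysis.Path_Connected"
    "HOL-Algebra.Group"
    "HOL-Library.Disjoint_Sets"
begin

inductive_set word_cong :: "'x set \<Rightarrow> ('x list \<times> 'x list) set \<Rightarrow> ('x list \<times> 'x list) set"
  for X :: "'x set" and R :: "('x list \<times> 'x list) set"
  where
    rel: "(u, v) \<in> R \<Longrightarrow> (u, v) \<in> word_cong X R"
  | refl: "w \<in> lists X \<Longrightarrow> (w, w) \<in> word_cong X R"
  | sym: "(u, v) \<in> word_cong X R \<Longrightarrow> (v, u) \<in> word_cong X R"
  | trans: "(u, v) \<in> word_cong X R \<Longrightarrow> (v, w) \<in> word_cong X R \<Longrightarrow> (u, w) \<in> word_cong X R"
  | ctxt: "(u, v) \<in> word_cong X R \<Longrightarrow> a \<in> lists X \<Longrightarrow> b \<in> lists X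
      \<Longrightarrow> (a @ u @ b, a @ v @ b) \<in> word_cong X R"

text \<open>The relations \<open>R\<close> are meant to lie in \<open>lists X \<times> lists X\<close>; a pair \<open>(u, v)\<close> stands for
  the relation \<open>u = v\<close>.\<close>

definition presented_monoid :: "'x set \<Rightarrow> ('x list \<times> 'x list) set \<Rightarrow> 'x list set monoid" where
  "presented_monoid X R =
     \<lparr>carrier = lists X // word_cong X R,
      mult = (\<lambda>A B. \<Union>a\<in>A. \<Union>b\<in>B. word_cong X R `` {a @ b}),
      one = word_cong X R `` {[]}\<rparr>"

definition monoid_presented_by ::
    "('a, 'm) monoid_scheme \<Rightarrow> 'x set \<Rightarrow> ('x list \<times> 'x list) set \<Rightarrow> ('x \<Rightarrow> 'a) \<Rightarrow> bool" where
  "monoid_presented_by M X R g \<longleftrightarrow>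
     monoid M \<and>
     (\<exists>\<phi> \<in> iso (presented_monoid X R) M. \<forall>x\<in>X. \<phi> (word_cong X R `` {[x]}) = g x)"

text \<open>Group words are words in the letters \<open>(x, True)\<close>, standing for \<open>x\<close>, and \<open>(x, False)\<close>,
  standing for the formal inverse of \<open>x\<close>.  The relations \<open>R\<close> are between positive words.\<close>

definition group_rels ::
    "'x set \<Rightarrow> ('x list \<times> 'x list) set \<Rightarrow> (('x \<times> bool) list \<times> ('x \<times> bool) list) set" where
  "group_rels X R =
     {(map (\<lambda>x. (x, True)) u, map (\<lambda>x. (x, True)) v) |u v. (u, v) \<in> R} \<union>
     {([(x, b), (x, \<not> b)], []) |x b. x \<in> X}"

definition presented_group ::
    "'x set \<Rightarrow> ('x list \<times> 'x list) set \<Rightarrow> ('x \<times> bool) list set monoid" where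
  "presented_group X R = presented_monoid (X \<times> UNIV) (group_rels X R)"

definition group_presented_by ::
    "('a, 'm) monoid_scheme \<Rightarrow> 'x set \<Rightarrow> ('x list \<times> 'x list) set \<Rightarrow> ('x \<Rightarrow> 'a) \<Rightarrow> bool" where
  "group_presented_by G X R g \<longleftrightarrow>
     group G \<and>
     (\<exists>\<phi> \<in> iso (presented_group X R) G.
        \<forall>x\<in>X. \<phi> (word_cong (X \<times> UNIV) (group_rels X R) `` {[(x, True)]}) = g x)"

datatype vertex = Top nat | Bot nat

definition vertices :: "nat \<Rightarrow> vertex set" where
  "vertices k = Top ` {1..k} \<union> Bot ` {1..k}"

definition A_set :: "nat \<Rightarrow> vertex set set set" where
  "A_set k = {d. partition_on (vertices k) d}"

text \<open>Placing \<open>d\<^sub>1\<close> above \<open>d\<^sub>2\<close> gives a picture with three rows of vertices, the bottom row of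
  \<open>d\<^sub>1\<close> and the top row of \<open>d\<^sub>2\<close> both becoming the middle row.\<close>

datatype stack_vertex = Upper nat | Middle nat | Lower nat

fun in_upper :: "vertex \<Rightarrow> stack_vertex" where
  "in_upper (Top i) = Upper i"
| "in_upper (Bot i) = Middle i"

fun in_lower :: "vertex \<Rightarrow> stack_vertex" where
  "in_lower (Top i) = Middle i"
| "in_lower (Bot i) = Lower i"

fun in_outer :: "vertex \<Rightarrow> stack_vertex" where
  "in_outer (Top i) = Upper i"
| "in_outer (Bot i) = Lower i"

definition stack_connected ::
    "vertex set set \<Rightarrow> vertex set set \<Rightarrow> (stack_vertex \<times> stack_vertex) set" where
  "stack_connected d1 d2 = ((\<Union>b\<in>d1. in_upper ` b \<times> in_upper ` b) \<union>
                            (\<Union>b\<in>d2. in_lower ` b \<times> in_lower ` b))\<^sup>*"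

definition diagram_mult :: "nat \<Rightarrow> vertex set set \<Rightarrow> vertex set set \<Rightarrow> vertex set set" where
  "diagram_mult k d1 d2 =
     vertices k // {(v, w) \<in> vertices k \<times> vertices k.
                      (in_outer v, in_outer w) \<in> stack_connected d1 d2}"

text \<open>The diagram with the blocks in \<open>F\<close>, all unmentioned vertices being joined vertically.\<close>

definition with_verticals :: "nat \<Rightarrow> vertex set set \<Rightarrow> vertex set set" where
  "with_verticals k F =
     F \<union> {{Top r, Bot r} |r. r \<in> {1..k} \<and> Top r \<notin> \<Union>F \<and> Bot r \<notin> \<Union>F}"

definition id_diagram :: "nat \<Rightarrow> vertex set set" where
  "id_diagram k = with_verticals k {}"

fun position :: "vertex \<Rightarrow> real \<times> real" where
  "position (Top i) = (real i, 1)"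
| "position (Bot i) = (real i, 0)"

text \<open>\<open>E\<close> is the edge set of a graph on the vertices, each edge being recorded by a pair
  \<open>(v, w)\<close> of its endpoints; the edge \<open>e\<close> is drawn as the arc \<open>\<gamma> e\<close> inside the rectangle spanned
  by the vertices.\<close>

definition planar_drawing ::
    "nat \<Rightarrow> (vertex \<times> vertex) set \<Rightarrow> (vertex \<times> vertex \<Rightarrow> real \<Rightarrow> real \<times> real) \<Rightarrow> bool" where
  "planar_drawing k E \<gamma> \<longleftrightarrow>
     E \<subseteq> vertices k \<times> vertices k \<and>
     (\<forall>(v, w)\<in>E.
        arc (\<gamma> (v, w)) \<and>
        pathstart (\<gamma> (v, w)) = position v \<and>
        pathfinish (\<gamma> (v, w)) = position w \<and>
        path_image (\<gamma> (v, w)) \<subseteq> {1..real k} \<times> {0..1} \<and>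
        path_image (\<gamma> (v, w)) \<inter> position ` vertices k = {position v, position w}) \<and>
     (\<forall>(v, w)\<in>E. \<forall>(v', w')\<in>E. (v, w) \<noteq> (v', w') \<longrightarrow>
        path_image (\<gamma> (v, w)) \<inter> path_image (\<gamma> (v', w'))
          \<subseteq> position ` ({v, w} \<inter> {v', w'}))"

definition graph_components :: "nat \<Rightarrow> (vertex \<times> vertex) set \<Rightarrow> vertex set set" where
  "graph_components k E = vertices k // {(v, w) \<in> vertices k \<times> vertices k. (v, w) \<in> (E \<union> E\<inverse>)\<^sup>*}"

definition planar :: "nat \<Rightarrow> vertex set set \<Rightarrow> bool" where
  "planar k d \<longleftrightarrow> (\<exists>E \<gamma>. planar_drawing k E \<gamma> \<and> graph_components k E = d)"

definition propagating_number :: "vertex set set \<Rightarrow> nat" where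
  "propagating_number d = card {b \<in> d. (\<exists>i. Top i \<in> b) \<and> (\<exists>i. Bot i \<in> b)}"

definition S_set :: "nat \<Rightarrow> vertex set set set" where
  "S_set k = {d \<in> A_set k. propagating_number d = k}"

definition P_set :: "nat \<Rightarrow> vertex set set set" where
  "P_set k = {d \<in> A_set k. planar k d}"

definition B_set :: "nat \<Rightarrow> vertex set set set" where
  "B_set k = {d \<in> A_set k. \<forall>b\<in>d. card b = 2}"

definition T_set :: "nat \<Rightarrow> vertex set set set" where
  "T_set k = P_set k \<inter> B_set k"

definition diagram_monoid :: "nat \<Rightarrow> vertex set set set \<Rightarrow> vertex set set monoid" where
  "diagram_monoid k D = \<lparr>carrier = D, mult = diagram_mult k, one = id_diagram k\<rparr>"

abbreviation A_monoid :: "nat \<Rightarrow> vertex set set monoid" where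
  "A_monoid k \<equiv> diagram_monoid k (A_set k)"

abbreviation P_monoid :: "nat \<Rightarrow> vertex set set monoid" where
  "P_monoid k \<equiv> diagram_monoid k (P_set k)"

abbreviation T_monoid :: "nat \<Rightarrow> vertex set set monoid" where
  "T_monoid k \<equiv> diagram_monoid k (T_set k)"

abbreviation S_monoid :: "nat \<Rightarrow> vertex set set monoid" where
  "S_monoid k \<equiv> diagram_monoid k (S_set k)"

text \<open>\<open>gen_p j\<close> is the symbol \<open>p\<^sub>j\<close>, and \<open>gen_ph i\<close> is the symbol \<open>p\<close> with index \<open>i + 1/2\<close>.\<close>

datatype generator = gen_e nat | gen_s nat | gen_p nat | gen_ph nat

fun index :: "generator \<Rightarrow> rat" where
  "index (gen_e i) = of_nat i"
| "index (gen_s i) = of_nat i"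
| "index (gen_p j) = of_nat j"
| "index (gen_ph i) = of_nat i + 1/2"

fun gen_diagram :: "nat \<Rightarrow> generator \<Rightarrow> vertex set set" where
  "gen_diagram k (gen_e i) =
     with_verticals k {{Top i, Top (i + 1)}, {Bot i, Bot (i + 1)}}"
| "gen_diagram k (gen_s i) =
     with_verticals k {{Top i, Bot (i + 1)}, {Top (i + 1), Bot i}}"
| "gen_diagram k (gen_p j) =
     with_verticals k {{Top j}, {Bot j}}"
| "gen_diagram k (gen_ph i) =
     with_verticals k {{Top i, Top (i + 1), Bot i, Bot (i + 1)}}"

definition e_gens :: "nat \<Rightarrow> generator set" where
  "e_gens k = gen_e ` {1..<k}"

definition s_gens :: "nat \<Rightarrow> generator set" where
  "s_gens k = gen_s ` {1..<k}"

definition p_gens :: "nat \<Rightarrow> generator set" where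
  "p_gens k = gen_p ` {1..k} \<union> gen_ph ` {1..<k}"

definition T_rels :: "nat \<Rightarrow> (generator list \<times> generator list) set" where
  "T_rels k =
     {([x, x], [x]) |x. x \<in> e_gens k} \<union>
     {([x, y, x], [x]) |x y. x \<in> e_gens k \<and> y \<in> e_gens k \<and> \<bar>index x - index y\<bar> = 1} \<union>
     {([x, y], [y, x]) |x y. x \<in> e_gens k \<and> y \<in> e_gens k \<and> \<bar>index x - index y\<bar> > 1}"

definition P_rels :: "nat \<Rightarrow> (generator list \<times> generator list) set" where
  "P_rels k =
     {([x, x], [x]) |x. x \<in> p_gens k} \<union>
     {([x, y, x], [x]) |x y. x \<in> p_gens k \<and> y \<in> p_gens k \<and> \<bar>index x - index y\<bar> = 1/2} \<union>
     {([x, y], [y, x]) |x y. x \<in> p_gens k \<and> y \<in> p_gens k \<and> \<bar>index x - index y\<bar> > 1/2}"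

definition S_rels :: "nat \<Rightarrow> (generator list \<times> generator list) set" where
  "S_rels k =
     {([x, x], []) |x. x \<in> s_gens k} \<union>
     {([gen_s i, gen_s (i+1), gen_s i], [gen_s (i+1), gen_s i, gen_s (i+1)])
        |i. i \<in> {1..<k} \<and> i + 1 \<in> {1..<k}} \<union>
     {([x, y], [y, x]) |x y. x \<in> s_gens k \<and> y \<in> s_gens k \<and> \<bar>index x - index y\<bar> > 1}"

definition SP_rels :: "nat \<Rightarrow> (generator list \<times> generator list) set" where
  "SP_rels k =
     {([gen_s i, gen_p i, gen_p (i+1)], [gen_p i, gen_p (i+1)]) |i. i \<in> {1..<k}} \<union>
     {([gen_p i, gen_p (i+1), gen_s i], [gen_p i, gen_p (i+1)]) |i. i \<in> {1..<k}} \<union>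
     {([gen_s i, gen_ph i], [gen_ph i]) |i. i \<in> {1..<k}} \<union>
     {([gen_ph i, gen_s i], [gen_ph i]) |i. i \<in> {1..<k}} \<union>
     {([gen_s i, gen_p i, gen_s i], [gen_p (i+1)]) |i. i \<in> {1..<k}} \<union>
     {([gen_s i, gen_s (i+1), gen_ph i, gen_s (i+1), gen_s i], [gen_ph (i+1)])
        |i. i \<in> {1..<k} \<and> i + 1 \<in> {1..<k}} \<union>
     {([gen_s i, x], [x, gen_s i])
        |i x. i \<in> {1..<k} \<and> x \<in> p_gens k \<and>
              index x \<notin> {of_nat i - 1/2, of_nat i, of_nat i + 1/2, of_nat i + 1, of_nat i + 3/2}}"

definition A_rels :: "nat \<Rightarrow> (generator list \<times> generator list) set" where
  "A_rels k = P_rels k \<union> S_rels k \<union> SP_rels k"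

end

(* A diagram is encoded by its equivalence relation on the coordinates -k, ..., -1 (top) and 1, ..., k
   (bottom), and a word by the effect of its letters on the identity relation. Completeness of the
   relations is shown by normal forms. For T_k these are Jones normal forms; P_k is reduced to T_(2k) by
   doubling every vertex; for S_k one splits off descending words. In A_k every word equals E_R S_sigma
   P_D E_R', where E_R merges the classes of R and P_D cuts the strands in D; R and R' are the
   restrictions of the diagram to the two rows, and any two choices of (sigma, D) for the same diagram
   differ by permutations absorbed by E_R, P_D and E_R'. Planarity is combinatorialised by the Fashoda
   theorem in one direction and by drawing half circles in an annulus in the other. *)
theory Submission
  imports Defs "HOL-Analysis.Fashoda_Theorem" "HOL-Combinatorics.Permutations"
begin

hide_const (open) Finite_Cartesian_Product.transpose Multiset.mult

text \<open>Completeness concerns a quotient of words. It is proved in the Cayley representation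
  \<open>h\<close>, where the relations are equations in a \<open>monoid_mult\<close>. There
  soundness is available as \<open>compat\<close>: words with equal image have equal effect. So
  rewriting a word to some normal form suffices; that this form still describes the same diagram
  costs no second computation. Doubling works for P_k since p_j becomes a cap across the thickened
  vertex j and p_{j+1/2} a cap across the space between j and j+1. Indices differing by 1/2 become
  neighbouring integers, so the relations of (b) are those of (a) for 2k. The relations of A_k speak
  of neighbouring columns, while E_R merges arbitrary ones. The missing elements
  \<open>Q a b\<close> are conjugates of p_{3/2} under permutations taking 1, 2 to a, b. They are
  well defined because permutations fixing 1 and 2 commute with p_{3/2}, and every identity about
  them is conjugate to one on the points 1, 2, 3, 4.\<close>

abbreviation (input) iff_ascii :: "bool \<Rightarrow> bool \<Rightarrow> bool"  (infixr "<->" 25) where "A <-> B \<equiv> A = B"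


section \<open>Presented monoids\<close>

text \<open>A wrapper type, so that composition can become the multiplication of a class
  instance.\<close>

datatype 'a endo = Endo (app: "'a => 'a")

instantiation endo :: (type) monoid_mult
begin
definition one_endo :: "'a endo" where "1 = Endo id"
definition times_endo :: "'a endo => 'a endo => 'a endo" where "f * g = Endo (app f \<circ> app g)"
instance
 by standard (auto simp: one_endo_def times_endo_def o_assoc)
end

abbreviation word_prod :: "('x => 'm::monoid_mult) => 'x list => 'm" where
 "word_prod h w \<equiv> prod_list (map h w)"

lemma word_cong_lists:
 assumes "R \<subseteq> lists X \<times> lists X" "(u, v) \<in> word_cong X R"
 shows "u \<in> lists X \<and> v \<in> lists X"
 using assms(2) by (induction rule: word_cong.induct) (use assms(1) in auto)

lemma equiv_word_cong:
 assumes "R \<subseteq> lists X \<times> lists X"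
 shows "equiv (lists X) (word_cong X R)"
proof (rule equivI)
 show "word_cong X R \<subseteq> lists X \<times> lists X"
  using word_cong_lists[OF assms] by auto
 show "refl_on (lists X) (word_cong X R)"
  by (auto simp: refl_on_def intro: word_cong.refl)
 show "Relation.sym (word_cong X R)"
  by (auto simp: Relation.sym_def intro: word_cong.sym)
 show "Relation.trans (word_cong X R)"
  by (auto simp: Relation.trans_def intro: word_cong.trans)
qed

lemma word_cong_append:
 assumes "R \<subseteq> lists X \<times> lists X" "(a, a') \<in> word_cong X R" "(b, b') \<in> word_cong X R"
 shows "(a @ b, a' @ b') \<in> word_cong X R"
proof -
 have l: "a \<in> lists X" "a' \<in> lists X" "b \<in> lists X" "b' \<in> lists X"
  using word_cong_lists[OF assms(1)] assms(2,3) by auto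
 have "(a @ b, a' @ b) \<in> word_cong X R"
  using word_cong.ctxt[OF assms(2), of "[]" b] l by simp
 moreover have "(a' @ b, a' @ b') \<in> word_cong X R"
  using word_cong.ctxt[OF assms(3), of a' "[]"] l by simp
 ultimately show ?thesis by (rule word_cong.trans)
qed

text \<open>Left multiplication on the congruence classes (the Cayley representation); it makes the
 automation for the type class \<open>monoid_mult\<close> available for computations in a presented monoid.\<close>

lemma faithful_representation:
 assumes R: "R \<subseteq> lists X \<times> lists X"
 obtains h :: "'x => 'x list set endo" where
  "\<And>u v. u \<in> lists X ==> v \<in> lists X ==>
    word_prod h u = word_prod h v <-> (u, v) \<in> word_cong X R"
proof -
 let ?c = "\<lambda>w. word_cong X R `` {w}"
 \<comment> \<open>Sets that are not congruence classes are left fixed, so that equality of two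
   endomorphisms is decided on the classes alone.\<close>
 define h where
  "h = (\<lambda>x. Endo (\<lambda>C. if C \<in> ?c ` lists X then \<Union>c\<in>C. ?c (x # c) else C))"
 note eq = equiv_word_cong[OF R]
 have step: "app (h x) (?c w) = ?c (x # w)" if "x \<in> X" "w \<in> lists X" for x w
 proof -
  have "?c (x # c) = ?c (x # w)" if "c \<in> ?c w" for c
  proof -
   have "(w, c) \<in> word_cong X R" using that by auto
   from word_cong_append[OF R word_cong.refl[of "[x]"] this]
   have "(x # w, x # c) \<in> word_cong X R" using \<open>x \<in> X\<close> by simp
   thus ?thesis using equiv_class_eq[OF eq] by auto
  qed
  moreover have "w \<in> ?c w" using that(2) by (auto intro: word_cong.refl)
  ultimately have "(\<Union>c\<in>?c w. ?c (x # c)) = ?c (x # w)" by blast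
  thus ?thesis using that(2) by (simp add: h_def)
 qed
 have prod: "app (word_prod h u) (?c w) = ?c (u @ w)" if "u \<in> lists X" "w \<in> lists X" for u w
  using that(1)
 proof (induction u)
  case (Cons x u)
  thus ?case using step[of x "u @ w"] that(2) by (simp add: times_endo_def)
 qed (simp add: one_endo_def)
 have other: "app (word_prod h u) C = C" if "C \<notin> ?c ` lists X" for u C
  using that by (induction u) (auto simp: one_endo_def times_endo_def h_def)
 have ap: "(word_prod h u = word_prod h v) = ((u, v) \<in> word_cong X R)"
  if uv: "u \<in> lists X" "v \<in> lists X" for u v
 proof
  assume "word_prod h u = word_prod h v"
  \<comment> \<open>Acting on the class of the empty word returns the class of the word itself; this
    is the faithfulness.\<close>
  with prod[of u "[]"] prod[of v "[]"] uv have "?c u = ?c v" by simp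
  thus "(u, v) \<in> word_cong X R" using eq_equiv_class[OF _ eq uv(2)] by auto
 next
  assume a: "(u, v) \<in> word_cong X R"
  have "app (word_prod h u) C = app (word_prod h v) C" for C
  proof (cases "C \<in> ?c ` lists X")
   case True
   then obtain w where w: "C = ?c w" "w \<in> lists X" by auto
   have "(u @ w, v @ w) \<in> word_cong X R"
    using word_cong_append[OF R a word_cong.refl[OF w(2)]] .
   thus ?thesis using prod uv w equiv_class_eq[OF eq] by simp
  qed (simp add: other)
  thus "word_prod h u = word_prod h v"
   by (metis endo.expand ext)
 qed
 thus ?thesis by (rule that)
qed

text \<open>Evaluation runs from the left, so that appending a letter is one multiplication on the
  right; letters act on the bottom row of a diagram in the same way.\<close>

definition (in monoid) word_eval :: "('x => 'a) => 'x list => 'a" where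
 "word_eval g w = foldl (\<lambda>d x. d \<otimes> g x) \<one> w"

lemma (in monoid) word_eval_simps [simp]:
 "word_eval g [] = \<one>" "word_eval g (w @ [x]) = word_eval g w \<otimes> g x"
 by (simp_all add: word_eval_def)

lemma (in monoid) word_eval_closed [simp]:
 assumes "g ` X \<subseteq> carrier G" "w \<in> lists X"
 shows "word_eval g w \<in> carrier G"
 using assms(2) by (induction w rule: rev_induct) (use assms(1) in auto)

lemma (in monoid) word_eval_append:
 assumes "g ` X \<subseteq> carrier G" "u \<in> lists X" "v \<in> lists X"
 shows "word_eval g (u @ v) = word_eval g u \<otimes> word_eval g v"
 using assms(3)
proof (induction v rule: rev_induct)
 case Nil
 thus ?case using word_eval_closed[OF assms(1,2)] by simp
next
 case (snoc x v)
 hence x: "g x \<in> carrier G" "word_eval g v \<in> carrier G" "v \<in> lists X"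
  using assms(1) by (auto intro!: word_eval_closed[OF assms(1)])
 have "word_eval g (u @ v @ [x]) = word_eval g (u @ v) \<otimes> g x"
  by (metis append_assoc word_eval_simps(2))
 also have "\<dots> = word_eval g u \<otimes> word_eval g v \<otimes> g x" using snoc.IH x(3) by simp
 finally show ?case
  using x word_eval_closed[OF assms(1,2)] by (simp add: m_assoc)
qed

text \<open>\<open>sound\<close> makes evaluation constant on congruence classes, \<open>gen\<close>
  makes it onto, and \<open>complete\<close> separates the classes. All four presentations are
  obtained from these three facts.\<close>

lemma (in monoid) presented_monoid_iso:
 assumes R: "R \<subseteq> lists X \<times> lists X"
  and g: "g ` X \<subseteq> carrier G"
  and sound: "\<And>u v. (u, v) \<in> R ==> word_eval g u = word_eval g v"
  and gen: "\<And>d. d \<in> carrier G ==> \<exists>w\<in>lists X. word_eval g w = d"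
  and complete: "\<And>u v. u \<in> lists X ==> v \<in> lists X ==> word_eval g u = word_eval g v
   ==> (u, v) \<in> word_cong X R"
 shows "\<exists>\<phi> \<in> iso (presented_monoid X R) G. \<forall>x\<in>X. \<phi> (word_cong X R `` {[x]}) = g x"
proof -
 let ?c = "\<lambda>w. word_cong X R `` {w}"
 note eq = equiv_word_cong[OF R]
 have snd: "word_eval g u = word_eval g v" if "(u, v) \<in> word_cong X R" for u v
  using that
 proof (induction rule: word_cong.induct)
  case (ctxt u v a b)
  hence l: "u \<in> lists X" "v \<in> lists X" using word_cong_lists[OF R] by auto
  show ?case
   using ctxt l word_eval_append[OF g] by auto
 qed (auto simp: sound)
 define \<phi> where "\<phi> C = word_eval g (SOME w. w \<in> C)" for C
 have \<phi>: "\<phi> (?c w) = word_eval g w" if "w \<in> lists X" for w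
 proof -
  have "w \<in> ?c w" using that by (auto intro: word_cong.refl)
  hence "(SOME w'. w' \<in> ?c w) \<in> ?c w" by (rule someI)
  thus ?thesis using snd unfolding \<phi>_def by fastforce
 qed
 have carr: "carrier (presented_monoid X R) = ?c ` lists X"
  by (auto simp: presented_monoid_def quotient_def)
 have mult: "mult (presented_monoid X R) (?c u) (?c v) = ?c (u @ v)"
  if "u \<in> lists X" "v \<in> lists X" for u v
 proof -
  have "?c (a @ b) = ?c (u @ v)" if "a \<in> ?c u" "b \<in> ?c v" for a b
   using word_cong_append[OF R, of u a v b] that equiv_class_eq[OF eq] by auto
  moreover have "u \<in> ?c u" "v \<in> ?c v" using that by (auto intro: word_cong.refl)
  ultimately have "(\<Union>a\<in>?c u. \<Union>b\<in>?c v. ?c (a @ b)) = ?c (u @ v)" by blast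
  thus ?thesis by (simp add: presented_monoid_def)
 qed
 have "\<phi> \<in> iso (presented_monoid X R) G"
 proof (rule isoI)
  show "\<phi> \<in> hom (presented_monoid X R) G"
  proof (rule homI; unfold carr; elim imageE; hypsubst)
   fix u v assume uv: "u \<in> lists X" "v \<in> lists X"
   hence "u @ v \<in> lists X" by auto
   with uv show "\<phi> (mult (presented_monoid X R) (?c u) (?c v)) = \<phi> (?c u) \<otimes> \<phi> (?c v)"
    by (metis mult \<phi> word_eval_append[OF g])
  next
   fix u assume "u \<in> lists X"
   thus "\<phi> (?c u) \<in> carrier G" by (metis \<phi> word_eval_closed[OF g])
  qed
  show "bij_betw \<phi> (carrier (presented_monoid X R)) (carrier G)"
  proof (rule bij_betw_imageI)
   show "inj_on \<phi> (carrier (presented_monoid X R))"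
   proof (rule inj_onI; unfold carr; elim imageE; hypsubst)
    fix u v assume uv: "u \<in> lists X" "v \<in> lists X" "\<phi> (?c u) = \<phi> (?c v)"
    hence "(u, v) \<in> word_cong X R" by (metis complete \<phi>)
    thus "?c u = ?c v" by (rule equiv_class_eq[OF eq])
   qed
   show "\<phi> ` carrier (presented_monoid X R) = carrier G"
   proof -
    have "\<phi> ` carrier (presented_monoid X R) = word_eval g ` lists X"
     unfolding carr image_image by (rule image_cong[OF HOL.refl]) (rule \<phi>)
    also have "\<dots> = carrier G" using gen word_eval_closed[OF g] by blast
    finally show ?thesis .
   qed
  qed
 qed
 moreover have "\<phi> (?c [x]) = g x" if "x \<in> X" for x
  using \<phi>[of "[x]"] word_eval_simps(2)[of g "[]" x] that g by (auto simp: word_eval_def image_subset_iff)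
 ultimately show ?thesis by blast
qed

section \<open>Diagrams as equivalence relations\<close>

text \<open>The order of the coordinates runs along the boundary of the rectangle: the top row from
  right to left, then the bottom row from left to right. Planarity thus becomes a condition on the
  order of integers. The coordinate 0 belongs to no vertex; it is sent to \<open>Top 0\<close>,
  which lies outside \<open>vertices k\<close>.\<close>

definition vtx :: "int => vertex" where
 "vtx a = (if a > 0 then Bot (nat a) else Top (nat (- a)))"

fun coord :: "vertex => int" where
 "coord (Top i) = - int i"
| "coord (Bot i) = int i"

definition pts :: "nat => int set" where
 "pts k = {a. a \<noteq> 0 \<and> \<bar>a\<bar> \<le> int k}"

lemma coord_vtx [simp]: "coord (vtx a) = a"
 by (simp add: vtx_def)

lemma vtx_inject [simp]: "vtx a = vtx b <-> a = b"
 by (metis coord_vtx)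

lemma vtx_coord: "v \<in> vertices k ==> vtx (coord v) = v"
 by (cases v) (auto simp: vtx_def vertices_def)

lemma coord_in_pts: "v \<in> vertices k ==> coord v \<in> pts k"
 by (cases v) (auto simp: pts_def vertices_def)

lemma vtx_in_vertices [simp]: "vtx a \<in> vertices k <-> a \<in> pts k"
proof
 assume "vtx a \<in> vertices k"
 from coord_in_pts[OF this] show "a \<in> pts k" by simp
qed (auto simp: vtx_def vertices_def pts_def image_iff Bex_def)

lemma vertices_eq_vtx: "vertices k = vtx ` pts k"
proof (rule subset_antisym)
 show "vertices k \<subseteq> vtx ` pts k"
  using coord_in_pts[of _ k] vtx_coord[of _ k] by (intro subsetI image_eqI[of _ vtx "coord _"]) auto
qed auto

lemma pts_uminus [simp]: "- a \<in> pts k <-> a \<in> pts k"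
 by (auto simp: pts_def)

definition rel :: "vertex set set => int => int => bool" where
 "rel d a b <-> (\<exists>B\<in>d. vtx a \<in> B \<and> vtx b \<in> B)"

definition eqv_on :: "nat => (int => int => bool) => bool" where
 "eqv_on k r <-> (\<forall>a b. r a b \<longrightarrow> a \<in> pts k \<and> b \<in> pts k) \<and> (\<forall>a\<in>pts k. r a a) \<and>
   (\<forall>a b. r a b \<longrightarrow> r b a) \<and> (\<forall>a b c. r a b \<longrightarrow> r b c \<longrightarrow> r a c)"

lemma eqv_onD:
 assumes "eqv_on k r"
 shows "r a b ==> a \<in> pts k" "r a b ==> b \<in> pts k" "a \<in> pts k ==> r a a"
  "r a b ==> r b a" "r a b ==> r b c ==> r a c"
 using assms unfolding eqv_on_def by blast+

definition diag :: "nat => (int => int => bool) => vertex set set" where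
 "diag k r = vertices k // {(v, w) \<in> vertices k \<times> vertices k. r (coord v) (coord w)}"

lemma equiv_diag:
 assumes "eqv_on k r"
 shows "equiv (vertices k) {(v, w) \<in> vertices k \<times> vertices k. r (coord v) (coord w)}"
proof (rule equivI)
 show "refl_on (vertices k) {(v, w) \<in> vertices k \<times> vertices k. r (coord v) (coord w)}"
  using eqv_onD(3)[OF assms] coord_in_pts by (auto simp: refl_on_def)
 show "sym {(v, w) \<in> vertices k \<times> vertices k. r (coord v) (coord w)}"
  using eqv_onD(4)[OF assms] by (auto simp: sym_def)
 show "trans {(v, w) \<in> vertices k \<times> vertices k. r (coord v) (coord w)}"
  using eqv_onD(5)[OF assms] by (auto simp: trans_def)
qed auto

lemma diag_in_A_set: "eqv_on k r ==> diag k r \<in> A_set k"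
 unfolding A_set_def diag_def using equiv_diag by (blast intro: partition_on_quotient)

lemma rel_diag [simp]:
 assumes "eqv_on k r"
 shows "rel (diag k r) = r"
proof (intro ext iffI)
 fix a b
 assume "rel (diag k r) a b"
 then obtain B where B: "B \<in> diag k r" "vtx a \<in> B" "vtx b \<in> B" by (auto simp: rel_def)
 from quotient_eq_iff[OF equiv_diag[OF assms], of B B "vtx a" "vtx b"] B
 show "r a b" by (auto simp: diag_def)
next
 fix a b
 assume r: "r a b"
 let ?R = "{(v, w) \<in> vertices k \<times> vertices k. r (coord v) (coord w)}"
 have "vtx a \<in> vertices k" "vtx b \<in> vertices k" using eqv_onD(1,2)[OF assms r] by auto
 hence B: "?R `` {vtx a} \<in> diag k r" unfolding diag_def by (intro quotientI)
 have "vtx a \<in> ?R `` {vtx a}" "vtx b \<in> ?R `` {vtx a}"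
  using r eqv_onD(1,2)[OF assms r] eqv_onD(3)[OF assms, of a] by auto
 thus "rel (diag k r) a b" unfolding rel_def by (intro bexI[OF _ B] conjI)
qed

lemma eqv_on_rel:
 assumes "d \<in> A_set k"
 shows "eqv_on k (rel d)"
proof -
 have d: "partition_on (vertices k) d" using assms by (simp add: A_set_def)
 note e = equiv_partition_on[OF d]
 let ?R = "{(x, y). \<exists>p\<in>d. x \<in> p \<and> y \<in> p}"
 have r: "rel d a b <-> (vtx a, vtx b) \<in> ?R" for a b by (auto simp: rel_def)
 have sub: "?R \<subseteq> vertices k \<times> vertices k" using e equiv_type by blast
 have t: "refl_on (vertices k) ?R" "trans ?R" using e by (simp_all add: equiv_def)
 show ?thesis
  unfolding eqv_on_def
 proof (intro conjI allI impI ballI)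
  fix a b assume "rel d a b"
  hence ab: "(vtx a, vtx b) \<in> ?R" by (simp only: r)
  from subsetD[OF sub ab] show "a \<in> pts k" "b \<in> pts k" by simp_all
  from \<open>rel d a b\<close> show "rel d b a" unfolding rel_def by blast
  fix c assume "rel d b c"
  hence "(vtx b, vtx c) \<in> ?R" by (simp only: r)
  from transD[OF t(2) ab this] show "rel d a c" by (simp only: r)
 next
  fix a assume "a \<in> pts k"
  hence "vtx a \<in> vertices k" by simp
  from refl_onD[OF t(1) this] show "rel d a a" by (simp only: r)
 qed
qed

lemma diag_rel [simp]:
 assumes "d \<in> A_set k"
 shows "diag k (rel d) = d"
proof -
 have d: "partition_on (vertices k) d" using assms by (simp add: A_set_def)
 have "(v, w) \<in> {(v, w) \<in> vertices k \<times> vertices k. rel d (coord v) (coord w)} <->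
  (v, w) \<in> {(x, y). \<exists>p\<in>d. x \<in> p \<and> y \<in> p}" for v w
 proof (cases "v \<in> vertices k \<and> w \<in> vertices k")
  case True
  thus ?thesis by (simp add: rel_def vtx_coord[of _ k])
 next
  case False
  thus ?thesis using partition_onD1[OF d] by blast
 qed
 hence "{(v, w) \<in> vertices k \<times> vertices k. rel d (coord v) (coord w)} =
  {(x, y). \<exists>p\<in>d. x \<in> p \<and> y \<in> p}"
  by (metis (no_types, lifting) subrelI subset_antisym)
 thus ?thesis unfolding diag_def using partition_on_eq_quotient[OF d] by simp
qed

text \<open>The point with coordinate \<open>a\<close> of a diagram whose top row is row \<open>i\<close> and whose bottom row is
 row \<open>j\<close> of a stack of diagrams.\<close>

definition row_pt :: "nat => nat => int => nat \<times> int" where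
 "row_pt i j a = (if a > 0 then (j, a) else (i, - a))"

definition row_edges :: "nat => nat => (int => int => bool) => ((nat \<times> int) \<times> (nat \<times> int)) set" where
 "row_edges i j r = {(row_pt i j a, row_pt i j b) |a b. r a b}"

text \<open>The product of diagrams in terms of relations, with rows 0, 1, 2 for upper, middle and
  lower. A closure is needed because a path may pass through the middle row many times.\<close>

definition stack_comp :: "nat => (int => int => bool) => (int => int => bool) => int => int => bool" where
 "stack_comp k r1 r2 a b <-> a \<in> pts k \<and> b \<in> pts k \<and>
   (row_pt 0 2 a, row_pt 0 2 b) \<in> (row_edges 0 1 r1 \<union> row_edges 1 2 r2)\<^sup>*"

text \<open>Paths do not depend on the names of the vertices. This translates
  \<open>stack_vertex\<close> into numbered rows and one numbering of rows into another.\<close>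

lemma rtrancl_inj_image:
 assumes "inj f"
 shows "(f x, f y) \<in> (map_prod f f ` G)\<^sup>* <-> (x, y) \<in> G\<^sup>*"
proof
 assume "(x, y) \<in> G\<^sup>*"
 thus "(f x, f y) \<in> (map_prod f f ` G)\<^sup>*"
  by (induction rule: rtrancl_induct) (force intro: rtrancl_into_rtrancl)+
next
 have "(x', y') \<in> (map_prod f f ` G)\<^sup>* ==> x' = f x ==> \<exists>y. y' = f y \<and> (x, y) \<in> G\<^sup>*" for x' y'
 proof (induction rule: rtrancl_induct)
  case (step y' z')
  then obtain y where y: "y' = f y" "(x, y) \<in> G\<^sup>*" by auto
  from step.hyps(2) y obtain z where "z' = f z" "(y, z) \<in> G"
   using assms by (auto dest: injD)
  with y(2) show ?case by (intro exI[of _ z]) (auto intro: rtrancl_into_rtrancl)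
 qed auto
 moreover assume "(f x, f y) \<in> (map_prod f f ` G)\<^sup>*"
 ultimately show "(x, y) \<in> G\<^sup>*" using assms by (metis injD)
qed

fun stack_row :: "stack_vertex => nat \<times> int" where
 "stack_row (Upper i) = (0, int i)"
| "stack_row (Middle i) = (1, int i)"
| "stack_row (Lower i) = (2, int i)"

lemma inj_stack_row: "inj stack_row"
proof (rule injI)
 show "stack_row x = stack_row y ==> x = y" for x y by (cases x; cases y) auto
qed

lemma stack_row_simps:
 "stack_row (in_upper (vtx a)) = row_pt 0 1 a"
 "stack_row (in_lower (vtx a)) = row_pt 1 2 a"
 "stack_row (in_outer (vtx a)) = row_pt 0 2 a"
 by (auto simp: vtx_def row_pt_def)

lemma block_edges:
 assumes "d \<in> A_set k"
 shows "(\<Union>b\<in>d. f ` b \<times> f ` b) = {(f (vtx a), f (vtx b)) |a b. rel d a b}"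
proof -
 have v: "v = vtx (coord v)" if "v \<in> b" "b \<in> d" for v b
 proof -
  have "v \<in> vertices k" using that assms unfolding A_set_def partition_on_def by blast
  thus ?thesis by (simp add: vtx_coord)
 qed
 show ?thesis
 proof (intro equalityI subsetI)
  fix e assume "e \<in> (\<Union>b\<in>d. f ` b \<times> f ` b)"
  then obtain b x y where e: "b \<in> d" "x \<in> b" "y \<in> b" "e = (f x, f y)" by blast
  hence "rel d (coord x) (coord y)" unfolding rel_def using v by metis
  moreover have "e = (f (vtx (coord x)), f (vtx (coord y)))" using e v by metis
  ultimately show "e \<in> {(f (vtx a), f (vtx b)) |a b. rel d a b}" by blast
 next
  fix e assume "e \<in> {(f (vtx a), f (vtx b)) |a b. rel d a b}"
  then obtain a b B where "B \<in> d" "vtx a \<in> B" "vtx b \<in> B" "e = (f (vtx a), f (vtx b))"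
   by (auto simp: rel_def)
  thus "e \<in> (\<Union>b\<in>d. f ` b \<times> f ` b)" by blast
 qed
qed

lemma map_prod_edges:
 "map_prod f f ` {(g a, g b) |a b. P a b} = {(f (g a), f (g b)) |a b. P a b}"
 by (auto simp: image_iff)

text \<open>Both descriptions of the product are connectivity in one graph, renamed by
  \<open>stack_row\<close>.\<close>

lemma rel_mult:
 assumes "d1 \<in> A_set k" "d2 \<in> A_set k"
 shows "diagram_mult k d1 d2 \<in> A_set k" "rel (diagram_mult k d1 d2) = stack_comp k (rel d1) (rel d2)"
proof -
 let ?G = "(\<Union>b\<in>d1. in_upper ` b \<times> in_upper ` b) \<union> (\<Union>b\<in>d2. in_lower ` b \<times> in_lower ` b)"
 have G: "map_prod stack_row stack_row ` ?G = row_edges 0 1 (rel d1) \<union> row_edges 1 2 (rel d2)"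
  unfolding block_edges[OF assms(1)] block_edges[OF assms(2)] row_edges_def image_Un map_prod_edges
   stack_row_simps ..
 have conn: "(in_outer (vtx a), in_outer (vtx b)) \<in> stack_connected d1 d2 <->
   (row_pt 0 2 a, row_pt 0 2 b) \<in> (row_edges 0 1 (rel d1) \<union> row_edges 1 2 (rel d2))\<^sup>*" for a b
  unfolding stack_connected_def G[symmetric] stack_row_simps(3)[symmetric]
  by (rule rtrancl_inj_image[OF inj_stack_row, symmetric])
 have symG: "sym (?G\<^sup>*)" by (rule sym_rtrancl) (auto simp: sym_def)
 have "eqv_on k (stack_comp k (rel d1) (rel d2))"
  unfolding eqv_on_def stack_comp_def conn[symmetric] stack_connected_def
  using symG by (blast dest: symD intro: rtrancl_trans)
 moreover have "diagram_mult k d1 d2 = diag k (stack_comp k (rel d1) (rel d2))"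
 proof -
  have "stack_comp k (rel d1) (rel d2) (coord v) (coord w) <-> (in_outer v, in_outer w) \<in> stack_connected d1 d2"
   if vw: "v \<in> vertices k" "w \<in> vertices k" for v w
   unfolding stack_comp_def conn[symmetric] vtx_coord[OF vw(1)] vtx_coord[OF vw(2)]
   using coord_in_pts[OF vw(1)] coord_in_pts[OF vw(2)] by blast
  hence "{(v, w) \<in> vertices k \<times> vertices k. (in_outer v, in_outer w) \<in> stack_connected d1 d2} =
   {(v, w) \<in> vertices k \<times> vertices k. stack_comp k (rel d1) (rel d2) (coord v) (coord w)}"
   by blast
  thus ?thesis unfolding diagram_mult_def diag_def by simp
 qed
 ultimately show "diagram_mult k d1 d2 \<in> A_set k" "rel (diagram_mult k d1 d2) = stack_comp k (rel d1) (rel d2)"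
  by (simp_all add: diag_in_A_set)
qed

lemma eqv_on_stack_comp:
 assumes "eqv_on k r1" "eqv_on k r2"
 shows "eqv_on k (stack_comp k r1 r2)"
 using eqv_on_rel[OF rel_mult(1)[OF diag_in_A_set[OF assms(1)] diag_in_A_set[OF assms(2)]]] assms
 by (simp add: rel_mult(2) diag_in_A_set)

text \<open>The graphs \<open>A\<close> and \<open>B\<close> touch only in \<open>U\<close>, so
  every excursion of a path into \<open>A\<close> enters and leaves through \<open>U\<close> and can
  be replaced by a single shortcut. This is what allows part of a stack to be multiplied out
  first.\<close>

lemma rtrancl_absorb:
 assumes "Field A \<inter> Field B \<subseteq> U" "x \<in> U \<union> - Field A" "y \<in> U \<union> - Field A"
 shows "(x, y) \<in> (A \<union> B)\<^sup>* <-> (x, y) \<in> ((A\<^sup>* \<inter> U \<times> U) \<union> B)\<^sup>*"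
proof
 let ?A = "A\<^sup>* \<inter> U \<times> U"
 have fld: "z = y \<or> z \<in> Field A \<and> y \<in> Field A" if "(z, y) \<in> A\<^sup>*" for z y
  using that by (metis FieldI1 FieldI2 converse_rtranclE rtranclE)
 assume "(x, y) \<in> (A \<union> B)\<^sup>*"
 \<comment> \<open>Invariant along the path: \<open>z\<close> is a point reached by shortcuts, and
   the rest of the way to the current point is an unfinished excursion in \<open>A\<close>. If
   \<open>z\<close> is outside \<open>Field A\<close>, that excursion is trivial.\<close>
 hence "\<exists>z \<in> U \<union> - Field A. (x, z) \<in> (?A \<union> B)\<^sup>* \<and> (z, y) \<in> A\<^sup>*"
 proof (induction rule: rtrancl_induct)
  case base
  thus ?case using assms(2) by blast
 next
  case (step y y')
  then obtain z where z: "z \<in> U \<union> - Field A" "(x, z) \<in> (?A \<union> B)\<^sup>*" "(z, y) \<in> A\<^sup>*" by blast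
  show ?case
  proof (cases "(y, y') \<in> A")
   case True
   thus ?thesis using z by (meson rtrancl_into_rtrancl)
  next
   case False
   hence B: "(y, y') \<in> B" using step by auto
   hence "y \<in> Field B" "y' \<in> Field B" by (auto simp: Field_def)
   hence "y' \<in> U \<union> - Field A" using assms(1) by auto
   moreover have "(z, y) \<in> (?A \<union> B)\<^sup>*"
    using fld[OF z(3)] z \<open>y \<in> Field B\<close> assms(1) by auto
   ultimately show ?thesis using z(2) B
    by (meson UnCI rtrancl.rtrancl_refl rtrancl_into_rtrancl rtrancl_trans)
  qed
 qed
 then obtain z where z: "z \<in> U \<union> - Field A" "(x, z) \<in> (?A \<union> B)\<^sup>*" "(z, y) \<in> A\<^sup>*" by blast
 hence "(z, y) \<in> (?A \<union> B)\<^sup>*" using fld[OF z(3)] assms(3) by auto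
 with z(2) show "(x, y) \<in> (?A \<union> B)\<^sup>*" by (rule rtrancl_trans)
next
 have "(A\<^sup>* \<inter> U \<times> U) \<union> B \<subseteq> (A \<union> B)\<^sup>*"
  using rtrancl_mono[of A "A \<union> B"] by auto
 thus "(x, y) \<in> ((A\<^sup>* \<inter> U \<times> U) \<union> B)\<^sup>* ==> (x, y) \<in> (A \<union> B)\<^sup>*"
  using rtrancl_subset_rtrancl by blast
qed

lemma stack_comp_rows:
 assumes "distinct [i, m, l]"
 shows "stack_comp k r1 r2 a b <-> a \<in> pts k \<and> b \<in> pts k \<and>
   (row_pt i l a, row_pt i l b) \<in> (row_edges i m r1 \<union> row_edges m l r2)\<^sup>*"
proof -
 \<comment> \<open>The value for \<open>n\<close> beyond 2 exceeds each of \<open>i\<close>,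
   \<open>m\<close>, \<open>l\<close>; it only serves to make \<open>g\<close> injective on all
   numbers.\<close>
 define g where "g n = (if n = 0 then i else if n = 1 then m else if n = 2 then l else n + i + m + l)" for n :: nat
 have g: "inj g" using assms by (auto simp: inj_def g_def)
 define f where "f = map_prod g (id :: int => int)"
 have f: "inj f" using g by (simp add: f_def prod.inj_map)
 have fr: "f (row_pt 0 1 a) = row_pt i m a" "f (row_pt 1 2 a) = row_pt m l a"
  "f (row_pt 0 2 a) = row_pt i l a" for a by (auto simp: f_def row_pt_def g_def)
 have "map_prod f f ` (row_edges 0 1 r1 \<union> row_edges 1 2 r2) = row_edges i m r1 \<union> row_edges m l r2"
  unfolding row_edges_def image_Un map_prod_edges fr ..
 thus ?thesis
  unfolding stack_comp_def fr[symmetric] using rtrancl_inj_image[OF f] by metis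
qed

text \<open>Both bracketings equal connectivity in the stack of all three diagrams, with four rows 0
  to 3: once the inner rows of the first two factors are absorbed, once those of the last
  two.\<close>

lemma stack_comp_assoc:
 assumes e: "eqv_on k r1" "eqv_on k r2" "eqv_on k r3"
 shows "stack_comp k (stack_comp k r1 r2) r3 = stack_comp k r1 (stack_comp k r2 r3)"
proof (intro ext)
 fix a b
 let ?E1 = "row_edges 0 1 r1" and ?E2 = "row_edges 1 2 r2" and ?E3 = "row_edges 2 3 r3"
 have ptsD: "r \<in> {r1, r2, r3, stack_comp k r1 r2, stack_comp k r2 r3} ==> r x y ==> x \<in> pts k \<and> y \<in> pts k" for r x y
  using eqv_onD(1,2)[OF e(1)] eqv_onD(1,2)[OF e(2)] eqv_onD(1,2)[OF e(3)] by (auto simp: stack_comp_def)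
 have fieldE: "Field (row_edges i j r) \<subseteq> row_pt i j ` pts k" if "r \<in> {r1, r2, r3}" for i j r
  using ptsD that unfolding Field_def row_edges_def by fastforce
 have ptI: "\<exists>a\<in>pts k. x = row_pt i l a"
  if x: "x \<in> row_pt i m ` pts k \<or> x \<in> row_pt m l ` pts k" "fst x \<noteq> m" for x i m l
 proof -
  obtain y where "y \<in> pts k" "x = row_pt i m y \<or> x = row_pt m l y" using x(1) by blast
  moreover have "x = row_pt i l y" using calculation(2) x(2) by (auto simp: row_pt_def split: if_splits)
  ultimately show ?thesis by blast
 qed
 have fstF: "fst x = i \<or> fst x = j" if "x \<in> Field (row_edges i j r)" for x i j r
  using that by (auto simp: Field_def row_edges_def row_pt_def)
 have fstP: "fst (row_pt i j a) = i \<or> fst (row_pt i j a) = j" for i j a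
  by (simp add: row_pt_def)
 \<comment> \<open>\<open>Id\<close> is allowed for because the closure has trivial loops at all
   points of the rows, also at those that are no vertices.\<close>
 have repl: "(A\<^sup>* \<inter> U \<times> U \<union> B)\<^sup>* = (E \<union> B)\<^sup>*"
  if "E \<subseteq> A\<^sup>* \<inter> U \<times> U" "A\<^sup>* \<inter> U \<times> U \<subseteq> E \<union> Id" for A B E :: "((nat \<times> int) \<times> nat \<times> int) set" and U
 proof (rule subset_antisym)
  show "(A\<^sup>* \<inter> U \<times> U \<union> B)\<^sup>* \<subseteq> (E \<union> B)\<^sup>*"
  proof (rule rtrancl_subset_rtrancl)
   have "E \<union> Id \<subseteq> (E \<union> B)\<^sup>*" by auto
   thus "A\<^sup>* \<inter> U \<times> U \<union> B \<subseteq> (E \<union> B)\<^sup>*" using that(2) by auto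
  qed
  show "(E \<union> B)\<^sup>* \<subseteq> (A\<^sup>* \<inter> U \<times> U \<union> B)\<^sup>*" by (rule rtrancl_mono) (use that(1) in auto)
 qed
 have comp2: "row_edges i l (stack_comp k r r') \<subseteq> (row_edges i m r \<union> row_edges m l r')\<^sup>* \<inter> U \<times> U
   \<and> (row_edges i m r \<union> row_edges m l r')\<^sup>* \<inter> U \<times> U \<subseteq> row_edges i l (stack_comp k r r') \<union> Id"
  if d: "distinct [i, m, l]" and U: "U = {x. fst x = i \<or> fst x = l}" and r: "r \<in> {r1, r2, r3}" "r' \<in> {r1, r2, r3}"
  for i m l r r' U
 proof (intro conjI subsetI)
  fix e assume "e \<in> row_edges i l (stack_comp k r r')"
  then obtain x y where "e = (row_pt i l x, row_pt i l y)" "stack_comp k r r' x y"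
   by (auto simp: row_edges_def)
  thus "e \<in> (row_edges i m r \<union> row_edges m l r')\<^sup>* \<inter> U \<times> U"
   using stack_comp_rows[OF d] by (auto simp: U row_pt_def)
 next
  fix e assume e: "e \<in> (row_edges i m r \<union> row_edges m l r')\<^sup>* \<inter> U \<times> U"
  obtain x y where xy: "e = (x, y)" by (cases e)
  show "e \<in> row_edges i l (stack_comp k r r') \<union> Id"
  proof (cases "x = y")
   case False
   hence "x \<in> Field (row_edges i m r \<union> row_edges m l r')" "y \<in> Field (row_edges i m r \<union> row_edges m l r')"
    using e xy by (metis FieldI1 FieldI2 IntD1 converse_rtranclE rtranclE)+
   hence "x \<in> row_pt i m ` pts k \<or> x \<in> row_pt m l ` pts k" "y \<in> row_pt i m ` pts k \<or> y \<in> row_pt m l ` pts k"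
    using fieldE r unfolding Field_Un by blast+
   moreover have "fst x \<noteq> m" "fst y \<noteq> m" using e xy d U by auto
   ultimately obtain a b where "a \<in> pts k" "b \<in> pts k" "x = row_pt i l a" "y = row_pt i l b"
    using ptI by meson
   hence "stack_comp k r r' a b" using stack_comp_rows[OF d] e xy by auto
   thus ?thesis using xy \<open>x = _\<close> \<open>y = _\<close> by (auto simp: row_edges_def)
  qed (use xy in auto)
 qed
 have repl2: "((row_edges i m r \<union> row_edges m l r')\<^sup>* \<inter> {x. fst x = i \<or> fst x = l} \<times> {x. fst x = i \<or> fst x = l} \<union> B)\<^sup>* =
   (row_edges i l (stack_comp k r r') \<union> B)\<^sup>*"
  if "distinct [i, m, l]" "r \<in> {r1, r2, r3}" "r' \<in> {r1, r2, r3}" for i m l r r' B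
  by (rule repl) (use comp2[OF that(1) HOL.refl that(2,3)] in blast)+
 have "stack_comp k (stack_comp k r1 r2) r3 a b <-> a \<in> pts k \<and> b \<in> pts k \<and>
   (row_pt 0 3 a, row_pt 0 3 b) \<in> (row_edges 0 2 (stack_comp k r1 r2) \<union> ?E3)\<^sup>*"
  by (rule stack_comp_rows) simp
 also have "\<dots> <-> a \<in> pts k \<and> b \<in> pts k \<and>
   (row_pt 0 3 a, row_pt 0 3 b) \<in> ((?E1 \<union> ?E2)\<^sup>* \<inter> {x. fst x = 0 \<or> fst x = 2} \<times> {x. fst x = 0 \<or> fst x = 2} \<union> ?E3)\<^sup>*"
  by (subst repl2) simp_all
 also have "\<dots> <-> a \<in> pts k \<and> b \<in> pts k \<and>
   (row_pt 0 3 a, row_pt 0 3 b) \<in> (?E1 \<union> ?E2 \<union> ?E3)\<^sup>*"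
 proof -
  have f: "fst x = 0 \<or> fst x = 1 \<or> fst x = 2" if "x \<in> Field (?E1 \<union> ?E2)" for x
   using that fstF[of x 0 1 r1] fstF[of x 1 2 r2] unfolding Field_Un by blast
  have "Field (?E1 \<union> ?E2) \<inter> Field ?E3 \<subseteq> {x. fst x = 0 \<or> fst x = 2}"
  proof (rule subsetI)
   fix x assume "x \<in> Field (?E1 \<union> ?E2) \<inter> Field ?E3"
   with f[of x] fstF[of x 2 3 r3] show "x \<in> {x. fst x = 0 \<or> fst x = 2}" by auto
  qed
  moreover have "row_pt 0 3 a \<in> {x. fst x = 0 \<or> fst x = 2} \<union> - Field (?E1 \<union> ?E2)" for a
   using f[of "row_pt 0 3 a"] fstP[of 0 3 a] by auto
  ultimately have "Field (?E1 \<union> ?E2) \<inter> Field ?E3 \<subseteq> {x. fst x = 0 \<or> fst x = 2}"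
   "row_pt 0 3 a \<in> {x. fst x = 0 \<or> fst x = 2} \<union> - Field (?E1 \<union> ?E2)"
   "row_pt 0 3 b \<in> {x. fst x = 0 \<or> fst x = 2} \<union> - Field (?E1 \<union> ?E2)" by blast+
  from rtrancl_absorb[OF this] show ?thesis by simp
 qed
 also have "\<dots> <-> a \<in> pts k \<and> b \<in> pts k \<and>
   (row_pt 0 3 a, row_pt 0 3 b) \<in> ((?E2 \<union> ?E3)\<^sup>* \<inter> {x. fst x = 1 \<or> fst x = 3} \<times> {x. fst x = 1 \<or> fst x = 3} \<union> ?E1)\<^sup>*"
 proof -
  have f: "fst x = 1 \<or> fst x = 2 \<or> fst x = 3" if "x \<in> Field (?E2 \<union> ?E3)" for x
   using that fstF[of x 1 2 r2] fstF[of x 2 3 r3] unfolding Field_Un by blast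
  have "Field (?E2 \<union> ?E3) \<inter> Field ?E1 \<subseteq> {x. fst x = 1 \<or> fst x = 3}"
  proof (rule subsetI)
   fix x assume "x \<in> Field (?E2 \<union> ?E3) \<inter> Field ?E1"
   with f[of x] fstF[of x 0 1 r1] show "x \<in> {x. fst x = 1 \<or> fst x = 3}" by auto
  qed
  moreover have "row_pt 0 3 a \<in> {x. fst x = 1 \<or> fst x = 3} \<union> - Field (?E2 \<union> ?E3)" for a
   using f[of "row_pt 0 3 a"] fstP[of 0 3 a] by auto
  ultimately have "Field (?E2 \<union> ?E3) \<inter> Field ?E1 \<subseteq> {x. fst x = 1 \<or> fst x = 3}"
   "row_pt 0 3 a \<in> {x. fst x = 1 \<or> fst x = 3} \<union> - Field (?E2 \<union> ?E3)"
   "row_pt 0 3 b \<in> {x. fst x = 1 \<or> fst x = 3} \<union> - Field (?E2 \<union> ?E3)" by blast+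
  from rtrancl_absorb[OF this] show ?thesis by (simp add: Un_ac)
 qed
 also have "\<dots> <-> a \<in> pts k \<and> b \<in> pts k \<and>
   (row_pt 0 3 a, row_pt 0 3 b) \<in> (?E1 \<union> row_edges 1 3 (stack_comp k r2 r3))\<^sup>*"
  by (subst repl2) (simp_all add: Un_commute)
 also have "\<dots> <-> stack_comp k r1 (stack_comp k r2 r3) a b"
  by (rule stack_comp_rows[symmetric]) simp
 finally show "stack_comp k (stack_comp k r1 r2) r3 a b = stack_comp k r1 (stack_comp k r2 r3) a b" .
qed

section \<open>Effect of the generators on equivalence relations\<close>

definition id_rel :: "nat => int => int => bool" where
 "id_rel k a b <-> a \<in> pts k \<and> (b = a \<or> b = - a)"

lemma id_rel_abs: "id_rel k a b <-> a \<in> pts k \<and> \<bar>a\<bar> = \<bar>b\<bar>"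
 unfolding id_rel_def abs_eq_iff by auto

definition swap_int :: "nat => int => int" where
 "swap_int i a = (if a = int i then int i + 1 else if a = int i + 1 then int i else a)"

text \<open>The equivalence in the second conjunct, rather than
  \<open>a \<noteq> int j \<and> b \<noteq> int j\<close>, keeps the pair of \<open>int j\<close>
  with itself, so the relation stays reflexive.\<close>

definition detach :: "nat => (int => int => bool) => int => int => bool" where
 "detach j r a b <-> r a b \<and> (a = int j <-> b = int j)"

text \<open>For an equivalence relation \<open>r\<close>, a path that uses the new connection needs
  it only once; hence no closure is taken.\<close>

definition merge :: "nat => nat => (int => int => bool) => int => int => bool" where
 "merge i j r a b <-> r a b \<or> r a (int i) \<and> r (int j) b \<or> r a (int j) \<and> r (int i) b"

text \<open>The line for \<open>gen_e\<close> reflects the identity e_i = p_{i+1/2} p_i p_{i+1}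
  p_{i+1/2} in A_k. The swap acts on positive coordinates only, that is, on the bottom row, when
  \<open>i\<close> is at least 1.\<close>

fun gen_act :: "generator => (int => int => bool) => int => int => bool" where
 "gen_act (gen_p j) r = detach j r"
| "gen_act (gen_ph i) r = merge i (i + 1) r"
| "gen_act (gen_s i) r = (\<lambda>a b. r (swap_int i a) (swap_int i b))"
| "gen_act (gen_e i) r = merge i (i + 1) (detach (i + 1) (detach i (merge i (i + 1) r)))"

fun valid_gen :: "nat => generator => bool" where
 "valid_gen k (gen_p j) <-> 1 \<le> j \<and> j \<le> k"
| "valid_gen k (gen_ph i) <-> 1 \<le> i \<and> i < k"
| "valid_gen k (gen_s i) <-> 1 \<le> i \<and> i < k"
| "valid_gen k (gen_e i) <-> 1 \<le> i \<and> i < k"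

lemma zero_notin_pts [simp]: "0 \<notin> pts k"
 by (simp add: pts_def)

lemma eqv_onI:
 assumes "\<And>a b. r a b ==> a \<in> pts k" "\<And>a. a \<in> pts k ==> r a a" "\<And>a b. r a b ==> r b a"
  "\<And>a b c. r a b ==> r b c ==> r a c"
 shows "eqv_on k r"
 unfolding eqv_on_def using assms by blast

lemma eqv_on_id_rel: "eqv_on k (id_rel k)"
 by (auto simp: eqv_on_def id_rel_def)

lemma eqv_on_detach:
 assumes "eqv_on k r"
 shows "eqv_on k (detach j r)"
proof (rule eqv_onI)
 note d = eqv_onD[OF assms]
 show "detach j r a b ==> a \<in> pts k" "a \<in> pts k ==> detach j r a a"
  "detach j r a b ==> detach j r b a" for a b
  using d(1)[of a b] d(3)[of a] d(4)[of a b] by (auto simp: detach_def)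
 show "detach j r a b ==> detach j r b c ==> detach j r a c" for a b c
  using d(5)[of a b c] by (auto simp: detach_def)
qed

lemma eqv_on_merge:
 assumes "eqv_on k r" "1 \<le> i" "i \<le> k" "1 \<le> j" "j \<le> k"
 shows "eqv_on k (merge i j r)"
proof (rule eqv_onI)
 note d = eqv_onD[OF assms(1)]
 show "merge i j r a b ==> a \<in> pts k" for a b unfolding merge_def using d(1) by blast
 show "a \<in> pts k ==> merge i j r a a" for a unfolding merge_def using d(3) by blast
 show "merge i j r a b ==> merge i j r b a" for a b unfolding merge_def using d(4) by blast
 fix a b c
 show "merge i j r a b ==> merge i j r b c ==> merge i j r a c"
  unfolding merge_def
  using d(5)[of a b c] d(5)[of a b "int i"] d(5)[of a b "int j"] d(5)[of "int j" b c]
   d(5)[of "int i" b c] d(5)[of a "int i" c] d(5)[of a "int j" c] by argo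
qed

lemma swap_int_simps [simp]:
 "swap_int i (swap_int i a) = a" "swap_int i (- a) = - a <-> a \<noteq> - int i \<and> a \<noteq> - int i - 1"
 "swap_int i a = swap_int i b <-> a = b"
 by (auto simp: swap_int_def)

lemma swap_int_pts: "1 \<le> i ==> i < k ==> swap_int i a \<in> pts k <-> a \<in> pts k"
 by (auto simp: swap_int_def pts_def)

lemma eqv_on_gen_act:
 assumes "eqv_on k r" "valid_gen k x"
 shows "eqv_on k (gen_act x r)"
proof (cases x)
 case (gen_s i)
 hence p: "swap_int i a \<in> pts k <-> a \<in> pts k" for a using assms(2) swap_int_pts by simp
 note d = eqv_onD[OF assms(1)]
 show ?thesis unfolding gen_s gen_act.simps
 proof (rule eqv_onI)
  show "r (swap_int i a) (swap_int i b) ==> a \<in> pts k" for a b using d(1) p by blast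
  show "a \<in> pts k ==> r (swap_int i a) (swap_int i a)" for a using d(3) p by blast
 qed (rule d(4), assumption, rule d(5))
qed (use assms in \<open>simp_all add: eqv_on_merge eqv_on_detach\<close>)

lemma vtx_eq: "vtx a = Top j <-> a = - int j" "vtx a = Bot j <-> a = int j \<and> j > 0"
 by (auto simp: vtx_def)

lemma bex_verticals: "(\<exists>B\<in>{g r |r. r \<in> S \<and> P r \<and> Q r}. R B) <-> (\<exists>r\<in>S. P r \<and> Q r \<and> R (g r))"
 by blast

lemma bex_pair: "(\<exists>B\<in>{X, Y}. P B) <-> P X \<or> P Y"
 by blast

text \<open>The hypothesis \<open>sym\<close> says that the given blocks use up whole columns. If
  they covered only one vertex of a column, the other one would be left without a block.\<close>

lemma with_verticals_rel:
 assumes F: "\<And>B. B \<in> F ==> B \<noteq> {} \<and> B \<subseteq> vertices k" "disjoint F"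
  and sym: "\<And>r. Top r \<in> \<Union>F <-> Bot r \<in> \<Union>F"
 shows "with_verticals k F \<in> A_set k"
  "rel (with_verticals k F) a b <->
   (\<exists>B\<in>F. vtx a \<in> B \<and> vtx b \<in> B) \<or> a \<in> pts k \<and> vtx a \<notin> \<Union>F \<and> (b = a \<or> b = - a)"
proof -
 show "with_verticals k F \<in> A_set k"
  unfolding A_set_def mem_Collect_eq
 proof (rule partition_onI)
  show "\<Union>(with_verticals k F) = vertices k"
  proof (intro equalityI subsetI)
   fix v assume "v \<in> \<Union>(with_verticals k F)"
   thus "v \<in> vertices k" using F(1) by (auto simp: with_verticals_def vertices_def)
  next
   fix v assume v: "v \<in> vertices k"
   show "v \<in> \<Union>(with_verticals k F)"
   proof (cases "v \<in> \<Union>F")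
    case False
    obtain r where r: "r \<in> {1..k}" "v = Top r \<or> v = Bot r" using v by (auto simp: vertices_def)
    hence "Top r \<notin> \<Union>F" "Bot r \<notin> \<Union>F" using False sym[of r] by metis+
    hence "{Top r, Bot r} \<in> with_verticals k F" using r(1) by (auto simp: with_verticals_def)
    thus ?thesis using r(2) by blast
   qed (auto simp: with_verticals_def)
  qed
  fix p q assume "p \<in> with_verticals k F" "q \<in> with_verticals k F" "p \<noteq> q"
  moreover have "disjnt p q" if "p \<in> F" "q \<in> F" "p \<noteq> q" for p q
   using F(2) that by (simp add: pairwise_def)
  moreover have "disjnt p {Top r, Bot r}" if "p \<in> F" "Top r \<notin> \<Union>F" "Bot r \<notin> \<Union>F" for p r
   using that by (auto simp: disjnt_def)
  ultimately show "disjnt p q"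
   unfolding with_verticals_def by (auto simp: disjnt_sym)
 next
  show "{} \<notin> with_verticals k F" using F(1) by (auto simp: with_verticals_def)
 qed
 have "(\<exists>r\<in>{1..k}. Top r \<notin> \<Union>F \<and> Bot r \<notin> \<Union>F \<and> vtx a \<in> {Top r, Bot r} \<and> vtx b \<in> {Top r, Bot r}) <->
   a \<in> pts k \<and> vtx a \<notin> \<Union>F \<and> (b = a \<or> b = - a)" (is "?l <-> ?r")
 proof
  assume ?l
  thus ?r
  proof (elim bexE conjE)
   fix r assume r: "r \<in> {1..k}" "Top r \<notin> \<Union>F" "Bot r \<notin> \<Union>F" "vtx a \<in> {Top r, Bot r}" "vtx b \<in> {Top r, Bot r}"
   have "a = - int r \<or> a = int r" "b = - int r \<or> b = int r"
    using r(4,5) unfolding insert_iff empty_iff vtx_eq by blast+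
   hence "a \<in> pts k" "b = a \<or> b = - a" using r(1) by (auto simp: pts_def)
   moreover have "vtx a \<notin> \<Union>F" using r(2-4) by (metis insertE singletonD)
   ultimately show ?thesis by blast
  qed
 next
  assume r: ?r
  let ?n = "nat \<bar>a\<bar>"
  have "a \<in> pts k" using r by (rule conjunct1)
  hence n: "?n \<in> {1..k}" "0 < ?n" by (auto simp: pts_def)
  have ba: "b = a \<or> b = - a" and va: "vtx a \<notin> \<Union>F" using r by (rule conjunct2[OF conjunct2], rule conjunct1[OF conjunct2])
  have v: "vtx a \<in> {Top ?n, Bot ?n}" "vtx b \<in> {Top ?n, Bot ?n}"
   using ba n by (auto simp: vtx_def)
  hence "Top ?n \<notin> \<Union>F \<and> Bot ?n \<notin> \<Union>F" using va sym[of ?n] by (metis insertE singletonD)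
  thus ?l using n(1) v by (intro bexI[of _ ?n]) auto
 qed
 thus "rel (with_verticals k F) a b <->
   (\<exists>B\<in>F. vtx a \<in> B \<and> vtx b \<in> B) \<or> a \<in> pts k \<and> vtx a \<notin> \<Union>F \<and> (b = a \<or> b = - a)"
  unfolding rel_def with_verticals_def bex_Un bex_verticals by (simp only:)
qed

lemma id_diagram_rel: "id_diagram k \<in> A_set k" "rel (id_diagram k) = id_rel k"
proof -
 have F: "\<And>B. B \<in> {} ==> B \<noteq> {} \<and> B \<subseteq> vertices k" "disjoint ({} :: vertex set set)"
  "\<And>r. Top r \<in> \<Union>{} <-> Bot r \<in> \<Union>{}" by auto
 show "id_diagram k \<in> A_set k" unfolding id_diagram_def by (rule with_verticals_rel(1)[OF F])
 show "rel (id_diagram k) = id_rel k"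
  unfolding id_diagram_def by (intro ext) (simp only: with_verticals_rel(2)[OF F], simp add: id_rel_def)
qed

lemma merge_id_rel:
 assumes "1 \<le> i" "i < k"
 shows "merge i (i + 1) (id_rel k) a b <-> a \<in> pts k \<and> b \<in> pts k \<and>
  (\<bar>a\<bar> = \<bar>b\<bar> \<or> (\<bar>a\<bar> = int i \<or> \<bar>a\<bar> = int i + 1) \<and> (\<bar>b\<bar> = int i \<or> \<bar>b\<bar> = int i + 1))"
proof -
 have "a \<in> pts k <-> \<bar>a\<bar> \<in> pts k" "b \<in> pts k <-> \<bar>b\<bar> \<in> pts k" "int i \<in> pts k" "int i + 1 \<in> pts k"
  using assms by (auto simp: pts_def)
 moreover have "merge i (i + 1) (id_rel k) a b <-> a \<in> pts k \<and> \<bar>a\<bar> = \<bar>b\<bar> \<or>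
  a \<in> pts k \<and> \<bar>a\<bar> = int i \<and> int i + 1 = \<bar>b\<bar> \<or> a \<in> pts k \<and> \<bar>a\<bar> = int i + 1 \<and> int i = \<bar>b\<bar>"
  unfolding merge_def id_rel_abs using calculation(3,4) by (auto simp: add.commute)
 ultimately show ?thesis by metis
qed

lemma pts_abs: "c \<in> pts k <-> \<bar>c\<bar> \<in> pts k"
 by (simp add: pts_def)

text \<open>After this lemma a generator is known only through its effect. The case distinctions
  compare the blocks with that effect on the affected columns and away from them.\<close>

lemma gen_diagram_rel:
 assumes "valid_gen k x"
 shows "gen_diagram k x \<in> A_set k \<and> rel (gen_diagram k x) = gen_act x (id_rel k)"
proof (cases x)
 case (gen_e i)
 let ?F = "{{Top i, Top (i + 1)}, {Bot i, Bot (i + 1)}}"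
 have F: "\<And>B. B \<in> ?F ==> B \<noteq> {} \<and> B \<subseteq> vertices k" "disjoint ?F"
  "\<And>r. Top r \<in> \<Union>?F <-> Bot r \<in> \<Union>?F"
  using assms gen_e by (auto simp: vertices_def disjoint_def)
 show ?thesis unfolding gen_e gen_diagram.simps gen_act.simps
 proof (intro conjI ext)
  show "with_verticals k ?F \<in> A_set k" by (rule with_verticals_rel(1)[OF F])
  show "rel (with_verticals k ?F) a b =
    merge i (i + 1) (detach (i + 1) (detach i (merge i (i + 1) (id_rel k)))) a b" for a b
  proof -
   have m: "merge i (i + 1) (id_rel k) a b <-> a \<in> pts k \<and> b \<in> pts k \<and>
    (\<bar>a\<bar> = \<bar>b\<bar> \<or> (\<bar>a\<bar> = int i \<or> \<bar>a\<bar> = int i + 1) \<and> (\<bar>b\<bar> = int i \<or> \<bar>b\<bar> = int i + 1))" for a b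
    using merge_id_rel assms gen_e by simp
   have w0: "rel (with_verticals k ?F) a b <-> (\<exists>B\<in>?F. vtx a \<in> B \<and> vtx b \<in> B) \<or>
     a \<in> pts k \<and> vtx a \<notin> \<Union>?F \<and> (b = a \<or> b = - a)" by (rule with_verticals_rel(2)[OF F])
   have w: "rel (with_verticals k ?F) a b <-> (a = - int i \<or> a = - int i - 1) \<and> (b = - int i \<or> b = - int i - 1) \<or>
     (a = int i \<or> a = int i + 1) \<and> (b = int i \<or> b = int i + 1) \<or> a \<in> pts k \<and>
     \<bar>a\<bar> \<noteq> int i \<and> \<bar>a\<bar> \<noteq> int i + 1 \<and> (b = a \<or> b = - a)"
   proof -
    have v: "vtx c \<in> {Top i, Top (i + 1)} <-> c = - int i \<or> c = - int i - 1"
     "vtx c \<in> {Bot i, Bot (i + 1)} <-> c = int i \<or> c = int i + 1" for c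
     using assms gen_e by (auto simp: vtx_eq)
    have nv: "vtx a \<notin> \<Union>?F <-> \<bar>a\<bar> \<noteq> int i \<and> \<bar>a\<bar> \<noteq> int i + 1"
     unfolding Union_insert Union_empty Un_empty_right Un_iff v by linarith
    show ?thesis unfolding w0 nv bex_pair v by argo
   qed
   have i: "0 < int i" "int i + 1 \<le> int k" using assms gen_e by auto
   hence p: "int i \<in> pts k" "int i + 1 \<in> pts k" "- int i \<in> pts k" "- int i - 1 \<in> pts k"
    by (auto simp: pts_def)
   define x y where "x = int i" and "y = int i + 1"
   have xy: "0 < x" "y = x + 1" "x \<in> pts k" "y \<in> pts k" using i(1) p(1,2) by (simp_all add: x_def y_def)
   have D: "detach (i + 1) (detach i (merge i (i + 1) (id_rel k))) a b <->
    (if a = x \<or> a = y \<or> b = x \<or> b = y then a = b else a \<in> pts k \<and> b \<in> pts k \<and>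
    (\<bar>a\<bar> = \<bar>b\<bar> \<or> (\<bar>a\<bar> = x \<or> \<bar>a\<bar> = y) \<and> (\<bar>b\<bar> = x \<or> \<bar>b\<bar> = y)))" for a b
    unfolding detach_def m of_nat_add of_nat_1 x_def[symmetric] y_def[symmetric] using xy by auto
   have N: "merge i (i + 1) (detach (i + 1) (detach i (merge i (i + 1) (id_rel k)))) a b <->
    (if a = x \<or> a = y then b = x \<or> b = y else b \<noteq> x \<and> b \<noteq> y \<and> a \<in> pts k \<and> b \<in> pts k \<and>
    (\<bar>a\<bar> = \<bar>b\<bar> \<or> (\<bar>a\<bar> = x \<or> \<bar>a\<bar> = y) \<and> (\<bar>b\<bar> = x \<or> \<bar>b\<bar> = y)))"
    unfolding merge_def[of _ _ "detach _ _"] D of_nat_add of_nat_1 x_def[symmetric] y_def[symmetric] using xy by auto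
   show ?thesis
   proof (cases "a = x \<or> a = y \<or> b = x \<or> b = y")
    case True
    show ?thesis
    proof (cases "a = x \<or> a = y")
     case a: True
     hence "a \<noteq> - x" "a \<noteq> - x - 1" "\<bar>a\<bar> = x \<or> \<bar>a\<bar> = y" using xy(1,2) by linarith+
     thus ?thesis unfolding w N x_def[symmetric] xy(2)[symmetric] using a by (simp, blast)
    next
     case a: False
     hence b: "b = x \<or> b = y" using True by simp
     hence "b \<noteq> - x" "b \<noteq> - x - 1" "b = a \<or> b = - a \<longrightarrow> \<bar>a\<bar> = x \<or> \<bar>a\<bar> = y"
      using xy(1,2) by linarith+
     thus ?thesis unfolding w N x_def[symmetric] xy(2)[symmetric] using a b by auto
    qed
   next
    case False
    hence e: "a = - x <-> \<bar>a\<bar> = x" "a = - x - 1 <-> \<bar>a\<bar> = y" "b = - x <-> \<bar>b\<bar> = x" "b = - x - 1 <-> \<bar>b\<bar> = y"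
     "b = a \<or> b = - a <-> \<bar>a\<bar> = \<bar>b\<bar>"
     using xy(1,2) by linarith+
    have Q: "\<bar>a\<bar> = x ==> a \<in> pts k" "\<bar>a\<bar> = y ==> a \<in> pts k" "\<bar>b\<bar> = x ==> b \<in> pts k"
     "\<bar>b\<bar> = y ==> b \<in> pts k" "\<bar>a\<bar> = \<bar>b\<bar> ==> a \<in> pts k <-> b \<in> pts k"
     using xy(3,4) pts_abs[of a] pts_abs[of b] by simp_all
    have nf: "a \<noteq> x" "a \<noteq> y" "b \<noteq> x" "b \<noteq> y" using False by auto
    have "(\<bar>a\<bar> = x \<or> \<bar>a\<bar> = y) \<and> (\<bar>b\<bar> = x \<or> \<bar>b\<bar> = y) \<or> a \<in> pts k \<and> \<bar>a\<bar> \<noteq> x \<and> \<bar>a\<bar> \<noteq> y \<and> \<bar>a\<bar> = \<bar>b\<bar> <->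
     a \<in> pts k \<and> b \<in> pts k \<and> (\<bar>a\<bar> = \<bar>b\<bar> \<or> (\<bar>a\<bar> = x \<or> \<bar>a\<bar> = y) \<and> (\<bar>b\<bar> = x \<or> \<bar>b\<bar> = y))"
     using Q by metis
    thus ?thesis unfolding w N x_def[symmetric] xy(2)[symmetric] e using nf by simp
   qed
  qed
 qed
next
 case (gen_s i)
 let ?F = "{{Top i, Bot (i + 1)}, {Top (i + 1), Bot i}}"
 have F: "\<And>B. B \<in> ?F ==> B \<noteq> {} \<and> B \<subseteq> vertices k" "disjoint ?F"
  "\<And>r. Top r \<in> \<Union>?F <-> Bot r \<in> \<Union>?F"
  using assms gen_s by (auto simp: vertices_def disjoint_def)
 show ?thesis unfolding gen_s gen_diagram.simps gen_act.simps
 proof (intro conjI ext)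
  show "with_verticals k ?F \<in> A_set k" by (rule with_verticals_rel(1)[OF F])
  show "rel (with_verticals k ?F) a b = id_rel k (swap_int i a) (swap_int i b)" for a b
  proof -
   have w0: "rel (with_verticals k ?F) a b <-> (\<exists>B\<in>?F. vtx a \<in> B \<and> vtx b \<in> B) \<or>
     a \<in> pts k \<and> vtx a \<notin> \<Union>?F \<and> (b = a \<or> b = - a)" by (rule with_verticals_rel(2)[OF F])
   define x y where "x = int i" and "y = int i + 1"
   have xy: "0 < x" "y = x + 1" "x \<in> pts k"
    using assms gen_s by (simp_all add: x_def y_def pts_def)
   have v: "vtx c \<in> {Top i, Bot (i + 1)} <-> c = - x \<or> c = y" "vtx c \<in> {Top (i + 1), Bot i} <-> c = - y \<or> c = x" for c
    using assms gen_s by (auto simp: vtx_eq x_def y_def)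
   have nv: "vtx a \<notin> \<Union>?F <-> \<bar>a\<bar> \<noteq> x \<and> \<bar>a\<bar> \<noteq> y"
    unfolding Union_insert Union_empty Un_empty_right Un_iff v using xy by linarith
   have p: "x \<in> pts k" "y \<in> pts k" "- x \<in> pts k" "- y \<in> pts k"
    using assms gen_s by (simp_all add: x_def y_def pts_def)
   have sw: "swap_int i c = (if c = x then y else if c = y then x else c)" for c
    by (simp add: swap_int_def x_def y_def)
   have A: "a = x \<or> a = y \<or> a = - x \<or> a = - y \<or> \<bar>a\<bar> \<noteq> x \<and> \<bar>a\<bar> \<noteq> y" using xy by linarith
   have ne: "x \<noteq> y" "x \<noteq> - x" "x \<noteq> - y" "y \<noteq> - x" "y \<noteq> - y" "- x \<noteq> x" "- y \<noteq> x" "- x \<noteq> y" "- y \<noteq> y" "y \<noteq> x"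
    using xy by linarith+
   have ab: "\<bar>swap_int i b\<bar> = x <-> b = y \<or> b = - x" "\<bar>swap_int i b\<bar> = y <-> b = x \<or> b = - y"
    "\<bar>a\<bar> \<noteq> x ==> \<bar>a\<bar> \<noteq> y ==> \<bar>a\<bar> = \<bar>swap_int i b\<bar> <-> b = a \<or> b = - a"
    unfolding sw using xy(1,2) by (simp_all split: if_split) linarith+
   have abs: "\<bar>x\<bar> = x" "\<bar>y\<bar> = y" "\<bar>- x\<bar> = x" "\<bar>- y\<bar> = y" using xy by auto
   have sa: "swap_int i x = y" "swap_int i y = x" "swap_int i (- x) = - x" "swap_int i (- y) = - y"
    unfolding sw by (simp_all only: ne if_False if_True simp_thms)
   have goal: "((a = - x \<or> a = y) \<and> (b = - x \<or> b = y) \<or> (a = - y \<or> a = x) \<and> (b = - y \<or> b = x)) \<or>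
    a \<in> pts k \<and> (\<bar>a\<bar> \<noteq> x \<and> \<bar>a\<bar> \<noteq> y) \<and> (b = a \<or> b = - a) <-> swap_int i a \<in> pts k \<and> \<bar>swap_int i a\<bar> = \<bar>swap_int i b\<bar>"
    using A
   proof (elim disjE)
    assume a: "a = x"
    have "y = \<bar>swap_int i b\<bar> <-> b = x \<or> b = - y" using ab(2) by auto
    thus ?thesis unfolding a sa abs using ne p by auto
   next
    assume a: "a = y"
    have "x = \<bar>swap_int i b\<bar> <-> b = y \<or> b = - x" using ab(1) by auto
    thus ?thesis unfolding a sa abs using ne p by auto
   next
    assume a: "a = - x"
    have "x = \<bar>swap_int i b\<bar> <-> b = y \<or> b = - x" using ab(1) by auto
    thus ?thesis unfolding a sa abs using ne p by auto
   next
    assume a: "a = - y"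
    have "y = \<bar>swap_int i b\<bar> <-> b = x \<or> b = - y" using ab(2) by auto
    thus ?thesis unfolding a sa abs using ne p by auto
   next
    assume a: "\<bar>a\<bar> \<noteq> x \<and> \<bar>a\<bar> \<noteq> y"
    hence "swap_int i a = a" "a \<noteq> x" "a \<noteq> y" "a \<noteq> - x" "a \<noteq> - y" unfolding sw using xy(1,2) by auto
    thus ?thesis using a ab(3) by simp
   qed
   thus ?thesis unfolding w0 bex_pair nv v id_rel_abs .
  qed
 qed
next
 case (gen_p i)
 let ?F = "{{Top i}, {Bot i}}"
 have F: "\<And>B. B \<in> ?F ==> B \<noteq> {} \<and> B \<subseteq> vertices k" "disjoint ?F"
  "\<And>r. Top r \<in> \<Union>?F <-> Bot r \<in> \<Union>?F"
  using assms gen_p by (auto simp: vertices_def disjoint_def)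
 show ?thesis unfolding gen_p gen_diagram.simps gen_act.simps
 proof (intro conjI ext)
  show "with_verticals k ?F \<in> A_set k" by (rule with_verticals_rel(1)[OF F])
  show "rel (with_verticals k ?F) a b = detach i (id_rel k) a b" for a b
  proof -
   have w0: "rel (with_verticals k ?F) a b <-> (\<exists>B\<in>?F. vtx a \<in> B \<and> vtx b \<in> B) \<or>
     a \<in> pts k \<and> vtx a \<notin> \<Union>?F \<and> (b = a \<or> b = - a)" by (rule with_verticals_rel(2)[OF F])
   define x y where "x = int i" and "y = int i + 1"
   have xy: "0 < x" "y = x + 1" "x \<in> pts k"
    using assms gen_p by (simp_all add: x_def y_def pts_def)
   have v: "vtx c \<in> {Top i} <-> c = - x" "vtx c \<in> {Bot i} <-> c = x" for c
    using assms gen_p by (auto simp: vtx_eq x_def)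
   have nv: "vtx a \<notin> \<Union>?F <-> \<bar>a\<bar> \<noteq> x"
    unfolding Union_insert Union_empty Un_empty_right Un_iff v using xy by linarith
   have A: "a = x \<or> a = - x \<or> \<bar>a\<bar> \<noteq> x" by linarith
   have "(a = - x \<and> b = - x \<or> a = x \<and> b = x) \<or> a \<in> pts k \<and> \<bar>a\<bar> \<noteq> x \<and> (b = a \<or> b = - a) <->
    (a \<in> pts k \<and> \<bar>a\<bar> = \<bar>b\<bar>) \<and> (a = x <-> b = x)"
    using A xy(1,3) by (elim disjE) auto
   thus ?thesis unfolding w0 bex_pair nv v detach_def id_rel_abs x_def[symmetric] .
  qed
 qed
next
 case (gen_ph i)
 let ?F = "{{Top i, Top (i + 1), Bot i, Bot (i + 1)}}"
 have F: "\<And>B. B \<in> ?F ==> B \<noteq> {} \<and> B \<subseteq> vertices k" "disjoint ?F"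
  "\<And>r. Top r \<in> \<Union>?F <-> Bot r \<in> \<Union>?F"
  using assms gen_ph by (auto simp: vertices_def disjoint_def)
 show ?thesis unfolding gen_ph gen_diagram.simps gen_act.simps
 proof (intro conjI ext)
  show "with_verticals k ?F \<in> A_set k" by (rule with_verticals_rel(1)[OF F])
  show "rel (with_verticals k ?F) a b = merge i (i + 1) (id_rel k) a b" for a b
  proof -
   have w0: "rel (with_verticals k ?F) a b <-> (\<exists>B\<in>?F. vtx a \<in> B \<and> vtx b \<in> B) \<or>
     a \<in> pts k \<and> vtx a \<notin> \<Union>?F \<and> (b = a \<or> b = - a)" by (rule with_verticals_rel(2)[OF F])
   define x y where "x = int i" and "y = int i + 1"
   have xy: "0 < x" "y = x + 1" "x \<in> pts k"
    using assms gen_ph by (simp_all add: x_def y_def pts_def)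
   have v: "vtx c \<in> {Top i, Top (i + 1), Bot i, Bot (i + 1)} <-> \<bar>c\<bar> = x \<or> \<bar>c\<bar> = y" for c
    using assms gen_ph by (auto simp: vtx_eq x_def y_def)
   have b1: "(\<exists>B\<in>{X}. P B) <-> P X" for P :: "vertex set => bool" and X by blast
   have "y \<in> pts k" using assms gen_ph by (simp add: y_def pts_def)
   hence Q: "\<bar>a\<bar> = x ==> a \<in> pts k" "\<bar>a\<bar> = y ==> a \<in> pts k" "\<bar>b\<bar> = x ==> b \<in> pts k"
    "\<bar>b\<bar> = y ==> b \<in> pts k" "\<bar>a\<bar> = \<bar>b\<bar> ==> a \<in> pts k <-> b \<in> pts k"
    using xy(3) pts_abs[of a] pts_abs[of b] by simp_all
   have ab: "b = a \<or> b = - a <-> \<bar>a\<bar> = \<bar>b\<bar>" by linarith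
   have m: "merge i (i + 1) (id_rel k) a b <-> a \<in> pts k \<and> b \<in> pts k \<and>
    (\<bar>a\<bar> = \<bar>b\<bar> \<or> (\<bar>a\<bar> = x \<or> \<bar>a\<bar> = y) \<and> (\<bar>b\<bar> = x \<or> \<bar>b\<bar> = y))"
    using merge_id_rel assms gen_ph by (simp add: x_def y_def)
   show ?thesis
    unfolding w0 b1 Union_insert Union_empty Un_empty_right v ab m using Q by metis
  qed
 qed
qed

text \<open>A product is determined by exhibiting paths and by labelling the three rows of the stack
 compatibly with both factors.\<close>

lemma stack_comp_eqI:
 fixes cu cm cl :: "int => 'l"
 assumes paths: "\<And>a b. r' a b ==> a \<in> pts k \<and> b \<in> pts k \<and>
   (row_pt 0 2 a, row_pt 0 2 b) \<in> (row_edges 0 1 r1 \<union> row_edges 1 2 r2)\<^sup>*"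
  and l1: "\<And>a b. r1 a b ==> (if a > 0 then cm a else cu (- a)) = (if b > 0 then cm b else cu (- b))"
  and l2: "\<And>a b. r2 a b ==> (if a > 0 then cl a else cm (- a)) = (if b > 0 then cl b else cm (- b))"
  and l: "\<And>a b. a \<in> pts k ==> b \<in> pts k ==>
   (if a > 0 then cl a else cu (- a)) = (if b > 0 then cl b else cu (- b)) ==> r' a b"
 shows "stack_comp k r1 r2 = r'"
proof (intro ext iffI)
 fix a b
 show "r' a b ==> stack_comp k r1 r2 a b" using paths by (simp add: stack_comp_def)
 define c :: "nat \<times> int => 'l" where "c = (\<lambda>(n, x). if n = 0 then cu x else if n = 1 then cm x else cl x)"
 have c: "c (row_pt 0 1 a) = (if a > 0 then cm a else cu (- a))"
  "c (row_pt 1 2 a) = (if a > 0 then cl a else cm (- a))"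
  "c (row_pt 0 2 a) = (if a > 0 then cl a else cu (- a))" for a by (auto simp: c_def row_pt_def)
 have e: "c x = c y" if "(x, y) \<in> row_edges 0 1 r1 \<union> row_edges 1 2 r2" for x y
  using that
 proof
  assume "(x, y) \<in> row_edges 0 1 r1"
  then obtain a b where "r1 a b" "x = row_pt 0 1 a" "y = row_pt 0 1 b" by (auto simp: row_edges_def)
  thus ?thesis using l1[of a b] by (simp only: c)
 next
  assume "(x, y) \<in> row_edges 1 2 r2"
  then obtain a b where "r2 a b" "x = row_pt 1 2 a" "y = row_pt 1 2 b" by (auto simp: row_edges_def)
  thus ?thesis using l2[of a b] by (simp only: c)
 qed
 assume "stack_comp k r1 r2 a b"
 hence "(row_pt 0 2 a, row_pt 0 2 b) \<in> (row_edges 0 1 r1 \<union> row_edges 1 2 r2)\<^sup>*"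
  "a \<in> pts k" "b \<in> pts k" by (auto simp: stack_comp_def)
 from this(1) have "c (row_pt 0 2 a) = c (row_pt 0 2 b)"
  by (induction rule: rtrancl_induct) (simp, use e in metis)
 with \<open>a \<in> pts k\<close> \<open>b \<in> pts k\<close> show "r' a b" using l unfolding c by blast
qed

section \<open>Composition with a generator\<close>

lemma row_edgesI: "r a b ==> (row_pt i j a, row_pt i j b) \<in> row_edges i j r"
 by (auto simp: row_edges_def)

lemma Collect_eqv: "eqv_on k r ==> a \<in> pts k ==> Collect (r a) = Collect (r b) <-> r a b"
 using eqv_onD(3,4,5)[of k r] by (safe; blast)

text \<open>Supplies the paths required by \<open>stack_comp_eqI\<close> for a second factor that
  changes only the bottom row: \<open>t a\<close> is the point of the first factor from which
  \<open>a\<close> hangs, and \<open>u\<close> marks the points that hang from one at all.\<close>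

lemma stack_comp_act:
 assumes r: "eqv_on k r" and v: "eqv_on k r2" and r': "eqv_on k r'"
  and down: "\<And>a. a \<in> pts k ==> t a \<in> pts k ==> 0 < a ==> u a ==> 0 < t a \<and> r2 a (- t a)"
  and neg: "\<And>a. a < 0 ==> t a = a"
  and r'D: "\<And>a b. r' a b ==> a = b \<or> u a \<and> u b \<and> t a \<in> pts k \<and> t b \<in> pts k \<and> 
    (row_pt 0 1 (t a), row_pt 0 1 (t b)) \<in> (row_edges 0 1 r \<union> row_edges 1 2 r2)\<^sup>*"
 shows "r' a b ==> a \<in> pts k \<and> b \<in> pts k \<and>
   (row_pt 0 2 a, row_pt 0 2 b) \<in> (row_edges 0 1 r \<union> row_edges 1 2 r2)\<^sup>*"
proof -
 let ?G = "(row_edges 0 1 r \<union> row_edges 1 2 r2)"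
 assume ab: "r' a b"
 have lift: "(row_pt 0 2 a, row_pt 0 1 (t a)) \<in> ?G\<^sup>* \<and> (row_pt 0 1 (t a), row_pt 0 2 a) \<in> ?G\<^sup>*"
  if "a \<in> pts k" "t a \<in> pts k" "u a" for a
 proof (cases "a > 0")
  case True
  with down that have d: "0 < t a" "r2 a (- t a)" by auto
  have "row_pt 1 2 a = row_pt 0 2 a" "row_pt 1 2 (- t a) = row_pt 0 1 (t a)"
   using True d by (auto simp: row_pt_def)
  thus ?thesis
   using row_edgesI[of r2 a "- t a" 1 2] row_edgesI[of r2 "- t a" a 1 2] d(2) eqv_onD(4)[OF v d(2)] by auto
 next
  case False
  hence "t a = a" using neg that by (auto simp: pts_def)
  thus ?thesis using False by (simp add: row_pt_def)
 qed
 have p: "a \<in> pts k" "b \<in> pts k" using eqv_onD(1,2)[OF r' ab] .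
 thus ?thesis using r'D[OF ab] lift by (meson rtrancl.rtrancl_refl rtrancl_trans)
qed

lemma stack_comp_gen_p:
 assumes r: "eqv_on k r" and j: "1 \<le> j" "j \<le> k"
 shows "stack_comp k r (detach j (id_rel k)) = detach j r"
\<comment> \<open>Points are labelled by their classes. Classes of points are nonempty, so the empty
  set is a fresh label for the detached point.\<close>
proof (rule stack_comp_eqI[where cu = "\<lambda>n. Collect (r (- n))" and cm = "\<lambda>n. Collect (r n)"
   and cl = "\<lambda>n. if n = int j then {} else Collect (r n)"])
 note i = eqv_on_id_rel[of k]
 show "a \<in> pts k \<and> b \<in> pts k \<and> (row_pt 0 2 a, row_pt 0 2 b) \<in>
  (row_edges 0 1 r \<union> row_edges 1 2 (detach j (id_rel k)))\<^sup>*" if "detach j r a b" for a b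
  by (rule stack_comp_act[OF r eqv_on_detach[OF i] eqv_on_detach[OF r], where t = "\<lambda>a. a" and u = "\<lambda>a. a \<noteq> int j"])
   (use that eqv_onD(1,2)[OF r] in \<open>auto simp: detach_def id_rel_def pts_def intro!: r_into_rtrancl row_edgesI\<close>)
 show "(if a > 0 then Collect (r a) else Collect (r (- (- a)))) =
   (if b > 0 then Collect (r b) else Collect (r (- (- b))))" if "r a b" for a b
  using that Collect_eqv[OF r eqv_onD(1)[OF r that]] by simp
 show "(if a > 0 then if a = int j then {} else Collect (r a) else Collect (r (- a))) =
   (if b > 0 then if b = int j then {} else Collect (r b) else Collect (r (- b)))"
  if "detach j (id_rel k) a b" for a b
  using that j by (auto simp: detach_def id_rel_def)
 show "detach j r a b" if "a \<in> pts k" "b \<in> pts k"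
  "(if a > 0 then if a = int j then {} else Collect (r a) else Collect (r (- (- a)))) =
   (if b > 0 then if b = int j then {} else Collect (r b) else Collect (r (- (- b))))" for a b
  using that Collect_eqv[OF r that(1)] eqv_onD(3)[OF r that(1)] eqv_onD(3)[OF r that(2)] j
  by (auto simp: detach_def split: if_splits)
qed

lemma stack_comp_gen_ph:
 assumes r: "eqv_on k r" and j: "1 \<le> i" "i < k"
 shows "stack_comp k r (merge i (i + 1) (id_rel k)) = merge i (i + 1) r"
proof -
 define r' where "r' = merge i (i + 1) r"
 have r': "eqv_on k r'" unfolding r'_def using j by (intro eqv_on_merge r) auto
 have e: "eqv_on k (merge i (i + 1) (id_rel k))" using j by (intro eqv_on_merge eqv_on_id_rel) auto
 let ?G = "row_edges 0 1 r \<union> row_edges 1 2 (merge i (i + 1) (id_rel k))"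
 have ii: "int i \<in> pts k" "int (i + 1) \<in> pts k" using j by (auto simp: pts_def)
 have mid: "(row_pt 0 1 (int i), row_pt 0 1 (int (i + 1))) \<in> ?G" "(row_pt 0 1 (int (i + 1)), row_pt 0 1 (int i)) \<in> ?G"
 proof -
  have "row_pt 0 1 (int i) = row_pt 1 2 (- int i)" "row_pt 0 1 (int (i + 1)) = row_pt 1 2 (- int (i + 1))"
   using j by (auto simp: row_pt_def)
  moreover have "merge i (i + 1) (id_rel k) (- int i) (- int (i + 1))"
   "merge i (i + 1) (id_rel k) (- int (i + 1)) (- int i)"
   unfolding merge_def id_rel_def pts_uminus minus_minus using ii by blast+
  ultimately show "(row_pt 0 1 (int i), row_pt 0 1 (int (i + 1))) \<in> ?G" "(row_pt 0 1 (int (i + 1)), row_pt 0 1 (int i)) \<in> ?G"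
   by (auto intro: row_edgesI simp del: of_nat_Suc of_nat_add)
 qed
 have "stack_comp k r (merge i (i + 1) (id_rel k)) = r'"
 proof (rule stack_comp_eqI[where cu = "\<lambda>n. Collect (r' (- n))" and cm = "\<lambda>n. Collect (r' n)"
    and cl = "\<lambda>n. Collect (r' n)"])
  show "a \<in> pts k \<and> b \<in> pts k \<and> (row_pt 0 2 a, row_pt 0 2 b) \<in> ?G\<^sup>*" if ab: "r' a b" for a b
  proof (rule stack_comp_act[OF r e r', where t = "\<lambda>a. a" and u = "\<lambda>a. True"])
   fix a b assume ab: "r' a b"
   have e1: "(row_pt 0 1 a, row_pt 0 1 b) \<in> ?G" if "r a b" for a b using row_edgesI[of r a b] that by auto
   have "(row_pt 0 1 a, row_pt 0 1 b) \<in> ?G\<^sup>*"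
    using ab e1 mid unfolding r'_def merge_def
    by (meson converse_rtrancl_into_rtrancl rtrancl.rtrancl_refl)
   thus "a = b \<or> True \<and> True \<and> a \<in> pts k \<and> b \<in> pts k \<and> (row_pt 0 1 a, row_pt 0 1 b) \<in> ?G\<^sup>*"
    using eqv_onD(1,2)[OF r' ab] by simp
  qed (use ab in \<open>auto simp: merge_def id_rel_def\<close>)
  show "(if a > 0 then Collect (r' a) else Collect (r' (- (- a)))) =
    (if b > 0 then Collect (r' b) else Collect (r' (- (- b))))" if "r a b" for a b
   using Collect_eqv[OF r' eqv_onD(1)[OF r that]] that by (simp add: r'_def merge_def)
  show "(if a > 0 then Collect (r' a) else Collect (r' (- a))) =
    (if b > 0 then Collect (r' b) else Collect (r' (- b)))" if ab: "merge i (i + 1) (id_rel k) a b" for a b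
  proof -
   have 1: "r' (int i) (int (i + 1))" using eqv_onD(3)[OF r] ii by (simp add: r'_def merge_def)
   have 2: "Collect (r' (int i)) = Collect (r' (int (i + 1)))" using Collect_eqv[OF r' ii(1)] 1 by blast
   have "\<bar>a\<bar> = \<bar>b\<bar> \<or> \<bar>a\<bar> \<in> {int i, int (i + 1)} \<and> \<bar>b\<bar> \<in> {int i, int (i + 1)}"
    using ab by (auto simp: merge_def id_rel_def)
   hence "Collect (r' \<bar>a\<bar>) = Collect (r' \<bar>b\<bar>)" using 2 by auto
   thus ?thesis by (auto simp: abs_if split: if_splits)
  qed
  show "r' a b" if "a \<in> pts k" "b \<in> pts k" "(if a > 0 then Collect (r' a) else Collect (r' (- (- a)))) =
    (if b > 0 then Collect (r' b) else Collect (r' (- (- b))))" for a b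
  proof -
   have "Collect (r' a) = Collect (r' b)" using that(3) by (simp only: minus_minus if_cancel)
   thus ?thesis using Collect_eqv[OF r' that(1)] by blast
  qed
 qed
 thus ?thesis by (simp add: r'_def)
qed

lemma stack_comp_gen_s:
 assumes r: "eqv_on k r" and j: "1 \<le> i" "i < k"
 shows "stack_comp k r (gen_act (gen_s i) (id_rel k)) = gen_act (gen_s i) r"
proof (rule stack_comp_eqI[where cu = "\<lambda>n. Collect (r (- n))" and cm = "\<lambda>n. Collect (r n)"
   and cl = "\<lambda>n. Collect (r (swap_int i n))"])
 have v: "valid_gen k (gen_s i)" using j by simp
 let ?r2 = "gen_act (gen_s i) (id_rel k)"
 show "a \<in> pts k \<and> b \<in> pts k \<and> (row_pt 0 2 a, row_pt 0 2 b) \<in> (row_edges 0 1 r \<union> row_edges 1 2 ?r2)\<^sup>*"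
  if ab: "gen_act (gen_s i) r a b" for a b
 proof (rule stack_comp_act[OF r eqv_on_gen_act[OF eqv_on_id_rel v] eqv_on_gen_act[OF r v],
    where t = "swap_int i" and u = "\<lambda>_. True"])
  show "a < 0 ==> swap_int i a = a" for a using j by (simp add: swap_int_def)
  show "0 < swap_int i a \<and> ?r2 a (- swap_int i a)" if "a \<in> pts k" "swap_int i a \<in> pts k" "0 < a" for a
   using that j by (auto simp: id_rel_def swap_int_def)
  show "a = b \<or> True \<and> True \<and> swap_int i a \<in> pts k \<and> swap_int i b \<in> pts k \<and>
    (row_pt 0 1 (swap_int i a), row_pt 0 1 (swap_int i b)) \<in> (row_edges 0 1 r \<union> row_edges 1 2 ?r2)\<^sup>*"
   if "gen_act (gen_s i) r a b" for a b
   using that eqv_onD(1,2)[OF r, of "swap_int i a" "swap_int i b"] by (auto intro!: r_into_rtrancl row_edgesI)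
 qed (use ab in auto)
 show "(if a > 0 then Collect (r a) else Collect (r (- (- a)))) =
   (if b > 0 then Collect (r b) else Collect (r (- (- b))))" if "r a b" for a b
  using that Collect_eqv[OF r eqv_onD(1)[OF r that]] by simp
 show "(if a > 0 then Collect (r (swap_int i a)) else Collect (r (- a))) =
   (if b > 0 then Collect (r (swap_int i b)) else Collect (r (- b)))"
  if "?r2 a b" for a b
 proof -
  have "b = a \<or> swap_int i b = - swap_int i a" using that by (auto simp: id_rel_def)
  thus ?thesis using j by (auto simp: swap_int_def add.commute split: if_splits)
 qed
 show "gen_act (gen_s i) r a b" if "a \<in> pts k" "b \<in> pts k"
  "(if a > 0 then Collect (r (swap_int i a)) else Collect (r (- (- a)))) =
   (if b > 0 then Collect (r (swap_int i b)) else Collect (r (- (- b))))" for a b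
 proof -
  have "(if a > 0 then Collect (r (swap_int i a)) else Collect (r (- (- a)))) = Collect (r (swap_int i a))"
   for a using j by (simp add: swap_int_def)
  thus ?thesis using that(3) Collect_eqv[OF r, of "swap_int i a" "swap_int i b"] swap_int_pts[OF j] that(1) by simp
 qed
qed

lemma stack_comp_id:
 assumes r: "eqv_on k r"
 shows "stack_comp k r (id_rel k) = r" "stack_comp k (id_rel k) r = r"
proof -
 show "stack_comp k r (id_rel k) = r"
 proof (rule stack_comp_eqI[where cu = "\<lambda>n. Collect (r (- n))" and cm = "\<lambda>n. Collect (r n)"
   and cl = "\<lambda>n. Collect (r n)"])
  show "a \<in> pts k \<and> b \<in> pts k \<and> (row_pt 0 2 a, row_pt 0 2 b) \<in> (row_edges 0 1 r \<union> row_edges 1 2 (id_rel k))\<^sup>*"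
   if "r a b" for a b
   by (rule stack_comp_act[OF r eqv_on_id_rel r, where t = "\<lambda>a. a" and u = "\<lambda>_. True"])
    (use that eqv_onD(1,2)[OF r] in \<open>auto simp: id_rel_def intro!: r_into_rtrancl row_edgesI\<close>)
  show "(if a > 0 then Collect (r a) else Collect (r (- (- a)))) =
    (if b > 0 then Collect (r b) else Collect (r (- (- b))))" if "r a b" for a b
   using that Collect_eqv[OF r eqv_onD(1)[OF r that]] by simp
  show "(if a > 0 then Collect (r a) else Collect (r (- a))) =
    (if b > 0 then Collect (r b) else Collect (r (- b)))" if "id_rel k a b" for a b
   using that by (auto simp: id_rel_def)
  show "r a b" if "a \<in> pts k" "(if a > 0 then Collect (r a) else Collect (r (- (- a)))) =
    (if b > 0 then Collect (r b) else Collect (r (- (- b))))" for a b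
  proof -
   have "Collect (r a) = Collect (r b)" using that(2) by (simp only: minus_minus if_cancel)
   thus ?thesis using Collect_eqv[OF r that(1)] by blast
  qed
 qed
 show "stack_comp k (id_rel k) r = r"
 proof (rule stack_comp_eqI[where cu = "\<lambda>n. Collect (r (- n))" and cm = "\<lambda>n. Collect (r (- n))"
   and cl = "\<lambda>n. Collect (r n)"])
  fix a b assume ab: "r a b"
  let ?G = "row_edges 0 1 (id_rel k) \<union> row_edges 1 2 r"
  have lift: "(row_pt 0 2 a, row_pt 1 2 a) \<in> ?G\<^sup>* \<and> (row_pt 1 2 a, row_pt 0 2 a) \<in> ?G\<^sup>*" if "a \<in> pts k" for a
  proof (cases "a > 0")
   case False
   hence "row_pt 0 2 a = row_pt 0 1 a" "row_pt 1 2 a = row_pt 0 1 (- a)"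
    using that by (auto simp: row_pt_def pts_def)
   thus ?thesis using that row_edgesI[of "id_rel k" a "- a" 0 1] row_edgesI[of "id_rel k" "- a" a 0 1]
    by (auto simp: id_rel_def)
  qed (simp add: row_pt_def)
  have "(row_pt 1 2 a, row_pt 1 2 b) \<in> ?G" using row_edgesI[of r, OF ab] by auto
  thus "a \<in> pts k \<and> b \<in> pts k \<and> (row_pt 0 2 a, row_pt 0 2 b) \<in> ?G\<^sup>*"
   using lift[of a] lift[of b] eqv_onD(1,2)[OF r ab] by (meson r_into_rtrancl rtrancl_trans)
  have "(if 0 < a then Collect (r a) else Collect (r (- (- a)))) = Collect (r a)" for a
   by (simp only: minus_minus if_cancel)
  show "(if 0 < a then Collect (r a) else Collect (r (- (- a)))) =
    (if 0 < b then Collect (r b) else Collect (r (- (- b))))"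
   unfolding \<open>\<And>a. (if 0 < a then Collect (r a) else Collect (r (- (- a)))) = Collect (r a)\<close>
   using Collect_eqv[OF r eqv_onD(1)[OF r ab]] ab by blast
 next
  fix a b assume "id_rel k a b"
  thus "(if a > 0 then Collect (r (- a)) else Collect (r (- (- a)))) =
    (if b > 0 then Collect (r (- b)) else Collect (r (- (- b))))"
   by (auto simp: id_rel_def pts_def)
 next
  fix a b
  have c: "(if a > 0 then Collect (r a) else Collect (r (- (- a)))) = Collect (r a)" for a
   by (simp only: minus_minus if_cancel)
  show "a \<in> pts k ==> b \<in> pts k ==> (if a > 0 then Collect (r a) else Collect (r (- (- a)))) =
    (if b > 0 then Collect (r b) else Collect (r (- (- b)))) ==> r a b"
   unfolding c using Collect_eqv[OF r] by blast
 qed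
qed

text \<open>The case e_i follows by associativity from its factorisation into the p's; only the
  other three kinds of generators need a direct computation of stacks.\<close>

lemma stack_comp_gen:
 assumes r: "eqv_on k r" and x: "valid_gen k x"
 shows "stack_comp k r (gen_act x (id_rel k)) = gen_act x r"
proof (cases x)
 case (gen_e i)
 have v: "valid_gen k (gen_ph i)" "valid_gen k (gen_p i)" "valid_gen k (gen_p (i + 1))" using x gen_e by auto
 have step: "stack_comp k r (gen_act y r2) = gen_act y (stack_comp k r r2)"
  if y: "y \<in> {gen_ph i, gen_p i, gen_p (i + 1)}" and r2: "eqv_on k r2" for y r2
 proof -
  have c: "stack_comp k r (gen_act y (id_rel k)) = gen_act y r" if "eqv_on k r" for r
   using y v stack_comp_gen_p[OF that, of i] stack_comp_gen_p[OF that, of "i + 1"] stack_comp_gen_ph[OF that, of i] by auto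
  have e: "eqv_on k (gen_act y (id_rel k))" using y v by (intro eqv_on_gen_act eqv_on_id_rel) auto
  show ?thesis
   unfolding c[OF r2, symmetric] c[OF eqv_on_stack_comp[OF r r2], symmetric]
   by (rule stack_comp_assoc[OF r r2 e, symmetric])
 qed
 define q p p' where "q = gen_act (gen_ph i)" and "p = gen_act (gen_p i)" and "p' = gen_act (gen_p (i + 1))"
 have ge: "gen_act (gen_e i) r = q (p' (p (q r)))" for r by (simp add: q_def p_def p'_def)
 have ev: "eqv_on k r2 ==> eqv_on k (q r2)" "eqv_on k r2 ==> eqv_on k (p r2)" "eqv_on k r2 ==> eqv_on k (p' r2)"
  for r2 using v eqv_on_gen_act by (auto simp: q_def p_def p'_def simp del: gen_act.simps)
 have st: "eqv_on k r2 ==> stack_comp k r (q r2) = q (stack_comp k r r2)"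
   "eqv_on k r2 ==> stack_comp k r (p r2) = p (stack_comp k r r2)"
   "eqv_on k r2 ==> stack_comp k r (p' r2) = p' (stack_comp k r r2)" for r2
  using step by (auto simp: q_def p_def p'_def simp del: gen_act.simps)
 show ?thesis unfolding gen_e ge by (simp add: st ev eqv_on_id_rel stack_comp_id[OF r])
qed (use assms stack_comp_gen_p stack_comp_gen_ph stack_comp_gen_s in \<open>auto simp del: gen_act.simps(3)\<close>)

section \<open>Words of generators and their diagrams\<close>

definition act_word :: "nat => generator list => int => int => bool" where
 "act_word k w = foldl (\<lambda>r x. gen_act x r) (id_rel k) w"

lemma act_word_simps [simp]:
 "act_word k [] = id_rel k" "act_word k (w @ [x]) = gen_act x (act_word k w)"
 by (simp_all add: act_word_def)

lemma eqv_on_act_word: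
 assumes "w \<in> lists (Collect (valid_gen k))"
 shows "eqv_on k (act_word k w)"
 using assms by (induction w rule: rev_induct) (auto simp: eqv_on_id_rel intro: eqv_on_gen_act)

lemma act_word_append:
 assumes u: "u \<in> lists (Collect (valid_gen k))" and v: "v \<in> lists (Collect (valid_gen k))"
 shows "act_word k (u @ v) = stack_comp k (act_word k u) (act_word k v)"
 using v
proof (induction v rule: rev_induct)
 case Nil
 thus ?case using stack_comp_id(1)[OF eqv_on_act_word[OF u]] by simp
next
 case (snoc x v)
 hence x: "valid_gen k x" and v: "v \<in> lists (Collect (valid_gen k))" by auto
 have "act_word k (u @ v @ [x]) = gen_act x (act_word k (u @ v))"
  by (metis append_assoc act_word_simps(2))
 also have "\<dots> = gen_act x (stack_comp k (act_word k u) (act_word k v))" using snoc.IH v by simp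
 also have "\<dots> = stack_comp k (stack_comp k (act_word k u) (act_word k v)) (gen_act x (id_rel k))"
  by (rule stack_comp_gen[symmetric, OF eqv_on_stack_comp[OF eqv_on_act_word[OF u] eqv_on_act_word[OF v]] x])
 also have "\<dots> = stack_comp k (act_word k u) (stack_comp k (act_word k v) (gen_act x (id_rel k)))"
  by (intro stack_comp_assoc eqv_on_act_word u v eqv_on_gen_act eqv_on_id_rel x)
 also have "\<dots> = stack_comp k (act_word k u) (act_word k (v @ [x]))"
  using stack_comp_gen[OF eqv_on_act_word[OF v] x] by simp
 finally show ?case .
qed

lemma diagram_mult_diag:
 assumes "eqv_on k r1" "eqv_on k r2"
 shows "diagram_mult k (diag k r1) (diag k r2) = diag k (stack_comp k r1 r2)"
 using rel_mult[OF diag_in_A_set[OF assms(1)] diag_in_A_set[OF assms(2)]] assms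
 by (metis diag_rel rel_diag)

text \<open>Concatenation of words provides closure under products, so closure never has to be
  checked on the sets P_k, T_k, S_k themselves.\<close>

lemma monoid_diagrams:
 assumes X: "X \<subseteq> Collect (valid_gen k)" and D: "D = diag k ` act_word k ` lists X"
 shows "monoid (diagram_monoid k D)"
proof -
 have l: "w \<in> lists (Collect (valid_gen k))" if "w \<in> lists X" for w using that X by auto
 have mult: "diagram_mult k (diag k (act_word k u)) (diag k (act_word k v)) = diag k (act_word k (u @ v))"
  if "u \<in> lists X" "v \<in> lists X" for u v
  using that diagram_mult_diag[OF eqv_on_act_word[OF l] eqv_on_act_word[OF l]] act_word_append[OF l l] by simp
 have one: "id_diagram k = diag k (act_word k [])"
  using id_diagram_rel diag_rel by (metis act_word_simps(1))
 have car: "d \<in> carrier (diagram_monoid k D) ==> \<exists>w\<in>lists X. d = diag k (act_word k w)" for d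
  by (auto simp: diagram_monoid_def D)
 show ?thesis
 proof (rule monoidI)
  fix x y assume "x \<in> carrier (diagram_monoid k D)" "y \<in> carrier (diagram_monoid k D)"
  then obtain u v where uv: "u \<in> lists X" "v \<in> lists X" "x = diag k (act_word k u)" "y = diag k (act_word k v)"
   using car by metis
  have "u @ v \<in> lists X" using uv(1,2) by auto
  thus "x \<otimes>\<^bsub>diagram_monoid k D\<^esub> y \<in> carrier (diagram_monoid k D)"
   using mult[OF uv(1,2)] uv(3,4) by (simp add: diagram_monoid_def D)
 next
  show "\<one>\<^bsub>diagram_monoid k D\<^esub> \<in> carrier (diagram_monoid k D)"
  proof -
   have "id_diagram k \<in> diag k ` act_word k ` lists X" unfolding one by (intro imageI) simp
   thus ?thesis by (simp add: diagram_monoid_def D)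
  qed
 next
  fix x y z assume "x \<in> carrier (diagram_monoid k D)" "y \<in> carrier (diagram_monoid k D)" "z \<in> carrier (diagram_monoid k D)"
  then obtain u v w where uv: "u \<in> lists X" "v \<in> lists X" "w \<in> lists X" "x = diag k (act_word k u)"
   "y = diag k (act_word k v)" "z = diag k (act_word k w)" using car by metis
  have "u @ v \<in> lists X" "v @ w \<in> lists X" using uv(1-3) by auto
  thus "x \<otimes>\<^bsub>diagram_monoid k D\<^esub> y \<otimes>\<^bsub>diagram_monoid k D\<^esub> z =
   x \<otimes>\<^bsub>diagram_monoid k D\<^esub> (y \<otimes>\<^bsub>diagram_monoid k D\<^esub> z)"
   using mult uv by (simp add: diagram_monoid_def)
 next
  fix x assume "x \<in> carrier (diagram_monoid k D)"
  then obtain u where u: "u \<in> lists X" "x = diag k (act_word k u)" using car by metis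
  show "\<one>\<^bsub>diagram_monoid k D\<^esub> \<otimes>\<^bsub>diagram_monoid k D\<^esub> x = x"
   using mult[of "[]" u] one u by (simp add: diagram_monoid_def)
  show "x \<otimes>\<^bsub>diagram_monoid k D\<^esub> \<one>\<^bsub>diagram_monoid k D\<^esub> = x"
   using mult[of u "[]"] one u by (simp add: diagram_monoid_def)
 qed
qed

text \<open>The renaming \<open>f\<close> of letters is there for the group presentation, whose
  letters carry a sign; for monoid presentations it is the identity.\<close>

lemma presented_diagrams:
 assumes X: "X \<subseteq> Collect (valid_gen k)" and D: "D = diag k ` act_word k ` lists X"
  and Y: "f ` Y = X" and R: "R \<subseteq> lists Y \<times> lists Y"
  and sound: "\<And>u v. (u, v) \<in> R ==> act_word k (map f u) = act_word k (map f v)"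
  and complete: "\<And>u v. u \<in> lists Y ==> v \<in> lists Y ==>
   act_word k (map f u) = act_word k (map f v) ==> (u, v) \<in> word_cong Y R"
 shows "\<exists>\<phi> \<in> iso (presented_monoid Y R) (diagram_monoid k D).
  \<forall>y\<in>Y. \<phi> (word_cong Y R `` {[y]}) = gen_diagram k (f y)"
proof -
 interpret M: monoid "diagram_monoid k D" by (rule monoid_diagrams[OF X D])
 have lf: "map f w \<in> lists (Collect (valid_gen k))" if "w \<in> lists Y" for w
  using that X Y by (auto simp: image_subset_iff)
 have ev: "M.word_eval (\<lambda>y. gen_diagram k (f y)) w = diag k (act_word k (map f w))" if "w \<in> lists Y" for w
  using that
 proof (induction w rule: rev_induct)
  case Nil
  thus ?case using id_diagram_rel diag_rel by (metis M.word_eval_simps(1) act_word_simps(1) diagram_monoid_def list.simps(8) monoid.select_convs(2))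
 next
  case (snoc y w)
  hence w: "w \<in> lists Y" and y: "valid_gen k (f y)" using X Y by auto
  have "gen_diagram k (f y) = diag k (gen_act (f y) (id_rel k))"
   using gen_diagram_rel[OF y] by (metis diag_rel)
  moreover have "eqv_on k (gen_act (f y) (id_rel k))" by (rule eqv_on_gen_act[OF eqv_on_id_rel y])
  ultimately have "diagram_mult k (diag k (act_word k (map f w))) (gen_diagram k (f y)) =
    diag k (gen_act (f y) (act_word k (map f w)))"
   using diagram_mult_diag[OF eqv_on_act_word[OF lf[OF w]]] stack_comp_gen[OF eqv_on_act_word[OF lf[OF w]] y] by simp
  moreover have "mult (diagram_monoid k D) = diagram_mult k" by (simp add: diagram_monoid_def)
  ultimately show ?case using snoc.IH[OF w] by simp
 qed
 have inj: "act_word k (map f u) = act_word k (map f v)"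
  if "diag k (act_word k (map f u)) = diag k (act_word k (map f v))" "u \<in> lists Y" "v \<in> lists Y" for u v
  using that rel_diag[OF eqv_on_act_word[OF lf]] by metis
 have lists: "lists X = map f ` lists Y" using Y by (metis lists_image)
 show ?thesis
 proof (rule M.presented_monoid_iso[OF R])
  show "(\<lambda>y. gen_diagram k (f y)) ` Y \<subseteq> carrier (diagram_monoid k D)"
  proof
   fix d assume "d \<in> (\<lambda>y. gen_diagram k (f y)) ` Y"
   then obtain y where y: "y \<in> Y" "d = gen_diagram k (f y)" by auto
   hence "valid_gen k (f y)" using X Y by auto
   hence "d = diag k (act_word k [f y])"
    using gen_diagram_rel y by (metis act_word_simps append_Nil diag_rel)
   moreover have "[f y] \<in> lists X" using y Y by auto
   ultimately show "d \<in> carrier (diagram_monoid k D)" by (auto simp: diagram_monoid_def D)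
  qed
  show "M.word_eval (\<lambda>y. gen_diagram k (f y)) u = M.word_eval (\<lambda>y. gen_diagram k (f y)) v" if "(u, v) \<in> R" for u v
  proof -
   have "u \<in> lists Y" "v \<in> lists Y" using that R by auto
   thus ?thesis using ev sound[OF that] by metis
  qed
  show "\<exists>w\<in>lists Y. M.word_eval (\<lambda>y. gen_diagram k (f y)) w = d" if d: "d \<in> carrier (diagram_monoid k D)" for d
  proof -
   have "d \<in> diag k ` act_word k ` map f ` lists Y" using d by (simp only: diagram_monoid_def D lists partial_object.select_convs)
   then obtain w where "w \<in> lists Y" "d = diag k (act_word k (map f w))" by blast
   thus ?thesis using ev by metis
  qed
  show "(u, v) \<in> word_cong Y R" if "u \<in> lists Y" "v \<in> lists Y"
   "M.word_eval (\<lambda>y. gen_diagram k (f y)) u = M.word_eval (\<lambda>y. gen_diagram k (f y)) v" for u v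
   using that complete inj ev by metis
 qed
qed

section \<open>Temperley--Lieb normal forms\<close>

text \<open>The effect of attaching e_i below a matching: the former partners of \<open>i\<close>
  and \<open>i + 1\<close> become partners of each other. If \<open>i\<close> and
  \<open>i + 1\<close> are partners already, only a closed loop arises, and it is discarded.\<close>

definition tl_act :: "int => (int => int) => int => int" where
 "tl_act i f = (if f i = i + 1 then f else f(f i := f (i + 1), f (i + 1) := f i, i := i + 1, i + 1 := i))"

text \<open>Matchings are involutions of all integers, so that no bound is carried along and
  equality of functions is equality of diagrams. The only fixed point is 0, which is no vertex;
  outside the diagram \<open>trivial_above\<close> prescribes verticals.\<close>

definition matching :: "(int => int) => bool" where
 "matching f <-> (\<forall>a. f (f a) = a) \<and> (\<forall>a. f a = a <-> a = 0)"

definition between :: "int => int => int => bool" where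
 "between a b q <-> a < q \<and> q < b \<or> b < q \<and> q < a"

definition noncrossing :: "(int => int) => bool" where
 "noncrossing f <-> matching f \<and> (\<forall>a q. between a (f a) q \<longrightarrow> between a (f a) (f q))"

definition trivial_above :: "int => (int => int) => bool" where
 "trivial_above n f <-> (\<forall>a. \<bar>a\<bar> > n \<longrightarrow> f a = - a)"

lemma matchingD:
 assumes "matching f"
 shows "f (f a) = a" "f a = a <-> a = 0" "f a = f b <-> a = b" "f a = b <-> f b = a" "f 0 = 0"
  "f a = 0 <-> a = 0"
 using assms unfolding matching_def by metis+

lemma trivial_above_bound:
 assumes "matching f" "trivial_above n f" "\<bar>a\<bar> \<le> n"
 shows "\<bar>f a\<bar> \<le> n"
proof (rule ccontr)
 assume "\<not> \<bar>f a\<bar> \<le> n"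
 hence "f (f a) = - f a" using assms(2) by (simp add: trivial_above_def)
 hence "\<bar>f a\<bar> = \<bar>a\<bar>" using matchingD(1)[OF assms(1)] by simp
 with \<open>\<not> \<bar>f a\<bar> \<le> n\<close> assms(3) show False by simp
qed

lemma tl_act_apply:
 assumes "matching f" "1 \<le> i"
 shows "tl_act i f a = (if f i = i + 1 then f a else if a = i then i + 1 else if a = i + 1 then i
  else if a = f i then f (i + 1) else if a = f (i + 1) then f i else f a)"
proof -
 have "f i = f (i + 1) <-> False" using matchingD(3)[OF assms(1)] by auto
 thus ?thesis using assms by (auto simp: tl_act_def)
qed

lemma matching_tl_act:
 assumes "matching f" "1 \<le> i"
 shows "matching (tl_act i f)"
proof (cases "f i = i + 1")
 case True
 thus ?thesis using assms by (simp add: tl_act_def)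
next
 case False
 define x y where "x = f i" and "y = f (i + 1)"
 have f: "f (f a) = a" "f a = a <-> a = 0" "f a = f b <-> a = b" for a b
  using matchingD[OF assms(1)] by auto
 have xy: "x \<noteq> i" "y \<noteq> i + 1" "x \<noteq> y" "x \<noteq> i + 1" "f x = i" "f y = i + 1"
  using False f(2)[of i] f(2)[of "i + 1"] f(3)[of i "i + 1"] assms(2) f(1)
  by (auto simp: x_def y_def)
 have "y \<noteq> i" using xy(4) f(1)[of "i + 1"] by (auto simp: x_def y_def)
 note xy = xy this
 have g: "tl_act i f a = (if a = i then i + 1 else if a = i + 1 then i
  else if a = x then y else if a = y then x else f a)" for a
  using False by (simp add: tl_act_apply[OF assms] x_def y_def)
 have o: "f a \<notin> {i, i + 1, x, y}" if "a \<notin> {i, i + 1, x, y}" for a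
  using that matchingD(4)[OF assms(1), of a i] matchingD(4)[OF assms(1), of a "i + 1"]
  by (auto simp: x_def y_def f(3))
 have z: "x \<noteq> 0" "y \<noteq> 0" "i \<noteq> 0" "i + 1 \<noteq> 0"
  using matchingD(6)[OF assms(1), of i] matchingD(6)[OF assms(1), of "i + 1"] assms(2) by (auto simp: x_def y_def)
 have "tl_act i f (tl_act i f a) = a \<and> (tl_act i f a = a <-> a = 0)" for a
 proof (cases "a \<in> {i, i + 1, x, y}")
  case True
  then consider "a = i" | "a = i + 1" | "a = x" | "a = y" by blast
  thus ?thesis by cases (use xy(1,2,3,4,7) z in \<open>simp_all add: g\<close>)
 next
  case False
  hence "tl_act i f a = f a" by (simp add: g)
  moreover have "tl_act i f (f a) = a" using o[OF False] f(1) by (simp add: g)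
  ultimately show ?thesis using f(2) by simp
 qed
 thus ?thesis by (simp add: matching_def)
qed

lemma trivial_above_tl_act:
 assumes "matching f" "1 \<le> i" "i + 1 \<le> n" "trivial_above n f"
 shows "trivial_above n (tl_act i f)"
 unfolding trivial_above_def
proof (intro allI impI)
 fix a :: int assume a: "n < \<bar>a\<bar>"
 have "\<bar>f i\<bar> \<le> n" "\<bar>f (i + 1)\<bar> \<le> n"
  using trivial_above_bound[OF assms(1,4)] assms(2,3) by auto
 hence "a \<noteq> i" "a \<noteq> i + 1" "a \<noteq> f i" "a \<noteq> f (i + 1)" using a assms(2,3) by auto
 thus "tl_act i f a = - a"
  using a assms(4) by (simp add: tl_act_apply[OF assms(1,2)] trivial_above_def)
qed

lemma between_f_iff:
 assumes "noncrossing f" "q \<noteq> a" "q \<noteq> f a"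
 shows "between a (f a) (f q) <-> between a (f a) q"
 using assms matchingD(1)[of f] unfolding noncrossing_def by metis

lemma between_commute: "between a b q <-> between b a q"
 by (auto simp: between_def)

lemma between_iff:
 assumes "q \<noteq> a" "q \<noteq> b"
 shows "between a b q <-> (q < a) \<noteq> (q < b)"
 using assms by (auto simp: between_def)

text \<open>A point lies under an arc when exactly one end is to its right. Adding the conditions
  for the two old arcs modulo 2, the ends \<open>i\<close> and \<open>i + 1\<close> cancel since no
  integer separates them.\<close>

lemma between_xor:
 assumes "q \<notin> {x, y, i, i + 1}"
 shows "between x y q <-> between i x q \<noteq> between (i + 1) y q"
proof -
 have "q < i + 1 <-> q < i" using assms by auto
 thus ?thesis using assms by (simp add: between_iff) blast
qed

text \<open>Nothing lies under the new cap. Whether a point lies under the arc joining the two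
  former partners is the exclusive or of the conditions for the two old arcs
  (\<open>between_xor\<close>), and each of these is invariant under \<open>f\<close>.\<close>

lemma noncrossing_tl_act:
 assumes nc: "noncrossing f" and i: "1 \<le> i"
 shows "noncrossing (tl_act i f)"
proof (cases "f i = i + 1")
 case True
 thus ?thesis using assms by (simp add: tl_act_def)
next
 case False
 have m: "matching f" using nc by (simp add: noncrossing_def)
 note f = matchingD(1)[OF m]
 define g x y where "g = tl_act i f" and "x = f i" and "y = f (i + 1)"
 have mg: "matching g" unfolding g_def by (rule matching_tl_act[OF m i])
 have g: "g a = (if a = i then i + 1 else if a = i + 1 then i else if a = x then y
   else if a = y then x else f a)" for a
  using False by (simp add: g_def tl_act_apply[OF m i] x_def y_def)
 have gx: "g x = y" "g y = x" "x \<noteq> y" "x \<noteq> i" "x \<noteq> i + 1" "y \<noteq> i" "y \<noteq> i + 1"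
  using matchingD(1,3)[OF mg, of i] False matchingD(2)[OF m, of i] matchingD(2)[OF m, of "i + 1"]
   matchingD(3)[OF m, of i "i + 1"] i f[of "i + 1"] by (auto simp: g x_def y_def)
 have out: "f q \<notin> {x, y, i, i + 1}" if "q \<notin> {x, y, i, i + 1}" for q
  using that f[of q] f[of i] f[of "i + 1"] by (auto simp: x_def y_def)
 have "between a (g a) (g q)" if b: "between a (g a) q" for a q
 proof -
  have q: "q \<noteq> a" "q \<noteq> g a" using b by (auto simp: between_def)
  have xy: "between x y (g q)" if b: "between x y q"
  proof (cases "q \<in> {i, i + 1}")
   case True
   have "i + 1 < x <-> i < x" "i + 1 < y <-> i < y" using gx by auto
   hence "between x y i <-> between x y (i + 1)" using gx by (simp add: between_iff)
   moreover have "g i = i + 1" "g (i + 1) = i" by (simp_all add: g)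
   ultimately show ?thesis using b True by auto
  next
   case False
   moreover have "q \<noteq> x" "q \<noteq> y" using b unfolding between_def by linarith+
   ultimately have n: "q \<notin> {x, y, i, i + 1}" by blast
   hence "g q = f q" by (simp add: g)
   thus ?thesis
    using b between_xor[OF n] between_xor[OF out[OF n]] between_f_iff[OF nc, of q i]
     between_f_iff[OF nc, of q "i + 1"] n by (simp add: x_def y_def)
  qed
  consider "a \<in> {i, i + 1}" | "a = x" | "a = y" | "a \<notin> {x, y, i, i + 1}" by auto
  thus ?thesis
  proof cases
   case 1
   hence False using b by (elim insertE) (auto simp: g between_def)
   thus ?thesis ..
  next
   case 2 thus ?thesis using b xy gx by simp
  next
   case 3 thus ?thesis using b xy gx by (simp add: between_commute)
  next
   case 4
   hence ga: "g a = f a" by (simp add: g)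
   have fa: "f a \<notin> {x, y, i, i + 1}" using out[OF 4] .
   have "i < a <-> i + 1 < a" "i < f a <-> i + 1 < f a" using 4 fa by auto
   \<comment> \<open>An untouched arc has \<open>i\<close> and \<open>i + 1\<close> on the same
     side, hence also their partners \<open>x\<close> and \<open>y\<close>; rejoining those does not
     create a crossing.\<close>
   hence adj: "between a (f a) i <-> between a (f a) (i + 1)" using 4 fa by (simp add: between_iff)
   have n: "i \<noteq> a" "i \<noteq> f a" "i + 1 \<noteq> a" "i + 1 \<noteq> f a" using 4 fa by simp_all
   have "between a (f a) x <-> between a (f a) i" "between a (f a) y <-> between a (f a) (i + 1)"
    unfolding x_def y_def by (rule between_f_iff[OF nc n(1,2)], rule between_f_iff[OF nc n(3,4)])
   with adj show ?thesis
    using b between_f_iff[OF nc, of q a] q unfolding ga g[of q] by auto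
  qed
 qed
 thus ?thesis using mg by (auto simp: noncrossing_def g_def)
qed

lemma tl_act_idem: "tl_act i (tl_act i f) = tl_act i f"
 by (auto simp: tl_act_def)

text \<open>After the first step there is a cap at \<open>i\<close>. The second step pulls the
  strand \<open>y\<close> of the outer neighbour through this cap, and the third step pulls it
  back.\<close>

lemma tl_act_braid:
 assumes "matching f" "1 \<le> i" "j = i + 1 \<or> i = j + 1" "1 \<le> j"
 shows "tl_act i (tl_act j (tl_act i f)) = tl_act i f"
proof -
 define g h where "g = tl_act i f" and "h = tl_act j g"
 have m: "matching g" and mh: "matching h" using assms matching_tl_act g_def h_def by auto
 have gi: "g i = i + 1" using assms by (simp add: g_def tl_act_apply)
 have gi': "g (i + 1) = i" using gi matchingD(4)[OF m] by auto
 have "tl_act i h a = g a" for a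
 proof (cases "j = i + 1")
  case True
  define y where "y = g (i + 2)"
  have gy: "g y = i + 2" using matchingD(1)[OF m] by (simp add: y_def)
  have y: "y \<noteq> i" "y \<noteq> i + 1" "y \<noteq> i + 2"
   using gy gi gi' matchingD(2)[OF m, of y] assms(2) by auto
  have jj: "j + 1 = i + 2" "j = i + 1" using True by auto
  have h: "h a = (if a = i + 1 then i + 2 else if a = i + 2 then i + 1 else if a = i then y
    else if a = y then i else g a)" for a
   unfolding h_def tl_act_apply[OF m assms(4)] unfolding jj(1) unfolding jj(2) gi' y_def[symmetric] by simp
  show ?thesis
   unfolding tl_act_apply[OF mh assms(2)] using y gy gi gi' by (simp add: h y_def[symmetric])
 next
  case False
  hence j: "j = i - 1" using assms(3) by auto
  define y where "y = g (i - 1)"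
  have gy: "g y = i - 1" using matchingD(1)[OF m] by (simp add: y_def)
  have y: "y \<noteq> i" "y \<noteq> i + 1" "y \<noteq> i - 1"
   using gy gi gi' matchingD(2)[OF m, of y] assms j by auto
  have h: "h a = (if a = i - 1 then i else if a = i then i - 1 else if a = y then i + 1
    else if a = i + 1 then y else g a)" for a
   unfolding h_def tl_act_apply[OF m assms(4)] unfolding j y_def[symmetric] using gi y by simp
  show ?thesis
   unfolding tl_act_apply[OF mh assms(2)] using y gy gi gi' by (simp add: h y_def[symmetric])
 qed
 thus ?thesis unfolding g_def[symmetric] h_def[symmetric] by auto
qed

lemma tl_act_commute:
 assumes m: "matching f" and i: "1 \<le> i" and j: "1 \<le> j" "i + 1 < j"
 shows "tl_act i (tl_act j f) = tl_act j (tl_act i f)"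
proof -
 define x y u v where "x = f i" and "y = f (i + 1)" and "u = f j" and "v = f (j + 1)"
 note inj = matchingD(3)[OF m]
 note f = matchingD(1,4)[OF m]
 have d: "x \<noteq> y" "u \<noteq> v" "x \<noteq> u" "x \<noteq> v" "y \<noteq> u" "y \<noteq> v"
  using j by (auto simp: x_def y_def u_def v_def inj)
 have n: "x \<noteq> i" "y \<noteq> i + 1" "u \<noteq> j" "v \<noteq> j + 1"
  using i j matchingD(2)[OF m] by (auto simp: x_def y_def u_def v_def)
 have e: "u = i <-> x = j" "v = i <-> x = j + 1" "u = i + 1 <-> y = j" "v = i + 1 <-> y = j + 1"
  "y = i <-> x = i + 1" "v = j <-> u = j + 1"
  unfolding x_def y_def u_def v_def using f(2) by blast+
 have fi: "f i = x" "f (i + 1) = y" "f j = u" "f (j + 1) = v" "f x = i" "f y = i + 1" "f u = j" "f v = j + 1"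
  by (simp_all add: x_def y_def u_def v_def f)
 have mi: "matching (tl_act i f)" and mj: "matching (tl_act j f)" using matching_tl_act m i j by auto
 have gi: "tl_act i f a = (if x = i + 1 then f a else if a = i then i + 1 else if a = i + 1 then i
  else if a = x then y else if a = y then x else f a)" for a
  by (simp add: tl_act_apply[OF m i] fi)
 have gj: "tl_act j f a = (if u = j + 1 then f a else if a = j then j + 1 else if a = j + 1 then j
  else if a = u then v else if a = v then u else f a)" for a
  by (simp add: tl_act_apply[OF m j(1)] fi)
 show ?thesis
 proof (cases "x = i + 1 \<or> u = j + 1")
  case True
  thus ?thesis
  proof
   assume x: "x = i + 1"
   hence "y = i" "u \<noteq> i" "v \<noteq> i" using e j(2) by auto
   hence "tl_act j f i = i + 1" using x j(2) by (simp add: gj fi)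
   thus ?thesis using x fi(1) by (simp add: tl_act_def[of i])
  next
   assume u: "u = j + 1"
   hence "v = j" "x \<noteq> j" "y \<noteq> j" using e j(2) by auto
   hence "tl_act i f j = j + 1" using u j(2) by (simp add: gi fi)
   thus ?thesis using u fi(3) by (simp add: tl_act_def[of j])
  qed
 next
  case False
  hence ne: "x \<noteq> i + 1" "u \<noteq> j + 1" "y \<noteq> i" "v \<noteq> j" using e by auto
  have gi: "tl_act i f a = (if a = i then i + 1 else if a = i + 1 then i
   else if a = x then y else if a = y then x else f a)" for a using ne(1) by (simp add: gi)
  have gj: "tl_act j f a = (if a = j then j + 1 else if a = j + 1 then j
   else if a = u then v else if a = v then u else f a)" for a using ne(2) by (simp add: gj)
  have ij: "i \<noteq> j" "i \<noteq> j + 1" "i + 1 \<noteq> j" using j by auto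
  have "tl_act i (tl_act j f) a = tl_act j (tl_act i f) a" for a
  proof -
   note A = tl_act_apply[OF mi j(1)] tl_act_apply[OF mj i]
   \<comment> \<open>The two surgeries interfere only if strands run between the columns
     \<open>i\<close>, \<open>i + 1\<close> and \<open>j\<close>, \<open>j + 1\<close>. The cases
     list how \<open>x\<close> and \<open>y\<close> meet the second pair; \<open>e\<close> then
     settles \<open>u\<close> and \<open>v\<close>.\<close>
   consider "x = j" "y = j + 1" | "x = j + 1" "y = j" | "x = j" "y \<noteq> j + 1" | "x = j + 1" "y \<noteq> j"
    | "y = j" "x \<noteq> j + 1" | "y = j + 1" "x \<noteq> j" | "x \<noteq> j" "x \<noteq> j + 1" "y \<noteq> j" "y \<noteq> j + 1" by blast
   thus ?thesis
   proof cases
    case 1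
    hence "u = i" "v = i + 1" using e by auto
    thus ?thesis unfolding A using 1 ij by (simp add: gi gj)
   next
    case 2
    hence "u = i + 1" "v = i" using e by auto
    thus ?thesis unfolding A using 2 ij by (simp add: gi gj)
   next
    case 3
    hence "u = i" "v \<noteq> i" "v \<noteq> i + 1" using e by auto
    thus ?thesis unfolding A using 3 ij ne d n by (simp add: gi gj fi)
   next
    case 4
    hence "v = i" "u \<noteq> i" "u \<noteq> i + 1" using e by auto
    thus ?thesis unfolding A using 4 ij ne d n by (simp add: gi gj fi)
   next
    case 5
    hence "u = i + 1" "v \<noteq> i" "v \<noteq> i + 1" using e by auto
    thus ?thesis unfolding A using 5 ij ne d n by (simp add: gi gj fi)
   next
    case 6
    hence "v = i + 1" "u \<noteq> i" "u \<noteq> i + 1" using e by auto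
    thus ?thesis unfolding A using 6 ij ne d n by (simp add: gi gj fi)
   next
    case 7
    hence "u \<noteq> i" "u \<noteq> i + 1" "v \<noteq> i" "v \<noteq> i + 1" using e by auto
    thus ?thesis unfolding A using 7 ij ne d n by (simp add: gi gj fi)
   qed
  qed
  thus ?thesis by auto
 qed
qed

definition tl_word :: "nat list => int => int" where
 "tl_word w = foldl (\<lambda>f i. tl_act (int i) f) uminus w"

lemma tl_word_simps [simp]:
 "tl_word [] = uminus" "tl_word (w @ [i]) = tl_act (int i) (tl_word w)"
 by (simp_all add: tl_word_def)

lemma noncrossing_uminus: "noncrossing uminus" "trivial_above n uminus"
 by (auto simp: noncrossing_def matching_def trivial_above_def between_def)

lemma noncrossing_tl_word:
 assumes "set w \<subseteq> {1..<n}"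
 shows "noncrossing (tl_word w) \<and> trivial_above (int n) (tl_word w)"
 using assms
proof (induction w rule: rev_induct)
 case (snoc i w)
 thus ?case
  using noncrossing_tl_act[of "tl_word w" "int i"] trivial_above_tl_act[of "tl_word w" "int i" "int n"]
  by (auto simp: noncrossing_def)
qed (simp add: noncrossing_uminus)

text \<open>The descending blocks from which the normal forms of T_k and of S_k are built. The lower
  end \<open>m + 1\<close> encodes the empty block.\<close>

definition down :: "nat => nat => nat list" where
 "down m b = rev [b..<Suc m]"

lemma down_simps:
 "m < b ==> down m b = []" "b \<le> m ==> down m b = down m (Suc b) @ [b]"
 "b \<le> Suc m ==> down (Suc m) b = Suc m # down m b" "set (down m b) = {b..m}"
 by (auto simp: down_def upt_conv_Cons[of b "Suc m"] simp del: upt_Suc) (simp add: upt_Suc_append)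

lemma down_split: "0 < b ==> b \<le> i ==> i \<le> Suc m ==> down m b = down m i @ down (i - 1) b"
proof -
 assume a: "0 < b" "b \<le> i" "i \<le> Suc m"
 hence "[b..<Suc m] = [b..<i] @ [i..<Suc m]" by (metis le_Suc_ex upt_add_eq_append)
 thus ?thesis using a by (cases i) (auto simp: down_def)
qed

locale tl_relations =
 fixes h :: "nat => 'm::monoid_mult" and n :: nat
 assumes idem: "\<And>i. 1 \<le> i ==> i < n ==> h i * h i = h i"
  and braid: "\<And>i. 1 \<le> i ==> i + 1 < n ==> h i * h (i + 1) * h i = h i"
   "\<And>i. 1 \<le> i ==> i + 1 < n ==> h (i + 1) * h i * h (i + 1) = h (i + 1)"
  and commute: "\<And>i j. 1 \<le> i ==> i + 1 < j ==> j < n ==> h i * h j = h j * h i"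
begin

abbreviation W :: "nat list => 'm" where "W \<equiv> word_prod h"

lemma W_commute:
 assumes "\<And>i. i \<in> set u ==> 1 \<le> i \<and> i + 1 < j" "j < n"
 shows "W u * h j = h j * W u"
 using assms(1)
proof (induction u)
 case (Cons i u)
 hence "h i * h j = h j * h i" using commute[of i j] assms(2) by auto
 moreover have "W u * h j = h j * W u" using Cons by simp
 ultimately show ?case by (simp add: mult.assoc) (metis mult.assoc)
qed simp

lemma W_commute_words:
 assumes "\<And>i j. i \<in> set u ==> j \<in> set v ==> 1 \<le> i \<and> i + 1 < j \<and> j < n"
 shows "W u * W v = W v * W u"
 using assms
proof (induction v)
 case (Cons j v)
 show ?case
 proof (cases "u = []")
  case False
  hence "j < n" using Cons.prems[of "hd u" j] by simp
  hence "W u * h j = h j * W u" using Cons.prems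
   by (intro W_commute) auto
  moreover have "W u * W v = W v * W u" by (rule Cons.IH) (use Cons.prems in auto)
  ultimately show ?thesis by (simp add: mult.assoc) (metis mult.assoc)
 qed simp
qed simp

text \<open>The letter \<open>i\<close> commutes past the tail below \<open>i - 1\<close>, and then
  e_i e_{i-1} e_i = e_i removes \<open>i - 1\<close>. The block falls apart into two commuting
  pieces; for \<open>i = b + 1\<close> the lower piece is empty.\<close>

lemma down_absorb:
 assumes "1 \<le> b" "b < i" "i \<le> m" "m < n"
 shows "W (down m b) * h i = W (down (i - 2) b) * W (down m i)"
proof -
 have d: "down m b = down m (Suc i) @ [i, i - 1] @ down (i - 2) b"
 proof -
  have "down m b = down m i @ down (i - 1) b" using assms by (intro down_split) auto
  moreover have "down (i - 1) b = (i - 1) # down (i - 2) b"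
  proof -
   have "Suc (i - 2) = i - 1" using assms by simp
   thus ?thesis using down_simps(3)[of b "i - 2"] assms by simp
  qed
  moreover have "down m i = down m (Suc i) @ [i]" using down_simps(2) assms by auto
  ultimately show ?thesis by simp
 qed
 have c: "W (down (i - 2) b) * h i = h i * W (down (i - 2) b)"
  using assms by (intro W_commute) (auto simp: down_simps)
 have br: "h i * h (i - 1) * h i = h i" using braid(2)[of "i - 1"] assms by simp
 have "W (down m b) * h i = W (down m (Suc i)) * (h i * h (i - 1) * (W (down (i - 2) b) * h i))"
  unfolding d by (simp add: mult.assoc)
 also have "\<dots> = W (down m (Suc i)) * (h i * h (i - 1) * h i) * W (down (i - 2) b)"
  unfolding c by (simp add: mult.assoc)
 also have "\<dots> = W (down m i) * W (down (i - 2) b)"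
  unfolding br using down_simps(2)[of i m] assms by simp
 also have "\<dots> = W (down (i - 2) b) * W (down m i)"
  using assms by (intro W_commute_words[symmetric]) (auto simp: down_simps)
 finally show ?thesis .
qed

text \<open>The top letter \<open>m\<close> is needed at most once, and then at the start of a
  descending block. A letter appended to such a block commutes to the left, prolongs the block, is
  absorbed by it, or cuts it by \<open>down_absorb\<close>.\<close>

lemma word_split:
 assumes "set w \<subseteq> {1..<Suc m}" "m < n"
 shows "\<exists>w' b. set w' \<subseteq> {1..<m} \<and> 1 \<le> b \<and> b \<le> Suc m \<and> W w = W w' * W (down m b)"
 using assms(1)
proof (induction w rule: rev_induct)
 case Nil
 show ?case by (intro exI[of _ "[]"] exI[of _ "Suc m"]) (simp add: down_simps)
next
 case (snoc i w)
 then obtain w' b where w: "set w' \<subseteq> {1..<m}" "1 \<le> b" "b \<le> Suc m" "W w = W w' * W (down m b)" by auto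
 have i: "1 \<le> i" "i \<le> m" using snoc.prems by auto
 have eq: "W (w @ [i]) = W w' * (W (down m b) * h i)" using w(4) by (simp add: mult.assoc)
 consider "i + 1 < b" | "i + 1 = b" | "i = b" | "b < i" by linarith
 thus ?case
 proof cases
  case 1
  have "W (down m b) * h i = h i * W (down m b)"
   using W_commute_words[of "[i]" "down m b"] 1 i assms(2) by (auto simp: down_simps)
  hence "W (w @ [i]) = W (w' @ [i]) * W (down m b)" using eq by (simp add: mult.assoc)
  moreover have "set (w' @ [i]) \<subseteq> {1..<m}" using w(1,3) i 1 by auto
  ultimately show ?thesis using w(2,3) by blast
 next
  case 2
  hence "W (w @ [i]) = W w' * W (down m i)" using eq down_simps(2)[of i m] i by auto
  thus ?thesis using w(1) i by (intro exI[of _ w'] exI[of _ i]) auto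
 next
  case 3
  hence "W (down m b) * h i = W (down m b)"
   using down_simps(2)[of b m] idem[of b] i assms(2) by (simp add: mult.assoc)
  thus ?thesis using eq w by metis
 next
  case 4
  hence "W (w @ [i]) = W (w' @ down (i - 2) b) * W (down m i)"
   using eq down_absorb[OF w(2) 4 i(2) assms(2)] by (simp add: mult.assoc)
  moreover have "set (w' @ down (i - 2) b) \<subseteq> {1..<m}" using w(1,2) i 4 by (auto simp: down_simps)
  ultimately show ?thesis using i by (intro exI[of _ "w' @ down (i - 2) b"] exI[of _ i]) auto
 qed
qed

text \<open>If the lower end of a block is not below that of the next block, a relation e_c e_{c+1}
  e_c = e_c applies where they meet, and the next block shrinks to lower end \<open>c + 2\<close>.
  This rule enforces increasing lower ends in the normal form.\<close>

lemma down_down: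
 assumes "1 \<le> b" "b \<le> c" "c \<le> a" "a < m" "m < n"
 shows "W (down a c) * W (down m b) = W (down a b) * W (down m (c + 2))"
 using assms(3,4)
proof (induction a rule: dec_induct)
 case base
 have d: "down m b = down m (c + 2) @ [c + 1, c] @ down (c - 1) b"
 proof -
  have "down m b = down m (c + 2) @ down (c + 1) b"
   using down_split[of b "c + 2" m] assms base by simp
  moreover have "down (c + 1) b = (c + 1) # c # down (c - 1) b"
   using down_simps(3)[of b c] down_simps(3)[of b "c - 1"] assms by simp
  ultimately show ?thesis by simp
 qed
 have c: "h c * W (down m (c + 2)) = W (down m (c + 2)) * h c"
  using W_commute_words[of "[c]" "down m (c + 2)"] assms base by (auto simp: down_simps)
 have br: "h c * h (c + 1) * h c = h c" using braid(1)[of c] assms base by simp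
 have dc: "down c c = [c]" "down c b = c # down (c - 1) b"
  using down_simps(2)[of c c] down_simps(1)[of c "Suc c"] down_simps(3)[of b "c - 1"] assms by auto
 have "W (down c c) * W (down m b) = (h c * W (down m (c + 2))) * (h (c + 1) * h c * W (down (c - 1) b))"
  unfolding dc d by (simp add: mult.assoc)
 also have "\<dots> = W (down m (c + 2)) * (h c * h (c + 1) * h c) * W (down (c - 1) b)"
  unfolding c by (simp add: mult.assoc)
 also have "\<dots> = W (down m (c + 2)) * W (down c b)" unfolding br dc by (simp add: mult.assoc)
 also have "\<dots> = W (down c b) * W (down m (c + 2))"
  using assms base by (intro W_commute_words[symmetric]) (auto simp: down_simps)
 finally show ?case .
next
 case (step a)
 hence "W (down a c) * W (down m b) = W (down a b) * W (down m (c + 2))" by simp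
 thus ?case using down_simps(3)[of c a] down_simps(3)[of b a] step assms
  by (simp add: mult.assoc)
qed

end

text \<open>Jones normal forms, with the last block of the word at the head of the list.\<close>

fun jones :: "nat => (nat \<times> nat) list => bool" where
 "jones n [] = True"
| "jones n ((a, b) # J) = (1 \<le> b \<and> b \<le> a \<and> a < n \<and> jones a J \<and> (J = [] \<or> snd (hd J) < b))"

fun jones_word :: "(nat \<times> nat) list => nat list" where
 "jones_word [] = []"
| "jones_word ((a, b) # J) = jones_word J @ down a b"

lemma jones_mono: "jones n J ==> n \<le> n' ==> jones n' J"
 by (cases "(n, J)" rule: jones.cases) auto

lemma set_jones_word: "jones n J ==> set (jones_word J) \<subseteq> {1..<n}"
proof (induction n J rule: jones.induct)
 case (2 n a b J)
 hence "set (jones_word J) \<subseteq> {1..<a}" by simp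
 thus ?case using 2(2) by (auto simp: down_simps)
qed simp

text \<open>Among all ways of splitting off a last block the one with the largest lower end
  \<open>b\<close> is taken. If the preceding block did not end below \<open>b\<close>,
  \<open>down_down\<close> would yield a split with the larger lower end
  \<open>c + 2\<close>.\<close>

lemma (in tl_relations) jones_normal_form:
 assumes "set w \<subseteq> {1..<m}" "m \<le> n"
 shows "\<exists>J. jones m J \<and> W w = W (jones_word J)"
 using assms
proof (induction m arbitrary: w)
 case 0
 thus ?case by (intro exI[of _ "[]"]) auto
next
 case (Suc m)
 define B where "B = {b. b \<le> Suc m \<and> 1 \<le> b \<and> (\<exists>w'. set w' \<subseteq> {1..<m} \<and> W w = W w' * W (down m b))}"
 have "finite B" by (rule finite_subset[of _ "{..Suc m}"]) (auto simp: B_def)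
 moreover have "B \<noteq> {}" using word_split[OF Suc.prems(1)] Suc.prems(2) by (auto simp: B_def)
 ultimately have M: "Max B \<in> B" "\<And>b. b \<in> B ==> b \<le> Max B" by auto
 define b where "b = Max B"
 obtain w' where w': "set w' \<subseteq> {1..<m}" "W w = W w' * W (down m b)" "b \<le> Suc m" "1 \<le> b"
  using M(1) by (auto simp: B_def b_def)
 obtain J where J: "jones m J" "W w' = W (jones_word J)" using Suc.IH[OF w'(1)] Suc.prems(2) by auto
 show ?case
 proof (cases "b = Suc m")
  case True
  hence "W w = W (jones_word J)" using w' J by (simp add: down_simps)
  thus ?thesis using J(1) jones_mono[of m J "Suc m"] by auto
 next
  case b: False
  have "J = [] \<or> snd (hd J) < b"
  proof (rule ccontr)
   assume c: "\<not> (J = [] \<or> snd (hd J) < b)"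
   then obtain a c J' where J': "J = (a, c) # J'" by (cases J) auto
   hence ac: "b \<le> c" "c \<le> a" "a < m" "jones a J'" using c J(1) by auto
   have "W w = W (jones_word J') * (W (down a c) * W (down m b))"
    using w'(2) J(2) by (simp add: J' mult.assoc)
   also have "W (down a c) * W (down m b) = W (down a b) * W (down m (c + 2))"
    using down_down[OF w'(4) ac(1-3)] Suc.prems(2) by simp
   finally have "W w = W (jones_word J' @ down a b) * W (down m (c + 2))" by (simp add: mult.assoc)
   moreover have "set (jones_word J' @ down a b) \<subseteq> {1..<m}"
    using set_jones_word[OF ac(4)] ac w'(4) by (auto simp: down_simps)
   ultimately have "c + 2 \<in> B" using ac unfolding B_def mem_Collect_eq by (intro conjI exI[of _ "jones_word J' @ down a b"]) auto
   thus False using M(2)[of "c + 2"] ac(1) by (simp add: b_def)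
  qed
  hence "jones (Suc m) ((m, b) # J)" using J(1) w'(3,4) b by auto
  moreover have "W w = W (jones_word ((m, b) # J))" using w'(2) J(2) by simp
  ultimately show ?thesis by blast
 qed
qed

text \<open>\<open>shift m b\<close> describes how the bottom of a matching moves when the block
 \<open>e\<^sub>m e\<^bsub>m-1\<^esub> \<dots> e\<^sub>b\<close> is attached: the strand at \<open>m\<close> turns back to the top vertex \<open>m + 1\<close>.\<close>

definition shift :: "int => int => int => int" where
 "shift m b j = (if j = m then - (m + 1) else if b \<le> j \<and> j < m then j + 2 else j)"

text \<open>Describes the matching \<open>g\<close> obtained from \<open>f\<close> by attaching a
  descending block, as a relation, so that it can be solved for either side. Points with absolute
  value \<open>m + 1\<close> are excluded: \<open>f\<close> is vertical there, and this is the
  strand through which the one at \<open>m\<close> turns back to the top.\<close>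

definition attached :: "int => int => (int => int) => (int => int) => bool" where
 "attached m b f g <->
   g b = b + 1 \<and> g (b + 1) = b \<and> (\<forall>j. \<bar>j\<bar> \<noteq> m + 1 \<longrightarrow> g (shift m b j) = shift m b (f j))"

lemma shift_inject:
 assumes "\<bar>i\<bar> \<noteq> m + 1" "\<bar>j\<bar> \<noteq> m + 1" "1 \<le> b" "b \<le> m"
 shows "shift m b i = shift m b j <-> i = j"
 using assms by (auto simp: shift_def)

lemma shift_range:
 assumes "\<bar>j\<bar> \<noteq> m + 1" "1 \<le> b" "b \<le> m"
 shows "shift m b j \<noteq> b" "shift m b j \<noteq> b + 1"
 using assms by (auto simp: shift_def)

definition unshift :: "int => int => int => int" where
 "unshift m b y = (if y = - (m + 1) then m else if b + 2 \<le> y \<and> y \<le> m + 1 then y - 2 else y)"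

lemma unshift_shift: "1 \<le> b ==> b \<le> m ==> \<bar>j\<bar> \<noteq> m + 1 ==> unshift m b (shift m b j) = j"
 by (auto simp: shift_def unshift_def)

lemma shift_unshift:
 "1 \<le> b ==> b \<le> m ==> y \<noteq> b ==> y \<noteq> b + 1 ==> shift m b (unshift m b y) = y"
 "1 \<le> b ==> b \<le> m ==> y \<noteq> b ==> y \<noteq> b + 1 ==> \<bar>unshift m b y\<bar> \<noteq> m + 1"
 by (auto simp: shift_def unshift_def)

lemma trivial_above_dom:
 assumes "matching f" "trivial_above m f" "0 \<le> m" "\<bar>j\<bar> \<noteq> m + 1"
 shows "\<bar>f j\<bar> \<noteq> m + 1"
proof (cases "\<bar>j\<bar> \<le> m")
 case True
 thus ?thesis using trivial_above_bound[OF assms(1,2) True] by auto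
next
 case False
 thus ?thesis using assms by (auto simp: trivial_above_def)
qed

lemma attached_start:
 assumes "matching f" "trivial_above m f" "1 \<le> m"
 shows "attached m m f (tl_act m f)"
proof -
 have t: "f (m + 1) = - (m + 1)" "f (- (m + 1)) = m + 1"
  using assms(2,3) by (auto simp: trivial_above_def)
 define x where "x = f m"
 have x: "x \<noteq> m" "f x = m" "\<bar>x\<bar> \<le> m"
  using matchingD(1,2)[OF assms(1)] trivial_above_bound[OF assms(1,2)] assms(3) by (auto simp: x_def)
 have g: "tl_act m f a = (if a = m then m + 1 else if a = m + 1 then m
   else if a = x then - (m + 1) else if a = - (m + 1) then x else f a)" for a
  unfolding tl_act_apply[OF assms(1,3)] using x t by (auto simp: x_def)
 have "tl_act m f (shift m m j) = shift m m (f j)" if j: "\<bar>j\<bar> \<noteq> m + 1" for j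
 proof -
  have "f j = m <-> j = x" using matchingD(4)[OF assms(1), of j m] by (auto simp: x_def)
  thus ?thesis using j x assms(3) by (cases "j = m") (auto simp: g shift_def x_def[symmetric])
 qed
 thus ?thesis using assms(3) by (auto simp: attached_def g)
qed

text \<open>The cap moves one step to the left, and the strand that ended at \<open>b - 1\<close>
  now ends at \<open>b + 1\<close>; this is the difference between \<open>shift m b\<close> and
  \<open>shift m (b - 1)\<close>.\<close>

lemma attached_step:
 assumes "matching f" "trivial_above m f" "matching g" "attached m b f g" "2 \<le> b" "b \<le> m"
 shows "attached m (b - 1) f (tl_act (b - 1) g)"
proof -
 have g: "g b = b + 1" "g (b + 1) = b" "\<And>j. \<bar>j\<bar> \<noteq> m + 1 ==> g (shift m b j) = shift m b (f j)"
  using assms(4) by (auto simp: attached_def)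
 have b: "1 \<le> b - 1" "1 \<le> b" using assms(5) by auto
 define z where "z = f (b - 1)"
 define x where "x = g (b - 1)"
 have sb: "shift m b (b - 1) = b - 1" using assms(5,6) by (auto simp: shift_def)
 have dz: "\<bar>z\<bar> \<noteq> m + 1" using trivial_above_dom[OF assms(1,2)] assms(5,6) by (auto simp: z_def)
 have xz: "x = shift m b z" using g(3)[of "b - 1"] sb assms(5,6) by (auto simp: x_def z_def)
 have fz: "f z = b - 1" "z \<noteq> b - 1" using matchingD(1,2)[OF assms(1)] assms(5) by (auto simp: z_def)
 have x: "x \<noteq> b" "x \<noteq> b + 1" "x \<noteq> b - 1"
  using shift_range[OF dz b(2) assms(6)] matchingD(2)[OF assms(3), of "b - 1"] assms(5) xz by (auto simp: x_def)
 have t: "tl_act (b - 1) g a = (if a = b - 1 then b else if a = b then b - 1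
   else if a = x then b + 1 else if a = b + 1 then x else g a)" for a
  unfolding tl_act_apply[OF assms(3) b(1)] using x g(1) by (auto simp: x_def)
 have s: "shift m (b - 1) j = (if j = b - 1 then b + 1 else shift m b j)" for j
  using assms(6) by (auto simp: shift_def)
 have "tl_act (b - 1) g (shift m (b - 1) j) = shift m (b - 1) (f j)" if j: "\<bar>j\<bar> \<noteq> m + 1" for j
 proof -
  consider "j = b - 1" | "j = z" "j \<noteq> b - 1" | "j \<noteq> b - 1" "j \<noteq> z" by blast
  thus ?thesis
  proof cases
   case 1
   thus ?thesis using x xz fz by (simp add: t s z_def[symmetric])
  next
   case 2
   thus ?thesis using x xz fz by (simp add: t s)
  next
   case 3
   have "shift m b j \<noteq> x" using shift_inject[OF j dz b(2) assms(6)] 3 xz by simp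
   moreover have "shift m b j \<noteq> b - 1"
    using shift_inject[OF j _ b(2) assms(6), of "b - 1"] 3 sb assms(5,6) by auto
   moreover have "f j \<noteq> b - 1" using 3 fz matchingD(4)[OF assms(1)] by metis
   ultimately show ?thesis using 3 shift_range[OF j b(2) assms(6)] g(3)[OF j] by (simp add: t s)
  qed
 qed
 thus ?thesis by (auto simp: attached_def t x)
qed

definition down_act :: "(int => int) => nat list => int => int" where
 "down_act f w = foldl (\<lambda>f i. tl_act (int i) f) f w"

lemma tl_word_append: "tl_word (u @ v) = down_act (tl_word u) v"
 by (simp add: tl_word_def down_act_def)

lemma attached_down:
 assumes f: "matching f" "trivial_above (int m) f" and b: "1 \<le> b" "b \<le> m"
 shows "matching (down_act f (down m b)) \<and> attached (int m) (int b) f (down_act f (down m b))"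
 using b(2,1)
proof (induction b rule: inc_induct)
 case base
 have "down m m = [m]" using down_simps(1)[of m "Suc m"] down_simps(2)[of m m] by simp
 thus ?case using attached_start[OF f] matching_tl_act[OF f(1)] base by (simp add: down_act_def)
next
 case (step b)
 have "down m b = down m (Suc b) @ [b]" using down_simps(2) step by simp
 hence e: "down_act f (down m b) = tl_act (int b) (down_act f (down m (Suc b)))"
  by (simp add: down_act_def)
 have IH: "matching (down_act f (down m (Suc b)))" "attached (int m) (int (Suc b)) f (down_act f (down m (Suc b)))"
  using step by auto
 show ?case unfolding e
  using attached_step[OF f IH] matching_tl_act[OF IH(1), of "int b"] step by simp
qed

text \<open>No arc opens at or to the right of \<open>b\<close>. If this holds for
  \<open>b + 1\<close> while \<open>b\<close> is joined to \<open>b + 1\<close>, then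
  \<open>b\<close> is the largest left end of an arc; so the lower end of the last block can be read
  off the matching.\<close>

definition caps_below :: "int => (int => int) => bool" where
 "caps_below b f <-> (\<forall>c\<ge>b. f c < c)"

lemma attached_left_unique:
 assumes f: "matching f" "trivial_above m f" and f': "matching f'" "trivial_above m f'"
  and a: "attached m b f g" "attached m b f' g" and b: "1 \<le> b" "b \<le> m"
 shows "f = f'"
proof (rule ext)
 fix j
 show "f j = f' j"
 proof (cases "\<bar>j\<bar> = m + 1")
  case True
  thus ?thesis using f(2) f'(2) by (auto simp: trivial_above_def)
 next
  case False
  hence "shift m b (f j) = shift m b (f' j)" using a by (metis attached_def)
  moreover have "\<bar>f j\<bar> \<noteq> m + 1" "\<bar>f' j\<bar> \<noteq> m + 1"
   using trivial_above_dom[OF f _ False] trivial_above_dom[OF f' _ False] b by auto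
  ultimately show ?thesis using shift_inject[OF _ _ b] by blast
 qed
qed

text \<open>Apart from the new cap, a point to the right of \<open>b\<close> comes from some
  \<open>j\<close> at least \<open>b\<close> whose arc goes to the left, and \<open>shift\<close>
  lets it still go to the left.\<close>

lemma attached_caps:
 assumes f: "trivial_above m f" and a: "attached m b f g" and b: "1 \<le> b" "b \<le> m" and c: "caps_below b f"
 shows "caps_below (b + 1) g"
 unfolding caps_below_def
proof (intro allI impI)
 fix y assume y: "b + 1 \<le> y"
 show "g y < y"
 proof (cases "y = b + 1")
  case True
  thus ?thesis using a by (simp add: attached_def)
 next
  case False
  define j where "j = unshift m b y"
  have j: "shift m b j = y" "\<bar>j\<bar> \<noteq> m + 1"
   using shift_unshift[OF b, of y] y False by (auto simp: j_def)
  have "j \<ge> b" using y False b by (auto simp: j_def unshift_def)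
  hence "f j < j" using c by (simp add: caps_below_def)
  moreover have "g y = shift m b (f j)" using a j by (metis attached_def)
  ultimately show ?thesis using j \<open>j \<ge> b\<close> b f y
   by (auto simp: shift_def trivial_above_def split: if_splits)
 qed
qed

text \<open>Both lower ends are the largest left end of an arc of \<open>g\<close>.\<close>

lemma attached_right_unique:
 assumes a: "attached m b f g" "attached m b' f' g" and b: "1 \<le> b" "b \<le> m" "1 \<le> b'" "b' \<le> m"
  and f: "trivial_above m f" "trivial_above m f'" and c: "caps_below b f" "caps_below b' f'"
 shows "b = b'"
proof (rule ccontr)
 assume "b \<noteq> b'"
 moreover have False if "b < b'" "attached m b' f' g" "attached m b f g" "caps_below b f" "1 \<le> b" "b \<le> m" "trivial_above m f"
  for b b' f f'
 proof -
  have "caps_below (b + 1) g" by (rule attached_caps[OF that(7,3,5,6,4)])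
  hence "g b' < b'" using that(1) by (simp add: caps_below_def)
  thus False using that(2) by (simp add: attached_def)
 qed
 ultimately show False using assms by (metis linorder_neqE)
qed

text \<open>A vertical strand at \<open>m + 1\<close> would force \<open>f m = m - 1\<close>, an arc
  opening too far to the right. Hence \<open>m + 1\<close> is the largest nonvertical column, which
  recovers the upper end of the last block.\<close>

lemma attached_top:
 assumes f: "matching f" "trivial_above m f" and a: "attached m b f g" and b: "1 \<le> b" "b \<le> m" and c: "caps_below b f"
  and g: "matching g"
 shows "g (m + 1) \<noteq> - (m + 1)"
proof
 assume "g (m + 1) = - (m + 1)"
 hence "g (- (m + 1)) = m + 1" using matchingD(1)[OF g] by metis
 moreover have "g (shift m b m) = shift m b (f m)" using a b by (simp add: attached_def)
 ultimately have s: "shift m b (f m) = m + 1" by (simp add: shift_def)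
 have "\<bar>f m\<bar> \<le> m" using trivial_above_bound[OF f] b by simp
 hence fm: "f m = m - 1" "b \<le> m - 1" using s by (auto simp: shift_def split: if_splits)
 hence "f (m - 1) = m" using matchingD(1)[OF f(1)] by metis
 thus False using c[unfolded caps_below_def, rule_format, of "m - 1"] fm by simp
qed

lemma jones_matching:
 assumes "jones n J"
 shows "matching (tl_word (jones_word J)) \<and> trivial_above (int n) (tl_word (jones_word J)) \<and>
  caps_below (if J = [] then 1 else int (snd (hd J)) + 1) (tl_word (jones_word J))"
 using assms
proof (induction n J rule: jones.induct)
 case (1 n)
 thus ?case using noncrossing_uminus by (auto simp: noncrossing_def caps_below_def)
next
 case (2 n a b J)
 let ?f = "tl_word (jones_word J)"
 have ab: "1 \<le> b" "b \<le> a" "a < n" "jones a J" "J = [] \<or> snd (hd J) < b" using 2(2) by auto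
 have f: "matching ?f" "trivial_above (int a) ?f" "caps_below (int b) ?f"
  using 2(1) ab by (auto simp: caps_below_def split: if_splits)
 have at: "attached (int a) (int b) ?f (tl_word (jones_word ((a, b) # J)))"
  using attached_down[OF f(1,2) ab(1,2)] by (simp add: tl_word_append)
 have "noncrossing (tl_word (jones_word ((a, b) # J)))" "trivial_above (int n) (tl_word (jones_word ((a, b) # J)))"
  using noncrossing_tl_word[OF set_jones_word[OF 2(2)]] by auto
 moreover have "caps_below (int b + 1) (tl_word (jones_word ((a, b) # J)))"
  using attached_caps[OF f(2) at] f(3) ab by simp
 ultimately show ?case by (simp add: noncrossing_def)
qed

lemma jones_top:
 assumes "jones n ((a, b) # J)"
 shows "tl_word (jones_word ((a, b) # J)) (int a + 1) \<noteq> - (int a + 1)"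
  "\<And>c. c > int a + 1 ==> tl_word (jones_word ((a, b) # J)) c = - c"
  "attached (int a) (int b) (tl_word (jones_word J)) (tl_word (jones_word ((a, b) # J)))"
  "matching (tl_word (jones_word J))" "trivial_above (int a) (tl_word (jones_word J))"
  "caps_below (int b) (tl_word (jones_word J))"
proof -
 let ?f = "tl_word (jones_word J)"
 have ab: "1 \<le> b" "b \<le> a" "a < n" "jones a J" "J = [] \<or> snd (hd J) < b" using assms by auto
 show f: "matching ?f" "trivial_above (int a) ?f" "caps_below (int b) ?f"
  using jones_matching[OF ab(4)] ab by (auto simp: caps_below_def split: if_splits)
 show at: "attached (int a) (int b) ?f (tl_word (jones_word ((a, b) # J)))"
  using attached_down[OF f(1,2) ab(1,2)] by (simp add: tl_word_append)
 have j: "jones (a + 1) ((a, b) # J)" using ab by simp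
 note jm = jones_matching[OF j]
 show "tl_word (jones_word ((a, b) # J)) (int a + 1) \<noteq> - (int a + 1)"
  using attached_top[OF f(1,2) at _ _ f(3)] jm ab by simp
 show "c > int a + 1 ==> tl_word (jones_word ((a, b) # J)) c = - c" for c
  using jm by (auto simp: trivial_above_def)
qed

text \<open>The last block is read off the matching: its upper end from the largest nonvertical
  column, its lower end from the last arc that opens. Then \<open>attached_left_unique\<close>
  cancels the block.\<close>

lemma jones_inject:
 assumes "jones n J" "jones n' J'" "tl_word (jones_word J) = tl_word (jones_word J')"
 shows "J = J'"
 using assms
proof (induction J arbitrary: J' n n')
 case Nil
 show ?case
 proof (cases J')
  case (Cons p J'')
  obtain a b where "p = (a, b)" by (cases p)
  thus ?thesis using jones_top(1)[of n' a b J''] Nil Cons by auto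
 qed simp
next
 case (Cons p J)
 obtain a b where p: "p = (a, b)" by (cases p)
 note t = jones_top[OF Cons.prems(1)[unfolded p]]
 show ?case
 proof (cases J')
  case Nil
  thus ?thesis using t(1) Cons.prems p by simp
 next
  case C: (Cons p' J'')
  obtain a' b' where p': "p' = (a', b')" by (cases p')
  note t' = jones_top[OF Cons.prems(2)[unfolded C p']]
  have e: "tl_word (jones_word ((a, b) # J)) = tl_word (jones_word ((a', b') # J''))"
   using Cons.prems(3) C p p' by simp
  have "\<not> a < a'" using t'(1) t(2)[of "int a' + 1"] e by force
  moreover have "\<not> a' < a" using t(1) t'(2)[of "int a + 1"] e by force
  ultimately have aa: "a' = a" by simp
  have ab: "1 \<le> b" "b \<le> a" "1 \<le> b'" "b' \<le> a" "jones a J" "jones a J''"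
   using Cons.prems(1,2) p C p' aa by auto
  have bb: "int b = int b'"
   using attached_right_unique[OF t(3) t'(3)[unfolded aa e[unfolded aa, symmetric]] _ _ _ _ t(5) t'(5)[unfolded aa] t(6) t'(6)] ab by simp
  hence "tl_word (jones_word J) = tl_word (jones_word J'')"
   using attached_left_unique[OF t(4,5) t'(4) t'(5)[unfolded aa] t(3)] t'(3) aa e ab by simp
  hence "J = J''" using Cons.IH[OF ab(5,6)] by simp
  thus ?thesis using C p p' aa bb by simp
 qed
qed

text \<open>By \<open>compat\<close>, replacing a word by its Jones word keeps the matching; so
  words with equal matchings have the same Jones word.\<close>

lemma (in tl_relations) tl_complete:
 assumes compat: "\<And>u v. set u \<subseteq> {1..<n} ==> set v \<subseteq> {1..<n} ==> W u = W v ==> tl_word u = tl_word v"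
  and uv: "set u \<subseteq> {1..<n}" "set v \<subseteq> {1..<n}" "tl_word u = tl_word v"
 shows "W u = W v"
proof -
 obtain J J' where J: "jones n J" "W u = W (jones_word J)" "jones n J'" "W v = W (jones_word J')"
  using jones_normal_form uv(1,2) by (metis order_refl)
 have "tl_word u = tl_word (jones_word J)" by (rule compat[OF uv(1) set_jones_word[OF J(1)] J(2)])
 moreover have "tl_word v = tl_word (jones_word J')" by (rule compat[OF uv(2) set_jones_word[OF J(3)] J(4)])
 ultimately have "J = J'" using uv(3) by (intro jones_inject[OF J(1,3)]) metis
 thus ?thesis using J by simp
qed

section \<open>Every noncrossing matching comes from a word\<close>

lemma matching_ex_cap:
 assumes nc: "noncrossing g" and t: "trivial_above n g" and n: "1 \<le> n" "g n \<noteq> - n"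
 shows "\<exists>c\<ge>1. c \<le> n \<and> c < g c"
proof (rule ccontr)
 assume "\<not> ?thesis"
 hence c: "g c \<le> c" if "1 \<le> c" "c \<le> n" for c using that by force
 have m: "matching g" using nc by (simp add: noncrossing_def)
 have neg: "g c < 0" if "1 \<le> c" "c \<le> n" for c
 proof (rule ccontr)
  assume "\<not> g c < 0"
  moreover have "g c \<noteq> 0" "g c \<noteq> c" using matchingD(2,6)[OF m, of c] that by auto
  ultimately have "1 \<le> g c" "g c < c" using c[OF that] by auto
  thus False using c[of "g c"] matchingD(1)[OF m, of c] that by auto
 qed
 \<comment> \<open>If no arc opens in the bottom row, the \<open>n\<close> bottom points are matched
   with all \<open>n\<close> top points. The one matched with \<open>- n\<close> must be
   \<open>n\<close>, since otherwise its strand would cross the strand at \<open>n\<close>.\<close>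
 have "g ` {1..n} \<subseteq> {-n..-1}"
 proof
  fix y assume "y \<in> g ` {1..n}"
  then obtain c where "y = g c" "1 \<le> c" "c \<le> n" by auto
  thus "y \<in> {-n..-1}" using neg[of c] trivial_above_bound[OF m t, of c] by auto
 qed
 moreover have "inj_on g {1..n}" using matchingD(3)[OF m] by (simp add: inj_on_def)
 hence "card (g ` {1..n}) = card {-n..-1}" by (simp add: card_image)
 ultimately have "g ` {1..n} = {-n..-1}" by (intro card_subset_eq) auto
 hence "- n \<in> g ` {1..n}" using n(1) by auto
 then obtain c where c: "g c = - n" "1 \<le> c" "c \<le> n" by auto
 hence "c < n" using n(2) by (cases "c = n") auto
 have "between c (g c) (- 1)" if "\<bar>c\<bar> > 1 \<or> n > 1" using c that \<open>c < n\<close> by (auto simp: between_def)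
 have gn: "between n (g n) c"
  using \<open>c < n\<close> neg[of n] n(1) c(2) by (auto simp: between_def)
 hence "between n (g n) (- n)" using nc c(1) unfolding noncrossing_def by metis
 thus False using trivial_above_bound[OF m t, of n] n(1) by (auto simp: between_def)
qed

text \<open>The inverse of attaching a block. The last left end \<open>b\<close> of an arc is joined
  to \<open>b + 1\<close>: otherwise \<open>b + 1\<close> would lie under its arc and could neither
  open an arc nor close one. Removing this cap and undoing \<open>shift\<close> leaves a matching of
  smaller size.\<close>

lemma attached_exists:
 assumes nc: "noncrossing g" and t: "trivial_above (m + 1) g" and m: "1 \<le> m" "g (m + 1) \<noteq> - (m + 1)"
 shows "\<exists>b f. 1 \<le> b \<and> b \<le> m \<and> noncrossing f \<and> trivial_above m f \<and> attached m b f g"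
proof -
 have mg: "matching g" using nc by (simp add: noncrossing_def)
 define C where "C = {c. 1 \<le> c \<and> c \<le> m + 1 \<and> c < g c}"
 have "finite C" by (rule finite_subset[of _ "{1..m + 1}"]) (auto simp: C_def)
 moreover have "C \<noteq> {}" using matching_ex_cap[OF nc t] m by (auto simp: C_def)
 ultimately have M: "Max C \<in> C" "\<And>c. c \<in> C ==> c \<le> Max C" by auto
 define b where "b = Max C"
 have b: "1 \<le> b" "b \<le> m + 1" "b < g b" using M(1) by (auto simp: C_def b_def)
 have gb: "g b \<le> m + 1" using trivial_above_bound[OF mg t, of b] b by auto
 hence bm: "b \<le> m" using b by auto
 have "g b = b + 1"
 proof (rule ccontr)
  assume "g b \<noteq> b + 1"
  hence "between b (g b) (b + 1)" using b by (auto simp: between_def)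
  hence "between b (g b) (g (b + 1))" using nc by (simp add: noncrossing_def)
  moreover have "b + 1 \<notin> C" using M(2)[of "b + 1"] by (auto simp: b_def)
  hence "g (b + 1) \<le> b + 1" using b bm by (auto simp: C_def)
  ultimately have "g (b + 1) = b + 1" using b by (auto simp: between_def)
  thus False using matchingD(2)[OF mg, of "b + 1"] b by simp
 qed
 note gb = this
 hence gb': "g (b + 1) = b" using matchingD(1)[OF mg, of b] by simp
 define f where "f j = (if \<bar>j\<bar> = m + 1 then - j else unshift m b (g (shift m b j)))" for j
 have go: "g (shift m b j) \<noteq> b" "g (shift m b j) \<noteq> b + 1" if "\<bar>j\<bar> \<noteq> m + 1" for j
  using shift_range[OF that b(1) bm] gb gb' matchingD(1)[OF mg, of "shift m b j"] by (metis, metis)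
 have sf: "shift m b (f j) = g (shift m b j)" "\<bar>f j\<bar> \<noteq> m + 1" if "\<bar>j\<bar> \<noteq> m + 1" for j
  using shift_unshift[OF b(1) bm go[OF that]] that by (auto simp: f_def)
 have ff: "f (f j) = j" for j
 proof (cases "\<bar>j\<bar> = m + 1")
  case False
  have "f (f j) = unshift m b (g (shift m b (f j)))" using sf(2)[OF False] by (simp add: f_def[of "f j"])
  also have "\<dots> = j" using sf(1)[OF False] matchingD(1)[OF mg] unshift_shift[OF b(1) bm False] by simp
  finally show ?thesis .
 qed (simp add: f_def)
 have fix0: "f j = j <-> j = 0" for j
 proof (cases "\<bar>j\<bar> = m + 1")
  case False
  have "f j = j <-> g (shift m b j) = shift m b j"
   using sf[OF False] shift_inject[OF sf(2)[OF False] False b(1) bm] by auto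
  also have "\<dots> <-> shift m b j = 0" by (rule matchingD(2)[OF mg])
  also have "\<dots> <-> j = 0" using b bm by (auto simp: shift_def)
  finally show ?thesis .
 qed (use m in \<open>auto simp: f_def\<close>)
 have mf: "matching f" using ff fix0 by (simp add: matching_def)
 have tf: "trivial_above m f"
  unfolding trivial_above_def
 proof (intro allI impI)
  fix j assume j: "m < \<bar>j\<bar>"
  show "f j = - j"
  proof (cases "\<bar>j\<bar> = m + 1")
   case False
   hence "shift m b j = j" "g j = - j" using j t b bm by (auto simp: shift_def trivial_above_def)
   thus ?thesis using j False b bm by (auto simp: f_def unshift_def)
  qed (simp add: f_def)
 qed
 have at: "attached m b f g" using gb gb' sf(1) by (auto simp: attached_def)
 \<comment> \<open>\<open>shift\<close> is monotone except at \<open>m\<close>, which is moved to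
   the left of all other points. So only arcs ending at \<open>m\<close> need care when the
   noncrossing property is pulled back.\<close>
 have "between u (f u) (f q)" if q: "between u (f u) q" for u q
 proof -
  have *: "between u (f u) (f q)" if q: "between u (f u) q" and u: "\<bar>u\<bar> \<le> m" and less: "u < f u" for u q
  proof -
   have fu: "\<bar>f u\<bar> \<le> m" using trivial_above_bound[OF mf tf u] .
   have qm: "\<bar>q\<bar> < m" "u < q" "q < f u" using q u fu less by (auto simp: between_def)
   have fq: "\<bar>f q\<bar> \<le> m" using trivial_above_bound[OF mf tf] qm by simp
   have ne: "f q \<noteq> u" "f q \<noteq> f u" using ff qm by (metis less_irrefl)+
   have gs: "g (shift m b u) = shift m b (f u)" "g (shift m b q) = shift m b (f q)"
    using sf(1) u qm by auto
   have nb: "between (shift m b u) (shift m b (f u)) (shift m b q) <->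
     between (shift m b u) (shift m b (f u)) (shift m b (f q))"
    using between_f_iff[OF nc, of "shift m b q" "shift m b u"] gs
     shift_inject[OF _ _ b(1) bm, of q u] shift_inject[OF _ _ b(1) bm, of q "f u"] qm u fu by auto
   have mono: "shift m b i < shift m b j <-> i < j" if "\<bar>i\<bar> \<le> m" "i \<noteq> m" "\<bar>j\<bar> \<le> m" "j \<noteq> m" for i j
    using that b bm by (auto simp: shift_def)
   have low: "shift m b m = - (m + 1)" "\<bar>i\<bar> \<le> m ==> i \<noteq> m ==> - (m + 1) < shift m b i" for i
    using b bm by (auto simp: shift_def)
   have um: "u \<noteq> m" using qm by auto
   show ?thesis
   proof (cases "f u = m")
    case False
    have "f q \<noteq> m"
    proof
     assume fm: "f q = m"
     have "between (shift m b u) (shift m b (f u)) (shift m b q)"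
      using mono[of u q] mono[of q "f u"] False u qm fu by (auto simp: between_def)
     hence "between (shift m b u) (shift m b (f u)) (- (m + 1))" using nb fm low(1) by simp
     moreover have "u \<noteq> m" using qm by auto
     ultimately show False using low(2)[of u] low(2)[of "f u"] False u fu qm by (auto simp: between_def)
    qed
    thus ?thesis
     using um nb mono[of u q] mono[of q "f u"] mono[of u "f q"] mono[of "f q" "f u"] mono[of u "f u"] False u qm fu fq
     by (auto simp: between_def)
   next
    \<comment> \<open>The arc from \<open>u\<close> to \<open>m\<close> corresponds in
      \<open>g\<close> to an arc from \<open>- (m + 1)\<close>, which covers the points to the left
      of \<open>u\<close> instead of those to its right.\<close>
    case True
    have "f q \<noteq> m" using ne True by simp
    hence "\<not> f q < u"
     using nb True low(1) low(2)[of "f q"] low(2)[of u] mono[of q u] mono[of "f q" u] u qm fq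
     by (auto simp: between_def)
    thus ?thesis using True ne fq by (auto simp: between_def)
   qed
  qed
  consider "\<bar>u\<bar> > m" | "\<bar>u\<bar> \<le> m" "u < f u" | "\<bar>u\<bar> \<le> m" "f u < u" using fix0[of u] q
   by (metis between_def linorder_neqE linorder_not_le less_asym)
  thus ?thesis
  proof cases
   case 1
   hence fu: "f u = - u" using tf by (simp add: trivial_above_def)
   hence "\<bar>q\<bar> < \<bar>u\<bar>" using q by (auto simp: between_def)
   moreover have "\<bar>f q\<bar> \<le> m \<or> f q = - q"
    using trivial_above_bound[OF mf tf, of q] tf by (cases "\<bar>q\<bar> \<le> m") (auto simp: trivial_above_def)
   ultimately have "\<bar>f q\<bar> < \<bar>u\<bar>" using 1 by auto
   thus ?thesis using fu by (auto simp: between_def)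
  next
   case 2
   thus ?thesis using *[OF q] by blast
  next
   case 3
   have "\<bar>f u\<bar> \<le> m" using trivial_above_bound[OF mf tf 3(1)] .
   thus ?thesis using *[of "f u" q] q 3 ff[of u] by (simp add: between_commute)
  qed
 qed
 hence "noncrossing f" using mf by (simp add: noncrossing_def)
 thus ?thesis using b bm tf at by blast
qed

lemma attached_image_unique:
 assumes "attached m b f g" "attached m b f g'" "1 \<le> b" "b \<le> m"
 shows "g = g'"
proof (rule ext)
 fix y
 show "g y = g' y"
 proof (cases "y = b \<or> y = b + 1")
  case True
  thus ?thesis using assms by (auto simp: attached_def)
 next
  case False
  hence "shift m b (unshift m b y) = y" "\<bar>unshift m b y\<bar> \<noteq> m + 1"
   using shift_unshift[OF assms(3,4)] by auto
  thus ?thesis using assms(1,2) by (metis attached_def)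
 qed
qed

text \<open>Induction on the number of columns: a vertical last strand is dropped, otherwise
  \<open>attached_exists\<close> splits off a descending block.\<close>

lemma noncrossing_is_tl_word:
 assumes "noncrossing f" "trivial_above (int n) f"
 shows "\<exists>w. set w \<subseteq> {1..<n} \<and> tl_word w = f"
 using assms
proof (induction n arbitrary: f)
 case 0
 hence "f = uminus" by (intro ext) (metis trivial_above_def noncrossing_def matchingD(5) abs_le_zero_iff linorder_not_le minus_zero of_nat_0)
 thus ?case by (intro exI[of _ "[]"]) simp
next
 case (Suc m)
 have mf: "matching f" using Suc.prems by (simp add: noncrossing_def)
 show ?case
 proof (cases "f (int m + 1) = - (int m + 1)")
  case True
  hence "f (- (int m + 1)) = int m + 1" using matchingD(1)[OF mf] by metis
  hence "trivial_above (int m) f"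
   using Suc.prems(2) True unfolding trivial_above_def by (smt (verit) of_nat_Suc)
  from Suc.IH[OF Suc.prems(1) this] obtain w where "set w \<subseteq> {1..<m}" "tl_word w = f" by blast
  thus ?thesis by (intro exI[of _ w]) auto
 next
  case False
  have "m \<noteq> 0"
  proof
   assume "m = 0"
   hence "\<bar>f 1\<bar> \<le> 1" using trivial_above_bound[OF mf Suc.prems(2), of 1] by simp
   moreover have "f 1 \<noteq> 1" "f 1 \<noteq> 0" using matchingD(2,6)[OF mf, of 1] by auto
   ultimately show False using False \<open>m = 0\<close> by auto
  qed
  then obtain b0 f0 where bf: "1 \<le> b0" "b0 \<le> int m" "noncrossing f0" "trivial_above (int m) f0" "attached (int m) b0 f0 f"
   using attached_exists[OF Suc.prems(1), of "int m"] Suc.prems(2) False by (auto simp: add.commute)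
  obtain w where w: "set w \<subseteq> {1..<m}" "tl_word w = f0" using Suc.IH[OF bf(3,4)] by blast
  define b where "b = nat b0"
  have b: "int b = b0" "1 \<le> b" "b \<le> m" using bf(1,2) by (auto simp: b_def)
  have "attached (int m) (int b) f0 (tl_word (w @ down m b))"
   using attached_down[of f0 m b] bf(3,4) b w(2) by (simp add: tl_word_append noncrossing_def)
  hence "tl_word (w @ down m b) = f" using attached_image_unique bf(1,2,5) b(1) by metis
  moreover have "set (w @ down m b) \<subseteq> {1..<Suc m}" using w(1) b by (auto simp: down_simps)
  ultimately show ?thesis by blast
 qed
qed

section \<open>Planar diagrams\<close>

text \<open>For an equivalence relation this is the usual notion of a noncrossing partition of
  linearly ordered points.\<close>

definition nc_rel :: "(int => int => bool) => bool" where
 "nc_rel r <-> (\<forall>a b c d. a < b \<longrightarrow> b < c \<longrightarrow> c < d \<longrightarrow> r a c \<longrightarrow> r b d \<longrightarrow> r a b)"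

text \<open>Bends the rectangle into a half annulus whose straight boundary part carries all vertices,
 in the order of their coordinates.\<close>

definition bend :: "real \<times> real => real ^ 2" where
 "bend p = (fst p * cos (pi * snd p)) *\<^sub>R axis 1 1 + (fst p * sin (pi * snd p)) *\<^sub>R axis 2 1"

section \<open>From planar drawings to noncrossing partitions\<close>

lemma bend_nth [simp]:
 "bend p $ 1 = fst p * cos (pi * snd p)" "bend p $ 2 = fst p * sin (pi * snd p)"
 by (simp_all add: bend_def axis_def)

lemma bend_position:
 "bend (position v) $ 1 = coord v" "bend (position v) $ 2 = 0"
 by (cases v; simp)+

lemma continuous_on_bend: "continuous_on S bend"
 unfolding bend_def by (intro continuous_intros)

lemma polar_inject:
 assumes "0 < fst p" "0 < fst q" "0 \<le> snd p" "snd p \<le> 1" "0 \<le> snd q" "snd q \<le> 1"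
  and "fst p * cos (pi * snd p) = fst q * cos (pi * snd q)" "(fst p)\<^sup>2 = (fst q)\<^sup>2"
 shows "p = q"
proof -
 have f: "fst p = fst q" using assms(1,2,8) by (simp add: power2_eq_iff)
 hence "cos (pi * snd p) = cos (pi * snd q)" using assms(1,7) by simp
 moreover have "0 \<le> pi * snd p" "0 \<le> pi * snd q" "pi * snd p \<le> pi" "pi * snd q \<le> pi"
  using assms(3-6) mult_left_le[of "snd p" pi] mult_left_le[of "snd q" pi] by simp_all
 ultimately have "pi * snd p = pi * snd q" using cos_inj_pi by blast
 thus ?thesis using f by (simp add: prod_eq_iff)
qed

lemma bend_inject:
 assumes "p \<in> {1..real k} \<times> {0..1}" "q \<in> {1..real k} \<times> {0..1}" "bend p = bend q"
 shows "p = q"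
proof -
 have n: "(fst p)\<^sup>2 = (bend p $ 1)\<^sup>2 + (bend p $ 2)\<^sup>2" for p
 proof -
  have "(fst p * cos (pi * snd p))\<^sup>2 + (fst p * sin (pi * snd p))\<^sup>2 =
    (fst p)\<^sup>2 * ((sin (pi * snd p))\<^sup>2 + (cos (pi * snd p))\<^sup>2)"
   by (simp only: power_mult_distrib distrib_left add.commute)
  thus ?thesis by (simp only: bend_nth sin_cos_squared_add mult_1_right)
 qed
 have "fst p * cos (pi * snd p) = fst q * cos (pi * snd q)"
  using assms(3) bend_nth(1)[of p] bend_nth(1)[of q] by simp
 moreover have "(fst p)\<^sup>2 = (fst q)\<^sup>2" using n[of p] n[of q] assms(3) by simp
 ultimately show ?thesis using assms(1,2) by (intro polar_inject) auto
qed

lemma bend_in_box: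
 assumes "p \<in> {1..real k} \<times> {0..1}"
 shows "bend p \<in> cbox ((- real k) *\<^sub>R axis 1 1) (real k *\<^sub>R axis 1 1 + real k *\<^sub>R axis 2 1)"
proof -
 have p: "1 \<le> fst p" "fst p \<le> real k" "0 \<le> snd p" "snd p \<le> 1" using assms by auto
 have s: "0 \<le> sin (pi * snd p)" using p by (intro sin_ge_zero) (auto simp: mult_le_cancel_left1)
 have "\<bar>fst p * cos (pi * snd p)\<bar> \<le> real k * 1"
  unfolding abs_mult using p by (intro mult_mono) auto
 moreover have "fst p * sin (pi * snd p) \<le> real k * 1" using p s by (intro mult_mono) auto
 moreover have "0 \<le> fst p * sin (pi * snd p)" using p s by simp
 ultimately show ?thesis unfolding mem_box_cart forall_2 bend_nth by (simp add: axis_def abs_le_iff)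
qed

lemma position_in_rect: "v \<in> vertices k ==> position v \<in> {1..real k} \<times> {0..1}"
 by (auto simp: vertices_def)

lemma position_inject: "position v = position w ==> v = w"
 by (cases v; cases w; simp)

text \<open>After bending, both paths run in a box and their ends interlace on its lower side, the
  situation of \<open>fashoda_interlace\<close>. Injectivity of \<open>bend\<close> on the rectangle
  brings the common point back.\<close>

lemma interlaced_paths_meet:
 assumes g: "path g" "path_image g \<subseteq> {1..real k} \<times> {0..1}" "pathstart g = position v1" "pathfinish g = position v3"
  and h: "path h" "path_image h \<subseteq> {1..real k} \<times> {0..1}" "pathstart h = position v2" "pathfinish h = position v4"
  and l: "coord v1 < coord v2" "coord v2 < coord v3" "coord v3 < coord v4"
 shows "path_image g \<inter> path_image h \<noteq> {}"
proof -
 let ?a = "(- real k) *\<^sub>R axis 1 1 :: real ^ 2" and ?b = "real k *\<^sub>R axis 1 1 + real k *\<^sub>R axis 2 1"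
 have p: "path (bend \<circ> g)" "path (bend \<circ> h)"
  using g(1) h(1) continuous_on_bend by (auto intro: path_continuous_image)
 have i: "path_image (bend \<circ> g) \<subseteq> cbox ?a ?b" "path_image (bend \<circ> h) \<subseteq> cbox ?a ?b"
  unfolding path_image_compose using g(2) h(2) bend_in_box by blast+
 have a2: "?a $ 2 = 0" by (simp add: axis_def)
 have e: "pathstart (bend \<circ> g) $ 1 = coord v1" "pathfinish (bend \<circ> g) $ 1 = coord v3"
  "pathstart (bend \<circ> h) $ 1 = coord v2" "pathfinish (bend \<circ> h) $ 1 = coord v4"
  "pathstart (bend \<circ> g) $ 2 = ?a $ 2" "pathfinish (bend \<circ> g) $ 2 = ?a $ 2"
  "pathstart (bend \<circ> h) $ 2 = ?a $ 2" "pathfinish (bend \<circ> h) $ 2 = ?a $ 2"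
  unfolding pathstart_compose pathfinish_compose g(3,4) h(3,4) bend_position a2 by simp_all
 have l': "pathstart (bend \<circ> g) $ 1 < pathstart (bend \<circ> h) $ 1"
  "pathstart (bend \<circ> h) $ 1 < pathfinish (bend \<circ> g) $ 1"
  "pathfinish (bend \<circ> g) $ 1 < pathfinish (bend \<circ> h) $ 1"
  unfolding e using l by simp_all
 obtain z where "z \<in> path_image (bend \<circ> g)" "z \<in> path_image (bend \<circ> h)"
  by (rule fashoda_interlace[OF p i e(5-8) l'])
 then obtain x y where "x \<in> path_image g" "y \<in> path_image h" "bend x = bend y"
  unfolding path_image_compose by (metis imageE)
 thus ?thesis using bend_inject[of x k y] g(2) h(2) by blast
qed

text \<open>Concatenates the arcs along a path of edges. The image is confined to arcs of the
  component of \<open>v\<close>, so that a common point of two such paths can be traced to vertices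
  or edges of both components; the inserted point covers the trivial path.\<close>

lemma graph_path:
 assumes d: "planar_drawing k E \<gamma>" and vw: "(v, w) \<in> (E \<union> E\<inverse>)\<^sup>*"
 shows "\<exists>g. path g \<and> pathstart g = position v \<and> pathfinish g = position w \<and>
  path_image g \<subseteq> insert (position v) (\<Union>{path_image (\<gamma> e) |e. e \<in> E \<and> (v, fst e) \<in> (E \<union> E\<inverse>)\<^sup>*})"
 using vw
proof (induction rule: rtrancl_induct)
 case base
 show ?case
  by (intro exI[of _ "linepath (position v) (position v)"] conjI)
   (simp_all only: path_linepath pathstart_linepath pathfinish_linepath path_image_linepath closed_segment_idem, auto)
next
 case (step w u)
 then obtain g where g: "path g" "pathstart g = position v" "pathfinish g = position w"
  "path_image g \<subseteq> insert (position v) (\<Union>{path_image (\<gamma> e) |e. e \<in> E \<and> (v, fst e) \<in> (E \<union> E\<inverse>)\<^sup>*})"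
  by blast
 have arcs: "arc (\<gamma> e) \<and> pathstart (\<gamma> e) = position (fst e) \<and> pathfinish (\<gamma> e) = position (snd e)" if "e \<in> E" for e
  using d that unfolding planar_drawing_def by (auto split: prod.splits)
 have vu: "(v, u) \<in> (E \<union> E\<inverse>)\<^sup>*" using step by (meson rtrancl_into_rtrancl)
 let ?U = "\<Union>{path_image (\<gamma> e) |e. e \<in> E \<and> (v, fst e) \<in> (E \<union> E\<inverse>)\<^sup>*}"
 have up: "path_image (\<gamma> e) \<subseteq> ?U" if "e \<in> E" "(v, fst e) \<in> (E \<union> E\<inverse>)\<^sup>*" for e
  using that by (intro Union_upper) blast
 from step(2) show ?case
 proof
  assume e: "(w, u) \<in> E"
  have a: "path (\<gamma> (w, u))" "pathstart (\<gamma> (w, u)) = position w" "pathfinish (\<gamma> (w, u)) = position u"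
   using arcs[OF e] by (simp_all add: arc_imp_path)
  have "path_image (g +++ \<gamma> (w, u)) \<subseteq> insert (position v) ?U"
  proof (rule subset_trans[OF path_image_join_subset], intro Un_least g(4))
   show "path_image (\<gamma> (w, u)) \<subseteq> insert (position v) ?U"
    by (rule subset_insertI2, rule up[OF e]) (simp add: step(1))
  qed
  thus ?thesis using g(1-3) a
   by (intro exI[of _ "g +++ \<gamma> (w, u)"]) (simp add: path_join_imp)
 next
  assume "(w, u) \<in> E\<inverse>"
  hence e: "(u, w) \<in> E" by simp
  have a: "path (\<gamma> (u, w))" "pathstart (\<gamma> (u, w)) = position u" "pathfinish (\<gamma> (u, w)) = position w"
   using arcs[OF e] by (simp_all add: arc_imp_path)
  have "path_image (g +++ reversepath (\<gamma> (u, w))) \<subseteq> insert (position v) ?U"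
  proof (rule subset_trans[OF path_image_join_subset], intro Un_least g(4))
   show "path_image (reversepath (\<gamma> (u, w))) \<subseteq> insert (position v) ?U"
    unfolding path_image_reversepath by (rule subset_insertI2, rule up[OF e]) (simp add: vu)
  qed
  thus ?thesis using g(1-3) a
   by (intro exI[of _ "g +++ reversepath (\<gamma> (u, w))"]) (simp add: path_join_imp)
 qed
qed

lemma sym_graph_rtrancl: "(v, w) \<in> (E \<union> E\<inverse>)\<^sup>* ==> (w, v) \<in> (E \<union> E\<inverse>)\<^sup>*"
 by (metis Un_commute converse_Un converse_converse rtrancl_converseD)

lemma rel_graph_components:
 "rel (graph_components k E) a b <-> a \<in> pts k \<and> b \<in> pts k \<and> (vtx a, vtx b) \<in> (E \<union> E\<inverse>)\<^sup>*"
proof -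
 let ?R = "{(v, w) \<in> vertices k \<times> vertices k. (v, w) \<in> (E \<union> E\<inverse>)\<^sup>*}"
 have R: "equiv (vertices k) ?R"
 proof (rule equivI)
  show "sym ?R" unfolding sym_def using sym_graph_rtrancl[of _ _ E] by blast
  show "trans ?R" unfolding trans_def by (auto intro: rtrancl_trans)
 qed (auto simp: refl_on_def)
 have "rel (graph_components k E) a b <-> (vtx a, vtx b) \<in> ?R"
 proof
  assume "rel (graph_components k E) a b"
  then obtain B where "B \<in> vertices k // ?R" "vtx a \<in> B" "vtx b \<in> B"
   by (auto simp: rel_def graph_components_def)
  thus "(vtx a, vtx b) \<in> ?R" using in_quotient_imp_in_rel[OF R] by blast
 next
  assume ab: "(vtx a, vtx b) \<in> ?R"
  hence "?R `` {vtx a} \<in> vertices k // ?R" by (intro quotientI) auto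
  moreover have "vtx a \<in> ?R `` {vtx a}" "vtx b \<in> ?R `` {vtx a}" using ab by auto
  ultimately show "rel (graph_components k E) a b"
   unfolding rel_def graph_components_def by (intro bexI[of _ "?R `` {vtx a}"] conjI)
 qed
 thus ?thesis by simp
qed

lemma planar_imp_nc_rel:
 assumes "planar k d"
 shows "nc_rel (rel d)"
 unfolding nc_rel_def
proof (intro allI impI)
 fix a b c e
 assume l: "a < b" "b < c" "c < e" and r: "rel d a c" "rel d b e"
 obtain E \<gamma> where E: "planar_drawing k E \<gamma>" "graph_components k E = d"
  using assms by (auto simp: planar_def)
 let ?C = "(E \<union> E\<inverse>)\<^sup>*"
 have p: "a \<in> pts k" "b \<in> pts k" "c \<in> pts k" "e \<in> pts k" and ac: "(vtx a, vtx c) \<in> ?C" and be: "(vtx b, vtx e) \<in> ?C"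
  using r rel_graph_components unfolding E(2)[symmetric] by blast+
 have Ev: "fst x \<in> vertices k \<and> snd x \<in> vertices k" if "x \<in> E" for x
  using E(1) that unfolding planar_drawing_def by auto
 have img: "path_image (\<gamma> x) \<subseteq> {1..real k} \<times> {0..1}"
  "path_image (\<gamma> x) \<inter> position ` vertices k = {position (fst x), position (snd x)}" if "x \<in> E" for x
  using E(1) that unfolding planar_drawing_def split_beta prod.collapse by simp_all
 have dj: "path_image (\<gamma> x) \<inter> path_image (\<gamma> y) \<subseteq> position ` ({fst x, snd x} \<inter> {fst y, snd y})"
  if "x \<in> E" "y \<in> E" "x \<noteq> y" for x y
  using E(1) that unfolding planar_drawing_def split_beta prod.collapse by blast
 let ?I = "\<lambda>v. insert (position v) (\<Union>{path_image (\<gamma> e) |e. e \<in> E \<and> (v, fst e) \<in> ?C})"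
 have rect: "?I v \<subseteq> {1..real k} \<times> {0..1}" if "v \<in> vertices k" for v
  using img(1) position_in_rect[OF that] by blast
 have "?I (vtx a) \<inter> ?I (vtx b) \<noteq> {}"
 proof -
  obtain g where g: "path g" "pathstart g = position (vtx a)" "pathfinish g = position (vtx c)" "path_image g \<subseteq> ?I (vtx a)"
   using graph_path[OF E(1) ac] by blast
  obtain h where h: "path h" "pathstart h = position (vtx b)" "pathfinish h = position (vtx e)" "path_image h \<subseteq> ?I (vtx b)"
   using graph_path[OF E(1) be] by blast
  have "path_image g \<inter> path_image h \<noteq> {}"
   using interlaced_paths_meet[OF g(1) subset_trans[OF g(4) rect] g(2,3) h(1) subset_trans[OF h(4) rect] h(2,3)] l p
   by simp
  thus ?thesis using Int_mono[OF g(4) h(4)] by (metis subset_empty)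
 qed
 then obtain z where z: "z \<in> ?I (vtx a)" "z \<in> ?I (vtx b)" by blast
 \<comment> \<open>An arc contains no vertices besides its own ends, so a vertex on an arc belongs
   to the component of that arc.\<close>
 have on: "(v, u) \<in> ?C" if "position u \<in> path_image (\<gamma> x)" "x \<in> E" "(v, fst x) \<in> ?C" "u \<in> vertices k" for u v x
 proof -
  have "position u \<in> {position (fst x), position (snd x)}" using img(2)[OF that(2)] that(1,4) by blast
  hence "u = fst x \<or> u = snd x" using position_inject by blast
  moreover have "(fst x, snd x) \<in> ?C" using that(2) by auto
  ultimately show ?thesis using that(3) by (metis rtrancl_trans)
 qed
 have va: "vtx a \<in> vertices k" "vtx b \<in> vertices k" using p by auto
 have "(vtx a, vtx b) \<in> ?C"
 proof -
  consider "z = position (vtx a)" "z = position (vtx b)"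
   | x where "z = position (vtx a)" "x \<in> E" "(vtx b, fst x) \<in> ?C" "z \<in> path_image (\<gamma> x)"
   | x where "z = position (vtx b)" "x \<in> E" "(vtx a, fst x) \<in> ?C" "z \<in> path_image (\<gamma> x)"
   | x y where "x \<in> E" "(vtx a, fst x) \<in> ?C" "z \<in> path_image (\<gamma> x)" "y \<in> E" "(vtx b, fst y) \<in> ?C" "z \<in> path_image (\<gamma> y)"
   using z by blast
  thus ?thesis
  proof cases
   case 1
   thus ?thesis using position_inject[of "vtx a" "vtx b"] by simp
  next
   case (2 x)
   hence "(vtx b, vtx a) \<in> ?C" using on[of "vtx a" x "vtx b"] va(1) by blast
   thus ?thesis by (rule sym_graph_rtrancl)
  next
   case (3 x)
   thus ?thesis using on[of "vtx b" x "vtx a"] va by blast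
  next
   case (4 x y)
   show ?thesis
   proof (cases "x = y")
    case True
    thus ?thesis using 4(2,5) sym_graph_rtrancl[of "vtx b" "fst y" E] by (metis rtrancl_trans)
   next
    case False
    then obtain u where u: "u \<in> {fst x, snd x} \<inter> {fst y, snd y}" "z = position u" using dj[OF 4(1,4)] 4(3,6) by blast
    hence "u \<in> vertices k" using Ev[OF 4(1)] by auto
    hence "(vtx a, u) \<in> ?C" "(vtx b, u) \<in> ?C"
     using on[OF _ 4(1,2)] on[OF _ 4(4,5)] 4(3,6) u(2) by blast+
    thus ?thesis using sym_graph_rtrancl[of "vtx b" u E] by (metis rtrancl_trans)
   qed
  qed
 qed
 thus "rel d a b" using p rel_graph_components unfolding E(2)[symmetric] by blast
qed

text \<open>The preimage under \<open>bend\<close> of the half circle over the segment from \<open>a\<close> to \<open>b\<close>.\<close>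

definition semicircle :: "int => int => real => real \<times> real" where
 "semicircle a b t = (sqrt ((1 - t) * (real_of_int a)\<^sup>2 + t * (real_of_int b)\<^sup>2),
   arccos ((real_of_int a + t * (real_of_int b - real_of_int a)) /
    sqrt ((1 - t) * (real_of_int a)\<^sup>2 + t * (real_of_int b)\<^sup>2)) / pi)"

text \<open>On the half circle with diameter from \<open>a\<close> to \<open>b\<close> the ordinate
  satisfies y^2 = (x - a)(b - x). With abscissa x = a + t(b - a) this gives x^2 + y^2 = (1 - t)a^2 +
  t b^2. As a convex combination of squares between 1 and k^2, the squared radius stays in the
  annulus, so the curve stays in the rectangle.\<close>

lemma semicircle_props:
 assumes ab: "a \<in> pts k" "b \<in> pts k" and t: "0 \<le> t" "t \<le> 1"
 defines "x \<equiv> real_of_int a + t * (real_of_int b - real_of_int a)" and "p \<equiv> semicircle a b t"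
 shows "1 \<le> fst p" "fst p \<le> real k" "0 \<le> snd p" "snd p \<le> 1" "fst p * cos (pi * snd p) = x"
  "(fst p)\<^sup>2 - x\<^sup>2 = (x - real_of_int a) * (real_of_int b - x)"
  "\<bar>x / sqrt ((1 - t) * (real_of_int a)\<^sup>2 + t * (real_of_int b)\<^sup>2)\<bar> \<le> 1"
  "0 < sqrt ((1 - t) * (real_of_int a)\<^sup>2 + t * (real_of_int b)\<^sup>2)"
proof -
 define A B where "A = real_of_int a" and "B = real_of_int b"
 define R where "R = (1 - t) * A\<^sup>2 + t * B\<^sup>2"
 have sq: "1 \<le> (real_of_int c)\<^sup>2 \<and> (real_of_int c)\<^sup>2 \<le> (real k)\<^sup>2" if "c \<in> pts k" for c
 proof -
  have "1 \<le> \<bar>real_of_int c\<bar>" "\<bar>real_of_int c\<bar> \<le> real k" using that unfolding pts_def by auto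
  hence "1\<^sup>2 \<le> \<bar>real_of_int c\<bar>\<^sup>2" "\<bar>real_of_int c\<bar>\<^sup>2 \<le> (real k)\<^sup>2" by (intro power_mono; simp)+
  thus ?thesis by simp
 qed
 have AB: "1 \<le> A\<^sup>2" "A\<^sup>2 \<le> (real k)\<^sup>2" "1 \<le> B\<^sup>2" "B\<^sup>2 \<le> (real k)\<^sup>2"
  using sq ab by (auto simp: A_def B_def)
 have "(1 - t) * 1 + t * 1 \<le> R" unfolding R_def using AB t by (intro add_mono mult_left_mono) auto
 hence R1: "1 \<le> R" by simp
 have "R \<le> (1 - t) * (real k)\<^sup>2 + t * (real k)\<^sup>2" unfolding R_def using AB t by (intro add_mono mult_left_mono) auto
 hence R2: "R \<le> (real k)\<^sup>2" by (simp add: algebra_simps)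
 have x: "x = A + t * (B - A)" by (simp add: x_def A_def B_def)
 have Rx: "R - x\<^sup>2 = (x - A) * (B - x)" unfolding R_def x by (simp add: algebra_simps power2_eq_square)
 have "(x - A) * (B - x) = t * (1 - t) * (B - A)\<^sup>2" unfolding x by (simp add: algebra_simps power2_eq_square)
 hence "x\<^sup>2 \<le> R" using Rx t by (smt (verit) mult_nonneg_nonneg zero_le_power2)
 hence "\<bar>x\<bar> \<le> sqrt R" using R1 by (simp add: real_le_rsqrt)
 moreover have pos: "0 < sqrt R" using R1 by simp
 ultimately have q: "\<bar>x / sqrt R\<bar> \<le> 1" by (simp add: abs_div divide_le_eq)
 have p: "fst p = sqrt R" "snd p = arccos (x / sqrt R) / pi"
  by (simp_all add: p_def semicircle_def R_def x_def A_def B_def)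
 have q2: "- 1 \<le> x / sqrt R" "x / sqrt R \<le> 1" using abs_le_D1[OF q] abs_le_D2[OF q] by linarith+
 show "1 \<le> fst p" using R1 by (simp add: p)
 show "fst p \<le> real k" unfolding p using R2 by (simp add: real_sqrt_le_iff[of R "(real k)\<^sup>2", simplified])
 show "0 \<le> snd p" "snd p \<le> 1" unfolding p using arccos_lbound[OF q2] arccos_ubound[OF q2] by (simp_all add: divide_le_eq)
 have "pi * snd p = arccos (x / sqrt R)" by (simp add: p)
 hence "cos (pi * snd p) = x / sqrt R" using cos_arccos[OF q2] by simp
 thus "fst p * cos (pi * snd p) = x" using pos by (simp add: p)
 show "(fst p)\<^sup>2 - x\<^sup>2 = (x - real_of_int a) * (real_of_int b - x)"
  using Rx R1 by (simp add: p A_def B_def)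
 show "\<bar>x / sqrt ((1 - t) * (real_of_int a)\<^sup>2 + t * (real_of_int b)\<^sup>2)\<bar> \<le> 1"
  "0 < sqrt ((1 - t) * (real_of_int a)\<^sup>2 + t * (real_of_int b)\<^sup>2)"
  using q pos by (simp_all only: R_def A_def B_def)
qed

lemma position_vtx:
 assumes "a \<in> pts k"
 shows "fst (position (vtx a)) * cos (pi * snd (position (vtx a))) = real_of_int a"
  "(fst (position (vtx a)))\<^sup>2 = (real_of_int a)\<^sup>2" "position (vtx a) \<in> {1..real k} \<times> {0..1}"
proof -
 show "fst (position (vtx a)) * cos (pi * snd (position (vtx a))) = real_of_int a"
  "(fst (position (vtx a)))\<^sup>2 = (real_of_int a)\<^sup>2"
  using assms by (auto simp: vtx_def pts_def)
 show "position (vtx a) \<in> {1..real k} \<times> {0..1}" using assms by (intro position_in_rect) simp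
qed

lemma arc_semicircle:
 assumes ab: "a \<in> pts k" "b \<in> pts k" "a < b"
 shows "arc (semicircle a b)" "pathstart (semicircle a b) = position (vtx a)"
  "pathfinish (semicircle a b) = position (vtx b)"
proof -
 note pr = semicircle_props[OF ab(1,2)]
 show "arc (semicircle a b)"
  unfolding arc_def
 proof
  have "continuous_on {0..1} (\<lambda>t. (sqrt ((1 - t) * (real_of_int a)\<^sup>2 + t * (real_of_int b)\<^sup>2),
   arccos ((real_of_int a + t * (real_of_int b - real_of_int a)) /
    sqrt ((1 - t) * (real_of_int a)\<^sup>2 + t * (real_of_int b)\<^sup>2)) / pi))"
  proof (intro continuous_intros ballI)
   fix t :: real assume "t \<in> {0..1}"
   hence t: "0 \<le> t" "t \<le> 1" by auto
   show "sqrt ((1 - t) * (real_of_int a)\<^sup>2 + t * (real_of_int b)\<^sup>2) \<noteq> 0" using pr(8)[OF t] by linarith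
   show "- 1 \<le> (real_of_int a + t * (real_of_int b - real_of_int a)) / sqrt ((1 - t) * (real_of_int a)\<^sup>2 + t * (real_of_int b)\<^sup>2) \<and>
    (real_of_int a + t * (real_of_int b - real_of_int a)) / sqrt ((1 - t) * (real_of_int a)\<^sup>2 + t * (real_of_int b)\<^sup>2) \<le> 1"
    using abs_le_D1[OF pr(7)[OF t]] abs_le_D2[OF pr(7)[OF t]] by (intro conjI) linarith+
  qed auto
  thus "path (semicircle a b)" unfolding path_def semicircle_def .
  show "inj_on (semicircle a b) {0..1}"
  proof (rule inj_onI)
   fix s t :: real assume st: "s \<in> {0..1}" "t \<in> {0..1}" "semicircle a b s = semicircle a b t"
   hence "real_of_int a + s * (real_of_int b - real_of_int a) = real_of_int a + t * (real_of_int b - real_of_int a)"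
    using pr(5)[of s] pr(5)[of t] by auto
   thus "s = t" using ab(3) by simp
  qed
 qed
 have e: "p = position (vtx c)" if "fst p * cos (pi * snd p) = real_of_int c" "(fst p)\<^sup>2 = (real_of_int c)\<^sup>2"
  "1 \<le> fst p" "0 \<le> snd p" "snd p \<le> 1" "c \<in> pts k" for p c
  using that position_vtx[OF that(6)] by (intro polar_inject) auto
 show "pathstart (semicircle a b) = position (vtx a)"
  unfolding pathstart_def using pr[of 0] ab by (intro e) auto
 show "pathfinish (semicircle a b) = position (vtx b)"
  unfolding pathfinish_def using pr[of 1] ab by (intro e) auto
qed

lemma semicircle_image:
 assumes ab: "a \<in> pts k" "b \<in> pts k" "a < b" and p: "p \<in> path_image (semicircle a b)"
 defines "x \<equiv> fst p * cos (pi * snd p)"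
 shows "p \<in> {1..real k} \<times> {0..1}" "real_of_int a \<le> x" "x \<le> real_of_int b"
  "(fst p)\<^sup>2 - x\<^sup>2 = (x - real_of_int a) * (real_of_int b - x)"
proof -
 obtain t where t: "0 \<le> t" "t \<le> 1" "p = semicircle a b t" using p by (auto simp: path_image_def)
 note pr = semicircle_props[OF ab(1,2) t(1,2), folded t(3)]
 show "p \<in> {1..real k} \<times> {0..1}" using pr(1-4) by (cases p) auto
 have x: "x = real_of_int a + t * (real_of_int b - real_of_int a)" unfolding x_def by (rule pr(5))
 have "0 \<le> t * (real_of_int b - real_of_int a)" "t * (real_of_int b - real_of_int a) \<le> 1 * (real_of_int b - real_of_int a)"
  using t ab(3) by (auto intro!: mult_right_mono mult_nonneg_nonneg)
 thus "real_of_int a \<le> x" "x \<le> real_of_int b" unfolding x by auto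
 show "(fst p)\<^sup>2 - x\<^sup>2 = (x - real_of_int a) * (real_of_int b - x)" using pr(6) unfolding x .
qed

text \<open>The hypothesis \<open>z\<close> says that the bent point has ordinate 0, where a half
  circle has only its two ends.\<close>

lemma semicircle_vertex:
 assumes ab: "a \<in> pts k" "b \<in> pts k" "a < b" and p: "p \<in> path_image (semicircle a b)"
  and z: "(fst p)\<^sup>2 = (fst p * cos (pi * snd p))\<^sup>2"
 shows "p = position (vtx a) \<and> fst p * cos (pi * snd p) = real_of_int a \<or>
  p = position (vtx b) \<and> fst p * cos (pi * snd p) = real_of_int b"
proof -
 note i = semicircle_image[OF ab p]
 have pos: "p = position (vtx c)" if "fst p * cos (pi * snd p) = real_of_int c" "c \<in> pts k" for c
  using that position_vtx[OF that(2)] i(1) z by (intro polar_inject) auto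
 have "(fst p * cos (pi * snd p) - real_of_int a) * (real_of_int b - fst p * cos (pi * snd p)) = 0"
  using i(4) z by simp
 hence "fst p * cos (pi * snd p) = real_of_int a \<or> fst p * cos (pi * snd p) = real_of_int b" by auto
 thus ?thesis using pos ab by blast
qed

text \<open>The squared height (x - a)(b - x) grows strictly when the diameter is enlarged, so half
  circles with nested diameters cannot meet above an inner point unless they coincide.\<close>

lemma nested_semicircles:
 fixes a b a' b' x :: real
 assumes "a \<le> a'" "b' \<le> b" "a' < x" "x < b'" "(x - a) * (b - x) = (x - a') * (b' - x)"
 shows "a = a' \<and> b = b'"
proof (rule ccontr)
 assume n: "\<not> (a = a' \<and> b = b')"
 have "(x - a') * (b' - x) < (x - a) * (b - x)"
 proof (cases "a = a'")
  case True
  hence "b' < b" using n assms by auto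
  thus ?thesis using mult_strict_left_mono[of "b' - x" "b - x" "x - a'"] True assms by simp
 next
  case False
  hence "(x - a') * (b' - x) < (x - a) * (b' - x)" using assms by (intro mult_strict_right_mono) auto
  also have "\<dots> \<le> (x - a) * (b - x)" using assms by (intro mult_left_mono) auto
  finally show ?thesis .
 qed
 thus False using assms by simp
qed

text \<open>Each point is joined to the next larger point of its class only: these edges connect the
  class, while half circles between all pairs would cross inside one class.\<close>

lemma nc_rel_imp_planar:
 assumes d: "d \<in> A_set k" and nc: "nc_rel (rel d)"
 shows "planar k d"
proof -
 define r where "r = rel d"
 have r: "eqv_on k r" unfolding r_def by (rule eqv_on_rel[OF d])
 note rD = eqv_onD[OF r]
 define N where "N a b <-> r a b \<and> a < b \<and> (\<forall>c. a < c \<longrightarrow> c < b \<longrightarrow> \<not> r a c)" for a b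
 define E where "E = {(vtx a, vtx b) |a b. N a b}"
 define \<gamma> where "\<gamma> = (\<lambda>(v, w). semicircle (coord v) (coord w))"
 have Np: "a \<in> pts k" "b \<in> pts k" "a < b" if "N a b" for a b using that rD(1,2)[of a b] by (auto simp: N_def)
 have disj: "path_image (semicircle a b) \<inter> path_image (semicircle a' b') \<subseteq> position ` ({vtx a, vtx b} \<inter> {vtx a', vtx b'})"
  if n: "N a b" "N a' b'" "(a, b) \<noteq> (a', b')" for a b a' b'
 proof
  fix p assume p: "p \<in> path_image (semicircle a b) \<inter> path_image (semicircle a' b')"
  define x where "x = fst p * cos (pi * snd p)"
  note i = semicircle_image[OF Np[OF n(1)], of p, folded x_def] semicircle_image[OF Np[OF n(2)], of p, folded x_def]
  show "p \<in> position ` ({vtx a, vtx b} \<inter> {vtx a', vtx b'})"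
  proof (cases "(fst p)\<^sup>2 = x\<^sup>2")
   case True
   have "p = position (vtx a) \<and> x = real_of_int a \<or> p = position (vtx b) \<and> x = real_of_int b"
    "p = position (vtx a') \<and> x = real_of_int a' \<or> p = position (vtx b') \<and> x = real_of_int b'"
    using semicircle_vertex[OF Np[OF n(1)], of p] semicircle_vertex[OF Np[OF n(2)], of p] p True
    unfolding x_def by blast+
   thus ?thesis by auto
  next
   case False
   have e: "(x - real_of_int a) * (real_of_int b - x) = (x - real_of_int a') * (real_of_int b' - x)"
    "real_of_int a \<le> x" "x \<le> real_of_int b" "real_of_int a' \<le> x" "x \<le> real_of_int b'"
    "(x - real_of_int a) * (real_of_int b - x) \<noteq> 0"
    using i p False by auto
   hence s: "real_of_int a < x" "x < real_of_int b" "real_of_int a' < x" "x < real_of_int b'"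
    by (auto simp: order_less_le)
   have lt: "a' < b" "a < b'" using s by linarith+
   \<comment> \<open>Interlacing diameters would put all four ends into one class, against the
     choice of consecutive points. What remains are nested diameters.\<close>
   have c1: "\<not> (a < a' \<and> b < b')"
    using nc[folded r_def] n(1,2) lt unfolding nc_rel_def N_def by metis
   have c2: "\<not> (a' < a \<and> b' < b)"
    using nc[folded r_def] n(1,2) lt unfolding nc_rel_def N_def by metis
   have "a \<le> a' \<and> b' \<le> b \<or> a' \<le> a \<and> b \<le> b'" using c1 c2 by linarith
   hence "a = a' \<and> b = b'"
    using nested_semicircles[of "real_of_int a" "real_of_int a'" "real_of_int b'" "real_of_int b" x]
     nested_semicircles[of "real_of_int a'" "real_of_int a" "real_of_int b" "real_of_int b'" x] s e(1) by auto
   thus ?thesis using n(3) by simp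
  qed
 qed
 have verts: "path_image (semicircle a b) \<inter> position ` vertices k = {position (vtx a), position (vtx b)}" if n: "N a b" for a b
 proof
  show "path_image (semicircle a b) \<inter> position ` vertices k \<subseteq> {position (vtx a), position (vtx b)}"
  proof
   fix p assume "p \<in> path_image (semicircle a b) \<inter> position ` vertices k"
   then obtain c where p: "p \<in> path_image (semicircle a b)" "c \<in> pts k" "p = position (vtx c)"
    unfolding vertices_eq_vtx by blast
   hence "(fst p)\<^sup>2 = (fst p * cos (pi * snd p))\<^sup>2" using position_vtx(1,2)[OF p(2)] by simp
   thus "p \<in> {position (vtx a), position (vtx b)}" using semicircle_vertex[OF Np[OF n] p(1)] by blast
  qed
  show "{position (vtx a), position (vtx b)} \<subseteq> path_image (semicircle a b) \<inter> position ` vertices k"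
   using arc_semicircle(2,3)[OF Np[OF n]] Np[OF n] pathstart_in_path_image[of "semicircle a b"]
    pathfinish_in_path_image[of "semicircle a b"] by auto
 qed
 have "planar_drawing k E \<gamma>"
  unfolding planar_drawing_def
 proof (intro conjI)
  show "E \<subseteq> vertices k \<times> vertices k" using Np by (auto simp: E_def)
  show "\<forall>(v, w)\<in>E. arc (\<gamma> (v, w)) \<and> pathstart (\<gamma> (v, w)) = position v \<and> pathfinish (\<gamma> (v, w)) = position w \<and>
    path_image (\<gamma> (v, w)) \<subseteq> {1..real k} \<times> {0..1} \<and>
    path_image (\<gamma> (v, w)) \<inter> position ` vertices k = {position v, position w}"
  proof (intro ballI)
   fix e assume "e \<in> E"
   then obtain a b where e: "e = (vtx a, vtx b)" and n: "N a b" by (auto simp: E_def)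
   have "path_image (semicircle a b) \<subseteq> {1..real k} \<times> {0..1}" using semicircle_image(1)[OF Np[OF n]] by blast
   thus "case e of (v, w) => arc (\<gamma> (v, w)) \<and> pathstart (\<gamma> (v, w)) = position v \<and> pathfinish (\<gamma> (v, w)) = position w \<and>
    path_image (\<gamma> (v, w)) \<subseteq> {1..real k} \<times> {0..1} \<and>
    path_image (\<gamma> (v, w)) \<inter> position ` vertices k = {position v, position w}"
    using arc_semicircle[OF Np[OF n]] verts[OF n] by (simp add: e \<gamma>_def)
  qed
  show "\<forall>(v, w)\<in>E. \<forall>(v', w')\<in>E. (v, w) \<noteq> (v', w') \<longrightarrow>
    path_image (\<gamma> (v, w)) \<inter> path_image (\<gamma> (v', w')) \<subseteq> position ` ({v, w} \<inter> {v', w'})"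
  proof (intro ballI)
   fix e assume "e \<in> E"
   then obtain a b where e: "e = (vtx a, vtx b)" "N a b" by (auto simp: E_def)
   have "path_image (\<gamma> e) \<inter> path_image (\<gamma> e') \<subseteq> position ` ({fst e, snd e} \<inter> {fst e', snd e'})"
    if "e' \<in> E" "e \<noteq> e'" for e'
   proof -
    obtain a' b' where e': "e' = (vtx a', vtx b')" "N a' b'" using \<open>e' \<in> E\<close> by (auto simp: E_def)
    thus ?thesis using disj[OF e(2) e'(2)] e(1) \<open>e \<noteq> e'\<close> by (simp add: \<gamma>_def)
   qed
   thus "case e of (v, w) => \<forall>(v', w')\<in>E. (v, w) \<noteq> (v', w') \<longrightarrow>
    path_image (\<gamma> (v, w)) \<inter> path_image (\<gamma> (v', w')) \<subseteq> position ` ({v, w} \<inter> {v', w'})"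
    unfolding split_beta prod.collapse by blast
  qed
 qed
 moreover have "graph_components k E = d"
 proof -
  have "(vtx a, vtx b) \<in> (E \<union> E\<inverse>)\<^sup>*" if "r a b" "a < b" for a b
   using that
  proof (induction "nat (b - a)" arbitrary: a b rule: less_induct)
   case less
   show ?case
   proof (cases "N a b")
    case True
    thus ?thesis by (auto simp: E_def)
   next
    case False
    then obtain c where c: "a < c" "c < b" "r a c" using less.prems by (auto simp: N_def)
    have "r c b" using rD(5)[OF rD(4)[OF c(3)] less.prems(1)] .
    moreover have "nat (c - a) < nat (b - a)" "nat (b - c) < nat (b - a)" using c by auto
    ultimately show ?thesis
     using less.hyps[of c a] less.hyps[of b c] c by (meson rtrancl_trans)
   qed
  qed
  hence conn: "(vtx a, vtx b) \<in> (E \<union> E\<inverse>)\<^sup>*" if "r a b" for a b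
   using that rD(4)[OF that] sym_graph_rtrancl[of "vtx b" "vtx a" E]
   by (metis linorder_neqE rtrancl.rtrancl_refl)
  have reach: "\<exists>b. w = vtx b \<and> r a b" if "(vtx a, w) \<in> (E \<union> E\<inverse>)\<^sup>*" "a \<in> pts k" for a w
   using that(1)
  proof (induction rule: rtrancl_induct)
   case base
   thus ?case using rD(3)[OF that(2)] by blast
  next
   case (step w u)
   then obtain b where b: "w = vtx b" "r a b" by blast
   from step(2) obtain c where "u = vtx c" "r b c" using b(1) rD(4) unfolding E_def N_def by auto
   thus ?case using b rD(5) by blast
  qed
  have "rel (graph_components k E) a b <-> r a b" for a b
  proof
   assume "rel (graph_components k E) a b"
   thus "r a b" using reach[of a "vtx b"] unfolding rel_graph_components by auto
  next
   assume ab: "r a b"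
   thus "rel (graph_components k E) a b"
    unfolding rel_graph_components using rD(1,2)[OF ab] conn[OF ab] by blast
  qed
  hence *: "rel (graph_components k E) = r" by blast
  have "{(v, w) \<in> vertices k \<times> vertices k. (v, w) \<in> (E \<union> E\<inverse>)\<^sup>*} =
   {(v, w) \<in> vertices k \<times> vertices k. r (coord v) (coord w)}"
  proof -
   have "(v, w) \<in> (E \<union> E\<inverse>)\<^sup>* <-> r (coord v) (coord w)" if "v \<in> vertices k" "w \<in> vertices k" for v w
    using fun_cong[OF fun_cong[OF *, of "coord v"], of "coord w"] coord_in_pts that
    unfolding rel_graph_components by (simp add: vtx_coord[OF that(1)] vtx_coord[OF that(2)])
   thus ?thesis by blast
  qed
  hence "graph_components k E = diag k r" unfolding graph_components_def diag_def by simp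
  thus ?thesis using diag_rel[OF d] by (simp add: r_def)
 qed
 ultimately show ?thesis unfolding planar_def by blast
qed

lemma planar_iff_nc_rel: "d \<in> A_set k ==> planar k d <-> nc_rel (rel d)"
 using planar_imp_nc_rel nc_rel_imp_planar by blast

section \<open>Presentations of the planar monoids\<close>

lemma gen_e_act:
 assumes r: "eqv_on k r" and i: "1 \<le> i" "i < k"
 shows "gen_act (gen_e i) r a b <-> (if a = int i \<or> a = int i + 1 then b = int i \<or> b = int i + 1
  else b \<noteq> int i \<and> b \<noteq> int i + 1 \<and> merge i (i + 1) r a b)"
proof -
 define x where "x = int i"
 define y where "y = x + 1"
 have xy: "x \<in> pts k" "y \<in> pts k" "x \<noteq> y" using i by (auto simp: x_def y_def pts_def)
 note m = eqv_onD[OF eqv_on_merge[OF r, of i "i + 1"]]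
 have D: "detach (i + 1) (detach i (merge i (i + 1) r)) a b <->
  (if a = x \<or> a = y \<or> b = x \<or> b = y then a = b else merge i (i + 1) r a b)" for a b
  unfolding detach_def of_nat_add of_nat_1 x_def[symmetric] y_def[symmetric]
  using xy m(3)[of x] m(3)[of y] i by auto
 show ?thesis
  unfolding gen_act.simps merge_def[of _ _ "detach _ _"] D of_nat_add of_nat_1 x_def[symmetric] y_def[symmetric]
  using xy(3) by auto
qed

section \<open>Matchings as diagrams with blocks of size 2\<close>

definition arc_rel :: "nat => (int => int) => int => int => bool" where
 "arc_rel k f a b <-> a \<in> pts k \<and> (b = a \<or> b = f a)"

lemma trivial_above_pts:
 assumes "matching f" "trivial_above (int k) f"
 shows "f a \<in> pts k <-> a \<in> pts k"
proof -
 have *: "f a \<in> pts k" if "a \<in> pts k" for a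
  using that trivial_above_bound[OF assms, of a] matchingD(6)[OF assms(1), of a] by (simp add: pts_def)
 thus ?thesis using matchingD(1)[OF assms(1), of a] by metis
qed

lemma eqv_on_arc_rel:
 assumes "matching f" "trivial_above (int k) f"
 shows "eqv_on k (arc_rel k f)"
 using trivial_above_pts[OF assms] matchingD(1)[OF assms(1)]
 by (intro eqv_onI) (auto simp: arc_rel_def)

lemma arc_rel_uminus: "arc_rel k uminus = id_rel k"
 by (intro ext) (simp add: arc_rel_def id_rel_def)

lemma arc_rel_tl_act:
 assumes f: "matching f" "trivial_above (int k) f" and i: "1 \<le> i" "i < k"
 shows "gen_act (gen_e i) (arc_rel k f) = arc_rel k (tl_act (int i) f)"
proof (intro ext)
 fix a b
 define X Y x y where "X = int i" and "Y = int i + 1" and "x = f X" and "y = f Y"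
 have p: "X \<in> pts k" "Y \<in> pts k" "X \<noteq> Y" "Y = X + 1" "1 \<le> X" using i by (auto simp: X_def Y_def pts_def)
 have xp: "x \<in> pts k" "y \<in> pts k" using trivial_above_pts[OF f] p by (auto simp: x_def y_def)
 have fx: "f x = X" "f y = Y" using matchingD(1)[OF f(1)] by (auto simp: x_def y_def)
 have n: "x \<noteq> X" "y \<noteq> Y" "x \<noteq> y" "y = X <-> x = Y"
  using matchingD(2)[OF f(1), of X] matchingD(2)[OF f(1), of Y] matchingD(3)[OF f(1), of X Y] p
   matchingD(4)[OF f(1), of X Y] by (auto simp: x_def y_def)
 have l: "gen_act (gen_e i) (arc_rel k f) a b <-> (if a = X \<or> a = Y then b = X \<or> b = Y
  else b \<noteq> X \<and> b \<noteq> Y \<and> (arc_rel k f a b \<or> arc_rel k f a X \<and> arc_rel k f Y b \<or> arc_rel k f a Y \<and> arc_rel k f X b))"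
  using gen_e_act[OF eqv_on_arc_rel[OF f] i] unfolding merge_def of_nat_add of_nat_1 X_def Y_def .
 have t: "tl_act (int i) f a = (if x = Y then f a else if a = X then Y else if a = Y then X
  else if a = x then y else if a = y then x else f a)"
  using tl_act_apply[OF f(1), of X a] p by (simp add: x_def y_def X_def Y_def)
 have e: "arc_rel k f c X <-> c = X \<or> c = x" "arc_rel k f c Y <-> c = Y \<or> c = y" for c
  using p xp fx matchingD(4)[OF f(1), of c X] matchingD(4)[OF f(1), of c Y] by (auto simp: arc_rel_def x_def y_def)
 have e': "arc_rel k f X c <-> c = X \<or> c = x" "arc_rel k f Y c <-> c = Y \<or> c = y" for c
  using p by (auto simp: arc_rel_def x_def y_def)
 consider "a = X" | "a = Y" | "a = x" "a \<noteq> X" "a \<noteq> Y" | "a = y" "a \<noteq> X" "a \<noteq> Y" | "a \<notin> {X, Y, x, y}" by blast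
 thus "gen_act (gen_e i) (arc_rel k f) a b = arc_rel k (tl_act (int i) f) a b"
 proof cases
  case 1
  thus ?thesis unfolding l arc_rel_def[of k "tl_act _ _"] t using n p x_def[symmetric] by auto
 next
  case 2
  thus ?thesis unfolding l arc_rel_def[of k "tl_act _ _"] t using n p y_def[symmetric] by auto
 next
  case 3
  hence "arc_rel k f a b <-> b = x \<or> b = X" using xp fx by (auto simp: arc_rel_def)
  thus ?thesis unfolding l arc_rel_def[of k "tl_act _ _"] t e e' using 3 n p xp by auto
 next
  case 4
  hence "arc_rel k f a b <-> b = y \<or> b = Y" using xp fx by (auto simp: arc_rel_def)
  thus ?thesis unfolding l arc_rel_def[of k "tl_act _ _"] t e e' using 4 n p xp by auto
 next
  case 5
  hence "f a \<noteq> X" "f a \<noteq> Y" using matchingD(4)[OF f(1), of a] by (auto simp: x_def y_def)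
  thus ?thesis unfolding l arc_rel_def[of k "tl_act _ _"] t e e' using 5 by (auto simp: arc_rel_def)
 qed
qed

lemma act_word_e:
 assumes "set w \<subseteq> {1..<k}"
 shows "act_word k (map gen_e w) = arc_rel k (tl_word w)"
 using assms
proof (induction w rule: rev_induct)
 case Nil
 thus ?case by (simp add: arc_rel_uminus)
next
 case (snoc i w)
 hence "set w \<subseteq> {1..<k}" "1 \<le> i" "i < k" by auto
 thus ?case using snoc.IH arc_rel_tl_act[of "tl_word w" k i] noncrossing_tl_word[of w k]
  by (simp add: noncrossing_def del: gen_act.simps)
qed

lemma arc_rel_inject:
 assumes f: "matching f" "trivial_above (int k) f" and g: "matching g" "trivial_above (int k) g"
  and e: "arc_rel k f = arc_rel k g"
 shows "f = g"
proof (rule ext)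
 fix a
 show "f a = g a"
 proof (cases "a \<in> pts k")
  case True
  hence "arc_rel k g a (f a)" unfolding e[symmetric] by (simp add: arc_rel_def)
  moreover have "f a \<noteq> a" using matchingD(2)[OF f(1), of a] True by auto
  ultimately show ?thesis by (simp add: arc_rel_def)
 next
  case False
  show ?thesis
  proof (cases "a = 0")
   case True
   thus ?thesis using matchingD(5)[OF f(1)] matchingD(5)[OF g(1)] by simp
  next
   case False
   hence "\<bar>a\<bar> > int k" using \<open>a \<notin> pts k\<close> by (simp add: pts_def)
   thus ?thesis using f(2) g(2) by (simp add: trivial_above_def)
  qed
 qed
qed

lemma tl_word_eqI:
 assumes "set u \<subseteq> {1..<k}" "set v \<subseteq> {1..<k}" "act_word k (map gen_e u) = act_word k (map gen_e v)"
 shows "tl_word u = tl_word v"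
 using arc_rel_inject[of "tl_word u" k "tl_word v"] assms noncrossing_tl_word[OF assms(1)] noncrossing_tl_word[OF assms(2)]
 by (simp add: act_word_e noncrossing_def)

lemma nc_rel_arc_rel:
 assumes "noncrossing f"
 shows "nc_rel (arc_rel k f)"
 unfolding nc_rel_def
proof (intro allI impI)
 fix a b c d assume l: "a < b" "b < c" "c < d" and r: "arc_rel k f a c" "arc_rel k f b d"
 have "c = f a" "d = f b" using l r by (auto simp: arc_rel_def)
 hence "between a (f a) b" "\<not> between a (f a) (f b)" using l by (auto simp: between_def)
 thus "arc_rel k f a b" using assms by (simp add: noncrossing_def)
qed

lemma two_element_blocks:
 assumes d: "d \<in> A_set k" and c: "\<forall>B\<in>d. card B = 2"
 shows "\<exists>f. matching f \<and> trivial_above (int k) f \<and> rel d = arc_rel k f"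
proof -
 note r = eqv_onD[OF eqv_on_rel[OF d]]
 have ex1: "\<exists>!b. b \<noteq> a \<and> rel d a b" if a: "a \<in> pts k" for a
 proof -
  obtain B where B: "B \<in> d" "vtx a \<in> B" using r(3)[OF a] by (auto simp: rel_def)
  have uniq: "B' = B" if "B' \<in> d" "vtx a \<in> B'" for B'
   using d B that unfolding A_set_def partition_on_def disjoint_def by blast
  have "B \<subseteq> vertices k" using d B unfolding A_set_def partition_on_def by blast
  moreover obtain p q where pq: "B = {p, q}" "p \<noteq> q" using c B(1) by (auto simp: card_2_iff)
  define v where "v = (if vtx a = p then q else p)"
  have v: "B = {vtx a, v}" "v \<noteq> vtx a" using pq B(2) by (auto simp: v_def)
  ultimately have vc: "v = vtx (coord v)" using vtx_coord[of v k] by simp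
  hence "vtx b = v <-> b = coord v" for b by (metis vtx_inject)
  moreover have "rel d a b <-> vtx b \<in> B" for b using uniq B unfolding rel_def by metis
  ultimately have "b \<noteq> a \<and> rel d a b <-> b = coord v" for b using v vc by auto
  thus ?thesis by simp
 qed
 define h where "h a = (THE b. b \<noteq> a \<and> rel d a b)" for a
 have h: "h a \<noteq> a \<and> rel d a (h a)" "\<And>b. b \<noteq> a ==> rel d a b ==> b = h a" if "a \<in> pts k" for a
  unfolding h_def using theI'[OF ex1[OF that]] the1_equality[OF ex1[OF that]] by blast+
 define f where "f a = (if a \<in> pts k then h a else - a)" for a
 have hp: "h a \<in> pts k" "h (h a) = a" if "a \<in> pts k" for a
 proof -
  show p: "h a \<in> pts k" using h(1)[OF that] r(2) by blast
  show "h (h a) = a" using h(2)[OF p, of a] h(1)[OF that] r(4) by metis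
 qed
 have "f (f a) = a" "f a = a <-> a = 0" for a using hp[of a] h(1)[of a] by (auto simp: f_def)
 hence "matching f" by (simp add: matching_def)
 moreover have "trivial_above (int k) f" by (auto simp: trivial_above_def f_def pts_def)
 moreover have "rel d a b <-> arc_rel k f a b" for a b
  using h[of a] r(1)[of a b] r(3)[of a] by (auto simp: arc_rel_def f_def)
 hence "rel d = arc_rel k f" by blast
 ultimately show ?thesis by blast
qed

text \<open>For arcs between vertices this is \<open>nc_rel\<close>; the verticals added outside the
  diagram enclose all vertices and cross nothing.\<close>

lemma noncrossing_of_nc_rel:
 assumes f: "matching f" "trivial_above (int k) f" and nc: "nc_rel (arc_rel k f)"
 shows "noncrossing f"
proof -
 have *: "x < f q \<and> f q < y" if xy: "x < q" "q < y" "f x = y" for x y q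
 proof (cases "x \<in> pts k")
  case True
  hence "y \<in> pts k" using trivial_above_pts[OF f, of x] xy(3) by simp
  hence "q \<in> pts k \<or> q = 0" using xy True by (auto simp: pts_def)
  moreover have "f 0 = 0" by (rule matchingD(5)[OF f(1)])
  moreover have "x < f q \<and> f q < y" if q: "q \<in> pts k"
  proof -
   have fq: "f (f q) = q" "f y = x" "f q \<in> pts k"
    using matchingD(1)[OF f(1)] trivial_above_pts[OF f] q xy(3) by auto
   have r: "arc_rel k f x y" "arc_rel k f q (f q)" "arc_rel k f (f q) q"
    using True q fq xy(3) by (auto simp: arc_rel_def)
   have n: "\<not> arc_rel k f x q" "\<not> arc_rel k f (f q) x"
    using xy fq matchingD(1)[OF f(1)] by (auto simp: arc_rel_def)
   have ne: "f q \<noteq> x" "f q \<noteq> y" using fq xy by auto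
   have "\<not> y < f q" using nc r(1,2) n(1) xy(1,2) unfolding nc_rel_def by blast
   moreover have "\<not> f q < x" using nc r(1,3) n(2) xy(1,2) unfolding nc_rel_def by blast
   ultimately show ?thesis using ne by linarith
  qed
  ultimately show ?thesis using xy by auto
 next
  case False
  have "x \<noteq> 0" using xy matchingD(5)[OF f(1)] by auto
  hence "\<bar>x\<bar> > int k" using False by (simp add: pts_def)
  hence y: "y = - x" using f(2) xy(3) by (simp add: trivial_above_def)
  have "\<bar>q\<bar> < \<bar>x\<bar>" using xy y by auto
  moreover have "\<bar>f q\<bar> \<le> int k \<or> f q = - q"
   using trivial_above_bound[OF f, of q] f(2) by (cases "\<bar>q\<bar> \<le> int k") (auto simp: trivial_above_def)
  ultimately have "\<bar>f q\<bar> < \<bar>x\<bar>" using \<open>\<bar>x\<bar> > int k\<close> by auto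
  thus ?thesis using y xy by auto
 qed
 have "between a (f a) (f q)" if "between a (f a) q" for a q
  using that *[of a q "f a"] *[of "f a" q a] matchingD(1)[OF f(1), of a] by (auto simp: between_def)
 thus ?thesis using f(1) by (simp add: noncrossing_def)
qed

text \<open>Doubling: the point \<open>a\<close> is thickened to the two consecutive points \<open>left_end a\<close>, \<open>right_end a\<close>.
 Two points lie in the same block of the planar partition belonging to a noncrossing matching
 iff no arc separates them.\<close>

definition left_end :: "int => int" where
 "left_end a = (if a > 0 then 2 * a - 1 else 2 * a)"

definition right_end :: "int => int" where
 "right_end a = left_end a + 1"

text \<open>Here \<open>p\<close> stands for the gap between \<open>p\<close> and
  \<open>p + 1\<close>. The inequality of truth values is symmetric in the two ends of the arc, so
  the order of the ends does not matter.\<close>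

definition encloses :: "(int => int) => int => int => bool" where
 "encloses f u p <-> (u \<le> p) \<noteq> (f u \<le> p)"

definition region_rel :: "nat => (int => int) => int => int => bool" where
 "region_rel k f a b <-> a \<in> pts k \<and> b \<in> pts k \<and>
   (\<forall>u. encloses f u (left_end a) = encloses f u (left_end b))"

section \<open>Regions cut out by the arcs of a matching\<close>

lemma eqv_on_region_rel: "eqv_on k (region_rel k f)"
 by (rule eqv_onI) (auto simp: region_rel_def)

lemma left_end_mono: "a \<noteq> 0 ==> b \<noteq> 0 ==> left_end a < left_end b <-> a < b"
 "a \<noteq> 0 ==> b \<noteq> 0 ==> left_end a \<le> left_end b <-> a \<le> b"
 "a \<noteq> 0 ==> b \<noteq> 0 ==> right_end a \<le> left_end b <-> a < b"
 "a \<noteq> 0 ==> b \<noteq> 0 ==> left_end a = left_end b <-> a = b"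
 "a \<noteq> 0 ==> b \<noteq> 0 ==> right_end a \<noteq> left_end b"
 by (auto simp: left_end_def right_end_def) presburger+

lemma pts_nonzero: "a \<in> pts k ==> a \<noteq> 0"
 by auto

lemma encloses_sym:
 assumes "matching f"
 shows "encloses f (f u) p = encloses f u p"
 using matchingD(1)[OF assms, of u] by (auto simp: encloses_def)

text \<open>The sets of gaps enclosed by two noncrossing arcs are disjoint or nested; gaps enclosed
  by both, by the first only and by the second only cannot all occur.\<close>

lemma not_crossing:
 assumes nc: "noncrossing f" and p: "encloses f u p" "encloses f v p"
  and q: "encloses f u q" "\<not> encloses f v q" and s: "\<not> encloses f u s" "encloses f v s"
 shows False
proof -
 have m: "matching f" using nc by (simp add: noncrossing_def)
 have *: False if "encloses f u p" "encloses f v p" "encloses f u q" "\<not> encloses f v q" "\<not> encloses f u s" "encloses f v s"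
  "u < f u" "v < f v" for u v
 proof -
  have e: "encloses f u t <-> u \<le> t \<and> t < f u" "encloses f v t <-> v \<le> t \<and> t < f v" for t
   using that(7,8) by (auto simp: encloses_def)
  have "u < v \<and> v < f u \<and> f u < f v \<or> v < u \<and> u < f v \<and> f v < f u"
   using that(1-6) unfolding e by linarith
  thus False
  proof (elim disjE)
   assume 1: "u < v \<and> v < f u \<and> f u < f v"
   hence "between u (f u) v" by (simp add: between_def)
   hence "between u (f u) (f v)" using nc unfolding noncrossing_def by blast
   thus False using 1 by (auto simp: between_def)
  next
   assume 2: "v < u \<and> u < f v \<and> f v < f u"
   hence "between v (f v) u" by (simp add: between_def)
   hence "between v (f v) (f u)" using nc unfolding noncrossing_def by blast
   thus False using 2 by (auto simp: between_def)
  qed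
 qed
 have n: "w \<noteq> f w" if "encloses f w t" for w t using that by (auto simp: encloses_def)
 define u' v' where "u' = min u (f u)" and "v' = min v (f v)"
 have u: "u' < f u'" "encloses f u' t = encloses f u t" for t
  using n[OF p(1)] matchingD(1)[OF m, of u] encloses_sym[OF m, of u t] by (auto simp: u'_def min_def)
 have v: "v' < f v'" "encloses f v' t = encloses f v t" for t
  using n[OF p(2)] matchingD(1)[OF m, of v] encloses_sym[OF m, of v t] by (auto simp: v'_def min_def)
 show False using *[of u' v'] p q s u v by blast
qed

text \<open>An arc encloses an interval of gaps, and the indicator function of an interval cannot
  alternate along \<open>a\<close>, \<open>b\<close>, \<open>c\<close>, \<open>d\<close>.\<close>

lemma nc_rel_region_rel: "nc_rel (region_rel k f)"
 unfolding nc_rel_def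
proof (intro allI impI)
 fix a b c d
 assume l: "a < b" "b < c" "c < d" and r: "region_rel k f a c" "region_rel k f b d"
 have p: "a \<in> pts k" "b \<in> pts k" "c \<in> pts k" "d \<in> pts k" using r by (auto simp: region_rel_def)
 have o: "left_end a < left_end b" "left_end b < left_end c" "left_end c < left_end d"
  using l p left_end_mono(1) pts_nonzero by blast+
 have "encloses f u (left_end a) = encloses f u (left_end b)" for u
 proof -
  have "encloses f u (left_end a) = encloses f u (left_end c)" "encloses f u (left_end b) = encloses f u (left_end d)"
   using r by (auto simp: region_rel_def)
  thus ?thesis using o unfolding encloses_def by linarith
 qed
 thus "region_rel k f a b" using p by (simp add: region_rel_def)
qed

lemma even_card_involution:
 assumes "finite S" "\<And>x. x \<in> S ==> f x \<in> S \<and> f x \<noteq> x \<and> f (f x) = x"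
 shows "even (card S)"
 using assms
proof (induction "card S" arbitrary: S rule: less_induct)
 case less
 show ?case
 proof (cases "S = {}")
  case False
  then obtain x where x: "x \<in> S" by blast
  note fx = less.prems(2)[OF x]
  let ?S = "S - {x, f x}"
  have c: "card ?S = card S - 2" using x fx less.prems(1) by (subst card_Diff_subset) auto
  have "2 \<le> card S" using card_mono[of S "{x, f x}"] x fx less.prems(1) by auto
  moreover have "even (card ?S)"
  proof (rule less.hyps)
   show "card ?S < card S" using x less.prems(1) by (intro psubset_card_mono) auto
   fix y assume y: "y \<in> ?S"
   hence "f y \<noteq> x" "f y \<noteq> f x" using less.prems(2) fx by (metis Diff_iff insertCI)+
   thus "f y \<in> ?S \<and> f y \<noteq> y \<and> f (f y) = y" using less.prems(2)[of y] y by auto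
  qed (use less.prems in auto)
  ultimately show ?thesis using c by auto
 qed simp
qed

text \<open>The ends in this range are \<open>right_end a\<close>, \<open>left_end b\<close> and
  both ends of every thickened point in between; 0 is skipped as it is no end.\<close>

lemma card_ends:
 assumes "a \<in> pts k" "b \<in> pts k" "a < b"
 shows "even (card ({left_end a<..left_end b} - {0}))"
proof (cases "a < 0 \<and> 0 < b")
 case True
 hence "card ({left_end a<..left_end b} - {0}) = nat (left_end b - left_end a) - 1"
  by (subst card_Diff_subset) (auto simp: left_end_def)
 also have "\<dots> = 2 * nat (b - a - 1)" using True by (auto simp: left_end_def)
 finally show ?thesis by simp
next
 case False
 hence "{left_end a<..left_end b} - {0} = {left_end a<..left_end b}"
  using assms by (auto simp: left_end_def pts_def)
 moreover have "left_end b - left_end a = 2 * (b - a)" using False assms by (auto simp: left_end_def pts_def)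
 moreover have "nat (2 * (b - a)) = 2 * nat (b - a)" using assms(3) by simp
 ultimately show ?thesis by (simp only: card_greaterThanAtMost_int) simp
qed

text \<open>Crossing a single arc leads from a block to a gap between blocks.\<close>

lemma not_one_separating_arc:
 assumes m: "matching f" and ab: "a \<in> pts k" "b \<in> pts k" "a < b"
  and w: "encloses f w (left_end a) \<noteq> encloses f w (left_end b)"
  and o: "\<And>u. u \<noteq> w ==> u \<noteq> f w ==> encloses f u (left_end a) = encloses f u (left_end b)"
 shows False
proof -
 let ?S = "{left_end a<..left_end b} - {0}"
 have lt: "left_end a < left_end b" using ab left_end_mono(1) pts_nonzero by blast
 have sep: "encloses f u (left_end a) \<noteq> encloses f u (left_end b) <->
  (u \<in> {left_end a<..left_end b}) \<noteq> (f u \<in> {left_end a<..left_end b})" for u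
  using lt by (auto simp: encloses_def)
 have w0: "w \<noteq> 0" "f w \<noteq> 0"
  using w matchingD(5)[OF m] matchingD(6)[OF m, of w] by (auto simp: encloses_def)
 obtain z where z: "z \<in> {w, f w}" "z \<in> ?S" "f z \<notin> ?S"
 proof (cases "w \<in> {left_end a<..left_end b}")
  case True
  thus ?thesis using that[of w] w sep[of w] w0 by auto
 next
  case False
  thus ?thesis using that[of "f w"] w sep[of w] w0 matchingD(1)[OF m, of w] by auto
 qed
 \<comment> \<open>All arcs but one have both ends or no end in the range. Without the end
   \<open>z\<close> of the exceptional arc the remaining ends pair off, whereas their total number
   in the range is even.\<close>
 have "even (card (?S - {z}))"
 proof (rule even_card_involution)
  fix x assume x: "x \<in> ?S - {z}"
  have zz: "{w, f w} = {z, f z}" using z(1) matchingD(1)[OF m, of w] by auto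
  hence "x \<noteq> w" "x \<noteq> f w" using x z(3) by auto
  hence "f x \<in> {left_end a<..left_end b}" using o sep x by blast
  moreover have "f x \<noteq> 0" "f x \<noteq> x" using x matchingD(2,6)[OF m, of x] by auto
  moreover have "f x \<noteq> z" using x z(3) matchingD(1)[OF m, of x] by auto
  ultimately show "f x \<in> ?S - {z} \<and> f x \<noteq> x \<and> f (f x) = x" using matchingD(1)[OF m] by auto
 qed simp
 moreover have "card (?S - {z}) = card ?S - 1" using z(2) by (intro card_Diff_singleton)
 moreover have "card ?S \<noteq> 0" using z(2) by auto
 ultimately show False using card_ends[OF ab] by simp
qed

lemma left_end_even: "a \<in> pts k ==> left_end a \<noteq> 2 * int (j::nat)" if "1 \<le> j"
 using that by (auto simp: left_end_def pts_def)  presburger+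

lemma left_end_odd: "a \<in> pts k ==> left_end a = 2 * int j - 1 <-> a = int j" if "1 \<le> j"
 using that by (auto simp: left_end_def pts_def)

text \<open>The new cap encloses the single gap \<open>i\<close>. The arc joining the former
  partners encloses the symmetric difference of what the two old arcs enclosed, except at the gap
  \<open>i\<close>. Hence comparing two gaps involves these two arcs and the untouched ones.\<close>

lemma region_rel_tl_act:
 assumes nc: "noncrossing f" and i: "1 \<le> i" and ne: "f i \<noteq> i + 1"
 shows "\<And>p. encloses (tl_act i f) i p <-> p = i"
  "\<And>p. p \<noteq> i ==> encloses (tl_act i f) (f i) p <-> encloses f i p \<noteq> encloses f (i + 1) p"
  "\<And>u p. u \<notin> {i, i + 1, f i, f (i + 1)} ==> encloses (tl_act i f) u p = encloses f u p"
  "(\<forall>u. encloses (tl_act i f) u p = encloses (tl_act i f) u q) <->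
   encloses (tl_act i f) i p = encloses (tl_act i f) i q \<and>
   encloses (tl_act i f) (f i) p = encloses (tl_act i f) (f i) q \<and>
   (\<forall>u. u \<notin> {i, i + 1, f i, f (i + 1)} \<longrightarrow> encloses f u p = encloses f u q)"
proof -
 have m: "matching f" using nc by (simp add: noncrossing_def)
 have g: "tl_act i f a = (if a = i then i + 1 else if a = i + 1 then i else if a = f i then f (i + 1)
   else if a = f (i + 1) then f i else f a)" for a
  using tl_act_apply[OF m i] ne by simp
 have mg: "matching (tl_act i f)" by (rule matching_tl_act[OF m i])
 have n: "f i \<noteq> i" "f i \<noteq> i + 1" using matchingD(2)[OF m, of i] i ne by auto
 show 1: "encloses (tl_act i f) i p <-> p = i" for p by (auto simp: encloses_def g)
 show 2: "encloses (tl_act i f) (f i) p <-> encloses f i p \<noteq> encloses f (i + 1) p" if "p \<noteq> i" for p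
 proof -
  have "i \<le> p <-> i + 1 \<le> p" using that by auto
  thus ?thesis using n by (simp add: encloses_def g) blast
 qed
 show 3: "encloses (tl_act i f) u p = encloses f u p" if "u \<notin> {i, i + 1, f i, f (i + 1)}" for u p
  using that by (simp add: encloses_def g)
 have "encloses (tl_act i f) (i + 1) p = encloses (tl_act i f) i p" for p
  using encloses_sym[OF mg, of i p] by (simp add: g)
 moreover have "encloses (tl_act i f) (f (i + 1)) p = encloses (tl_act i f) (f i) p" for p
  using encloses_sym[OF mg, of "f i" p] n by (simp add: g)
 moreover have "(\<forall>u. P u) <-> P i \<and> P (i + 1) \<and> P (f i) \<and> P (f (i + 1)) \<and>
  (\<forall>u. u \<notin> {i, i + 1, f i, f (i + 1)} \<longrightarrow> P u)" for P :: "int => bool"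
  by (intro iffI) (simp, metis insert_iff empty_iff)
 from this[of "\<lambda>u. encloses (tl_act i f) u p = encloses (tl_act i f) u q"]
 have "(\<forall>u. encloses (tl_act i f) u p = encloses (tl_act i f) u q) <->
   encloses (tl_act i f) i p = encloses (tl_act i f) i q \<and>
   encloses (tl_act i f) (i + 1) p = encloses (tl_act i f) (i + 1) q \<and>
   encloses (tl_act i f) (f i) p = encloses (tl_act i f) (f i) q \<and>
   encloses (tl_act i f) (f (i + 1)) p = encloses (tl_act i f) (f (i + 1)) q \<and>
   (\<forall>u. u \<notin> {i, i + 1, f i, f (i + 1)} \<longrightarrow> encloses f u p = encloses f u q)"
  using 3 by simp
 ultimately show "(\<forall>u. encloses (tl_act i f) u p = encloses (tl_act i f) u q) <->
   encloses (tl_act i f) i p = encloses (tl_act i f) i q \<and>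
   encloses (tl_act i f) (f i) p = encloses (tl_act i f) (f i) q \<and>
   (\<forall>u. u \<notin> {i, i + 1, f i, f (i + 1)} \<longrightarrow> encloses f u p = encloses f u q)"
  by simp
qed

lemma all_encloses:
 assumes m: "matching f"
 shows "(\<forall>u. encloses f u p = encloses f u q) <-> encloses f i p = encloses f i q \<and>
  encloses f (i + 1) p = encloses f (i + 1) q \<and>
  (\<forall>u. u \<notin> {i, i + 1, f i, f (i + 1)} \<longrightarrow> encloses f u p = encloses f u q)"
 using encloses_sym[OF m] by (metis insert_iff singletonD)

text \<open>An even position \<open>2 * j\<close> is the right end of the point \<open>j\<close>,
  and the next one is the left end of \<open>j + 1\<close>. The surgery there opens a passage
  between the regions of these two points and joins no other blocks.\<close>

lemma region_rel_even:
 assumes nc: "noncrossing f" and j: "1 \<le> j" "j < k"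
 shows "merge j (j + 1) (region_rel k f) = region_rel k (tl_act (2 * int j) f)"
proof (intro ext)
 fix a b
 define i where "i = 2 * int j"
 define E where "E u c = encloses f u (left_end c)" for u c
 have m: "matching f" using nc by (simp add: noncrossing_def)
 have i: "1 \<le> i" using j by (simp add: i_def)
 define J J' where "J = int j" and "J' = int j + 1"
 have p: "J \<in> pts k" "J' \<in> pts k" using j by (auto simp: pts_def J_def J'_def)
 have lJ: "left_end J = i - 1" "left_end J' = i + 1" using j by (auto simp: left_end_def i_def J_def J'_def)
 have mg: "merge j (j + 1) r a b <-> r a b \<or> r a J \<and> r J' b \<or> r a J' \<and> r J b" for r
  by (simp add: merge_def J_def J'_def add.commute)
 have CJ: "E u J = E u J'" if "u \<notin> {i, i + 1, f i, f (i + 1)}" for u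
 proof -
  have "u \<noteq> i" "u \<noteq> i + 1" "f u \<noteq> i" "f u \<noteq> i + 1" using that matchingD(1)[OF m, of u] by auto
  hence "u \<le> i - 1 <-> u \<le> i + 1" "f u \<le> i - 1 <-> f u \<le> i + 1" by linarith+
  thus ?thesis by (simp add: E_def encloses_def lJ)
 qed
 have rE: "region_rel k f c d <-> c \<in> pts k \<and> d \<in> pts k \<and> E i c = E i d \<and> E (i + 1) c = E (i + 1) d \<and>
  (\<forall>u. u \<notin> {i, i + 1, f i, f (i + 1)} \<longrightarrow> E u c = E u d)" for c d
  unfolding region_rel_def E_def using all_encloses[OF m, of "left_end c" "left_end d" i] by blast
 show "merge j (j + 1) (region_rel k f) a b = region_rel k (tl_act (2 * int j) f) a b"
 proof (cases "f i = i + 1")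
  case True
  hence "tl_act i f = f" by (simp add: tl_act_def)
  moreover have "region_rel k f J J'"
  proof -
   have "f (i + 1) = i" using True matchingD(1)[OF m, of i] by simp
   hence "E i J = E i J'" "E (i + 1) J = E (i + 1) J'" using True by (simp_all add: E_def encloses_def lJ)
   thus ?thesis using p CJ unfolding rE by blast
  qed
  ultimately show ?thesis
   unfolding mg i_def[symmetric] using eqv_onD(4,5)[OF eqv_on_region_rel[of k f]] by metis
 next
  case False
  note t = region_rel_tl_act[OF nc i False]
  have ne: "left_end c \<noteq> i" if "c \<in> pts k" for c
   using left_end_even[OF j(1) that] by (simp add: i_def)
  have gE: "region_rel k (tl_act i f) a b <-> a \<in> pts k \<and> b \<in> pts k \<and>
   ((E i a \<noteq> E (i + 1) a) = (E i b \<noteq> E (i + 1) b)) \<and> (\<forall>u. u \<notin> {i, i + 1, f i, f (i + 1)} \<longrightarrow> E u a = E u b)"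
  proof (cases "a \<in> pts k \<and> b \<in> pts k")
   case True
   hence n: "left_end a \<noteq> i" "left_end b \<noteq> i" using ne by auto
   show ?thesis unfolding region_rel_def t(4) t(1) t(2)[OF n(1)] t(2)[OF n(2)] E_def using True n by blast
  qed (auto simp: region_rel_def)
  have x: "f i \<noteq> i" "f (i + 1) \<noteq> i + 1" "f (i + 1) \<noteq> i"
   using matchingD(2)[OF m, of i] matchingD(2)[OF m, of "i + 1"] matchingD(1)[OF m, of "i + 1"] i False by auto
  have flip: "E i J \<noteq> E i J'" "E (i + 1) J \<noteq> E (i + 1) J'"
  proof -
   have "f i \<le> i - 1 <-> f i \<le> i + 1" "f (i + 1) \<le> i - 1 <-> f (i + 1) \<le> i + 1" using x False by linarith+
   thus "E i J \<noteq> E i J'" "E (i + 1) J \<noteq> E (i + 1) J'" by (auto simp: E_def encloses_def lJ)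
  qed
  \<comment> \<open>All four combinations of lying inside or outside two arcs would occur, which
    \<open>not_crossing\<close> excludes.\<close>
  have four: False if "E u c1 = E u c2" "E u c3 = E u c4" "E u c1 \<noteq> E u c3" "E v c1 = E v c3" "E v c2 = E v c4" "E v c1 \<noteq> E v c2"
   for u v c1 c2 c3 c4
  proof -
   have "\<exists>x\<in>{c1,c2,c3,c4}. E u x \<and> E v x" "\<exists>x\<in>{c1,c2,c3,c4}. E u x \<and> \<not> E v x" "\<exists>x\<in>{c1,c2,c3,c4}. \<not> E u x \<and> E v x"
    using that by auto
   thus False unfolding E_def using not_crossing[OF nc] by metis
  qed
  \<comment> \<open>If \<open>c\<close> and \<open>d\<close> are separated by both cut arcs and by
    no other arc, they lie in the two regions adjacent to the place of surgery, namely those of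
    \<open>J\<close> and \<open>J'\<close>.\<close>
  have main: "region_rel k f c J \<and> region_rel k f J' d"
   if c: "c \<in> pts k" "d \<in> pts k" "E i c \<noteq> E i d" "E (i + 1) c \<noteq> E (i + 1) d" "E i c = E i J"
    "\<And>u. u \<notin> {i, i + 1, f i, f (i + 1)} ==> E u c = E u d" for c d
  proof -
   have B: "E (i + 1) c = E (i + 1) J"
   proof (rule ccontr)
    assume "E (i + 1) c \<noteq> E (i + 1) J"
    thus False using four[of i c J J' d "i + 1"] c flip by auto
   qed
   have C: "E u c = E u J" if u: "u \<notin> {i, i + 1, f i, f (i + 1)}" for u
   proof (rule ccontr)
    assume "E u c \<noteq> E u J"
    thus False using four[of i c J d J' u] c flip c(6)[OF u] CJ[OF u] by auto
   qed
   show ?thesis unfolding rE using c p B C flip CJ by metis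
  qed
  show ?thesis
  proof
   assume "merge j (j + 1) (region_rel k f) a b"
   moreover have "region_rel k (tl_act i f) a b"
    if ab: "region_rel k f a c" "region_rel k f d b" "{c, d} = {J, J'}" for c d
   proof -
    have c: "E i c = (\<not> E i d)" "E (i + 1) c = (\<not> E (i + 1) d)"
     "\<And>u. u \<notin> {i, i + 1, f i, f (i + 1)} ==> E u c = E u d"
     using ab(3) flip CJ by (auto simp: doubleton_eq_iff)
    have a: "a \<in> pts k" "b \<in> pts k" "E i a = E i c" "E (i + 1) a = E (i + 1) c" "E i d = E i b" "E (i + 1) d = E (i + 1) b"
     "\<And>u. u \<notin> {i, i + 1, f i, f (i + 1)} ==> E u a = E u c" "\<And>u. u \<notin> {i, i + 1, f i, f (i + 1)} ==> E u d = E u b"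
     using ab(1,2) unfolding rE by blast+
    have "E u a = E u b" if "u \<notin> {i, i + 1, f i, f (i + 1)}" for u
     using a(7)[OF that] a(8)[OF that] c(3)[OF that] by simp
    thus ?thesis unfolding gE using a(1-6) c(1,2) by blast
   qed
   moreover have "region_rel k (tl_act i f) a b" if "region_rel k f a b"
    using that unfolding gE rE by blast
   ultimately show "region_rel k (tl_act (2 * int j) f) a b"
    unfolding mg i_def[symmetric] by blast
  next
   assume "region_rel k (tl_act (2 * int j) f) a b"
   hence g: "a \<in> pts k" "b \<in> pts k" "(E i a \<noteq> E (i + 1) a) = (E i b \<noteq> E (i + 1) b)"
    "\<And>u. u \<notin> {i, i + 1, f i, f (i + 1)} ==> E u a = E u b"
    unfolding i_def[symmetric] gE by blast+
   show "merge j (j + 1) (region_rel k f) a b"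
   proof (cases "E i a = E i b")
    case True
    thus ?thesis unfolding mg rE using g by blast
   next
    case ne: False
    hence ne': "E (i + 1) a \<noteq> E (i + 1) b" using g(3) by blast
    show ?thesis
    proof (cases "E i a = E i J")
     case True
     thus ?thesis unfolding mg using main[OF g(1,2) ne ne' True g(4)] by blast
    next
     case False
     hence "E i b = E i J" using ne by blast
     hence "region_rel k f b J \<and> region_rel k f J' a" using main[of b a] g ne ne' by metis
     thus ?thesis unfolding mg using eqv_onD(4)[OF eqv_on_region_rel[of k f]] by blast
    qed
   qed
  qed
 qed
qed

text \<open>An odd position \<open>2 * j - 1\<close> and the next one are the two ends of the point
  \<open>j\<close>, whose gap is closed off by the new cap. The other new arc joins the regions on
  both sides of \<open>j\<close>; a vertex in one of these would be separated from \<open>j\<close>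
  by a single arc, against parity.\<close>

lemma region_rel_odd:
 assumes nc: "noncrossing f" and j: "1 \<le> j" "j \<le> k"
 shows "detach j (region_rel k f) = region_rel k (tl_act (2 * int j - 1) f)"
proof (intro ext)
 fix a b
 define i where "i = 2 * int j - 1"
 define J where "J = int j"
 have m: "matching f" using nc by (simp add: noncrossing_def)
 have i: "1 \<le> i" using j by (simp add: i_def)
 have p: "J \<in> pts k" using j by (auto simp: pts_def J_def)
 have lJ: "c \<in> pts k ==> left_end c = i <-> c = J" for c
  using left_end_odd[OF j(1)] by (auto simp: i_def J_def)
 have lJ': "left_end J = i" using lJ p by blast
 show "detach j (region_rel k f) a b = region_rel k (tl_act (2 * int j - 1) f) a b"
 proof (cases "f i = i + 1")
  case True
  hence "tl_act i f = f" by (simp add: tl_act_def)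
  moreover have "c = J" if "region_rel k f J c" for c
  proof -
   have "encloses f i (left_end J) = encloses f i (left_end c)" using that by (simp add: region_rel_def)
   moreover have "encloses f i q <-> q = i" for q using True by (auto simp: encloses_def)
   ultimately have "left_end c = i" using lJ' by simp
   thus ?thesis using lJ that by (auto simp: region_rel_def)
  qed
  ultimately show ?thesis
   unfolding i_def[symmetric] unfolding detach_def J_def[symmetric] using eqv_onD(4)[OF eqv_on_region_rel[of k f]] by metis
 next
  case False
  note t = region_rel_tl_act[OF nc i False]
  define E where "E u q = encloses f u q" for u q
  have rE: "region_rel k f c d <-> c \<in> pts k \<and> d \<in> pts k \<and> E i (left_end c) = E i (left_end d) \<and>
   E (i + 1) (left_end c) = E (i + 1) (left_end d) \<and>
   (\<forall>u. u \<notin> {i, i + 1, f i, f (i + 1)} \<longrightarrow> E u (left_end c) = E u (left_end d))" for c d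
   unfolding region_rel_def E_def using all_encloses[OF m, of "left_end c" "left_end d" i] by blast
  have four: False if "E u c1 = E u c2" "E u c3 = E u c4" "E u c1 \<noteq> E u c3" "E v c1 = E v c3" "E v c2 = E v c4" "E v c1 \<noteq> E v c2"
   for u v c1 c2 c3 c4
  proof -
   have "\<exists>x\<in>{c1,c2,c3,c4}. E u x \<and> E v x" "\<exists>x\<in>{c1,c2,c3,c4}. E u x \<and> \<not> E v x" "\<exists>x\<in>{c1,c2,c3,c4}. \<not> E u x \<and> E v x"
    using that by auto
   thus False unfolding E_def using not_crossing[OF nc] by metis
  qed
  have x: "f i \<noteq> i" "f (i + 1) \<noteq> i + 1" "f (i + 1) \<noteq> i"
   using matchingD(2)[OF m, of i] matchingD(2)[OF m, of "i + 1"] matchingD(1)[OF m, of "i + 1"] i False by auto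
  have nb: "E i (i - 1) \<noteq> E i i" "E (i + 1) (i - 1) = E (i + 1) i" "E i (i + 1) = E i i" "E (i + 1) (i + 1) \<noteq> E (i + 1) i"
  proof -
   have "f i \<le> i - 1 <-> f i \<le> i" "f (i + 1) \<le> i - 1 <-> f (i + 1) \<le> i"
    "f i \<le> i + 1 <-> f i \<le> i" "f (i + 1) \<le> i + 1 <-> f (i + 1) \<le> i" using x False by linarith+
   thus "E i (i - 1) \<noteq> E i i" "E (i + 1) (i - 1) = E (i + 1) i" "E i (i + 1) = E i i" "E (i + 1) (i + 1) \<noteq> E (i + 1) i"
    by (simp_all add: E_def encloses_def)
  qed
  have Cn: "E u (i - 1) = E u i" "E u (i + 1) = E u i" if "u \<notin> {i, i + 1, f i, f (i + 1)}" for u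
  proof -
   have "u \<noteq> i" "u \<noteq> i + 1" "f u \<noteq> i" "f u \<noteq> i + 1" using that matchingD(1)[OF m, of u] by auto
   hence "u \<le> i - 1 <-> u \<le> i" "f u \<le> i - 1 <-> f u \<le> i" "u \<le> i + 1 <-> u \<le> i" "f u \<le> i + 1 <-> f u \<le> i" by linarith+
   thus "E u (i - 1) = E u i" "E u (i + 1) = E u i" by (simp_all add: E_def encloses_def)
  qed
  \<comment> \<open>Excluding combinations of arcs shows that \<open>c\<close> is separated from
    \<open>J\<close> by the arc at \<open>i\<close> alone, contradicting
    \<open>not_one_separating_arc\<close>.\<close>
  have key: False if c: "c \<in> pts k" "d \<in> pts k" "c \<noteq> J" "E i (left_end c) \<noteq> E i (left_end d)"
   "E (i + 1) (left_end c) \<noteq> E (i + 1) (left_end d)" "E i (left_end c) \<noteq> E i i"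
   "\<And>u. u \<notin> {i, i + 1, f i, f (i + 1)} ==> E u (left_end c) = E u (left_end d)" for c d
  proof -
   have B: "E (i + 1) (left_end c) = E (i + 1) i"
   proof (rule ccontr)
    assume "E (i + 1) (left_end c) \<noteq> E (i + 1) i"
    thus False using four[of i i "i + 1" "i - 1" "left_end c" "i + 1"] c(6) nb by auto
   qed
   have C: "E u (left_end c) = E u i" if u: "u \<notin> {i, i + 1, f i, f (i + 1)}" for u
   proof (rule ccontr)
    assume "E u (left_end c) \<noteq> E u i"
    thus False
     using four[of i "left_end c" "i - 1" "left_end d" i u] c(4,6) c(7)[OF u] Cn(1)[OF u] nb by auto
   qed
   have sep: "encloses f i (left_end c) \<noteq> encloses f i (left_end J)" using c(6) lJ' by (simp add: E_def)
   have oth: "encloses f u (left_end c) = encloses f u (left_end J)" if "u \<noteq> i" "u \<noteq> f i" for u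
    using C[of u] B encloses_sym[OF m, of "i + 1"] that lJ' unfolding E_def by (metis insert_iff singletonD)
   show False
   proof (cases "c < J")
    case True
    thus False using not_one_separating_arc[OF m c(1) p True sep oth] by blast
   next
    case False
    hence "J < c" using c(3) by simp
    thus False using not_one_separating_arc[OF m p c(1) _ sep[symmetric] oth[symmetric]] by blast
   qed
  qed
  show ?thesis
  proof (cases "a \<in> pts k \<and> b \<in> pts k")
   case ab: True
   show ?thesis
   proof (cases "a = J \<or> b = J")
    case True
    have "region_rel k (tl_act i f) a b ==> a = J \<and> b = J"
     unfolding region_rel_def using t(1)[of "left_end a"] t(1)[of "left_end b"] lJ ab True by metis
    moreover have "region_rel k (tl_act i f) J J" "region_rel k f J J" using p by (auto simp: region_rel_def)
    ultimately show ?thesis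
     unfolding i_def[symmetric] unfolding detach_def J_def[symmetric] using True by metis
   next
    case n: False
    hence le: "left_end a \<noteq> i" "left_end b \<noteq> i" using lJ ab by auto
    have gE: "region_rel k (tl_act i f) a b <->
     ((E i (left_end a) \<noteq> E (i + 1) (left_end a)) = (E i (left_end b) \<noteq> E (i + 1) (left_end b))) \<and>
     (\<forall>u. u \<notin> {i, i + 1, f i, f (i + 1)} \<longrightarrow> E u (left_end a) = E u (left_end b))"
     unfolding region_rel_def t(4) t(1) t(2)[OF le(1)] t(2)[OF le(2)] E_def using ab le by blast
    have "region_rel k f a b" if g: "region_rel k (tl_act i f) a b"
    proof -
     note g = g[unfolded gE]
     have "E i (left_end a) = E i (left_end b)"
     proof (rule ccontr)
      assume ne: "E i (left_end a) \<noteq> E i (left_end b)"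
      hence ne': "E (i + 1) (left_end a) \<noteq> E (i + 1) (left_end b)" using g by blast
      have "E i (left_end a) \<noteq> E i i \<or> E i (left_end b) \<noteq> E i i" using ne by blast
      thus False using key[of a b] key[of b a] ab n ne ne' g by metis
     qed
     thus ?thesis unfolding rE using ab g by blast
    qed
    moreover have "region_rel k f a b ==> region_rel k (tl_act i f) a b" unfolding gE rE by blast
    ultimately show ?thesis unfolding i_def[symmetric] unfolding detach_def J_def[symmetric] using n by blast
   qed
  next
   case False
   thus ?thesis by (auto simp: detach_def region_rel_def)
  qed
 qed
qed

text \<open>The cyclic successor of \<open>a\<close> in its class: the next larger element, or the
  least one if \<open>a\<close> is the largest. A singleton is its own successor.\<close>

definition next_in :: "(int => int => bool) => int => int => bool" where
 "next_in r a b <-> r a b \<and>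
   (a < b \<and> (\<forall>c. a < c \<longrightarrow> c < b \<longrightarrow> \<not> r a c) \<or> b \<le> a \<and> (\<forall>c. r a c \<longrightarrow> b \<le> c \<and> c \<le> a))"

lemma finite_pts: "finite (pts k)"
 by (rule finite_subset[of _ "{- int k..int k}"]) (auto simp: pts_def)

lemma next_in_unique:
 assumes r: "eqv_on k r"
 shows "next_in r a b ==> next_in r a b' ==> b = b'" "next_in r a b ==> next_in r a' b ==> a = a'"
proof -
 note rD = eqv_onD[OF r]
 assume n: "next_in r a b"
 show "b = b'" if n': "next_in r a b'"
 proof (rule ccontr)
  assume "b \<noteq> b'"
  have ab: "r a b" "r a b'" using n n' by (auto simp: next_in_def)
  from n show False unfolding next_in_def
  proof (elim conjE disjE)
   assume 1: "a < b" "\<forall>c. a < c \<longrightarrow> c < b \<longrightarrow> \<not> r a c"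
   show False using n' ab 1 \<open>b \<noteq> b'\<close> unfolding next_in_def by (metis linorder_neqE linorder_not_le)
  next
   assume 1: "b \<le> a" "\<forall>c. r a c \<longrightarrow> b \<le> c \<and> c \<le> a"
   show False using n' ab 1 \<open>b \<noteq> b'\<close> unfolding next_in_def by (metis linorder_not_le order_antisym)
  qed
 qed
 show "a = a'" if n': "next_in r a' b"
 proof (rule ccontr)
  assume "a \<noteq> a'"
  have ab: "r a b" "r a' b" using n n' by (auto simp: next_in_def)
  have aa: "r a a'" "r a' a" using rD(5)[OF ab(1) rD(4)[OF ab(2)]] rD(4) by blast+
  have bb: "r a a" "r a' a'" using rD(1,3) ab by blast+
  have *: False if "next_in r a b" "next_in r a' b" "a < a'" "r a a'" "r a b" "r a' b" "r a' a" for a a'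
   using that unfolding next_in_def by (metis linorder_not_le order_less_le_trans order_antisym)
  show False using *[of a a'] *[of a' a] n n' ab aa \<open>a \<noteq> a'\<close> by (metis linorder_neqE)
 qed
qed

lemma next_in_exists:
 assumes r: "eqv_on k r" and a: "a \<in> pts k"
 shows "\<exists>b. next_in r a b" "\<exists>b. next_in r b a"
proof -
 note rD = eqv_onD[OF r]
 have fin: "finite {c. r a c \<and> P c}" for P by (rule finite_subset[OF _ finite_pts[of k]]) (use rD(2) in auto)
 have fin0: "finite {c. r a c}" using fin[of "\<lambda>_. True"] by simp
 have aa: "r a a" using rD(3)[OF a] .
 show "\<exists>b. next_in r a b"
 proof (cases "\<exists>c. r a c \<and> a < c")
  case True
  define b where "b = Min {c. r a c \<and> a < c}"
  have "b \<in> {c. r a c \<and> a < c}" unfolding b_def using fin True by (intro Min_in) auto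
  moreover have "b \<le> c" if "r a c" "a < c" for c unfolding b_def using fin that by (intro Min_le) auto
  ultimately have "next_in r a b" unfolding next_in_def by force
  thus ?thesis ..
 next
  case False
  define b where "b = Min {c. r a c}"
  have "b \<in> {c. r a c}" unfolding b_def using fin0 aa by (intro Min_in) auto
  moreover have "b \<le> c" if "r a c" for c unfolding b_def using fin0 that by (intro Min_le) auto
  ultimately have "next_in r a b" unfolding next_in_def using False aa by force
  thus ?thesis ..
 qed
 show "\<exists>b. next_in r b a"
 proof (cases "\<exists>c. r a c \<and> c < a")
  case True
  define b where "b = Max {c. r a c \<and> c < a}"
  have b: "b \<in> {c. r a c \<and> c < a}" unfolding b_def using fin True by (intro Max_in) auto
  have m: "c \<le> b" if "r a c" "c < a" for c unfolding b_def using fin that by (intro Max_ge) auto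
  have "r b a" using b rD(4) by blast
  moreover have "\<not> r b c" if "b < c" "c < a" for c using m[of c] rD(5)[of a b c] b that by auto
  ultimately have "next_in r b a" unfolding next_in_def using b by blast
  thus ?thesis ..
 next
  case False
  define b where "b = Max {c. r a c}"
  have b: "b \<in> {c. r a c}" unfolding b_def using fin0 aa by (intro Max_in) auto
  have m: "c \<le> b" if "r a c" for c unfolding b_def using fin0 that by (intro Max_ge) auto
  have "r b a" using b rD(4) by blast
  moreover have "a \<le> c \<and> c \<le> b" if "r b c" for c
   using m[of c] rD(5)[of a b c] b that False by (metis linorder_not_le mem_Collect_eq)
  moreover have "a \<le> b" using m[OF aa] .
  ultimately have "next_in r b a" unfolding next_in_def by blast
  thus ?thesis ..
 qed
qed

lemma ends_cases:
 assumes "q \<noteq> 0" "\<bar>q\<bar> \<le> 2 * int k"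
 obtains a where "a \<in> pts k" "q = left_end a" | a where "a \<in> pts k" "q = right_end a"
proof -
 define a where "a = (if q > 0 then (q + 1) div 2 else q div 2)"
 have "a \<in> pts k" using assms by (auto simp: a_def pts_def)
 moreover have "q = left_end a \<or> q = right_end a"
  using assms by (cases "even q") (auto simp: a_def left_end_def right_end_def elim!: evenE oddE)
 ultimately show ?thesis using that by blast
qed

lemma ends_bound: "a \<in> pts k ==> \<bar>left_end a\<bar> \<le> 2 * int k" "a \<in> pts k ==> \<bar>right_end a\<bar> \<le> 2 * int k"
 "a \<in> pts k ==> left_end a \<noteq> 0" "a \<in> pts k ==> right_end a \<noteq> 0"
 by (auto simp: left_end_def right_end_def pts_def)

lemma right_end_mono: "a \<noteq> 0 ==> b \<noteq> 0 ==> right_end a < right_end b <-> a < b"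
 "a \<noteq> 0 ==> b \<noteq> 0 ==> left_end a < right_end b <-> a \<le> b"
 "a \<noteq> 0 ==> b \<noteq> 0 ==> right_end a = right_end b <-> a = b"
 "a \<noteq> 0 ==> b \<noteq> 0 ==> right_end a < left_end b <-> a < b"
 by (auto simp: left_end_def right_end_def)

text \<open>The arc starting at the right end of a point leads to the left end of a point: the interval
 enclosed by an arc contains an even number of points.\<close>

lemma right_to_left:
 assumes nc: "noncrossing f" and t: "trivial_above (2 * int k) f" and a: "a \<in> pts k"
 shows "\<exists>b\<in>pts k. f (right_end a) = left_end b"
proof (rule ccontr)
 assume n: "\<not> ?thesis"
 have m: "matching f" using nc by (simp add: noncrossing_def)
 have "\<bar>f (right_end a)\<bar> \<le> 2 * int k" "f (right_end a) \<noteq> 0"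
  using trivial_above_bound[OF m t] ends_bound(2,4)[OF a] matchingD(6)[OF m] by auto
 then obtain b where b: "b \<in> pts k" "f (right_end a) = right_end b"
  using n by (metis ends_cases)
 have *: False if ab: "a \<in> pts k" "b \<in> pts k" "a < b" "f (right_end a) = right_end b" for a b
 proof -
  let ?S = "{right_end a<..<right_end b} - {0}"
  have z: "a \<noteq> 0" "b \<noteq> 0" using ab(1,2) by auto
  have fb: "f (right_end b) = right_end a" using ab(4) matchingD(1)[OF m] by metis
  have lt: "right_end a < right_end b" using right_end_mono(1)[OF z] ab(3) by simp
  have "even (card ?S)"
  proof (rule even_card_involution)
   fix x assume x: "x \<in> ?S"
   hence "between (right_end a) (f (right_end a)) x" using ab(4) by (auto simp: between_def)
   hence "between (right_end a) (f (right_end a)) (f x)" using nc unfolding noncrossing_def by blast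
   moreover have "f x \<noteq> 0" "f x \<noteq> x" using x matchingD(2,6)[OF m, of x] by auto
   ultimately show "f x \<in> ?S \<and> f x \<noteq> x \<and> f (f x) = x"
    using matchingD(1)[OF m] ab(4) lt by (auto simp: between_def)
  qed simp
  moreover have "?S = {left_end a + 1<..left_end b} - {0}" by (auto simp: right_end_def)
  ultimately have "even (card ({left_end a + 1<..left_end b} - {0}))" by simp
  moreover have "{left_end a<..left_end b} - {0} = insert (left_end a + 1) ({left_end a + 1<..left_end b} - {0})"
   using left_end_mono(3)[OF z] ab(3) ends_bound(4)[OF ab(1)] by (auto simp: right_end_def)
  ultimately have "odd (card ({left_end a<..left_end b} - {0}))" by simp
  thus False using card_ends[OF ab(1-3)] by simp
 qed
 have "a \<noteq> b" using b(2) matchingD(2)[OF m, of "right_end a"] ends_bound(4)[OF a] by auto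
 moreover have "f (right_end b) = right_end a" using b(2) matchingD(1)[OF m] by metis
 ultimately show False using *[of a b] *[of b a] a b by (metis linorder_neqE)
qed

text \<open>No other arc separates the two ends of the arc from \<open>right_end a\<close> to
  \<open>left_end b\<close>, so following it leads from \<open>a\<close> to \<open>b\<close> inside
  one region. The remaining vertices of the region all lie on one side of this arc, which makes
  \<open>b\<close> the cyclic successor.\<close>

lemma next_in_region_rel:
 assumes nc: "noncrossing f" and t: "trivial_above (2 * int k) f" and a: "a \<in> pts k" "b \<in> pts k"
  and fa: "f (right_end a) = left_end b"
 shows "next_in (region_rel k f) a b"
proof -
 have m: "matching f" using nc by (simp add: noncrossing_def)
 have z: "a \<noteq> 0" "b \<noteq> 0" using a by auto
 have fb: "f (left_end b) = right_end a" using fa matchingD(1)[OF m] by metis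
 have o: "u \<notin> {right_end a, left_end b} ==> between (right_end a) (left_end b) (f u) <-> between (right_end a) (left_end b) u" for u
  using between_f_iff[OF nc, of u "right_end a"] fa by simp
 have ne: "f u \<notin> {right_end a, left_end b}" if "u \<notin> {right_end a, left_end b}" for u
  using that fa fb matchingD(1)[OF m, of u] by auto
 have enc: "encloses f u (left_end c) <-> (right_end a \<le> left_end c) \<noteq> (left_end b \<le> left_end c)"
  if "u \<in> {right_end a, left_end b}" for u c using that fa fb by (auto simp: encloses_def)
 show ?thesis
 proof (cases "a < b")
  case True
  hence l: "right_end a < left_end b" using right_end_mono(4)[OF z] by simp
  have "encloses f u (left_end a) = encloses f u (left_end b)" for u
  proof (cases "u \<in> {right_end a, left_end b}")
   case True
   thus ?thesis unfolding enc[OF True] using left_end_mono(1,3)[OF z] left_end_mono(3)[OF z(1) z(1)] \<open>a < b\<close> l by auto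
  next
   case False
   have bt: "between (right_end a) (left_end b) q <-> left_end a < q \<and> q \<le> left_end b" if "q \<notin> {right_end a, left_end b}" for q
    using that l by (auto simp: between_def right_end_def)
   show ?thesis using o[OF False] bt[OF False] bt[OF ne[OF False]] l unfolding encloses_def right_end_def by auto
  qed
  hence "region_rel k f a b" using a by (simp add: region_rel_def)
  moreover have "\<not> region_rel k f a c" if "a < c" "c < b" for c
  proof
   assume r: "region_rel k f a c"
   hence "c \<noteq> 0" by (auto simp: region_rel_def)
   have "encloses f (right_end a) (left_end a) = encloses f (right_end a) (left_end c)" using r by (simp add: region_rel_def)
   thus False unfolding enc[of "right_end a", simplified]
    using left_end_mono(3)[OF z(1) z(1)] left_end_mono(2)[OF z(2) z(1)] left_end_mono(3)[OF z(1) \<open>c \<noteq> 0\<close>]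
     left_end_mono(2)[OF z(2) \<open>c \<noteq> 0\<close>] that True by auto
  qed
  ultimately show ?thesis using True by (auto simp: next_in_def)
 next
  case False
  hence l: "left_end b < right_end a" using right_end_mono(2)[of b a] z by simp
  have "encloses f u (left_end a) = encloses f u (left_end b)" for u
  proof (cases "u \<in> {right_end a, left_end b}")
   case True
   thus ?thesis unfolding enc[OF True]
    using left_end_mono(2)[OF z(2) z(1)] left_end_mono(3)[OF z(1) z(1)] left_end_mono(3)[OF z] False by auto
  next
   case n: False
   have bt: "between (right_end a) (left_end b) q <-> left_end b < q \<and> q \<le> left_end a" if "q \<notin> {right_end a, left_end b}" for q
    using that l by (auto simp: between_def right_end_def)
   show ?thesis using o[OF n] bt[OF n] bt[OF ne[OF n]] l unfolding encloses_def right_end_def by auto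
  qed
  hence r: "region_rel k f a b" using a by (simp add: region_rel_def)
  have "b \<le> c \<and> c \<le> a" if "region_rel k f a c" for c
  proof -
   have "c \<noteq> 0" using that by (auto simp: region_rel_def)
   have "encloses f (right_end a) (left_end a) = encloses f (right_end a) (left_end c)" using that by (simp add: region_rel_def)
   thus ?thesis unfolding enc[of "right_end a", simplified]
    using left_end_mono(3)[OF z(1) z(1)] left_end_mono(2)[OF z(2) z(1)] left_end_mono(3)[OF z(1) \<open>c \<noteq> 0\<close>]
     left_end_mono(2)[OF z(2) \<open>c \<noteq> 0\<close>] False by auto
  qed
  thus ?thesis using r False by (auto simp: next_in_def)
 qed
qed

text \<open>Right ends are joined to left ends of cyclic successors, and the successor depends only
  on the partition.\<close>

lemma region_rel_inject:
 assumes f: "noncrossing f" "trivial_above (2 * int k) f" and g: "noncrossing g" "trivial_above (2 * int k) g"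
  and e: "region_rel k f = region_rel k g"
 shows "f = g"
proof -
 have m: "matching f" "matching g" using f g by (simp_all add: noncrossing_def)
 have R: "f (right_end a) = g (right_end a)" if a: "a \<in> pts k" for a
 proof -
  obtain b b' where b: "b \<in> pts k" "f (right_end a) = left_end b" "b' \<in> pts k" "g (right_end a) = left_end b'"
   using right_to_left[OF f a] right_to_left[OF g a] by blast
  have "b = b'"
   using next_in_unique(1)[OF eqv_on_region_rel] next_in_region_rel[OF f a b(1,2)] next_in_region_rel[OF g a b(3,4)] e by metis
  thus ?thesis using b by simp
 qed
 have L: "\<exists>a\<in>pts k. f (right_end a) = left_end b" if b: "b \<in> pts k" for b
 proof -
  obtain a where a: "next_in (region_rel k f) a b" using next_in_exists(2)[OF eqv_on_region_rel b] by blast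
  hence ap: "a \<in> pts k" by (auto simp: next_in_def region_rel_def)
  obtain b' where b': "b' \<in> pts k" "f (right_end a) = left_end b'" using right_to_left[OF f ap] by blast
  hence "b' = b" using next_in_unique(1)[OF eqv_on_region_rel _ a] next_in_region_rel[OF f ap b'] by blast
  thus ?thesis using ap b' by blast
 qed
 have "f q = g q" for q
 proof (cases "q = 0 \<or> \<bar>q\<bar> > 2 * int k")
  case True
  thus ?thesis using f(2) g(2) matchingD(5)[OF m(1)] matchingD(5)[OF m(2)] by (auto simp: trivial_above_def)
 next
  case False
  hence "q \<noteq> 0" "\<bar>q\<bar> \<le> 2 * int k" by auto
  thus ?thesis
  proof (cases rule: ends_cases)
   case (1 b)
   then obtain a where "a \<in> pts k" "f (right_end a) = q" using L by blast
   thus ?thesis using R[of a] matchingD(1)[OF m(1), of "right_end a"] matchingD(1)[OF m(2), of "right_end a"] by metis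
  next
   case (2 a)
   thus ?thesis using R by simp
  qed
 qed
 thus ?thesis by blast
qed

text \<open>The matching is the contour of the partition: walking around a block, one passes from
  the right end of each vertex to the left end of its cyclic successor.\<close>

lemma region_rel_surj:
 assumes r: "eqv_on k r" and nc: "nc_rel r"
 shows "\<exists>f. noncrossing f \<and> trivial_above (2 * int k) f \<and> region_rel k f = r"
proof -
 note rD = eqv_onD[OF r]
 have nz: "a \<noteq> 0" if "a \<in> pts k" for a using that by auto
 have np: "a \<in> pts k" "b \<in> pts k" "r a b" if "next_in r a b" for a b using that rD(1,2) by (auto simp: next_in_def)
 \<comment> \<open>A relation instead of a function by cases; that it is functional and symmetric
   follows from uniqueness and existence of cyclic successors. Beyond the doubled vertices the
   matching is vertical, and 0 is fixed.\<close>
 define P where "P q q' <-> (\<exists>a b. next_in r a b \<and> (q = right_end a \<and> q' = left_end b \<or> q = left_end b \<and> q' = right_end a))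
   \<or> (q = 0 \<or> \<bar>q\<bar> > 2 * int k) \<and> q' = - q" for q q'
 have range: "q \<noteq> 0 \<and> \<bar>q\<bar> \<le> 2 * int k" if "a \<in> pts k" "q = left_end a \<or> q = right_end a" for a q
  using that ends_bound[OF that(1)] by auto
 have ex: "\<exists>q'. P q q'" for q
 proof (cases "q = 0 \<or> \<bar>q\<bar> > 2 * int k")
  case False
  hence "q \<noteq> 0" "\<bar>q\<bar> \<le> 2 * int k" by auto
  thus ?thesis
  proof (cases rule: ends_cases)
   case (1 b)
   thus ?thesis using next_in_exists(2)[OF r, of b] unfolding P_def by blast
  next
   case (2 a)
   thus ?thesis using next_in_exists(1)[OF r, of a] unfolding P_def by blast
  qed
 qed (auto simp: P_def)
 have LR: "left_end a \<noteq> right_end b" if "a \<in> pts k" "b \<in> pts k" for a b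
  using left_end_mono(5)[OF nz[OF that(2)] nz[OF that(1)]] by simp
 have LL: "left_end a = left_end b <-> a = b" "right_end a = right_end b <-> a = b" if "a \<in> pts k" "b \<in> pts k" for a b
  using left_end_mono(4)[OF nz[OF that(1)] nz[OF that(2)]] right_end_mono(3)[OF nz[OF that(1)] nz[OF that(2)]] .
 have uniq: "q' = q''" if P: "P q q'" "P q q''" for q q' q''
 proof (cases "q = 0 \<or> \<bar>q\<bar> > 2 * int k")
  case True
  hence "\<not> (q = left_end a \<or> q = right_end a)" if "a \<in> pts k" for a using range[OF that, of q] by auto
  thus ?thesis using P np(1,2) unfolding P_def by metis
 next
  case False
  hence "\<exists>a b. next_in r a b \<and> (q = right_end a \<and> q' = left_end b \<or> q = left_end b \<and> q' = right_end a)"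
   "\<exists>a b. next_in r a b \<and> (q = right_end a \<and> q'' = left_end b \<or> q = left_end b \<and> q'' = right_end a)"
   using P unfolding P_def by blast+
  then obtain a b a' b' where n: "next_in r a b" "q = right_end a \<and> q' = left_end b \<or> q = left_end b \<and> q' = right_end a"
   "next_in r a' b'" "q = right_end a' \<and> q'' = left_end b' \<or> q = left_end b' \<and> q'' = right_end a'" by blast
  note p = np(1,2)[OF n(1)] np(1,2)[OF n(3)]
  from n(2,4) show ?thesis
  proof (elim disjE conjE)
   assume "q = right_end a" "q' = left_end b" "q = right_end a'" "q'' = left_end b'"
   moreover have "a = a'" using calculation LL(2)[OF p(1,3)] by simp
   ultimately show ?thesis using next_in_unique(1)[OF r n(1)] n(3) by blast
  next
   assume "q = left_end b" "q' = right_end a" "q = left_end b'" "q'' = right_end a'"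
   moreover have "b = b'" using calculation LL(1)[OF p(2,4)] by simp
   ultimately show ?thesis using next_in_unique(2)[OF r n(1)] n(3) by blast
  next
   assume "q = right_end a" "q = left_end b'"
   thus ?thesis using LR[OF p(4,1)] by simp
  next
   assume "q = left_end b" "q = right_end a'"
   thus ?thesis using LR[OF p(2,3)] by simp
  qed
 qed
 have symP: "P q' q" if "P q q'" for q q' using that unfolding P_def by auto
 define f where "f q = (SOME q'. P q q')" for q
 have Pf: "P q (f q)" for q unfolding f_def using someI_ex[OF ex] .
 have fP: "P q q' <-> f q = q'" for q q' using uniq Pf by blast
 have ff: "f (f q) = q" for q using symP[OF Pf[of q]] fP by blast
 have fix0: "f q = q <-> q = 0" for q
 proof
  assume "f q = q"
  hence "P q q" using fP by blast
  thus "q = 0" unfolding P_def using LR np(1,2) by (metis neg_equal_zero)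
 qed (use fP[of 0 0] in \<open>simp add: P_def\<close>)
 have m: "matching f" using ff fix0 by (simp add: matching_def)
 have tr: "trivial_above (2 * int k) f" unfolding trivial_above_def using fP unfolding P_def by blast
 have fr: "f (right_end a) = left_end b" "f (left_end b) = right_end a" if "next_in r a b" for a b
  using that fP unfolding P_def by blast+
 have fq: "\<exists>e\<in>pts k. r c e \<and> (f q = left_end e \<or> f q = right_end e)" if c: "c \<in> pts k" "q = left_end c \<or> q = right_end c" for c q
 proof -
  obtain a b where "next_in r c a" "next_in r b c" using next_in_exists[OF r c(1)] by blast
  thus ?thesis using c fr np rD(4) by metis
 qed
 have cls1: "a < e \<and> e < b" if n: "next_in r a b" "a < b" and c: "a < c" "c < b" "r c e" for a b c e
 proof -
  have ac: "\<not> r a c" using n c(1,2) by (auto simp: next_in_def)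
  have rab: "r a b" using np(3)[OF n(1)] .
  have "e \<noteq> a" "e \<noteq> b" using ac c(3) rD(4,5) rab by blast+
  moreover have "\<not> e < a"
  proof
   assume "e < a"
   hence "r e a" using nc rD(4)[OF c(3)] rab c(1,2) unfolding nc_rel_def by blast
   thus False using ac rD(4,5) c(3) by blast
  qed
  moreover have "\<not> b < e"
  proof
   assume "b < e"
   hence "r a c" using nc c rab unfolding nc_rel_def by blast
   thus False using ac by blast
  qed
  ultimately show ?thesis by linarith
 qed
 \<comment> \<open>The same for the closing arc, from the largest point \<open>a\<close> of a class
   back to its least point \<open>b\<close>.\<close>
 have cls2: "b \<le> e \<and> e \<le> a" if n: "next_in r a b" "b \<le> a" and c: "b \<le> c" "c \<le> a" "r c e" for a b c e
 proof -
  have in_cls: "r a d ==> b \<le> d \<and> d \<le> a" for d using n by (auto simp: next_in_def)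
  have rab: "r a b" using np(3)[OF n(1)] .
  show ?thesis
  proof (cases "r a c")
   case True
   thus ?thesis using in_cls rD(5)[OF True c(3)] by blast
  next
   case False
   hence ne: "c \<noteq> a" "c \<noteq> b" using rab np(1)[OF n(1)] rD(3) by blast+
   have "\<not> e < b"
   proof
    assume "e < b"
    hence "r e b" using nc rD(4)[OF c(3)] rD(4)[OF rab] ne c(1,2) unfolding nc_rel_def by (metis order_less_le)
    thus False using False rD(4,5) c(3) rab by blast
   qed
   moreover have "\<not> a < e"
   proof
    assume "a < e"
    hence "r b c" using nc c ne rD(4)[OF rab] unfolding nc_rel_def by (metis order_less_le)
    thus False using False rD(5) rab by blast
   qed
   ultimately show ?thesis by linarith
  qed
 qed
 have btw: "between (right_end a) (left_end b) (f q)" if n: "next_in r a b" and q: "between (right_end a) (left_end b) q" for a b q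
 proof (cases "q = 0 \<or> \<bar>q\<bar> > 2 * int k")
  case True
  have "\<bar>right_end a\<bar> \<le> 2 * int k" "\<bar>left_end b\<bar> \<le> 2 * int k" using ends_bound np[OF n] by blast+
  hence "q = 0" using True q by (auto simp: between_def)
  thus ?thesis using fix0[of 0] q by simp
 next
  case False
  hence q0: "q \<noteq> 0" "\<bar>q\<bar> \<le> 2 * int k" by auto
  obtain c where c: "c \<in> pts k" "q = left_end c \<or> q = right_end c" using q0 by (rule ends_cases) blast+
  obtain e where e: "e \<in> pts k" "r c e" "f q = left_end e \<or> f q = right_end e" using fq[OF c] by blast
  have z: "a \<noteq> 0" "b \<noteq> 0" "c \<noteq> 0" "e \<noteq> 0" using np(1,2)[OF n] c(1) e(1) by auto
  have nq: "f q \<noteq> right_end a" "f q \<noteq> left_end b"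
   using q fr[OF n] ff[of q] by (auto simp: between_def)
  note lin = left_end_def right_end_def
  show ?thesis
  proof (cases "a < b")
   case True
   hence l: "right_end a < left_end b" using right_end_mono(4)[OF z(1,2)] by simp
   hence "right_end a < q" "q < left_end b" using q by (auto simp: between_def)
   hence "a < c" "c < b"
    using c(2) right_end_mono(1,4)[OF z(1) z(3)] left_end_mono(1)[OF z(3) z(2)] left_end_mono(3)[OF z(3) z(2)] by auto
   hence "a < e" "e < b" using cls1[OF n True _ _ e(2)] by auto
   thus ?thesis
    using e(3) right_end_mono(1,4)[OF z(1) z(4)] left_end_mono(1)[OF z(4) z(2)] right_end_mono(4)[OF z(4) z(2)]
    by (auto simp: between_def)
  next
   case False
   hence l: "left_end b < right_end a" using right_end_mono(2)[OF z(2) z(1)] by simp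
   hence "left_end b < q" "q < right_end a" using q by (auto simp: between_def)
   hence "b \<le> c" "c \<le> a"
    using c(2) right_end_mono(1)[OF z(3) z(1)] right_end_mono(2)[OF z(3) z(1)] left_end_mono(1)[OF z(2) z(3)] right_end_mono(2)[OF z(2) z(3)]
    by auto
   hence "b \<le> e" "e \<le> a" using cls2[OF n _ _ _ e(2)] False by auto
   hence "left_end b \<le> f q" "f q \<le> right_end a"
    using e(3) left_end_mono(2)[OF z(2) z(4)] right_end_mono(2)[OF z(2) z(4)] right_end_mono(2)[OF z(4) z(1)] right_end_mono(1,3)[OF z(4) z(1)]
    by auto
   thus ?thesis using nq by (auto simp: between_def)
  qed
 qed
 have ncf: "noncrossing f"
  unfolding noncrossing_def
 proof (intro conjI allI impI m)
  fix u q assume q: "between u (f u) q"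
  from Pf[of u] show "between u (f u) (f q)" unfolding P_def
  proof (elim disjE exE conjE)
   fix a b assume "next_in r a b" "u = right_end a" "f u = left_end b"
   thus ?thesis using btw q by metis
  next
   fix a b assume "next_in r a b" "u = left_end b" "f u = right_end a"
   thus ?thesis using btw q between_commute by metis
  next
   assume "f u = - u" "u = 0"
   thus ?thesis using q by (simp add: between_def)
  next
   assume u: "f u = - u" "2 * int k < \<bar>u\<bar>"
   hence "\<bar>q\<bar> < \<bar>u\<bar>" using q by (auto simp: between_def)
   moreover have "\<bar>f q\<bar> \<le> 2 * int k \<or> f q = - q"
    using trivial_above_bound[OF m tr, of q] tr by (cases "\<bar>q\<bar> \<le> 2 * int k") (auto simp: trivial_above_def)
   ultimately have "\<bar>f q\<bar> < \<bar>u\<bar>" using u by auto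
   thus ?thesis using u by (auto simp: between_def)
  qed
 qed
 have enc: "encloses f u (left_end d) <-> (a < d) \<noteq> (b \<le> d)"
  if "next_in r a b" "u = right_end a \<or> u = left_end b" "d \<in> pts k" for a b u d
 proof -
  have "encloses f u (left_end d) <-> (right_end a \<le> left_end d) \<noteq> (left_end b \<le> left_end d)"
   using that(2) fr[OF that(1)] by (auto simp: encloses_def)
  thus ?thesis using left_end_mono(3)[of a d] left_end_mono(2)[of b d] np[OF that(1)] that(3) nz by metis
 qed
 have "region_rel k f a b <-> r a b" for a b
 proof
  assume ab: "r a b"
  have p: "a \<in> pts k" "b \<in> pts k" using rD(1,2)[OF ab] .
  have "encloses f u (left_end a) = encloses f u (left_end b)" for u
  proof -
   have far: "encloses f u (left_end d) = encloses f u (left_end d')" if "f u = - u" "u = 0 \<or> \<bar>u\<bar> > 2 * int k" "d \<in> pts k" "d' \<in> pts k" for d d'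
    using that ends_bound(1)[OF that(3)] ends_bound(1)[OF that(4)] by (auto simp: encloses_def)
   have near: "(c < a) \<noteq> (e \<le> a) <-> (c < b) \<noteq> (e \<le> b)" if n: "next_in r c e" for c e
   proof (cases "c < e")
    case True
    have "c < a \<and> a < e <-> c < b \<and> b < e"
     using cls1[OF n True] ab rD(4)[OF ab] by blast
    thus ?thesis using True by auto
   next
    case False
    hence "e \<le> a \<and> a \<le> c <-> e \<le> b \<and> b \<le> c"
     using cls2[OF n] ab rD(4)[OF ab] by (metis linorder_not_less)
    thus ?thesis using False by auto
   qed
   from Pf[of u] show ?thesis unfolding P_def
   proof (elim disjE exE conjE)
    fix c e assume n: "next_in r c e" "u = right_end c" "f u = left_end e"
    thus ?thesis using enc[OF n(1) _ p(1), of u] enc[OF n(1) _ p(2), of u] near[OF n(1)] by blast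
   next
    fix c e assume n: "next_in r c e" "u = left_end e" "f u = right_end c"
    thus ?thesis using enc[OF n(1) _ p(1), of u] enc[OF n(1) _ p(2), of u] near[OF n(1)] by blast
   qed (use far p in blast)+
  qed
  thus "region_rel k f a b" using p by (simp add: region_rel_def)
 next
  \<comment> \<open>Let \<open>c\<close> be the last point before \<open>b\<close> in the class of
    \<open>a\<close>. The arc leaving \<open>c\<close> at its right end separates \<open>a\<close>
    from \<open>b\<close>.\<close>
  have *: False if ab: "region_rel k f a b" "\<not> r a b" "a < b" for a b
  proof -
   have p: "a \<in> pts k" "b \<in> pts k" using ab(1) by (auto simp: region_rel_def)
   define c where "c = Max {c. r a c \<and> c < b}"
   have fin: "finite {c. r a c \<and> c < b}" by (rule finite_subset[OF _ finite_pts[of k]]) (use rD(2) in auto)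
   have "c \<in> {c. r a c \<and> c < b}" unfolding c_def using fin ab(3) rD(3)[OF p(1)] by (intro Max_in) auto
   hence c: "r a c" "c < b" by auto
   have cm: "d \<le> c" if "r a d" "d < b" for d unfolding c_def using fin that by (intro Max_ge) auto
   have ac: "a \<le> c" using cm rD(3)[OF p(1)] ab(3) by blast
   obtain e where e: "next_in r c e" using next_in_exists(1)[OF r rD(2)[OF c(1)]] by blast
   have ae: "r a e" using rD(5)[OF c(1) np(3)[OF e]] .
   have "encloses f (right_end c) (left_end a) = encloses f (right_end c) (left_end b)" using ab(1) by (simp add: region_rel_def)
   hence q: "(c < a) \<noteq> (e \<le> a) <-> (c < b) \<noteq> (e \<le> b)"
    using enc[OF e _ p(1), of "right_end c"] enc[OF e _ p(2), of "right_end c"] by blast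
   show False
   proof (cases "c < e")
    case True
    hence "\<not> e < b" using cm[OF ae] by auto
    moreover have "e \<noteq> b" using ae ab(2) by blast
    ultimately show False using q ac c(2) True by auto
   next
    case False
    hence "e \<le> a" using e rD(4)[OF c(1)] by (auto simp: next_in_def)
    thus False using q ac c(2) ab(3) by auto
   qed
  qed
  assume "region_rel k f a b"
  moreover from this have "region_rel k f b a" "a \<in> pts k" by (auto simp: region_rel_def)
  ultimately show "r a b" using *[of a b] *[of b a] rD(3,4) by (metis linorder_neqE)
 qed
 hence "region_rel k f = r" by blast
 thus ?thesis using ncf tr by blast
qed

section \<open>Presentations from completeness in a representation\<close>

lemma act_word_cong:
 assumes X: "X \<subseteq> Collect (valid_gen k)" and Y: "f ` Y = X" and R: "R \<subseteq> lists Y \<times> lists Y"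
  and sound: "\<And>u v. (u, v) \<in> R ==> act_word k (map f u) = act_word k (map f v)"
  and uv: "(u, v) \<in> word_cong Y R"
 shows "act_word k (map f u) = act_word k (map f v)"
proof -
 have l: "map f w \<in> lists (Collect (valid_gen k))" if "w \<in> lists Y" for w
  using that X Y by (auto simp: image_subset_iff)
 show ?thesis using uv
 proof (induction rule: word_cong.induct)
  case (ctxt u v a b)
  hence "u \<in> lists Y" "v \<in> lists Y" using word_cong_lists[OF R] by auto
  hence "map f u \<in> lists (Collect (valid_gen k))" "map f v \<in> lists (Collect (valid_gen k))"
   "map f a \<in> lists (Collect (valid_gen k))" "map f b \<in> lists (Collect (valid_gen k))"
   using l ctxt by blast+
  moreover have "map f u @ map f b \<in> lists (Collect (valid_gen k))" "map f v @ map f b \<in> lists (Collect (valid_gen k))"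
   using calculation by auto
  ultimately show ?case using ctxt.IH by (simp only: map_append act_word_append)
 qed (auto simp: sound)
qed

text \<open>The premise \<open>complete\<close> may assume a monoid \<open>h\<close> in which the
  relations hold and in which equal values imply equal diagrams. The Cayley representation has both
  properties, the second one because the relations are sound.\<close>

lemma presented_diagramsI:
 fixes f :: "'y => generator"
 assumes X: "X \<subseteq> Collect (valid_gen k)" and D: "D = diag k ` act_word k ` lists X"
  and Y: "f ` Y = X" and R: "R \<subseteq> lists Y \<times> lists Y"
  and sound: "\<And>u v. (u, v) \<in> R ==> act_word k (map f u) = act_word k (map f v)"
  and complete: "\<And>(h :: 'y => 'y list set endo) u v. (\<And>u v. (u, v) \<in> R ==> word_prod h u = word_prod h v) ==>
   (\<And>u v. u \<in> lists Y ==> v \<in> lists Y ==> word_prod h u = word_prod h v ==>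
    act_word k (map f u) = act_word k (map f v)) ==>
   u \<in> lists Y ==> v \<in> lists Y ==> act_word k (map f u) = act_word k (map f v) ==>
   word_prod h u = word_prod h v"
 shows "\<exists>\<phi> \<in> iso (presented_monoid Y R) (diagram_monoid k D).
  \<forall>y\<in>Y. \<phi> (word_cong Y R `` {[y]}) = gen_diagram k (f y)"
proof (rule presented_diagrams[OF X D Y R sound])
 obtain h :: "'y => 'y list set endo" where h: "\<And>u v. u \<in> lists Y ==> v \<in> lists Y ==>
    word_prod h u = word_prod h v <-> (u, v) \<in> word_cong Y R"
  by (rule faithful_representation[OF R]) blast
 fix u v assume uv: "u \<in> lists Y" "v \<in> lists Y" "act_word k (map f u) = act_word k (map f v)"
 have "word_prod h u = word_prod h v"
 proof (rule complete[OF _ _ uv])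
  show "word_prod h u = word_prod h v" if "(u, v) \<in> R" for u v
  proof -
   have "u \<in> lists Y" "v \<in> lists Y" using that R by auto
   thus ?thesis using h word_cong.rel[OF that] by blast
  qed
  show "act_word k (map f u) = act_word k (map f v)"
   if "u \<in> lists Y" "v \<in> lists Y" "word_prod h u = word_prod h v" for u v
   using act_word_cong[OF X Y R sound] h that by blast
 qed
 thus "(u, v) \<in> word_cong Y R" using h uv(1,2) by blast
qed

lemma monoid_presented_byI:
 assumes X: "X \<subseteq> Collect (valid_gen k)" and D: "D = diag k ` act_word k ` lists X"
  and R: "R \<subseteq> lists X \<times> lists X"
  and sound: "\<And>u v. (u, v) \<in> R ==> act_word k u = act_word k v"
  and complete: "\<And>(h :: generator => generator list set endo) u v.
   (\<And>u v. (u, v) \<in> R ==> word_prod h u = word_prod h v) ==>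
   (\<And>u v. u \<in> lists X ==> v \<in> lists X ==> word_prod h u = word_prod h v ==>
    act_word k u = act_word k v) ==>
   u \<in> lists X ==> v \<in> lists X ==> act_word k u = act_word k v ==>
   word_prod h u = word_prod h v"
 shows "monoid_presented_by (diagram_monoid k D) X R (gen_diagram k)"
proof -
 have "\<exists>\<phi> \<in> iso (presented_monoid X R) (diagram_monoid k D).
  \<forall>y\<in>X. \<phi> (word_cong X R `` {[y]}) = gen_diagram k (id y)"
 proof (rule presented_diagramsI[OF X D _ R], unfold list.map_id)
  show "id ` X = X" by simp
 next
  show "act_word k u = act_word k v" if "(u, v) \<in> R" for u v by (rule sound[OF that])
  fix h :: "generator => generator list set endo" and u v
  assume "\<And>u v. (u, v) \<in> R ==> word_prod h u = word_prod h v"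
   "\<And>u v. u \<in> lists X ==> v \<in> lists X ==> word_prod h u = word_prod h v ==> act_word k u = act_word k v"
   "u \<in> lists X" "v \<in> lists X" "act_word k u = act_word k v"
  thus "word_prod h u = word_prod h v" by (rule complete)
 qed
 thus ?thesis using monoid_diagrams[OF X D] by (simp add: monoid_presented_by_def)
qed

section \<open>The presentation of the Temperley-Lieb monoid\<close>

lemma map_lists:
 assumes "u \<in> lists (g ` A)"
 obtains u' where "u = map g u'" "set u' \<subseteq> A"
 using assms by (metis lists_image imageE lists_eq_set mem_Collect_eq)

lemma map_in_lists: "set w \<subseteq> A ==> map f w \<in> lists (f ` A)"
 by (simp add: lists_eq_set image_mono)

lemma rat_diff: "\<bar>rat_of_nat i - rat_of_nat j\<bar> = rat_of_int \<bar>int i - int j\<bar>"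
 by simp

lemma rat_diff_iff:
 "\<bar>rat_of_nat i - rat_of_nat j\<bar> = 1 <-> i = j + 1 \<or> j = i + 1"
 "\<bar>rat_of_nat i - rat_of_nat j\<bar> > 1 <-> i + 1 < j \<or> j + 1 < i"
 unfolding rat_diff by (simp_all only: of_int_eq_1_iff of_int_1_less_iff) linarith+

lemma diag_arc_rel_in_T_set:
 assumes f: "noncrossing f" "trivial_above (int k) f"
 shows "diag k (arc_rel k f) \<in> T_set k"
proof -
 have m: "matching f" using f by (simp add: noncrossing_def)
 note e = eqv_on_arc_rel[OF m f(2)]
 define d where "d = diag k (arc_rel k f)"
 have d: "d \<in> A_set k" "rel d = arc_rel k f" using e by (simp_all add: d_def diag_in_A_set)
 have dj: "B = B'" if "B \<in> d" "B' \<in> d" "v \<in> B" "v \<in> B'" for B B' v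
  using d(1) that unfolding A_set_def partition_on_def disjoint_def by blast
 have "card B = 2" if B: "B \<in> d" for B
 proof -
  have sub: "B \<subseteq> vertices k" "B \<noteq> {}" using d(1) B unfolding A_set_def partition_on_def by blast+
  then obtain v where v: "v \<in> B" "v \<in> vertices k" by blast
  define a where "a = coord v"
  have a: "v = vtx a" "a \<in> pts k" using v(2) by (simp_all add: a_def vtx_coord coord_in_pts)
  have "rel d a (f a)" unfolding d(2) arc_rel_def using a by simp
  hence "vtx (f a) \<in> B" unfolding rel_def using dj B v(1) a(1) by blast
  moreover have "w = vtx a \<or> w = vtx (f a)" if "w \<in> B" for w
  proof -
   have w: "w = vtx (coord w)" using sub(1) that vtx_coord[of w k] by auto
   hence "rel d a (coord w)" unfolding rel_def using B v(1) a(1) that by metis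
   thus ?thesis using w unfolding d(2) arc_rel_def by metis
  qed
  ultimately have "B = {vtx a, vtx (f a)}" using v(1) a(1) by blast
  moreover have "f a \<noteq> a" using matchingD(2)[OF m, of a] a(2) by auto
  ultimately show ?thesis by simp
 qed
 moreover have "planar k d" using planar_iff_nc_rel[OF d(1)] nc_rel_arc_rel[OF f(1)] d(2) by simp
 ultimately show ?thesis using d(1) unfolding T_set_def P_set_def B_set_def d_def by blast
qed

lemma T_set_eq: "T_set k = diag k ` act_word k ` lists (e_gens k)"
proof (intro equalityI subsetI)
 fix d assume "d \<in> T_set k"
 hence d: "d \<in> A_set k" "planar k d" "\<forall>B\<in>d. card B = 2" by (auto simp: T_set_def P_set_def B_set_def)
 obtain f where f: "matching f" "trivial_above (int k) f" "rel d = arc_rel k f" using two_element_blocks[OF d(1,3)] by blast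
 have "noncrossing f" using noncrossing_of_nc_rel[OF f(1,2)] planar_iff_nc_rel[OF d(1)] d(2) f(3) by simp
 then obtain w where w: "set w \<subseteq> {1..<k}" "tl_word w = f" using noncrossing_is_tl_word f(2) by blast
 have "d = diag k (act_word k (map gen_e w))" using act_word_e[OF w(1)] w(2) f(3) diag_rel[OF d(1)] by simp
 moreover have "map gen_e w \<in> lists (e_gens k)" unfolding e_gens_def by (rule map_in_lists[OF w(1)])
 ultimately show "d \<in> diag k ` act_word k ` lists (e_gens k)" by blast
next
 fix d assume "d \<in> diag k ` act_word k ` lists (e_gens k)"
 then obtain u where u: "u \<in> lists (e_gens k)" "d = diag k (act_word k u)" by blast
 obtain w where w: "u = map gen_e w" "set w \<subseteq> {1..<k}" using u(1) unfolding e_gens_def by (rule map_lists)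
 thus "d \<in> T_set k" using u(2) diag_arc_rel_in_T_set noncrossing_tl_word[OF w(2)] act_word_e[OF w(2)] by simp
qed

lemma tl_word_rels:
 assumes "1 \<le> i" "1 \<le> j"
 shows "tl_word [i, i] = tl_word [i]"
  "i = j + 1 \<or> j = i + 1 ==> tl_word [i, j, i] = tl_word [i]"
  "i + 1 < j \<or> j + 1 < i ==> tl_word [i, j] = tl_word [j, i]"
proof -
 have m: "matching uminus" using noncrossing_uminus(1) by (simp add: noncrossing_def)
 show "tl_word [i, i] = tl_word [i]" by (simp add: tl_word_def tl_act_idem)
 show "i = j + 1 \<or> j = i + 1 ==> tl_word [i, j, i] = tl_word [i]"
  using tl_act_braid[OF m, of "int i" "int j"] assms by (auto simp: tl_word_def)
 show "i + 1 < j \<or> j + 1 < i ==> tl_word [i, j] = tl_word [j, i]"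
  using tl_act_commute[OF m, of "int i" "int j"] tl_act_commute[OF m, of "int j" "int i"] assms by (auto simp: tl_word_def)
qed

text \<open>The common shape of the relations in (a) and (b), where \<open>c\<close> is the distance
  of neighbouring indices: 1 for the e's and 1/2 for the p's.\<close>

definition tl_rels :: "generator set => rat => (generator list \<times> generator list) set" where
 "tl_rels X c =
   {([x, x], [x]) |x. x \<in> X} \<union>
   {([x, y, x], [x]) |x y. x \<in> X \<and> y \<in> X \<and> \<bar>index x - index y\<bar> = c} \<union>
   {([x, y], [y, x]) |x y. x \<in> X \<and> y \<in> X \<and> \<bar>index x - index y\<bar> > c}"

text \<open>Generators \<open>g 1\<close>, ..., \<open>g (n - 1)\<close> whose words have the same
  diagram exactly when the corresponding Temperley-Lieb words have the same matching. This serves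
  T_k with \<open>n = k\<close> and P_k with \<open>n = 2 * k\<close>.\<close>

locale tl_diagrams =
 fixes k n :: nat and g :: "nat => generator" and c :: rat
 assumes near: "\<And>i j. 1 \<le> i ==> 1 \<le> j ==> \<bar>index (g i) - index (g j)\<bar> = c <-> i = j + 1 \<or> j = i + 1"
  and far: "\<And>i j. 1 \<le> i ==> 1 \<le> j ==> \<bar>index (g i) - index (g j)\<bar> > c <-> i + 1 < j \<or> j + 1 < i"
  and act_eq_iff: "\<And>u v. set u \<subseteq> {1..<n} ==> set v \<subseteq> {1..<n} ==>
   act_word k (map g u) = act_word k (map g v) <-> tl_word u = tl_word v"
  and valid: "g ` {1..<n} \<subseteq> Collect (valid_gen k)"
begin

abbreviation X :: "generator set" where "X \<equiv> g ` {1..<n}"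

lemma mem_X:
 assumes "x \<in> X"
 obtains i where "x = g i" "i \<in> {1..<n}" "1 \<le> i"
 using assms by auto

lemma tl_rels_sound:
 assumes "(u, v) \<in> tl_rels X c"
 shows "act_word k u = act_word k v"
proof -
 from assms consider x where "u = [x, x]" "v = [x]" "x \<in> X"
  | x y where "u = [x, y, x]" "v = [x]" "x \<in> X" "y \<in> X" "\<bar>index x - index y\<bar> = c"
  | x y where "u = [x, y]" "v = [y, x]" "x \<in> X" "y \<in> X" "\<bar>index x - index y\<bar> > c"
  unfolding tl_rels_def by blast
 thus ?thesis
 proof cases
  case (1 x)
  obtain i where "x = g i" "i \<in> {1..<n}" "1 \<le> i" by (rule mem_X[OF 1(3)])
  thus ?thesis using 1 act_eq_iff[of "[i, i]" "[i]"] tl_word_rels(1)[of i i] by simp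
 next
  case (2 x y)
  obtain i where i: "x = g i" "i \<in> {1..<n}" "1 \<le> i" by (rule mem_X[OF 2(3)])
  obtain j where j: "y = g j" "j \<in> {1..<n}" "1 \<le> j" by (rule mem_X[OF 2(4)])
  have "i = j + 1 \<or> j = i + 1" using 2(5) near[OF i(3) j(3)] i(1) j(1) by simp
  thus ?thesis using 2(1,2) i j act_eq_iff[of "[i, j, i]" "[i]"] tl_word_rels(2)[of i j] by simp
 next
  case (3 x y)
  obtain i where i: "x = g i" "i \<in> {1..<n}" "1 \<le> i" by (rule mem_X[OF 3(3)])
  obtain j where j: "y = g j" "j \<in> {1..<n}" "1 \<le> j" by (rule mem_X[OF 3(4)])
  have "i + 1 < j \<or> j + 1 < i" using 3(5) far[OF i(3) j(3)] i(1) j(1) by simp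
  thus ?thesis using 3(1,2) i j act_eq_iff[of "[i, j]" "[j, i]"] tl_word_rels(3)[of i j] by simp
 qed
qed

lemma tl_presentation:
 assumes "D = diag k ` act_word k ` lists X"
 shows "monoid_presented_by (diagram_monoid k D) X (tl_rels X c) (gen_diagram k)"
proof (rule monoid_presented_byI[OF valid assms _ tl_rels_sound])
 show "tl_rels X c \<subseteq> lists X \<times> lists X" unfolding tl_rels_def by auto
 fix h :: "generator => generator list set endo" and u v
 assume rels: "\<And>u v. (u, v) \<in> tl_rels X c ==> word_prod h u = word_prod h v"
  and compat: "\<And>u v. u \<in> lists X ==> v \<in> lists X ==> word_prod h u = word_prod h v ==> act_word k u = act_word k v"
  and uv: "u \<in> lists X" "v \<in> lists X" "act_word k u = act_word k v"
 have gen: "g i \<in> X" if "1 \<le> i" "i < n" for i using that by simp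
 interpret tl_relations "\<lambda>i. h (g i)" n
 proof
  fix i assume i: "1 \<le> i" "i < n"
  have "([g i, g i], [g i]) \<in> tl_rels X c" unfolding tl_rels_def using gen[OF i] by blast
  from rels[OF this] show "h (g i) * h (g i) = h (g i)" by simp
 next
  fix i assume i: "1 \<le> i" "i + 1 < n"
  have g: "g i \<in> X" "g (i + 1) \<in> X" using gen i by simp_all
  have "\<bar>index (g i) - index (g (i + 1))\<bar> = c" "\<bar>index (g (i + 1)) - index (g i)\<bar> = c"
   using near[of i "i + 1"] near[of "i + 1" i] i by simp_all
  hence "([g i, g (i + 1), g i], [g i]) \<in> tl_rels X c" "([g (i + 1), g i, g (i + 1)], [g (i + 1)]) \<in> tl_rels X c"
   unfolding tl_rels_def using g by blast+
  from rels[OF this(1)] rels[OF this(2)]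
  show "h (g i) * h (g (i + 1)) * h (g i) = h (g i)"
   "h (g (i + 1)) * h (g i) * h (g (i + 1)) = h (g (i + 1))" by (simp_all add: mult.assoc)
 next
  fix i j assume i: "1 \<le> i" "i + 1 < j" "j < n"
  have g: "g i \<in> X" "g j \<in> X" using gen i by simp_all
  have "\<bar>index (g i) - index (g j)\<bar> > c" using far[of i j] i by simp
  hence "([g i, g j], [g j, g i]) \<in> tl_rels X c" unfolding tl_rels_def using g by blast
  from rels[OF this] show "h (g i) * h (g j) = h (g j) * h (g i)" by simp
 qed
 obtain u' where u': "u = map g u'" "set u' \<subseteq> {1..<n}" by (rule map_lists[OF uv(1)])
 obtain v' where v': "v = map g v'" "set v' \<subseteq> {1..<n}" by (rule map_lists[OF uv(2)])
 have "W u' = W v'"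
 proof (rule tl_complete[OF _ u'(2) v'(2)])
  show "tl_word u = tl_word v" if s: "set u \<subseteq> {1..<n}" "set v \<subseteq> {1..<n}" and e: "W u = W v" for u v
   using act_eq_iff[OF s] compat[OF map_in_lists[OF s(1)] map_in_lists[OF s(2)]] e by (simp add: comp_def)
  show "tl_word u' = tl_word v'" using act_eq_iff[OF u'(2) v'(2)] uv(3) u'(1) v'(1) by simp
 qed
 thus "word_prod h u = word_prod h v" by (simp add: u' v' comp_def)
qed

end

lemma T_presentation: "monoid_presented_by (T_monoid k) (e_gens k) (T_rels k) (gen_diagram k)"
proof -
 interpret tl_diagrams k k gen_e 1
 proof
  show "act_word k (map gen_e u) = act_word k (map gen_e v) <-> tl_word u = tl_word v"
   if "set u \<subseteq> {1..<k}" "set v \<subseteq> {1..<k}" for u v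
   using act_word_e[OF that(1)] act_word_e[OF that(2)] tl_word_eqI[OF that] by metis
 qed (simp_all only: index.simps rat_diff_iff, auto)
 have "T_rels k = tl_rels (e_gens k) 1" by (simp only: T_rels_def tl_rels_def)
 thus ?thesis using tl_presentation[folded e_gens_def, OF T_set_eq] by simp
qed

section \<open>The presentation of the monoid of planar partitions\<close>

definition half_gen :: "nat => generator" where
 "half_gen a = (if odd a then gen_p ((a + 1) div 2) else gen_ph (a div 2))"

lemma half_gen_image: "half_gen ` {1..<2 * k} = p_gens k"
proof (intro equalityI subsetI)
 fix x assume "x \<in> half_gen ` {1..<2 * k}"
 thus "x \<in> p_gens k" by (auto simp: half_gen_def p_gens_def elim!: oddE evenE)
next
 fix x assume "x \<in> p_gens k"
 then consider j where "x = gen_p j" "1 \<le> j" "j \<le> k" | i where "x = gen_ph i" "1 \<le> i" "i < k"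
  by (auto simp: p_gens_def)
 thus "x \<in> half_gen ` {1..<2 * k}"
 proof cases
  case (1 j)
  hence "x = half_gen (2 * j - 1)" by (auto simp: half_gen_def)
  moreover have "2 * j - 1 \<in> {1..<2 * k}" using 1 by auto
  ultimately show ?thesis by blast
 next
  case (2 i)
  hence "x = half_gen (2 * i)" "2 * i \<in> {1..<2 * k}" by (auto simp: half_gen_def)
  thus ?thesis by blast
 qed
qed

text \<open>The half-integer indices 1, 3/2, ..., k are numbered consecutively from 1 to 2k - 1, so
  adjacency of generators becomes adjacency of integers.\<close>

lemma index_half_gen:
 assumes "1 \<le> a"
 shows "index (half_gen a) = (rat_of_nat a + 1) / 2"
 using assms by (cases "odd a") (auto simp: half_gen_def elim!: oddE evenE)

lemma index_half_gen_diff: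
 assumes "1 \<le> a" "1 \<le> b"
 shows "\<bar>index (half_gen a) - index (half_gen b)\<bar> = 1 / 2 <-> a = b + 1 \<or> b = a + 1"
  "\<bar>index (half_gen a) - index (half_gen b)\<bar> > 1 / 2 <-> a + 1 < b \<or> b + 1 < a"
proof -
 have "index (half_gen a) - index (half_gen b) = (rat_of_nat a - rat_of_nat b) / 2"
  using assms by (simp add: index_half_gen diff_divide_distrib[symmetric])
 hence e: "\<bar>index (half_gen a) - index (half_gen b)\<bar> = \<bar>rat_of_nat a - rat_of_nat b\<bar> / 2"
  by (simp only: abs_divide abs_numeral)
 show "\<bar>index (half_gen a) - index (half_gen b)\<bar> = 1 / 2 <-> a = b + 1 \<or> b = a + 1"
  unfolding e rat_diff_iff(1)[symmetric] by simp
 show "\<bar>index (half_gen a) - index (half_gen b)\<bar> > 1 / 2 <-> a + 1 < b \<or> b + 1 < a"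
  unfolding e rat_diff_iff(2)[symmetric] by simp
qed

text \<open>The gap inside the point \<open>c\<close> is enclosed by the arcs joining
  \<open>u\<close> and \<open>- u\<close> with \<open>\<bar>u\<bar> \<ge> 2 * \<bar>c\<bar>\<close>,
  so two points share a region only if they lie in the same column.\<close>

lemma region_rel_uminus: "region_rel k uminus = id_rel k"
proof (intro ext)
 fix a b
 have e: "encloses uminus u (left_end c) <-> \<bar>u\<bar> \<ge> 2 * \<bar>c\<bar>" if "c \<noteq> 0" for u c
  using that by (auto simp: encloses_def left_end_def abs_if)
 show "region_rel k uminus a b = id_rel k a b"
 proof (cases "a \<in> pts k \<and> b \<in> pts k")
  case True
  hence "a \<noteq> 0" "b \<noteq> 0" by auto
  hence "(\<forall>u. encloses uminus u (left_end a) = encloses uminus u (left_end b)) <->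
   (\<forall>u. \<bar>u\<bar> \<ge> 2 * \<bar>a\<bar> <-> \<bar>u\<bar> \<ge> 2 * \<bar>b\<bar>)" by (simp add: e)
  also have "\<dots> <-> \<bar>a\<bar> = \<bar>b\<bar>"
  proof
   assume A: "\<forall>u::int. \<bar>u\<bar> \<ge> 2 * \<bar>a\<bar> <-> \<bar>u\<bar> \<ge> 2 * \<bar>b\<bar>"
   show "\<bar>a\<bar> = \<bar>b\<bar>" using A[rule_format, of "2 * \<bar>a\<bar>"] A[rule_format, of "2 * \<bar>b\<bar>"] by simp
  qed simp
  finally show ?thesis using True by (simp add: region_rel_def id_rel_abs)
 next
  case False
  thus ?thesis by (auto simp: region_rel_def id_rel_def)
 qed
qed

lemma act_word_half_gen:
 assumes "set w \<subseteq> {1..<2 * k}"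
 shows "act_word k (map half_gen w) = region_rel k (tl_word w)"
 using assms
proof (induction w rule: rev_induct)
 case Nil
 thus ?case by (simp add: region_rel_uminus)
next
 case (snoc a w)
 hence w: "set w \<subseteq> {1..<2 * k}" and a: "1 \<le> a" "a < 2 * k" by auto
 have nc: "noncrossing (tl_word w)" using noncrossing_tl_word[OF w] by blast
 show ?case
 proof (cases "odd a")
  case True
  then obtain j where j: "a = 2 * j + 1" by (elim oddE)
  have "gen_act (half_gen a) (region_rel k (tl_word w)) = region_rel k (tl_act (int a) (tl_word w))"
   using region_rel_odd[OF nc, of "j + 1" k] j a by (simp add: half_gen_def)
  thus ?thesis using snoc.IH[OF w] by simp
 next
  case False
  then obtain j where j: "a = 2 * j" using evenE by blast
  have "gen_act (half_gen a) (region_rel k (tl_word w)) = region_rel k (tl_act (int a) (tl_word w))"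
   using region_rel_even[OF nc, of j k] j a by (simp add: half_gen_def)
  thus ?thesis using snoc.IH[OF w] by simp
 qed
qed

lemma tl_word_half_eqI:
 assumes "set u \<subseteq> {1..<2 * k}" "set v \<subseteq> {1..<2 * k}" "act_word k (map half_gen u) = act_word k (map half_gen v)"
 shows "tl_word u = tl_word v"
 using region_rel_inject[of "tl_word u" k "tl_word v"] assms noncrossing_tl_word[OF assms(1)] noncrossing_tl_word[OF assms(2)]
 by (simp add: act_word_half_gen)

lemma P_set_eq: "P_set k = diag k ` act_word k ` lists (p_gens k)"
proof (intro equalityI subsetI)
 fix d assume "d \<in> P_set k"
 hence d: "d \<in> A_set k" "planar k d" by (auto simp: P_set_def)
 obtain f where f: "noncrossing f" "trivial_above (int (2 * k)) f" "region_rel k f = rel d"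
  using region_rel_surj[OF eqv_on_rel[OF d(1)]] planar_iff_nc_rel[OF d(1)] d(2) by auto
 obtain w where w: "set w \<subseteq> {1..<2 * k}" "tl_word w = f" using noncrossing_is_tl_word[OF f(1,2)] by blast
 have "d = diag k (act_word k (map half_gen w))" using act_word_half_gen[OF w(1)] w(2) f(3) diag_rel[OF d(1)] by simp
 moreover have "map half_gen w \<in> lists (p_gens k)" unfolding half_gen_image[symmetric] by (rule map_in_lists[OF w(1)])
 ultimately show "d \<in> diag k ` act_word k ` lists (p_gens k)" by blast
next
 fix d assume "d \<in> diag k ` act_word k ` lists (p_gens k)"
 then obtain u where u: "u \<in> lists (p_gens k)" "d = diag k (act_word k u)" by blast
 obtain w where w: "u = map half_gen w" "set w \<subseteq> {1..<2 * k}"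
  using u(1) unfolding half_gen_image[symmetric] by (rule map_lists)
 have d: "d = diag k (region_rel k (tl_word w))" using u(2) w act_word_half_gen by simp
 hence "d \<in> A_set k" "rel d = region_rel k (tl_word w)" using eqv_on_region_rel by (simp_all add: diag_in_A_set)
 thus "d \<in> P_set k" using planar_iff_nc_rel nc_rel_region_rel by (simp add: P_set_def)
qed

lemma p_gens_valid: "p_gens k \<subseteq> Collect (valid_gen k)"
 by (auto simp: p_gens_def)

lemma P_rels_lists: "P_rels k \<subseteq> lists (p_gens k) \<times> lists (p_gens k)"
 unfolding P_rels_def by auto

lemma tl_diagrams_half_gen: "tl_diagrams k (2 * k) half_gen (1 / 2)"
proof
 show "act_word k (map half_gen u) = act_word k (map half_gen v) <-> tl_word u = tl_word v"
  if "set u \<subseteq> {1..<2 * k}" "set v \<subseteq> {1..<2 * k}" for u v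
  using act_word_half_gen[OF that(1)] act_word_half_gen[OF that(2)] tl_word_half_eqI[OF that] by metis
qed (simp_all only: index_half_gen_diff half_gen_image p_gens_valid)

lemma P_rels_eq: "P_rels k = tl_rels (p_gens k) (1 / 2)"
 by (simp only: P_rels_def tl_rels_def)

lemma P_rels_sound: "(u, v) \<in> P_rels k ==> act_word k u = act_word k v"
 unfolding P_rels_eq using tl_diagrams.tl_rels_sound[OF tl_diagrams_half_gen[of k]] unfolding half_gen_image .

lemma P_presentation: "monoid_presented_by (P_monoid k) (p_gens k) (P_rels k) (gen_diagram k)"
 using tl_diagrams.tl_presentation[OF tl_diagrams_half_gen[of k], unfolded half_gen_image, OF P_set_eq]
 unfolding P_rels_eq .

section \<open>The symmetric group\<close>

text \<open>Letters multiply on the right since they act on the bottom row: in the diagram of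
  \<open>w\<close> the bottom vertex \<open>j\<close> is joined to the top vertex
  \<open>perm_word w j\<close>.\<close>

definition perm_word :: "nat list => nat => nat" where
 "perm_word w = foldl (\<lambda>\<sigma> i. \<sigma> \<circ> transpose i (i + 1)) id w"

lemma perm_word_simps [simp]:
 "perm_word [] = id" "perm_word (w @ [i]) = perm_word w \<circ> transpose i (i + 1)"
 by (simp_all add: perm_word_def)

lemma perm_word_append: "perm_word (u @ v) = perm_word u \<circ> perm_word v"
proof (induction v rule: rev_induct)
 case (snoc i v)
 have "perm_word (u @ v @ [i]) = perm_word (u @ v) \<circ> transpose i (i + 1)"
  by (metis append_assoc perm_word_simps(2))
 thus ?case using snoc by (simp add: o_assoc)
qed simp

lemma perm_word_permutes:
 assumes "set w \<subseteq> {c..<m}"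
 shows "perm_word w permutes {c..m}"
 using assms
proof (induction w rule: rev_induct)
 case (snoc i w)
 hence "transpose i (i + 1) permutes {c..m}" by (intro permutes_swap_id) auto
 moreover have "perm_word w permutes {c..m}" using snoc by simp
 ultimately show ?case unfolding perm_word_simps by (rule permutes_compose)
qed (simp add: permutes_id)

lemma perm_word_down:
 assumes "b \<le> m"
 shows "perm_word (down m b) b = m + 1"
 using assms
proof (induction b rule: inc_induct)
 case base
 thus ?case using down_simps(1)[of m "Suc m"] down_simps(2)[of m m] by (simp add: perm_word_def)
next
 case (step b)
 hence "down m b = down m (Suc b) @ [b]" using down_simps(2)[of b m] by simp
 thus ?case using step by simp
qed

text \<open>The lower bound \<open>c\<close> is kept general because the permutations of
  \<open>{3..k}\<close>, which fix 1 and 2, also have to be generated by their own simple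
  transpositions.\<close>

lemma permutes_word:
 assumes "\<sigma> permutes {c..m}"
 shows "\<exists>w. set w \<subseteq> {c..<m} \<and> perm_word w = \<sigma>"
 using assms
proof (induction m arbitrary: \<sigma>)
 case 0
 hence "\<sigma> permutes {}" if "c \<noteq> 0" using that by simp
 moreover have "\<sigma> permutes {0}" if "c = 0" using that 0 by simp
 ultimately have "\<sigma> = id" by (cases "c = 0") (simp_all add: permutes_empty permutes_sing)
 thus ?case by (intro exI[of _ "[]"]) simp
next
 case (Suc m)
 show ?case
 proof (cases "c \<le> Suc m")
  case False
  hence "\<sigma> = id" using Suc.prems by (simp add: permutes_empty)
  thus ?thesis by (intro exI[of _ "[]"]) simp
 next
  case True
  \<comment> \<open>A descending word carries the preimage \<open>b\<close> of the largest point to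
    the top; after cancelling it, a permutation fixing the largest point remains.\<close>
  define b where "b = Hilbert_Choice.inv \<sigma> (Suc m)"
  have b: "\<sigma> b = Suc m" "b \<in> {c..Suc m}"
   using permutes_inverses(1)[OF Suc.prems] permutes_in_image[OF permutes_inv[OF Suc.prems], of "Suc m"] True
   by (auto simp: b_def)
  define d where "d = (if b = Suc m then [] else down m b)"
  have d: "set d \<subseteq> {c..<Suc m}" "perm_word d b = Suc m"
   using b(2) perm_word_down[of b m] by (auto simp: d_def down_simps)
  have pd: "perm_word d permutes {c..Suc m}" by (rule perm_word_permutes[OF d(1)])
  define \<tau> where "\<tau> = \<sigma> \<circ> Hilbert_Choice.inv (perm_word d)"
  have \<tau>: "\<tau> permutes {c..Suc m}" unfolding \<tau>_def by (rule permutes_compose[OF permutes_inv[OF pd] Suc.prems])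
  have "Hilbert_Choice.inv (perm_word d) (Suc m) = b" using d(2) permutes_inverses(2)[OF pd] by metis
  hence "\<tau> (Suc m) = Suc m" using b(1) by (simp add: \<tau>_def)
  hence "\<tau> permutes {c..m}"
   using \<tau> unfolding permutes_def by (metis atLeastAtMost_iff le_Suc_eq)
  then obtain w where w: "set w \<subseteq> {c..<m}" "perm_word w = \<tau>" using Suc.IH by blast
  have "perm_word (w @ d) = \<sigma>"
   unfolding perm_word_append w(2) \<tau>_def using permutes_inv_o(2)[OF pd] by (simp add: o_assoc[symmetric])
  moreover have "set (w @ d) \<subseteq> {c..<Suc m}" using w(1) d(1) by auto
  ultimately show ?thesis by blast
 qed
qed

section \<open>Descending words and the relations of the symmetric group\<close>

locale sym_relations =
 fixes h :: "nat => 'm::monoid_mult" and n :: nat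
 assumes sq: "\<And>i. 1 \<le> i ==> i < n ==> h i * h i = 1"
  and sbraid: "\<And>i. 1 \<le> i ==> i + 1 < n ==> h i * h (i + 1) * h i = h (i + 1) * h i * h (i + 1)"
  and scommute: "\<And>i j. 1 \<le> i ==> i + 1 < j ==> j < n ==> h i * h j = h j * h i"
begin

abbreviation W :: "nat list => 'm" where "W \<equiv> word_prod h"

lemma W_commute_high:
 assumes "\<And>i. i \<in> set u ==> j + 1 < i \<and> i < n" "1 \<le> j"
 shows "W u * h j = h j * W u"
 using assms(1)
proof (induction u)
 case (Cons i u)
 hence a: "h j * h i = h i * h j" and b: "W u * h j = h j * W u" using scommute[of j i] assms(2) by auto
 have "W (i # u) * h j = h i * (W u * h j)" by (simp add: mult.assoc)
 also have "\<dots> = h i * h j * W u" unfolding b by (simp add: mult.assoc)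
 also have "\<dots> = h j * W (i # u)" unfolding a[symmetric] by (simp add: mult.assoc)
 finally show ?case .
qed simp

lemma W_commute_low:
 assumes "\<And>i. i \<in> set u ==> 1 \<le> i \<and> i + 1 < j" "j < n"
 shows "W u * h j = h j * W u"
 using assms(1)
proof (induction u)
 case (Cons i u)
 hence a: "h i * h j = h j * h i" and b: "W u * h j = h j * W u" using scommute[of i j] assms(2) by auto
 have "W (i # u) * h j = h i * (W u * h j)" by (simp add: mult.assoc)
 also have "\<dots> = h i * h j * W u" unfolding b by (simp add: mult.assoc)
 also have "\<dots> = h j * W (i # u)" unfolding a by (simp add: mult.assoc)
 finally show ?case .
qed simp

text \<open>Descending blocks represent the cosets of S_m in S_{m+1}. As in
  \<open>word_split\<close>, but a letter equal to the end of the block now cancels with it, and a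
  larger letter \<open>i\<close> passes through the block by the braid relation and emerges in front
  as \<open>i - 1\<close>.\<close>

lemma sym_word_split:
 assumes "set w \<subseteq> {1..<Suc m}" "m < n"
 shows "\<exists>w' b. set w' \<subseteq> {1..<m} \<and> 1 \<le> b \<and> b \<le> Suc m \<and> W w = W w' * W (down m b)"
 using assms(1)
proof (induction w rule: rev_induct)
 case Nil
 show ?case by (intro exI[of _ "[]"] exI[of _ "Suc m"]) (simp add: down_simps)
next
 case (snoc i w)
 then obtain w' b where w: "set w' \<subseteq> {1..<m}" "1 \<le> b" "b \<le> Suc m" "W w = W w' * W (down m b)" by auto
 have i: "1 \<le> i" "i \<le> m" using snoc.prems by auto
 have eq: "W (w @ [i]) = W w' * (W (down m b) * h i)" using w(4) by (simp add: mult.assoc)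
 consider "i + 1 < b" | "i + 1 = b" | "i = b" | "b < i" by linarith
 thus ?case
 proof cases
  case 1
  have "W (down m b) * h i = h i * W (down m b)"
   using 1 i assms(2) by (intro W_commute_high) (auto simp: down_simps)
  hence "W (w @ [i]) = W (w' @ [i]) * W (down m b)" using eq by (simp add: mult.assoc)
  moreover have "set (w' @ [i]) \<subseteq> {1..<m}" using w(1,3) i 1 by auto
  ultimately show ?thesis using w(2,3) by blast
 next
  case 2
  hence "W (w @ [i]) = W w' * W (down m i)" using eq down_simps(2)[of i m] i by auto
  thus ?thesis using w(1) i by (intro exI[of _ w'] exI[of _ i]) auto
 next
  case 3
  hence "W (down m b) * h i = W (down m (Suc b))"
   using down_simps(2)[of b m] sq[of b] i assms(2) by (simp add: mult.assoc)
  hence "W (w @ [i]) = W w' * W (down m (Suc b))" using eq by simp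
  thus ?thesis using w(1) i 3 by (intro exI[of _ w'] exI[of _ "Suc b"]) auto
 next
  case 4
  have d: "down m b = down m (Suc i) @ [i, i - 1] @ down (i - 2) b"
  proof -
   have "down m b = down m i @ down (i - 1) b" using w 4 i by (intro down_split) auto
   moreover have "down (i - 1) b = (i - 1) # down (i - 2) b"
   proof -
    have "Suc (i - 2) = i - 1" using w 4 by simp
    thus ?thesis using down_simps(3)[of b "i - 2"] w 4 by simp
   qed
   moreover have "down m i = down m (Suc i) @ [i]" using down_simps(2) i by auto
   ultimately show ?thesis by simp
  qed
  have c: "W (down (i - 2) b) * h i = h i * W (down (i - 2) b)"
   using w i assms(2) by (intro W_commute_low) (auto simp: down_simps)
  have c': "W (down m (Suc i)) * h (i - 1) = h (i - 1) * W (down m (Suc i))"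
   using 4 w i assms(2) by (intro W_commute_high) (auto simp: down_simps)
  have br: "h i * h (i - 1) * h i = h (i - 1) * h i * h (i - 1)" using sbraid[of "i - 1"] 4 w i assms(2) by simp
  have "W (down m b) * h i = W (down m (Suc i)) * (h i * h (i - 1) * (W (down (i - 2) b) * h i))"
   unfolding d by (simp add: mult.assoc)
  also have "\<dots> = W (down m (Suc i)) * (h i * h (i - 1) * h i) * W (down (i - 2) b)"
   unfolding c by (simp add: mult.assoc)
  also have "\<dots> = (W (down m (Suc i)) * h (i - 1)) * h i * h (i - 1) * W (down (i - 2) b)"
   unfolding br by (simp add: mult.assoc)
  also have "\<dots> = h (i - 1) * W (down m b)" unfolding c' d by (simp add: mult.assoc)
  finally have "W (w @ [i]) = W (w' @ [i - 1]) * W (down m b)" using eq by (simp add: mult.assoc)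
  moreover have "set (w' @ [i - 1]) \<subseteq> {1..<m}" using w(1,2) i 4 by auto
  ultimately show ?thesis using w(2,3) by blast
 qed
qed

text \<open>The coset is determined by the permutation: the lower end of the last block is the point
  mapped to the largest one. The blocks agree, are cancelled, and induction applies.\<close>

lemma sym_complete:
 assumes compat: "\<And>u v. set u \<subseteq> {1..<n} ==> set v \<subseteq> {1..<n} ==> W u = W v ==> perm_word u = perm_word v"
  and uv: "set u \<subseteq> {1..<n}" "set v \<subseteq> {1..<n}" "perm_word u = perm_word v"
 shows "W u = W v"
proof -
 have "W u = W v" if "set u \<subseteq> {1..<m}" "set v \<subseteq> {1..<m}" "perm_word u = perm_word v" "m \<le> n" for m u v
  using that
 proof (induction m arbitrary: u v)
  case (Suc m)
  have mn: "m < n" using Suc.prems(4) by simp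
  obtain u' b where u: "set u' \<subseteq> {1..<m}" "1 \<le> b" "b \<le> Suc m" "W u = W u' * W (down m b)"
   using sym_word_split[OF Suc.prems(1) mn] by blast
  obtain v' c where v: "set v' \<subseteq> {1..<m}" "1 \<le> c" "c \<le> Suc m" "W v = W v' * W (down m c)"
   using sym_word_split[OF Suc.prems(2) mn] by blast
  have sub: "set (x @ down m e) \<subseteq> {1..<n}" if "set x \<subseteq> {1..<m}" "1 \<le> e" for x e
   using that mn by (auto simp: down_simps)
  have "perm_word u = perm_word (u' @ down m b)"
   using Suc.prems(1,4) u sub[OF u(1,2)] by (intro compat) auto
  moreover have "perm_word v = perm_word (v' @ down m c)"
   using Suc.prems(2,4) v sub[OF v(1,2)] by (intro compat) auto
  ultimately have e: "perm_word u' \<circ> perm_word (down m b) = perm_word v' \<circ> perm_word (down m c)"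
   using Suc.prems(3) by (simp only: perm_word_append)
  have top: "(perm_word x \<circ> perm_word (down m d)) d = Suc m" if "set x \<subseteq> {1..<m}" "d \<le> Suc m" for x d
  proof -
   have "perm_word (down m d) d = Suc m"
    using perm_word_down[of d m] that(2) by (cases "d = Suc m") (simp_all add: down_simps)
   moreover have "perm_word x (Suc m) = Suc m"
    using perm_word_permutes[OF that(1)] unfolding permutes_def by auto
   ultimately show ?thesis by simp
  qed
  have pd: "bij (perm_word (down m d))" if "1 \<le> d" for d
  proof -
   have "set (down m d) \<subseteq> {1..<Suc m}" using that by (auto simp: down_simps)
   thus ?thesis by (rule permutes_bij[OF perm_word_permutes])
  qed
  have bij: "bij (perm_word u' \<circ> perm_word (down m b))"
   using perm_word_permutes[OF u(1)] pd[OF u(2)] by (auto intro: bij_comp permutes_bij)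
  have "(perm_word u' \<circ> perm_word (down m b)) c = (perm_word u' \<circ> perm_word (down m b)) b"
   using top[OF u(1,3)] top[OF v(1,3)] e by metis
  hence bc: "c = b" using bij by (metis bij_is_inj injD)
  hence "perm_word u' = perm_word v'"
   using e pd[OF u(2)] by (metis (no_types, lifting) bij_is_surj surj_f_inv_f ext comp_apply)
  thus ?case using Suc.IH[OF u(1) v(1)] Suc.prems(4) u(4) v(4) bc by simp
 qed simp
 thus ?thesis using uv by blast
qed

end

section \<open>Diagrams of permutations\<close>

definition color :: "(nat => nat) => int => int" where
 "color \<sigma> a = (if a > 0 then int (\<sigma> (nat a)) else - a)"

text \<open>Comparing colours, with the top vertex \<open>i\<close> coloured \<open>i\<close> and
  the bottom vertex \<open>j\<close> coloured \<open>\<sigma> j\<close>, makes this an equivalence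
  relation for every function \<open>\<sigma>\<close>.\<close>

definition perm_rel :: "nat => (nat => nat) => int => int => bool" where
 "perm_rel k \<sigma> a b <-> a \<in> pts k \<and> b \<in> pts k \<and> color \<sigma> a = color \<sigma> b"

lemma eqv_on_perm_rel: "eqv_on k (perm_rel k \<sigma>)"
 by (rule eqv_onI) (auto simp: perm_rel_def)

lemma perm_rel_id: "perm_rel k id = id_rel k"
proof -
 have "color id a = \<bar>a\<bar>" for a by (simp add: color_def)
 moreover have "a \<in> pts k \<and> b \<in> pts k \<and> \<bar>a\<bar> = \<bar>b\<bar> <-> a \<in> pts k \<and> \<bar>a\<bar> = \<bar>b\<bar>" for a b
  using pts_abs[of a k] pts_abs[of b k] by auto
 ultimately show ?thesis by (intro ext) (simp only: perm_rel_def id_rel_abs)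
qed

lemma color_swap: "1 \<le> i ==> color \<sigma> (swap_int i a) = color (\<sigma> \<circ> transpose i (i + 1)) a"
proof -
 assume i: "1 \<le> i"
 consider "a = int i" | "a = int i + 1" | "a \<le> 0" | "a > 0" "a \<noteq> int i" "a \<noteq> int i + 1" by linarith
 thus ?thesis
 proof cases
  case 1
  thus ?thesis using i by (simp add: color_def swap_int_def nat_add_distrib)
 next
  case 2
  hence "nat a = i + 1" by simp
  thus ?thesis using i 2 by (simp add: color_def swap_int_def)
 next
  case 3
  thus ?thesis using i by (simp add: color_def swap_int_def)
 next
  case 4
  hence "nat a \<noteq> i" "nat a \<noteq> i + 1" by auto
  thus ?thesis using i 4 by (simp add: color_def swap_int_def)
 qed
qed

lemma perm_rel_act: "1 \<le> i ==> i < k ==> gen_act (gen_s i) (perm_rel k \<sigma>) = perm_rel k (\<sigma> \<circ> transpose i (i + 1))"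
 by (intro ext) (simp only: gen_act.simps perm_rel_def color_swap swap_int_pts)

lemma act_word_s:
 assumes "set w \<subseteq> {1..<k}"
 shows "act_word k (map gen_s w) = perm_rel k (perm_word w)"
 using assms
proof (induction w rule: rev_induct)
 case Nil
 thus ?case by (simp only: list.map perm_word_simps perm_rel_id act_word_simps)
next
 case (snoc i w)
 hence "1 \<le> i" "i < k" "act_word k (map gen_s w) = perm_rel k (perm_word w)" by auto
 thus ?case using perm_rel_act[of i k "perm_word w"]
  by (simp only: list.map map_append act_word_simps perm_word_simps)
qed

lemma perm_rel_inject:
 assumes "\<sigma> permutes {1..k}" "\<tau> permutes {1..k}" "perm_rel k \<sigma> = perm_rel k \<tau>"
 shows "\<sigma> = \<tau>"
proof (rule ext)
 fix j
 show "\<sigma> j = \<tau> j"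
 proof (cases "j \<in> {1..k}")
  case True
  hence "\<sigma> j \<in> {1..k}" using permutes_in_image[OF assms(1)] by blast
  hence "perm_rel k \<sigma> (int j) (- int (\<sigma> j))" using True by (auto simp: perm_rel_def color_def pts_def)
  hence "perm_rel k \<tau> (int j) (- int (\<sigma> j))" using assms(3) by simp
  thus ?thesis using True by (auto simp: perm_rel_def color_def split: if_splits)
 next
  case False
  thus ?thesis using assms(1,2) by (simp add: permutes_def)
 qed
qed

lemma perm_word_eqI:
 assumes "set u \<subseteq> {1..<k}" "set v \<subseteq> {1..<k}" "act_word k (map gen_s u) = act_word k (map gen_s v)"
 shows "perm_word u = perm_word v"
 using perm_rel_inject[OF perm_word_permutes[OF assms(1)] perm_word_permutes[OF assms(2)]] assms by (simp add: act_word_s)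

lemma S_set_perm_rel:
 assumes \<sigma>: "\<sigma> permutes {1..k}"
 shows "diag k (perm_rel k \<sigma>) \<in> S_set k"
proof -
 define d where "d = diag k (perm_rel k \<sigma>)"
 have d: "d \<in> A_set k" "rel d = perm_rel k \<sigma>" using eqv_on_perm_rel by (simp_all add: d_def diag_in_A_set)
 have dj: "B = B'" if "B \<in> d" "B' \<in> d" "v \<in> B" "v \<in> B'" for B B' v
  using d(1) that unfolding A_set_def partition_on_def disjoint_def by blast
 let ?P = "{b \<in> d. (\<exists>i. Top i \<in> b) \<and> (\<exists>i. Bot i \<in> b)}"
 define blk where "blk j = (THE B. B \<in> d \<and> vtx (int j) \<in> B)" for j
 have in_pts: "int j \<in> pts k" "- int (\<sigma> j) \<in> pts k" "- int j \<in> pts k" if "j \<in> {1..k}" for j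
  using that permutes_in_image[OF \<sigma>, of j] by (auto simp: pts_def)
 have blk: "blk j \<in> d" "vtx (int j) \<in> blk j" "vtx (- int (\<sigma> j)) \<in> blk j" if j: "j \<in> {1..k}" for j
 proof -
  have "rel d (int j) (- int (\<sigma> j))" using in_pts[OF j] j permutes_in_image[OF \<sigma>, of j]
   by (auto simp: d(2) perm_rel_def color_def)
  then obtain B where B: "B \<in> d" "vtx (int j) \<in> B" "vtx (- int (\<sigma> j)) \<in> B" by (auto simp: rel_def)
  hence "blk j = B" unfolding blk_def using dj by (intro the_equality) blast+
  thus "blk j \<in> d" "vtx (int j) \<in> blk j" "vtx (- int (\<sigma> j)) \<in> blk j" using B by auto
 qed
 have "bij_betw blk {1..k} ?P"
 proof (rule bij_betw_imageI)
  show "inj_on blk {1..k}"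
  proof (rule inj_onI)
   fix i j assume ij: "i \<in> {1..k}" "j \<in> {1..k}" "blk i = blk j"
   hence "rel d (int i) (int j)" unfolding rel_def using blk by metis
   hence "\<sigma> i = \<sigma> j" using ij by (auto simp: d(2) perm_rel_def color_def)
   thus "i = j" using permutes_inj[OF \<sigma>] by (meson injD)
  qed
  show "blk ` {1..k} = ?P"
  proof (intro equalityI subsetI)
   fix B assume "B \<in> blk ` {1..k}"
   then obtain j where j: "j \<in> {1..k}" "B = blk j" by blast
   have "\<sigma> j \<in> {1..k}" using permutes_in_image[OF \<sigma>] j(1) by blast
   hence "Bot j \<in> B" "Top (\<sigma> j) \<in> B" using blk[OF j(1)] j by (simp_all add: vtx_def)
   thus "B \<in> ?P" using blk(1)[OF j(1)] j(2) by blast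
  next
   fix B assume B: "B \<in> ?P"
   then obtain j where j: "B \<in> d" "Bot j \<in> B" by blast
   have "Bot j \<in> vertices k" using d(1) j unfolding A_set_def partition_on_def by blast
   hence "j \<in> {1..k}" by (auto simp: vertices_def)
   moreover from this have "vtx (int j) \<in> B" using j(2) by (simp add: vtx_def)
   ultimately show "B \<in> blk ` {1..k}" using dj[OF j(1) blk(1)[of j] _ blk(2)[of j]] by blast
  qed
 qed
 hence "card ?P = k" using bij_betw_same_card by fastforce
 thus ?thesis using d(1) by (simp add: S_set_def propagating_number_def d_def)
qed

text \<open>Choosing a top vertex in each of the \<open>k\<close> propagating blocks is injective,
  so it exhausts the top row, and likewise for the bottom row. Every vertex is therefore the chosen
  vertex of a propagating block, and no block has room for a second one in either row.\<close>

lemma S_set_is_perm_rel: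
 assumes "d \<in> S_set k"
 shows "\<exists>\<sigma>. \<sigma> permutes {1..k} \<and> rel d = perm_rel k \<sigma>"
proof -
 let ?P = "{b \<in> d. (\<exists>i. Top i \<in> b) \<and> (\<exists>i. Bot i \<in> b)}"
 have d: "d \<in> A_set k" and c: "card ?P = k" using assms by (auto simp: S_set_def propagating_number_def)
 have sub: "B \<subseteq> vertices k" if "B \<in> d" for B using d that unfolding A_set_def partition_on_def by blast
 have dj: "B = B'" if "B \<in> d" "B' \<in> d" "v \<in> B" "v \<in> B'" for B B' v
  using d that unfolding A_set_def partition_on_def disjoint_def by blast
 define t where "t B = (SOME i. Top i \<in> B)" for B
 define b where "b B = (SOME i. Bot i \<in> B)" for B
 have t: "Top (t B) \<in> B" and b: "Bot (b B) \<in> B" if "B \<in> ?P" for B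
  unfolding t_def b_def using that by (metis (mono_tags, lifting) mem_Collect_eq someI_ex)+
 have tk: "t ` ?P = {1..k}" and bk: "b ` ?P = {1..k}"
 proof -
  have "inj_on t ?P" "inj_on b ?P" using t b dj by (intro inj_onI; metis (mono_tags, lifting) mem_Collect_eq)+
  hence "card (t ` ?P) = card {1..k}" "card (b ` ?P) = card {1..k}" using c by (simp_all add: card_image)
  moreover have "t ` ?P \<subseteq> {1..k}" "b ` ?P \<subseteq> {1..k}" using t b sub by (auto simp: vertices_def)
  ultimately show "t ` ?P = {1..k}" "b ` ?P = {1..k}" by (simp_all add: card_subset_eq)
 qed
 have blk: "\<exists>B\<in>?P. vtx a \<in> B \<and> (a < 0 \<longrightarrow> int (t B) = - a) \<and> (a > 0 \<longrightarrow> int (b B) = a)" if a: "a \<in> pts k" for a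
 proof (cases "a > 0")
  case True
  hence "nat a \<in> b ` ?P" unfolding bk using a by (auto simp: pts_def)
  then obtain B where "B \<in> ?P" "nat a = b B" by blast
  thus ?thesis using b[of B] True by (intro bexI[of _ B]) (auto simp: vtx_def)
 next
  case False
  hence "nat (- a) \<in> t ` ?P" unfolding tk using a by (auto simp: pts_def)
  then obtain B where "B \<in> ?P" "nat (- a) = t B" by blast
  thus ?thesis using t[of B] False a by (intro bexI[of _ B]) (auto simp: vtx_def pts_def)
 qed
 define blk where "blk a = (SOME B. B \<in> ?P \<and> vtx a \<in> B \<and> (a < 0 \<longrightarrow> int (t B) = - a) \<and> (a > 0 \<longrightarrow> int (b B) = a))" for a
 have blk: "blk a \<in> ?P" "vtx a \<in> blk a" "a < 0 ==> int (t (blk a)) = - a" "a > 0 ==> int (b (blk a)) = a" if a: "a \<in> pts k" for a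
  using someI_ex[OF blk[OF a, unfolded Bex_def]] unfolding blk_def by blast+
 have blkd: "blk a \<in> d" if "a \<in> pts k" for a using blk(1)[OF that] by blast
 have tinj: "blk x = blk y" if xy: "x \<in> pts k" "y \<in> pts k" "t (blk x) = t (blk y)" for x y
  using dj[OF blkd[OF xy(1)] blkd[OF xy(2)] t[OF blk(1)[OF xy(1)]]] t[OF blk(1)[OF xy(2)]] xy(3) by simp
 have relblk: "rel d x y <-> t (blk x) = t (blk y)" if xy: "x \<in> pts k" "y \<in> pts k" for x y
 proof
  assume "rel d x y"
  then obtain B where B: "B \<in> d" "vtx x \<in> B" "vtx y \<in> B" unfolding rel_def by blast
  have "blk x = B" "blk y = B"
   using dj[OF blkd[OF xy(1)] B(1) blk(2)[OF xy(1)] B(2)] dj[OF blkd[OF xy(2)] B(1) blk(2)[OF xy(2)] B(3)] .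
  thus "t (blk x) = t (blk y)" by simp
 next
  assume e: "t (blk x) = t (blk y)"
  hence "blk x = blk y" by (rule tinj[OF xy])
  hence "vtx y \<in> blk x" using blk(2)[OF xy(2)] by simp
  thus "rel d x y" unfolding rel_def using xy blkd[OF xy(1)] blk(2)[OF xy(1)] by blast
 qed
 define \<sigma> where "\<sigma> j = (if j \<in> {1..k} then t (blk (int j)) else j)" for j
 have ip: "int j \<in> pts k" if "j \<in> {1..k}" for j using that by (auto simp: pts_def)
 have "\<sigma> permutes {1..k}"
 proof (rule bij_imp_permutes)
  have "inj_on \<sigma> {1..k}"
  proof (rule inj_onI)
   fix i j assume ij: "i \<in> {1..k}" "j \<in> {1..k}" "\<sigma> i = \<sigma> j"
   hence "t (blk (int i)) = t (blk (int j))" by (simp add: \<sigma>_def)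
   hence "blk (int i) = blk (int j)" by (rule tinj[OF ip[OF ij(1)] ip[OF ij(2)]])
   moreover have "int (b (blk (int i))) = int i" using ij(1) by (intro blk(4)[OF ip[OF ij(1)]]) simp
   moreover have "int (b (blk (int j))) = int j" using ij(2) by (intro blk(4)[OF ip[OF ij(2)]]) simp
   ultimately show "i = j" by (metis of_nat_eq_iff)
  qed
  moreover have "\<sigma> ` {1..k} \<subseteq> {1..k}"
  proof
   fix x assume "x \<in> \<sigma> ` {1..k}"
   then obtain j where "j \<in> {1..k}" "x = t (blk (int j))" by (auto simp: \<sigma>_def)
   thus "x \<in> {1..k}" using blk(1)[OF ip] unfolding tk[symmetric] by blast
  qed
  ultimately have "\<sigma> ` {1..k} = {1..k}" by (intro endo_inj_surj) simp_all
  thus "bij_betw \<sigma> {1..k} {1..k}" using \<open>inj_on \<sigma> {1..k}\<close> by (simp add: bij_betw_def)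
 next
  fix x assume "x \<notin> {1..k}"
  thus "\<sigma> x = x" unfolding \<sigma>_def by (rule if_not_P)
 qed
 moreover have "rel d = perm_rel k \<sigma>"
 proof (intro ext)
  fix x y
  have col: "color \<sigma> a = int (t (blk a))" if "a \<in> pts k" for a
  proof (cases "a > 0")
   case True
   hence "nat a \<in> {1..k}" "int (nat a) = a" using that by (auto simp: pts_def)
   thus ?thesis using True by (simp add: color_def \<sigma>_def)
  next
   case False
   thus ?thesis using blk(3)[OF that] that by (auto simp: color_def pts_def)
  qed
  show "rel d x y = perm_rel k \<sigma> x y"
  proof (cases "x \<in> pts k \<and> y \<in> pts k")
   case True
   thus ?thesis using relblk col by (simp add: perm_rel_def)
  next
   case False
   thus ?thesis using eqv_onD(1,2)[OF eqv_on_rel[OF d], of x y] by (auto simp: perm_rel_def)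
  qed
 qed
 ultimately show ?thesis by blast
qed

lemma S_set_eq: "S_set k = diag k ` act_word k ` lists (s_gens k)"
proof (intro equalityI subsetI)
 fix d assume d: "d \<in> S_set k"
 obtain \<sigma> where s: "\<sigma> permutes {1..k}" "rel d = perm_rel k \<sigma>" using S_set_is_perm_rel[OF d] by blast
 obtain w where w: "set w \<subseteq> {1..<k}" "perm_word w = \<sigma>" using permutes_word[OF s(1)] by blast
 have "d \<in> A_set k" using d by (simp add: S_set_def)
 hence "d = diag k (act_word k (map gen_s w))" using act_word_s[OF w(1)] w(2) s(2) diag_rel by metis
 moreover have "map gen_s w \<in> lists (s_gens k)" unfolding s_gens_def by (rule map_in_lists[OF w(1)])
 ultimately show "d \<in> diag k ` act_word k ` lists (s_gens k)" by blast
next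
 fix d assume "d \<in> diag k ` act_word k ` lists (s_gens k)"
 then obtain u where u: "u \<in> lists (s_gens k)" "d = diag k (act_word k u)" by blast
 obtain w where w: "u = map gen_s w" "set w \<subseteq> {1..<k}" using u(1) unfolding s_gens_def by (rule map_lists)
 thus "d \<in> S_set k" using u(2) S_set_perm_rel[OF perm_word_permutes[OF w(2)]] act_word_s[OF w(2)] by simp
qed

lemma perm_word_rels:
 "perm_word [i, i] = perm_word []"
 "perm_word [i, i + 1, i] = perm_word [i + 1, i, i + 1]"
 "i + 1 < j ==> perm_word [i, j] = perm_word [j, i]"
 by (auto simp: perm_word_def fun_eq_iff Transposition.transpose_def)

lemma s_gens_valid: "s_gens k \<subseteq> Collect (valid_gen k)"
 by (auto simp: s_gens_def)

lemma S_rels_lists: "S_rels k \<subseteq> lists (s_gens k) \<times> lists (s_gens k)"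
 by (auto simp: S_rels_def s_gens_def)

lemma S_rels_sound:
 assumes uv: "(u, v) \<in> S_rels k"
 shows "act_word k u = act_word k v"
proof -
 have *: "act_word k (map gen_s u) = act_word k (map gen_s v)"
  if "set u \<subseteq> {1..<k}" "set v \<subseteq> {1..<k}" "perm_word u = perm_word v" for u v
  using that act_word_s by simp
 from uv consider x where "u = [x, x]" "v = []" "x \<in> s_gens k"
  | i where "u = [gen_s i, gen_s (i + 1), gen_s i]" "v = [gen_s (i + 1), gen_s i, gen_s (i + 1)]" "i \<in> {1..<k}" "i + 1 \<in> {1..<k}"
  | x y where "u = [x, y]" "v = [y, x]" "x \<in> s_gens k" "y \<in> s_gens k" "\<bar>index x - index y\<bar> > 1"
  unfolding S_rels_def by blast
 thus ?thesis
 proof cases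
  case (1 x)
  then obtain i where "x = gen_s i" "i \<in> {1..<k}" by (auto simp: s_gens_def)
  thus ?thesis using 1 *[of "[i, i]" "[]"] perm_word_rels(1)[of i] by simp
 next
  case (2 i)
  thus ?thesis using *[of "[i, i + 1, i]" "[i + 1, i, i + 1]"] perm_word_rels(2)[of i] by simp
 next
  case (3 x y)
  then obtain i j where ij: "x = gen_s i" "i \<in> {1..<k}" "y = gen_s j" "j \<in> {1..<k}" by (auto simp: s_gens_def)
  hence "i + 1 < j \<or> j + 1 < i" using 3(5) rat_diff_iff(2)[of i j] by simp
  thus ?thesis using 3(1,2) ij *[of "[i, j]" "[j, i]"] perm_word_rels(3)[of i j] perm_word_rels(3)[of j i] by auto
 qed
qed

lemma sym_relationsI:
 assumes rels: "\<And>u v. (u, v) \<in> S_rels k ==> word_prod h u = word_prod h v"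
 shows "sym_relations (\<lambda>i. h (gen_s i)) k"
proof
 have gen: "gen_s i \<in> s_gens k" if "1 \<le> i" "i < k" for i using that by (simp add: s_gens_def)
 {
  fix i assume i: "1 \<le> i" "i < k"
  have "([gen_s i, gen_s i], []) \<in> S_rels k" unfolding S_rels_def using gen[OF i] by blast
  from rels[OF this] show "h (gen_s i) * h (gen_s i) = 1" by simp
 next
  fix i assume i: "1 \<le> i" "i + 1 < k"
  have "([gen_s i, gen_s (i+1), gen_s i], [gen_s (i+1), gen_s i, gen_s (i+1)]) \<in> S_rels k"
   unfolding S_rels_def using i by (intro UnI1 UnI2 CollectI exI[of _ i]) auto
  from rels[OF this] show "h (gen_s i) * h (gen_s (i + 1)) * h (gen_s i) = h (gen_s (i + 1)) * h (gen_s i) * h (gen_s (i + 1))"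
   by (simp add: mult.assoc)
 next
  fix i j assume i: "1 \<le> i" "i + 1 < j" "j < k"
  have "\<bar>index (gen_s i) - index (gen_s j)\<bar> > 1" unfolding index.simps rat_diff_iff(2) using i by simp
  hence "([gen_s i, gen_s j], [gen_s j, gen_s i]) \<in> S_rels k" unfolding S_rels_def using gen i by auto
  from rels[OF this] show "h (gen_s i) * h (gen_s j) = h (gen_s j) * h (gen_s i)" by simp
 }
qed

lemma S_presentation: "group_presented_by (S_monoid k) (s_gens k) (S_rels k) (gen_diagram k)"
proof -
 interpret M: monoid "S_monoid k" by (rule monoid_diagrams[OF s_gens_valid S_set_eq])
 \<comment> \<open>The inverse is the diagram of a word for the inverse permutation.\<close>
 have units: "d \<in> Units (S_monoid k)" if d: "d \<in> carrier (S_monoid k)" for d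
 proof -
  obtain \<sigma> where s: "\<sigma> permutes {1..k}" "rel d = perm_rel k \<sigma>"
   using S_set_is_perm_rel d by (auto simp: diagram_monoid_def)
  have da: "d \<in> A_set k" using d by (simp add: diagram_monoid_def S_set_def)
  obtain w w' where w: "set w \<subseteq> {1..<k}" "perm_word w = \<sigma>" "set w' \<subseteq> {1..<k}" "perm_word w' = Hilbert_Choice.inv \<sigma>"
   using permutes_word[OF s(1)] permutes_word[OF permutes_inv[OF s(1)]] by blast
  have l: "map gen_s u \<in> lists (Collect (valid_gen k))" if "set u \<subseteq> {1..<k}" for u
   using map_in_lists[OF that, of gen_s] lists_mono[of "gen_s ` {1..<k}" "Collect (valid_gen k)"] by auto
  have dw: "d = diag k (act_word k (map gen_s w))" using act_word_s[OF w(1)] w(2) s(2) diag_rel[OF da] by simp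
  define e where "e = diag k (act_word k (map gen_s w'))"
  have "map gen_s w' \<in> lists (s_gens k)" unfolding s_gens_def by (rule map_in_lists[OF w(3)])
  hence "e \<in> S_set k" unfolding S_set_eq e_def by blast
  moreover have "diagram_mult k (diag k (act_word k (map gen_s u))) (diag k (act_word k (map gen_s v))) = id_diagram k"
   if uv: "set u \<subseteq> {1..<k}" "set v \<subseteq> {1..<k}" "perm_word u \<circ> perm_word v = id" for u v
  proof -
   have "diagram_mult k (diag k (act_word k (map gen_s u))) (diag k (act_word k (map gen_s v))) =
     diag k (act_word k (map gen_s (u @ v)))"
    using diagram_mult_diag[OF eqv_on_act_word[OF l] eqv_on_act_word[OF l]] act_word_append[OF l l] uv(1,2) by simp
   also have "act_word k (map gen_s (u @ v)) = id_rel k"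
    using act_word_s[of "u @ v" k] uv perm_rel_id by (simp add: perm_word_append)
   finally show ?thesis using id_diagram_rel diag_rel by metis
  qed
  hence "diagram_mult k d e = id_diagram k" "diagram_mult k e d = id_diagram k"
   unfolding dw e_def using w permutes_inv_o[OF s(1)] by auto
  ultimately show ?thesis using d unfolding Units_def by (auto simp: diagram_monoid_def)
 qed
 have grp: "group (S_monoid k)" by unfold_locales (use units in blast)
 let ?Y = "s_gens k \<times> (UNIV :: bool set)"
 have img: "fst ` ?Y = s_gens k" by force
 have R: "group_rels (s_gens k) (S_rels k) \<subseteq> lists ?Y \<times> lists ?Y"
  using S_rels_lists[of k] unfolding group_rels_def by fastforce
 have mf: "map fst (map (\<lambda>x. (x, True)) u) = u" for u :: "generator list" by (induction u) auto
 have "\<exists>\<phi> \<in> iso (presented_monoid ?Y (group_rels (s_gens k) (S_rels k))) (S_monoid k).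
   \<forall>y\<in>?Y. \<phi> (word_cong ?Y (group_rels (s_gens k) (S_rels k)) `` {[y]}) = gen_diagram k (fst y)"
 proof (rule presented_diagramsI[OF s_gens_valid S_set_eq img R])
  fix u v assume "(u, v) \<in> group_rels (s_gens k) (S_rels k)"
  then consider u' v' where "(u', v') \<in> S_rels k" "u = map (\<lambda>x. (x, True)) u'" "v = map (\<lambda>x. (x, True)) v'"
   | x b where "u = [(x, b), (x, \<not> b)]" "v = []" "x \<in> s_gens k" unfolding group_rels_def by blast
  thus "act_word k (map fst u) = act_word k (map fst v)"
  proof cases
   case (1 u' v')
   thus ?thesis using S_rels_sound by (simp only: mf)
  next
   case (2 x b)
   hence "([x, x], []) \<in> S_rels k" unfolding S_rels_def by blast
   thus ?thesis using S_rels_sound 2 by fastforce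
  qed
 next
  fix h :: "generator \<times> bool => (generator \<times> bool) list set endo" and u v
  assume rels: "\<And>u v. (u, v) \<in> group_rels (s_gens k) (S_rels k) ==> word_prod h u = word_prod h v"
   and compat: "\<And>u v. u \<in> lists ?Y ==> v \<in> lists ?Y ==> word_prod h u = word_prod h v ==>
    act_word k (map fst u) = act_word k (map fst v)"
   and uv: "u \<in> lists ?Y" "v \<in> lists ?Y" "act_word k (map fst u) = act_word k (map fst v)"
  define g where "g x = h (x, True)" for x
  have gh: "word_prod g w = word_prod h (map (\<lambda>x. (x, True)) w)" for w unfolding map_map comp_def g_def[abs_def] ..
  have grels: "word_prod g u = word_prod g v" if "(u, v) \<in> S_rels k" for u v
   unfolding gh by (rule rels) (use that in \<open>auto simp: group_rels_def\<close>)
  interpret sym_relations "\<lambda>i. g (gen_s i)" k by (rule sym_relationsI[OF grels])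
  \<comment> \<open>The generators are involutions, so a formal inverse has the same value as its
    letter and signed words reduce to positive ones.\<close>
  have hx: "h (x, b) = g x" if x: "x \<in> s_gens k" for x b
  proof (cases b)
   case False
   have "([x, x], []) \<in> S_rels k" unfolding S_rels_def using x by blast
   from grels[OF this] have sq: "h (x, True) * h (x, True) = 1" by (simp add: g_def)
   have "([(x, False), (x, \<not> False)], []) \<in> group_rels (s_gens k) (S_rels k)" unfolding group_rels_def using x by blast
   from rels[OF this] have "h (x, False) * h (x, True) = 1" by simp
   hence "h (x, False) * h (x, True) * h (x, True) = h (x, True)" by simp
   thus ?thesis using False sq by (simp add: mult.assoc g_def)
  qed (simp add: g_def)
  have hw: "word_prod h w = word_prod g (map fst w)" if "w \<in> lists ?Y" for w
   using that by (induction w) (auto simp: hx)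
  obtain u' v' where u': "map fst u = map gen_s u'" "set u' \<subseteq> {1..<k}" "map fst v = map gen_s v'" "set v' \<subseteq> {1..<k}"
  proof -
   have "map fst u \<in> lists (gen_s ` {1..<k})" "map fst v \<in> lists (gen_s ` {1..<k})"
    using uv(1,2) unfolding s_gens_def by fastforce+
   thus ?thesis using that map_lists by metis
  qed
  have l: "map (\<lambda>x. (x, True)) (map gen_s w) \<in> lists ?Y" if "set w \<subseteq> {1..<k}" for w
  proof -
   have "map gen_s w \<in> lists (s_gens k)" unfolding s_gens_def by (rule map_in_lists[OF that])
   thus ?thesis by auto
  qed
  have "W u' = W v'"
  proof (rule sym_complete[OF _ u'(2,4)])
   show "perm_word u = perm_word v" if "set u \<subseteq> {1..<k}" "set v \<subseteq> {1..<k}" "W u = W v" for u v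
   proof -
    have "word_prod g (map gen_s u) = word_prod g (map gen_s v)" using that(3) by (simp add: comp_def)
    hence "act_word k (map gen_s u) = act_word k (map gen_s v)"
     using compat[OF l[OF that(1)] l[OF that(2)]] unfolding gh mf by blast
    thus ?thesis by (rule perm_word_eqI[OF that(1,2)])
   qed
   show "perm_word u' = perm_word v'" using perm_word_eqI[OF u'(2,4)] uv(3) u'(1,3) by simp
  qed
  thus "word_prod h u = word_prod h v" unfolding hw[OF uv(1)] hw[OF uv(2)] u' by (simp add: comp_def)
 qed
 thus ?thesis using grp unfolding group_presented_by_def presented_group_def by auto
qed

section \<open>The partition monoid\<close>

lemma prod_list_absorb:
 fixes m :: "'m::monoid_mult"
 assumes "\<And>x. x \<in> set L ==> m * x = m"
 shows "m * prod_list L = m"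
 using assms by (induction L) (simp_all add: mult.assoc[symmetric])

lemma prod_list_commute:
 fixes x :: "'m::monoid_mult"
 assumes "\<And>y. y \<in> set L ==> y * x = x * y"
 shows "prod_list L * x = x * prod_list L"
 using assms
proof (induction L)
 case (Cons y L)
 hence "y * x = x * y" "prod_list L * x = x * prod_list L" by auto
 thus ?case by (metis mult.assoc prod_list.Cons)
qed simp

lemma prod_list_mem_absorb:
 fixes x :: "'m::monoid_mult"
 assumes "x \<in> set L" "\<And>y. y \<in> set L ==> y * x = x * y" "x * x = x"
 shows "prod_list L * x = prod_list L"
 using assms(1,2)
proof (induction L)
 case (Cons y L)
 show ?case
 proof (cases "x \<in> set L")
  case True
  thus ?thesis using Cons by (simp add: mult.assoc)
 next
  case False
  hence y: "y = x" using Cons.prems(1) by simp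
  have "prod_list L * x = x * prod_list L" by (rule prod_list_commute) (use Cons.prems(2) in auto)
  hence "x * prod_list L * x = x * x * prod_list L" by (metis mult.assoc)
  thus ?thesis using y assms(3) by simp
 qed
qed simp

text \<open>If each product absorbs the factors of the other and all factors commute across, then L
  = L L' = L' L = L'. Thus order and multiplicity of the factors need never be compared.\<close>

lemma prod_list_eqI:
 fixes L L' :: "'m::monoid_mult list"
 assumes "\<And>x y. x \<in> set L ==> y \<in> set L' ==> x * y = y * x"
  "\<And>y. y \<in> set L' ==> prod_list L * y = prod_list L"
  "\<And>x. x \<in> set L ==> prod_list L' * x = prod_list L'"
 shows "prod_list L = prod_list L'"
proof -
 have c: "prod_list L * y = y * prod_list L" if "y \<in> set L'" for y
  by (rule prod_list_commute) (use assms(1) that in blast)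
 have "prod_list L = prod_list L * prod_list L'" by (rule prod_list_absorb[symmetric]) (rule assms(2))
 also have "\<dots> = prod_list L' * prod_list L" by (rule prod_list_commute[symmetric]) (use c in simp)
 also have "\<dots> = prod_list L'" by (rule prod_list_absorb) (rule assms(3))
 finally show ?thesis .
qed

abbreviation A_gens :: "nat => generator set" where "A_gens k \<equiv> s_gens k \<union> p_gens k"

abbreviation top_rel :: "(int => int => bool) => nat => nat => bool" where
 "top_rel r x y \<equiv> r (- int x) (- int y)"

abbreviation bot_rel :: "(int => int => bool) => nat => nat => bool" where
 "bot_rel r x y \<equiv> r (int x) (int y)"

text \<open>\<open>Q a b\<close> is the diagram obtained from the identity by merging the verticals \<open>a\<close> and \<open>b\<close>.\<close>

locale partition_relations =
 fixes k :: nat and S :: "(nat => nat) => 'm::monoid_mult" and P :: "nat => 'm" and Q :: "nat => nat => 'm"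
 assumes S_id: "S id = 1"
  and S_comp: "\<And>\<sigma> \<tau>. \<sigma> permutes {1..k} ==> \<tau> permutes {1..k} ==> S (\<sigma> \<circ> \<tau>) = S \<sigma> * S \<tau>"
  and S_P: "\<And>\<sigma> a. \<sigma> permutes {1..k} ==> a \<in> {1..k} ==> S \<sigma> * P a = P (\<sigma> a) * S \<sigma>"
  and S_Q: "\<And>\<sigma> a b. \<sigma> permutes {1..k} ==> a \<in> {1..k} ==> b \<in> {1..k} ==> S \<sigma> * Q a b = Q (\<sigma> a) (\<sigma> b) * S \<sigma>"
  and P_idem: "\<And>a. a \<in> {1..k} ==> P a * P a = P a"
  and P_comm: "\<And>a b. a \<in> {1..k} ==> b \<in> {1..k} ==> P a * P b = P b * P a"
  and Q_self: "\<And>a. Q a a = 1"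
  and Q_sym: "\<And>a b. a \<in> {1..k} ==> b \<in> {1..k} ==> Q a b = Q b a"
  and Q_idem: "\<And>a b. a \<in> {1..k} ==> b \<in> {1..k} ==> Q a b * Q a b = Q a b"
  and Q_comm: "\<And>a b c d. a \<in> {1..k} ==> b \<in> {1..k} ==> c \<in> {1..k} ==> d \<in> {1..k} ==>
   Q a b * Q c d = Q c d * Q a b"
  and Q_trans: "\<And>a b c. a \<in> {1..k} ==> b \<in> {1..k} ==> c \<in> {1..k} ==>
   Q a b * Q b c * Q a c = Q a b * Q b c"
  and PQ_comm: "\<And>a b c. a \<in> {1..k} ==> b \<in> {1..k} ==> c \<in> {1..k} ==> c \<noteq> a ==> c \<noteq> b ==>
   P c * Q a b = Q a b * P c"
  and PQP: "\<And>a b. a \<in> {1..k} ==> b \<in> {1..k} ==> a \<noteq> b ==> P a * Q a b * P a = P a"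
  and QPQ: "\<And>a b. a \<in> {1..k} ==> b \<in> {1..k} ==> a \<noteq> b ==> Q a b * P a * Q a b = Q a b"
  and Q_S: "\<And>a b. a \<in> {1..k} ==> b \<in> {1..k} ==> Q a b * S (transpose a b) = Q a b"
  and P_S: "\<And>a b. a \<in> {1..k} ==> b \<in> {1..k} ==> P a * P b * S (transpose a b) = P a * P b"
begin

abbreviation V :: "nat set" where "V \<equiv> {1..k}"

abbreviation QL :: "(nat \<times> nat) list => 'm" where "QL L \<equiv> prod_list (map (case_prod Q) L)"

lemma QL_elem:
 assumes "set L \<subseteq> V \<times> V" "x \<in> set (map (case_prod Q) L)"
 obtains a b where "x = Q a b" "a \<in> V" "b \<in> V"
proof -
 obtain p where p: "p \<in> set L" "x = case_prod Q p" using assms(2) by auto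
 have "p \<in> V \<times> V" using p(1) assms(1) by blast
 thus ?thesis using that[of "fst p" "snd p"] p(2) by (simp add: split_beta mem_Times_iff)
qed

lemma QL_commute:
 assumes "set L \<subseteq> V \<times> V" "a \<in> V" "b \<in> V"
 shows "QL L * Q a b = Q a b * QL L"
proof (rule prod_list_commute)
 fix y assume "y \<in> set (map (case_prod Q) L)"
 thus "y * Q a b = Q a b * y" by (rule QL_elem[OF assms(1)]) (use assms(2,3) Q_comm in blast)
qed

lemma QL_mem_absorb:
 assumes "set L \<subseteq> V \<times> V" "(a, b) \<in> set L"
 shows "QL L * Q a b = QL L"
proof (rule prod_list_mem_absorb)
 show "Q a b \<in> set (map (case_prod Q) L)" using assms(2) by force
 have ab: "a \<in> V" "b \<in> V" using assms by blast+
 show "y * Q a b = Q a b * y" if "y \<in> set (map (case_prod Q) L)" for y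
  using that by (rule QL_elem[OF assms(1)]) (use ab Q_comm in blast)
 show "Q a b * Q a b = Q a b" by (rule Q_idem[OF ab])
qed

lemma QL_eqI:
 assumes "set L \<subseteq> V \<times> V" "set L' \<subseteq> V \<times> V"
  "\<And>a b. (a, b) \<in> set L' ==> QL L * Q a b = QL L" "\<And>a b. (a, b) \<in> set L ==> QL L' * Q a b = QL L'"
 shows "QL L = QL L'"
proof (rule prod_list_eqI)
 fix x y assume xy: "x \<in> set (map (case_prod Q) L)" "y \<in> set (map (case_prod Q) L')"
 obtain a b where x: "x = Q a b" "a \<in> V" "b \<in> V" by (rule QL_elem[OF assms(1) xy(1)])
 obtain c d where y: "y = Q c d" "c \<in> V" "d \<in> V" by (rule QL_elem[OF assms(2) xy(2)])
 show "x * y = y * x" unfolding x(1) y(1) by (rule Q_comm[OF x(2,3) y(2,3)])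
qed (use assms(3,4) in auto)

text \<open>The pairs \<open>(a, b)\<close> with \<open>m * Q a b = m\<close> behave like an
  equivalence relation; this is its transitivity.\<close>

lemma absorb_trans:
 assumes "a \<in> V" "b \<in> V" "c \<in> V" "m * Q a b = m" "m * Q b c = m"
 shows "m * Q a c = m"
proof -
 have "m = m * (Q a b * Q b c)" by (simp add: mult.assoc[symmetric] assms(4,5))
 hence "m * Q a c = m * (Q a b * Q b c * Q a c)" by (simp add: mult.assoc[symmetric] assms(4,5))
 also have "\<dots> = m" unfolding Q_trans[OF assms(1-3)] by (simp add: mult.assoc[symmetric] assms(4,5))
 finally show ?thesis .
qed

text \<open>The product of \<open>Q a b\<close> over all related pairs, which is highly redundant.
  The chosen enumeration does not matter by \<open>QL_eqI\<close>, and having all pairs makes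
  absorption immediate.\<close>

definition E :: "(nat => nat => bool) => 'm" where
 "E R = QL (SOME L. set L = {(a, b). a \<in> V \<and> b \<in> V \<and> R a b})"

lemma E_list:
 obtains L where "E R = QL L" "set L = {(a, b). a \<in> V \<and> b \<in> V \<and> R a b}" "set L \<subseteq> V \<times> V"
proof -
 have "{(a, b). a \<in> V \<and> b \<in> V \<and> R a b} \<subseteq> V \<times> V" by blast
 hence "finite {(a, b). a \<in> V \<and> b \<in> V \<and> R a b}" by (rule finite_subset) simp
 from someI_ex[OF finite_list[OF this]] show ?thesis by (intro that) (auto simp: E_def)
qed

lemma E_comm:
 assumes "a \<in> V" "b \<in> V"
 shows "E R * Q a b = Q a b * E R"
proof -
 obtain L where L: "E R = QL L" "set L = {(a, b). a \<in> V \<and> b \<in> V \<and> R a b}" "set L \<subseteq> V \<times> V" by (rule E_list[of R])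
 show ?thesis unfolding L(1) by (rule QL_commute[OF L(3) assms])
qed

lemma E_absorb:
 assumes "R a b" "a \<in> V" "b \<in> V"
 shows "E R * Q a b = E R"
proof -
 obtain L where L: "E R = QL L" "set L = {(a, b). a \<in> V \<and> b \<in> V \<and> R a b}" "set L \<subseteq> V \<times> V" by (rule E_list[of R])
 have "(a, b) \<in> set L" unfolding L(2) using assms by blast
 thus ?thesis unfolding L(1) by (rule QL_mem_absorb[OF L(3)])
qed

lemma E_cong:
 assumes "\<And>x y. x \<in> V ==> y \<in> V ==> R x y <-> R' x y"
 shows "E R = E R'"
proof -
 have "{(a, b). a \<in> V \<and> b \<in> V \<and> R a b} = {(a, b). a \<in> V \<and> b \<in> V \<and> R' a b}" using assms by blast
 thus ?thesis unfolding E_def by simp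
qed

text \<open>The product on the left absorbs the pairs of \<open>R\<close> and the pair
  \<open>(a, b)\<close>, hence by \<open>absorb_trans\<close> all pairs of \<open>R'\<close>. The
  hypotheses constrain \<open>R'\<close> without naming \<open>merge\<close>, so the lemma serves
  the top row, the bottom row and the undoing of \<open>detach\<close>.\<close>

lemma E_merge:
 assumes "a \<in> V" "b \<in> V" "\<And>x y. x \<in> V ==> y \<in> V ==> R x y ==> R' x y" "R' a b"
  "\<And>x y. x \<in> V ==> y \<in> V ==> R' x y ==> R x y \<or> R x a \<and> R b y \<or> R x b \<and> R a y"
 shows "E R * Q a b = E R'"
proof -
 obtain L where L: "E R = QL L" "set L = {(a, b). a \<in> V \<and> b \<in> V \<and> R a b}" "set L \<subseteq> V \<times> V" by (rule E_list[of R])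
 obtain L' where L': "E R' = QL L'" "set L' = {(a, b). a \<in> V \<and> b \<in> V \<and> R' a b}" "set L' \<subseteq> V \<times> V" using E_list[of R'] by blast
 let ?m = "E R * Q a b"
 have sub: "set (L @ [(a, b)]) \<subseteq> V \<times> V" using L(3) assms(1,2) by auto
 have m: "?m = QL (L @ [(a, b)])" unfolding L(1) by simp
 have old: "?m * Q x y = ?m" if "R x y" "x \<in> V" "y \<in> V" for x y
  unfolding m by (rule QL_mem_absorb[OF sub]) (use that L(2) in simp)
 have new: "?m * Q a b = ?m" unfolding m by (rule QL_mem_absorb[OF sub]) simp
 have new': "?m * Q b a = ?m" using new Q_sym[OF assms(1,2)] by simp
 have "QL (L @ [(a, b)]) = QL L'"
 proof (rule QL_eqI[OF sub L'(3)])
  fix x y assume "(x, y) \<in> set L'"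
  hence xy: "x \<in> V" "y \<in> V" "R' x y" unfolding L'(2) by blast+
  have "?m * Q x y = ?m"
   using assms(5)[OF xy]
  proof (elim disjE conjE)
   assume "R x y" thus ?thesis by (rule old) (use xy in blast)+
  next
   assume "R x a" "R b y"
   hence "?m * Q x a = ?m" "?m * Q b y = ?m" using old xy assms(1,2) by blast+
   thus ?thesis using absorb_trans[of x a y] absorb_trans[of a b y] new xy assms(1,2) by blast
  next
   assume "R x b" "R a y"
   hence "?m * Q x b = ?m" "?m * Q a y = ?m" using old xy assms(1,2) by blast+
   thus ?thesis using absorb_trans[of x b y] absorb_trans[of b a y] new' xy assms(1,2) by blast
  qed
  thus "QL (L @ [(a, b)]) * Q x y = QL (L @ [(a, b)])" unfolding m .
 next
  fix x y assume "(x, y) \<in> set (L @ [(a, b)])"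
  hence "R' x y" "x \<in> V" "y \<in> V" using L(2) assms(1-4) by auto
  hence "(x, y) \<in> set L'" unfolding L'(2) by blast
  thus "QL L' * Q x y = QL L'" by (rule QL_mem_absorb[OF L'(3)])
 qed
 thus ?thesis using m L'(1) by simp
qed

lemma E_id: 
 assumes "\<And>x y. x \<in> V ==> y \<in> V ==> R x y ==> x = y"
 shows "E R = 1"
proof -
 obtain L where L: "E R = QL L" "set L = {(a, b). a \<in> V \<and> b \<in> V \<and> R a b}" "set L \<subseteq> V \<times> V" by (rule E_list[of R])
 have "set L \<subseteq> {(x, y). x = y}" unfolding L(2) using assms by blast
 hence "QL L = 1" by (induction L) (auto simp: Q_self)
 thus ?thesis using L(1) by simp
qed

lemma E_P:
 assumes "c \<in> V" "\<And>x. x \<in> V ==> R c x \<or> R x c ==> x = c"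
 shows "E R * P c = P c * E R"
proof -
 obtain L where L: "E R = QL L" "set L = {(a, b). a \<in> V \<and> b \<in> V \<and> R a b}" "set L \<subseteq> V \<times> V" by (rule E_list[of R])
 show ?thesis unfolding L(1)
 proof (rule prod_list_commute)
  fix y assume "y \<in> set (map (case_prod Q) L)"
  then obtain a b where "y = Q a b" "(a, b) \<in> set L" by auto
  hence ab: "y = Q a b" "a \<in> V" "b \<in> V" "R a b" unfolding L(2) by auto
  show "y * P c = P c * y"
  proof (cases "c = a \<or> c = b")
   case True
   hence "a = c \<and> b = c" using assms(2)[OF ab(2)] assms(2)[OF ab(3)] ab(4) by blast
   thus ?thesis using ab(1) Q_self by simp
  next
   case False
   thus ?thesis using PQ_comm[OF ab(2,3) assms(1)] ab(1) by simp
  qed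
 qed
qed

lemma S_QL:
 assumes "\<sigma> permutes V" "set L \<subseteq> V \<times> V"
 shows "S \<sigma> * QL L = QL (map (map_prod \<sigma> \<sigma>) L) * S \<sigma>"
 using assms(2)
proof (induction L)
 case (Cons p L)
 obtain a b where p: "p = (a, b)" by (cases p)
 have "S \<sigma> * QL (p # L) = S \<sigma> * Q a b * QL L" using p by (simp add: mult.assoc)
 also have "\<dots> = Q (\<sigma> a) (\<sigma> b) * (S \<sigma> * QL L)"
  using S_Q[OF assms(1), of a b] Cons.prems p by (simp add: mult.assoc)
 also have "S \<sigma> * QL L = QL (map (map_prod \<sigma> \<sigma>) L) * S \<sigma>" using Cons by simp
 finally show ?case using p by (simp add: mult.assoc)
qed simp

lemma E_S:
 assumes "\<sigma> permutes V"
 shows "E R * S \<sigma> = S \<sigma> * E (\<lambda>x y. R (\<sigma> x) (\<sigma> y))"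
proof -
 let ?R = "\<lambda>x y. R (\<sigma> x) (\<sigma> y)"
 obtain L where L: "E R = QL L" "set L = {(a, b). a \<in> V \<and> b \<in> V \<and> R a b}" "set L \<subseteq> V \<times> V" by (rule E_list[of R])
 obtain L' where L': "E ?R = QL L'" "set L' = {(a, b). a \<in> V \<and> b \<in> V \<and> ?R a b}" "set L' \<subseteq> V \<times> V" using E_list[of ?R] by blast
 note im = permutes_in_image[OF assms]
 have "set (map (map_prod \<sigma> \<sigma>) L') = set L"
 proof (intro equalityI subsetI)
  fix p assume "p \<in> set (map (map_prod \<sigma> \<sigma>) L')"
  thus "p \<in> set L" unfolding L(2) using L'(2) im by auto
 next
  fix p assume "p \<in> set L"
  then obtain a b where p: "p = (a, b)" "a \<in> V" "b \<in> V" "R a b" unfolding L(2) by auto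
  obtain x y where xy: "a = \<sigma> x" "b = \<sigma> y" using permutes_surj[OF assms] by (metis surjD)
  hence "(x, y) \<in> set L'" unfolding L'(2) using p im by blast
  hence "map_prod \<sigma> \<sigma> (x, y) \<in> set (map (map_prod \<sigma> \<sigma>) L')" unfolding set_map by (rule imageI)
  thus "p \<in> set (map (map_prod \<sigma> \<sigma>) L')" using p(1) xy by simp
 qed
 hence s: "(a, b) \<in> set (map (map_prod \<sigma> \<sigma>) L') <-> (a, b) \<in> set L" and
  s': "set (map (map_prod \<sigma> \<sigma>) L') \<subseteq> V \<times> V" for a b using L(3) by (simp_all del: set_map)
 have "QL (map (map_prod \<sigma> \<sigma>) L') = QL L"
  by (rule QL_eqI[OF s' L(3)]; rule QL_mem_absorb) (simp_all only: s s' L(3))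
 thus ?thesis using S_QL[OF assms L'(3)] L(1) L'(1) by simp
qed

lemma transpose_permutes: "a \<in> V ==> b \<in> V ==> transpose a b permutes V"
 by (rule permutes_swap_id)

lemma Q_S': "a \<in> V ==> b \<in> V ==> S (transpose a b) * Q a b = Q a b"
 using S_Q[OF transpose_permutes, of a b a b] Q_S[of a b] Q_sym[of a b] by simp

text \<open>Merged columns may be exchanged: \<open>E R\<close> contains the factor
  \<open>Q a b\<close>, which absorbs the transposition.\<close>

lemma E_transpose:
 assumes "R a b" "a \<in> V" "b \<in> V"
 shows "E R * S (transpose a b) = E R" "S (transpose a b) * E R = E R"
proof -
 have e: "E R = E R * Q a b" using E_absorb[of R, OF assms] by simp
 have "E R * S (transpose a b) = E R * (Q a b * S (transpose a b))" by (subst e) (simp only: mult.assoc)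
 also have "\<dots> = E R" unfolding Q_S[OF assms(2,3)] by (rule e[symmetric])
 finally show "E R * S (transpose a b) = E R" .
 have e': "E R = Q a b * E R" using e E_comm[OF assms(2,3), of R] by simp
 have "S (transpose a b) * E R = S (transpose a b) * Q a b * E R" by (subst e') (simp only: mult.assoc)
 also have "\<dots> = E R" unfolding Q_S'[OF assms(2,3)] by (rule e'[symmetric])
 finally show "S (transpose a b) * E R = E R" .
qed

section \<open>Products of cuts\<close>

definition PD :: "nat set => 'm" where
 "PD D = prod_list (map P (sorted_list_of_set D))"

lemma PL_absorb:
 assumes "set L \<subseteq> V" "a \<in> set L"
 shows "prod_list (map P L) * P a = prod_list (map P L)"
proof (rule prod_list_mem_absorb)
 have a: "a \<in> V" using assms by blast
 show "P a \<in> set (map P L)" using assms(2) by simp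
 show "P a * P a = P a" by (rule P_idem[OF a])
 fix y assume "y \<in> set (map P L)"
 then obtain b where "y = P b" "b \<in> set L" by auto
 thus "y * P a = P a * y" using P_comm[OF _ a, of b] assms(1) by blast
qed

lemma PD_eq:
 assumes "set L \<subseteq> V"
 shows "prod_list (map P L) = PD (set L)"
proof -
 have s: "set (sorted_list_of_set (set L)) = set L" by simp
 show ?thesis unfolding PD_def
 proof (rule prod_list_eqI)
  fix x y assume "x \<in> set (map P L)" "y \<in> set (map P (sorted_list_of_set (set L)))"
  then obtain a b where "x = P a" "y = P b" "a \<in> set L" "b \<in> set L" by auto
  moreover from this have "a \<in> V" "b \<in> V" using assms by blast+
  ultimately show "x * y = y * x" using P_comm by simp
 next
  fix y assume "y \<in> set (map P (sorted_list_of_set (set L)))"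
  thus "prod_list (map P L) * y = prod_list (map P L)"
   using PL_absorb assms by auto
 next
  fix y assume "y \<in> set (map P L)"
  thus "prod_list (map P (sorted_list_of_set (set L))) * y = prod_list (map P (sorted_list_of_set (set L)))"
   using PL_absorb[of "sorted_list_of_set (set L)"] assms by auto
 qed
qed

lemma PD_list:
 assumes "D \<subseteq> V"
 obtains L where "set L = D" "PD D = prod_list (map P L)"
 using finite_subset[OF assms] that[of "sorted_list_of_set D"] by (simp add: PD_def)

lemma PD_comm:
 assumes "D \<subseteq> V" "a \<in> V"
 shows "PD D * P a = P a * PD D"
proof -
 obtain L where L: "set L = D" "PD D = prod_list (map P L)" by (rule PD_list[OF assms(1)])
 show ?thesis unfolding L(2) by (rule prod_list_commute) (use L(1) assms P_comm in auto)
qed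

lemma PD_insert:
 assumes "D \<subseteq> V" "a \<in> V"
 shows "PD D * P a = PD (insert a D)"
proof -
 obtain L where L: "set L = D" "PD D = prod_list (map P L)" by (rule PD_list[OF assms(1)])
 thus ?thesis using PD_eq[of "L @ [a]"] assms by simp
qed

lemma PD_Q:
 assumes "D \<subseteq> V" "a \<in> V" "b \<in> V" "a \<notin> D" "b \<notin> D"
 shows "PD D * Q a b = Q a b * PD D"
proof -
 obtain L where L: "set L = D" "PD D = prod_list (map P L)" by (rule PD_list[OF assms(1)])
 show ?thesis unfolding L(2)
 proof (rule prod_list_commute)
  fix y assume "y \<in> set (map P L)"
  then obtain c where "y = P c" "c \<in> D" using L(1) by auto
  moreover have "c \<in> V" using \<open>c \<in> D\<close> assms(1) by blast
  ultimately show "y * Q a b = Q a b * y" using PQ_comm[OF assms(2,3), of c] assms(4,5) by blast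
 qed
qed

lemma S_PD:
 assumes "\<sigma> permutes V" "D \<subseteq> V"
 shows "S \<sigma> * PD D = PD (\<sigma> ` D) * S \<sigma>"
proof -
 obtain L where L: "set L = D" "PD D = prod_list (map P L)" by (rule PD_list[OF assms(2)])
 have "S \<sigma> * prod_list (map P L) = prod_list (map P (map \<sigma> L)) * S \<sigma>" if "set L \<subseteq> V"
  using that
 proof (induction L)
  case (Cons a L)
  have "S \<sigma> * prod_list (map P (a # L)) = P (\<sigma> a) * (S \<sigma> * prod_list (map P L))"
   using S_P[OF assms(1), of a] Cons.prems by (simp add: mult.assoc[symmetric])
  also have "S \<sigma> * prod_list (map P L) = prod_list (map P (map \<sigma> L)) * S \<sigma>" using Cons by simp
  finally show ?case by (simp add: mult.assoc)
 qed simp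
 moreover have "set (map \<sigma> L) \<subseteq> V" using L(1) assms permutes_in_image[OF assms(1)] by auto
 ultimately show ?thesis using L PD_eq[of "map \<sigma> L"] assms(2) by simp
qed

lemma PD_transpose:
 assumes "a \<in> V" "b \<in> V" "D \<subseteq> V"
 shows "S (transpose a b) * PD (transpose a b ` D) = PD D * S (transpose a b)"
proof -
 have "transpose a b ` D \<subseteq> V" using permutes_in_image[OF transpose_permutes[OF assms(1,2)]] assms(3) by blast
 from S_PD[OF transpose_permutes[OF assms(1,2)] this] show ?thesis by (simp add: image_image)
qed

text \<open>Induction over transpositions: a swap of two cut strands disappears in
  \<open>P a * P b\<close>.\<close>

lemma PD_permutes:
 assumes "\<pi> permutes D" "D \<subseteq> V"
 shows "S \<pi> * PD D = PD D"
proof -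
 have "finite D" using assms(2) by (rule finite_subset) simp
 with assms(1) show ?thesis
 proof (induction \<pi> rule: permutes_induct)
  case id
  thus ?case by (simp only: S_id mult_1_left)
 next
  case (swap a b p)
  have ab: "a \<in> V" "b \<in> V" using swap assms(2) by blast+
  have p: "p permutes V" using swap(4) assms(2) by (rule permutes_subset)
  have pp: "P a * P b * PD D = PD D"
  proof -
   have "P a * P b * PD D = PD D * P a * P b"
    using PD_comm[OF assms(2) ab(1)] PD_comm[OF assms(2) ab(2)] P_comm[OF ab] by (metis mult.assoc)
   also have "\<dots> = PD D" using PD_insert[OF assms(2)] ab swap(1,2) by (simp add: insert_absorb)
   finally show ?thesis .
  qed
  have "S (transpose a b) * P a * P b = P b * (S (transpose a b) * P b)"
   using S_P[OF transpose_permutes[OF ab] ab(1)] by (simp add: mult.assoc)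
  also have "\<dots> = P a * P b * S (transpose a b)"
   using S_P[OF transpose_permutes[OF ab] ab(2)] P_comm[OF ab] by (simp add: mult.assoc[symmetric])
  finally have t: "S (transpose a b) * P a * P b = P a * P b" using P_S[OF ab] by simp
  have "S (transpose a b \<circ> p) * PD D = S (transpose a b) * (S p * PD D)"
   using S_comp[OF transpose_permutes[OF ab] p] by (simp add: mult.assoc)
  also have "\<dots> = S (transpose a b) * (P a * P b * PD D)" using swap(5) pp by simp
  also have "\<dots> = S (transpose a b) * P a * P b * PD D" by (simp add: mult.assoc)
  finally show ?case unfolding t pp .
 qed
qed

text \<open>\<open>U\<close> contains one bottom point of every propagating block of \<open>r\<close>, and \<open>\<sigma>\<close> selects a top
 point of the same block.\<close>

definition form :: "(int => int => bool) => nat set => (nat => nat) => bool" where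
 "form r U \<sigma> <-> U \<subseteq> V \<and> \<sigma> permutes V \<and> (\<forall>c\<in>U. r (- int (\<sigma> c)) (int c)) \<and>
   (\<forall>x\<in>V. \<forall>j\<in>V. r (- int x) (int j) \<longrightarrow> (\<exists>c\<in>U. r (int c) (int j))) \<and>
   (\<forall>c\<in>U. \<forall>c'\<in>U. r (int c) (int c') \<longrightarrow> c = c')"

text \<open>Only the strands at the chosen representatives \<open>U\<close> survive the cut, one for
  each propagating block; the outer factors restore the remaining members of the blocks in each
  row.\<close>

definition form_val :: "(int => int => bool) => nat set => (nat => nat) => 'm" where
 "form_val r U \<sigma> = E (top_rel r) * S \<sigma> * PD (V - U) * E (bot_rel r)"

lemma formI:
 assumes "U \<subseteq> V" "\<sigma> permutes V" "\<And>c. c \<in> U ==> r (- int (\<sigma> c)) (int c)"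
  "\<And>x j. x \<in> V ==> j \<in> V ==> r (- int x) (int j) ==> \<exists>c\<in>U. r (int c) (int j)"
  "\<And>c c'. c \<in> U ==> c' \<in> U ==> r (int c) (int c') ==> c = c'"
 shows "form r U \<sigma>"
 using assms unfolding form_def by blast

lemma formD:
 assumes "form r U \<sigma>"
 shows "U \<subseteq> V" "\<sigma> permutes V" "\<And>c. c \<in> U ==> r (- int (\<sigma> c)) (int c)"
  "\<And>x j. x \<in> V ==> j \<in> V ==> r (- int x) (int j) ==> \<exists>c\<in>U. r (int c) (int j)"
  "\<And>c c'. c \<in> U ==> c' \<in> U ==> r (int c) (int c') ==> c = c'"
proof -
 note a = assms[unfolded form_def]
 show "U \<subseteq> V" "\<sigma> permutes V" using a by simp_all
 show "c \<in> U ==> r (- int (\<sigma> c)) (int c)" for c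
  using conjunct1[OF conjunct2[OF conjunct2[OF a]]] by blast
 show "x \<in> V ==> j \<in> V ==> r (- int x) (int j) ==> \<exists>c\<in>U. r (int c) (int j)" for x j
  using conjunct1[OF conjunct2[OF conjunct2[OF conjunct2[OF a]]]] by blast
 show "c \<in> U ==> c' \<in> U ==> r (int c) (int c') ==> c = c'" for c c'
  using conjunct2[OF conjunct2[OF conjunct2[OF conjunct2[OF a]]]] by blast
qed

section \<open>Independence of the normal form from the choices\<close>

lemma V_pts: "int x \<in> pts k <-> x \<in> V" "- int x \<in> pts k <-> x \<in> V"
 by (auto simp: pts_def)

lemma transpose_rel:
 assumes "eqv_on k r" "r (f c) (f c')" "f x \<in> pts k"
 shows "r (f x) (f (transpose c c' x))" "r (f (transpose c c' x)) (f x)"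
 using assms(2) eqv_onD(3)[OF assms(1,3)] eqv_onD(4)[OF assms(1,2)]
 by (cases "x = c"; cases "x = c'"; simp)+

lemma transpose_image_mem: "x \<in> transpose c c' ` U <-> transpose c c' x \<in> U"
 by (metis image_iff transpose_involutory)

text \<open>Used twice: with \<open>r'\<close> obtained from \<open>r\<close> by exchanging two
  bottom points, which is the action of s_i, and with \<open>r' = r\<close> when the two points lie
  in one block.\<close>

lemma form_transpose:
 assumes f: "form r U \<sigma>" and a: "a \<in> V" "b \<in> V"
  and g: "\<And>x y. bot_rel r' x y <-> bot_rel r (transpose a b x) (transpose a b y)"
   "\<And>x y. top_rel r' x y <-> top_rel r x y" "\<And>x y. r' (- int x) (int y) <-> r (- int x) (int (transpose a b y))"
 shows "form r' (transpose a b ` U) (\<sigma> \<circ> transpose a b)"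
  "form_val r' (transpose a b ` U) (\<sigma> \<circ> transpose a b) = form_val r U \<sigma> * S (transpose a b)"
proof -
 let ?t = "transpose a b"
 note f = formD[OF f]
 note t = transpose_permutes[OF a]
 have tV: "?t x \<in> V <-> x \<in> V" for x using permutes_in_image[OF t] by blast
 show "form r' (?t ` U) (\<sigma> \<circ> ?t)"
 proof (rule formI)
  show "?t ` U \<subseteq> V" using f(1) tV by blast
  show "\<sigma> \<circ> ?t permutes V" by (rule permutes_compose[OF t f(2)])
  show "r' (- int ((\<sigma> \<circ> ?t) x)) (int x)" if "x \<in> ?t ` U" for x
   using that f(3)[of "?t x"] unfolding g by (simp add: transpose_image_mem)
 next
  fix x j assume "x \<in> V" "j \<in> V" "r' (- int x) (int j)"
  then obtain d where d: "d \<in> U" "r (int d) (int (?t j))" using f(4)[of x "?t j"] tV unfolding g by blast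
  hence "r' (int (?t d)) (int j)" unfolding g by simp
  thus "\<exists>c\<in>?t ` U. r' (int c) (int j)" using d(1) by blast
 next
  fix x y assume "x \<in> ?t ` U" "y \<in> ?t ` U" "r' (int x) (int y)"
  hence "?t x = ?t y" using f(5) unfolding g by (simp add: transpose_image_mem)
  thus "x = y" by (metis transpose_involutory)
 qed
 have "V - ?t ` U = ?t ` (V - U)" using permutes_image[OF t] inj_on_image_set_diff[OF permutes_inj[OF t], of V U] by simp
 hence "form_val r' (?t ` U) (\<sigma> \<circ> ?t) = E (top_rel r) * S \<sigma> * (S ?t * PD (?t ` (V - U))) * E (\<lambda>x y. bot_rel r (?t x) (?t y))"
  unfolding form_val_def S_comp[OF f(2) t] g by (simp add: mult.assoc)
 also have "S ?t * PD (?t ` (V - U)) = PD (V - U) * S ?t" by (rule PD_transpose[OF a]) blast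
 also have "E (top_rel r) * S \<sigma> * (PD (V - U) * S ?t) * E (\<lambda>x y. bot_rel r (?t x) (?t y)) =
   E (top_rel r) * S \<sigma> * PD (V - U) * (E (bot_rel r) * S ?t)" unfolding E_S[OF t] by (simp only: mult.assoc)
 also have "\<dots> = form_val r U \<sigma> * S ?t" unfolding form_val_def by (simp only: mult.assoc)
 finally show "form_val r' (?t ` U) (\<sigma> \<circ> ?t) = form_val r U \<sigma> * S ?t" .
qed

text \<open>A representative may be replaced by another bottom point of its block, because the right
  factor \<open>E (bot_rel r)\<close> absorbs the transposition.\<close>

lemma form_bot:
 assumes r: "eqv_on k r" and f: "form r U \<sigma>" and c: "r (int c) (int c')" "c \<in> V" "c' \<in> V"
 shows "form r (transpose c c' ` U) (\<sigma> \<circ> transpose c c')"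
  "form_val r (transpose c c' ` U) (\<sigma> \<circ> transpose c c') = form_val r U \<sigma>"
proof -
 note c' = eqv_onD(4)[OF r c(1)]
 have e: "r (int c) z <-> r (int c') z" for z by (rule iffI, rule eqv_onD(5)[OF r c'], assumption, rule eqv_onD(5)[OF r c(1)])
 have e': "r z (int c) <-> r z (int c')" for z by (rule iffI, rule eqv_onD(5)[OF r _ c(1)], assumption, rule eqv_onD(5)[OF r _ c'])
 have t: "r (int (transpose c c' x)) z <-> r (int x) z" "r z (int (transpose c c' x)) <-> r z (int x)" for x z
 proof -
  consider "x = c" | "x = c'" | "x \<noteq> c" "x \<noteq> c'" by blast
  thus "r (int (transpose c c' x)) z <-> r (int x) z" "r z (int (transpose c c' x)) <-> r z (int x)"
   by (cases; simp only: transpose_apply_first transpose_apply_second transpose_apply_other e e')+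
 qed
 note ft = form_transpose[of r U \<sigma>, OF f c(2,3), of r, unfolded t, OF HOL.refl HOL.refl HOL.refl]
 show "form r (transpose c c' ` U) (\<sigma> \<circ> transpose c c')" by (rule ft(1))
 show "form_val r (transpose c c' ` U) (\<sigma> \<circ> transpose c c') = form_val r U \<sigma>"
  unfolding ft(2) unfolding form_val_def mult.assoc E_transpose(1)[of "bot_rel r", OF c] ..
qed

text \<open>Likewise for the top point selected by \<open>\<sigma>\<close>, with the left factor
  \<open>E (top_rel r)\<close>.\<close>

lemma form_top:
 assumes r: "eqv_on k r" and f: "form r U \<sigma>" and c: "r (- int c) (- int c')" "c \<in> V" "c' \<in> V"
 shows "form r U (transpose c c' \<circ> \<sigma>)" "form_val r U (transpose c c' \<circ> \<sigma>) = form_val r U \<sigma>"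
proof -
 let ?t = "transpose c c'"
 note f = formD[OF f]
 note t = transpose_permutes[OF c(2,3)]
 note tr = transpose_rel[of r "\<lambda>x. - int x", OF r c(1), unfolded V_pts]
 show "form r U (?t \<circ> \<sigma>)"
 proof (rule formI[OF f(1)])
  show "\<And>x j. x \<in> V ==> j \<in> V ==> r (- int x) (int j) ==> \<exists>c\<in>U. r (int c) (int j)"
   "\<And>c c'. c \<in> U ==> c' \<in> U ==> r (int c) (int c') ==> c = c'" by (rule f(4), assumption+, rule f(5))
  show "?t \<circ> \<sigma> permutes V" by (rule permutes_compose[OF f(2) t])
  fix x assume x: "x \<in> U"
  hence "\<sigma> x \<in> V" using f(1) permutes_in_image[OF f(2)] by blast
  thus "r (- int ((?t \<circ> \<sigma>) x)) (int x)" using eqv_onD(5)[OF r tr(2) f(3)[OF x]] by simp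
 qed
 show "form_val r U (?t \<circ> \<sigma>) = form_val r U \<sigma>"
  unfolding form_val_def S_comp[OF t f(2)] mult.assoc[symmetric] E_transpose(1)[of "top_rel r", OF c] ..
qed

text \<open>Transpositions of top points make \<open>\<sigma>\<close> agree with
  \<open>\<tau>\<close> on \<open>U\<close>, one place at a time. Then the two differ by a
  permutation of \<open>V - U\<close>, which the cuts absorb.\<close>

lemma form_val_same_U:
 assumes r: "eqv_on k r" and f: "form r U \<sigma>" "form r U \<tau>"
 shows "form_val r U \<sigma> = form_val r U \<tau>"
 using f(1)
proof (induction "card {c \<in> U. \<sigma> c \<noteq> \<tau> c}" arbitrary: \<sigma> rule: less_induct)
 case less
 note s = formD[OF less.prems] and t = formD[OF f(2)]
 have fin: "finite U" using s(1) by (rule finite_subset) simp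
 show ?case
 proof (cases "\<exists>c\<in>U. \<sigma> c \<noteq> \<tau> c")
  case True
  then obtain c where c: "c \<in> U" "\<sigma> c \<noteq> \<tau> c" by blast
  let ?a = "transpose (\<sigma> c) (\<tau> c)"
  have cV: "\<sigma> c \<in> V" "\<tau> c \<in> V" using c(1) s(1) permutes_in_image[OF s(2)] permutes_in_image[OF t(2)] by blast+
  have rel: "r (- int (\<sigma> c)) (- int (\<tau> c))" by (rule eqv_onD(5)[OF r s(3)[OF c(1)] eqv_onD(4)[OF r t(3)[OF c(1)]]])
  note ft = form_top[OF r less.prems rel cV]
  have keep: "?a (\<sigma> x) = \<tau> x" if "\<sigma> x = \<tau> x" for x
  proof -
   have "x \<noteq> c" using that c(2) by blast
   hence "\<sigma> x \<noteq> \<sigma> c" "\<tau> x \<noteq> \<tau> c"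
    using permutes_inj[OF s(2)] permutes_inj[OF t(2)] by (simp_all add: inj_eq)
   thus ?thesis using that by simp
  qed
  have "{x \<in> U. (?a \<circ> \<sigma>) x \<noteq> \<tau> x} \<subset> {c \<in> U. \<sigma> c \<noteq> \<tau> c}"
  proof (rule psubsetI)
   show "{x \<in> U. (?a \<circ> \<sigma>) x \<noteq> \<tau> x} \<subseteq> {c \<in> U. \<sigma> c \<noteq> \<tau> c}" using keep by auto
   have "c \<notin> {x \<in> U. (?a \<circ> \<sigma>) x \<noteq> \<tau> x}" "c \<in> {c \<in> U. \<sigma> c \<noteq> \<tau> c}" using c by simp_all
   thus "{x \<in> U. (?a \<circ> \<sigma>) x \<noteq> \<tau> x} \<noteq> {c \<in> U. \<sigma> c \<noteq> \<tau> c}" by metis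
  qed
  hence "card {x \<in> U. (?a \<circ> \<sigma>) x \<noteq> \<tau> x} < card {c \<in> U. \<sigma> c \<noteq> \<tau> c}"
   using fin by (intro psubset_card_mono) auto
  from less.hyps[OF this ft(1)] ft(2) show ?thesis by simp
 next
  case False
  define \<pi> where "\<pi> = Hilbert_Choice.inv \<sigma> \<circ> \<tau>"
  have pV: "\<pi> permutes V" unfolding \<pi>_def by (rule permutes_compose[OF t(2) permutes_inv[OF s(2)]])
  have fix_U: "\<pi> x = x" if "x \<in> U" for x
  proof -
   have "\<tau> x = \<sigma> x" using False that by simp
   thus ?thesis unfolding \<pi>_def using permutes_inverses(2)[OF s(2)] by simp
  qed
  have "\<pi> permutes V - U"
  proof -
   have "\<pi> x = x" if "x \<notin> V - U" for x using that fix_U permutes_not_in[OF pV] by blast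
   thus ?thesis using pV unfolding permutes_def by blast
  qed
  hence p: "S \<pi> * PD (V - U) = PD (V - U)" by (rule PD_permutes) blast
  have "\<sigma> \<circ> \<pi> = \<tau>" unfolding \<pi>_def using permutes_inv_o(1)[OF s(2)] by (simp add: o_assoc)
  hence "S \<tau> * PD (V - U) = S \<sigma> * PD (V - U)"
   using S_comp[OF s(2) pV] p by (simp add: mult.assoc)
  thus ?thesis unfolding form_val_def by (simp add: mult.assoc)
 qed
qed

text \<open>A representative outside \<open>U'\<close> is exchanged for the one that
  \<open>U'\<close> has in the same block, which shrinks \<open>U - U'\<close>. When this is empty,
  \<open>U = U'\<close>, since each propagating block has exactly one representative in either
  set.\<close>

lemma form_val_unique:
 assumes r: "eqv_on k r" and f: "form r U \<sigma>" "form r U' \<tau>"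
 shows "form_val r U \<sigma> = form_val r U' \<tau>"
 using f(1)
proof (induction "card (U - U')" arbitrary: U \<sigma> rule: less_induct)
 case less
 note s = formD[OF less.prems] and t = formD[OF f(2)]
 have fin: "finite U" "finite U'" using s(1) t(1) by (auto intro: finite_subset)
 show ?case
 proof (cases "U \<subseteq> U'")
  case False
  then obtain c where c: "c \<in> U" "c \<notin> U'" by blast
  have cV: "c \<in> V" "\<sigma> c \<in> V" using c(1) s(1) permutes_in_image[OF s(2)] by blast+
  obtain d where d: "d \<in> U'" "r (int d) (int c)" using t(4)[OF cV(2,1) s(3)[OF c(1)]] by blast
  have dV: "d \<in> V" using d(1) t(1) by blast
  have cd: "r (int c) (int d)" by (rule eqv_onD(4)[OF r d(2)])
  have dU: "d \<notin> U" using s(5)[OF c(1) _ cd] c d by blast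
  note fb = form_bot[OF r less.prems cd cV(1) dV]
  have "transpose c d ` U - U' \<subset> U - U'"
  proof -
   have "x \<in> U" if "x \<in> transpose c d ` U" "x \<notin> U'" for x
    using that d(1) dU transpose_image_mem[of x c d U] by (cases "x = c"; cases "x = d") auto
   moreover have "c \<notin> transpose c d ` U" using dU by (simp add: transpose_image_mem)
   ultimately show ?thesis using c by blast
  qed
  hence "card (transpose c d ` U - U') < card (U - U')" using fin by (intro psubset_card_mono) auto
  from less.hyps[OF this fb(1)] fb(2) show ?thesis by simp
 next
  case True
  have "U' \<subseteq> U"
  proof
   fix d assume d: "d \<in> U'"
   have "d \<in> V" "\<tau> d \<in> V" using d t(1) permutes_in_image[OF t(2)] by blast+
   then obtain c where c: "c \<in> U" "r (int c) (int d)" using s(4)[OF _ _ t(3)[OF d]] by blast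
   hence "c = d" using t(5)[of c d] True d by blast
   thus "d \<in> U" using c(1) by simp
  qed
  hence "U = U'" using True by blast
  thus ?thesis using form_val_same_U[OF r less.prems] f(2) by simp
 qed
qed

text \<open>The bottom factor always absorbs \<open>Q a b\<close>. The rest changes only if two
  distinct propagating blocks are merged: then one representative is given up, and the merging has
  to appear in the top row too.\<close>

lemma form_val_merge:
 assumes r: "eqv_on k r" and f: "form r U \<sigma>" and a: "a \<in> V" "b \<in> V"
 shows "\<exists>U' \<sigma>'. form (merge a b r) U' \<sigma>' \<and> form_val (merge a b r) U' \<sigma>' = form_val r U \<sigma> * Q a b"
proof -
 note f' = formD[OF f]
 let ?r = "merge a b r"
 have mr: "?r x y" if "r x y" for x y using that by (simp add: merge_def)
 have raa: "r (int a) (int a)" "r (int b) (int b)" using eqv_onD(3)[OF r] a V_pts(1) by blast+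
 have bot: "E (bot_rel r) * Q a b = E (bot_rel ?r)"
  by (rule E_merge[OF a]) (use raa in \<open>auto simp: merge_def\<close>)
 have mab: "?r (int a) (int b)" unfolding merge_def using raa by blast
 have er: "eqv_on k ?r" using a by (intro eqv_on_merge[OF r]) auto
 have two: "\<exists>U' \<sigma>'. form ?r U' \<sigma>' \<and> form_val ?r U' \<sigma>' = form_val r U \<sigma> * Q a b"
  if c1: "c1 \<in> U" "r (int c1) (int a)" and c2: "c2 \<in> U" "r (int c2) (int b)" and nab: "\<not> r (int a) (int b)" for c1 c2
 proof -
  have ne: "c1 \<noteq> c2"
  proof
   assume "c1 = c2"
   hence "r (int a) (int b)" using eqv_onD(5)[OF r eqv_onD(4)[OF r c1(2)]] c2(2) by blast
   thus False using nab by blast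
  qed
  have cV: "c1 \<in> V" "c2 \<in> V" "\<sigma> c1 \<in> V" "\<sigma> c2 \<in> V"
   using c1(1) c2(1) f'(1) permutes_in_image[OF f'(2)] by blast+
  have mc: "?r (int c1) (int c2)" unfolding merge_def using c1(2) eqv_onD(4)[OF r c2(2)] by blast
  have at: "r x (- int (\<sigma> c1)) <-> r x (int a)" "r (- int (\<sigma> c1)) x <-> r (int a) x"
   "r x (- int (\<sigma> c2)) <-> r x (int b)" "r (- int (\<sigma> c2)) x <-> r (int b) x" for x
  proof -
   have l: "r (- int (\<sigma> c1)) (int a)" "r (- int (\<sigma> c2)) (int b)"
    using eqv_onD(5)[OF r f'(3)[OF c1(1)] c1(2)] eqv_onD(5)[OF r f'(3)[OF c2(1)] c2(2)] .
   have l': "r (int a) (- int (\<sigma> c1))" "r (int b) (- int (\<sigma> c2))" using eqv_onD(4)[OF r] l by blast+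
   show "r x (- int (\<sigma> c1)) <-> r x (int a)" using eqv_onD(5)[OF r _ l(1), of x] eqv_onD(5)[OF r _ l'(1), of x] by blast
   show "r x (- int (\<sigma> c2)) <-> r x (int b)" using eqv_onD(5)[OF r _ l(2), of x] eqv_onD(5)[OF r _ l'(2), of x] by blast
   show "r (- int (\<sigma> c1)) x <-> r (int a) x" using eqv_onD(5)[OF r l(1), of x] eqv_onD(5)[OF r l'(1), of x] by blast
   show "r (- int (\<sigma> c2)) x <-> r (int b) x" using eqv_onD(5)[OF r l(2), of x] eqv_onD(5)[OF r l'(2), of x] by blast
  qed
  have top: "E (top_rel r) * Q (\<sigma> c1) (\<sigma> c2) = E (top_rel ?r)"
  proof (rule E_merge[OF cV(3,4)])
   show "?r (- int (\<sigma> c1)) (- int (\<sigma> c2))" unfolding merge_def at using raa by blast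
  qed (simp_all add: merge_def at)
  have bot': "E (bot_rel ?r) = Q c1 c2 * E (bot_rel ?r)"
   using E_absorb[of "bot_rel ?r", OF mc cV(1,2)] E_comm[OF cV(1,2), of "bot_rel ?r"] by simp
  \<comment> \<open>The source of the additional cut at \<open>c2\<close>. The first copy of
    \<open>Q c1 c2\<close> moves left through the cuts, which avoid \<open>c1\<close> and
    \<open>c2\<close>, and through \<open>S \<sigma>\<close> into the top factor; the second copy is
    absorbed by the bottom factor.\<close>
  have q: "Q c1 c2 = Q c1 c2 * P c2 * Q c1 c2"
   using QPQ[OF cV(2,1) ne[symmetric]] Q_sym[OF cV(1,2)] by simp
  have D: "PD (V - U) * P c2 = PD (V - (U - {c2}))"
  proof -
   have "insert c2 (V - U) = V - (U - {c2})" using cV(2) c2(1) by blast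
   thus ?thesis using PD_insert[of "V - U" c2] cV(2) by simp
  qed
  have "form_val r U \<sigma> * Q a b = E (top_rel r) * S \<sigma> * PD (V - U) * E (bot_rel ?r)"
   unfolding form_val_def mult.assoc bot ..
  also have "\<dots> = E (top_rel r) * S \<sigma> * (PD (V - U) * Q c1 c2) * E (bot_rel ?r)"
   by (subst bot') (simp only: mult.assoc)
  also have "PD (V - U) * Q c1 c2 = PD (V - U) * Q c1 c2 * P c2 * Q c1 c2"
   by (subst q) (simp only: mult.assoc)
  also have "PD (V - U) * Q c1 c2 = Q c1 c2 * PD (V - U)"
   using PD_Q[OF _ cV(1,2), of "V - U"] c1(1) c2(1) by blast
  also have "Q c1 c2 * PD (V - U) * P c2 = Q c1 c2 * PD (V - (U - {c2}))" using D by (simp add: mult.assoc)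
  also have "E (top_rel r) * S \<sigma> * (Q c1 c2 * PD (V - (U - {c2})) * Q c1 c2) * E (bot_rel ?r) =
    E (top_rel r) * (S \<sigma> * Q c1 c2) * PD (V - (U - {c2})) * (Q c1 c2 * E (bot_rel ?r))"
   by (simp only: mult.assoc)
  also have "\<dots> = E (top_rel r) * Q (\<sigma> c1) (\<sigma> c2) * S \<sigma> * PD (V - (U - {c2})) * E (bot_rel ?r)"
   unfolding S_Q[OF f'(2) cV(1,2)] bot'[symmetric] by (simp only: mult.assoc)
  also have "\<dots> = form_val ?r (U - {c2}) \<sigma>" unfolding top form_val_def ..
  finally have val: "form_val ?r (U - {c2}) \<sigma> = form_val r U \<sigma> * Q a b" by (rule HOL.sym)
  have "form ?r (U - {c2}) \<sigma>"
  proof (rule formI[OF _ f'(2)])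
   show "U - {c2} \<subseteq> V" using f'(1) by blast
   show "?r (- int (\<sigma> c)) (int c)" if "c \<in> U - {c2}" for c using mr f'(3) that by blast
  next
   fix x j assume x: "x \<in> V" "j \<in> V" "?r (- int x) (int j)"
   have "\<exists>y\<in>V. \<exists>j'. r (- int y) (int j') \<and> j' \<in> V \<and> ?r (int j') (int j)"
    using x(3) unfolding merge_def[of a b r "- int x"]
   proof (elim disjE conjE)
    assume "r (- int x) (int j)"
    thus ?thesis using x eqv_onD(3)[OF er, of "int j"] V_pts(1)[of j] by blast
   next
    assume "r (- int x) (int a)" "r (int b) (int j)"
    thus ?thesis using x a raa unfolding merge_def by blast
   next
    assume "r (- int x) (int b)" "r (int a) (int j)"
    thus ?thesis using x a raa unfolding merge_def by blast
   qed
   then obtain y j' where y: "y \<in> V" "r (- int y) (int j')" "j' \<in> V" "?r (int j') (int j)" by blast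
   then obtain c where c: "c \<in> U" "r (int c) (int j')" using f'(4) by blast
   have cj: "?r (int c) (int j)" by (rule eqv_onD(5)[OF er mr[OF c(2)] y(4)])
   show "\<exists>c\<in>U - {c2}. ?r (int c) (int j)"
   proof (cases "c = c2")
    case True
    thus ?thesis using eqv_onD(5)[OF er mc, of "int j"] cj c1(1) ne by blast
   next
    case False
    thus ?thesis using c(1) cj by blast
   qed
  next
   fix c c' assume c: "c \<in> U - {c2}" "c' \<in> U - {c2}" "?r (int c) (int c')"
   have no: "\<not> r (int d) (int b)" "\<not> r (int b) (int d)" if "d \<in> U - {c2}" for d
   proof -
    show "\<not> r (int d) (int b)"
     using f'(5)[OF _ c2(1), of d] eqv_onD(5)[OF r _ eqv_onD(4)[OF r c2(2)], of "int d"] that by blast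
    thus "\<not> r (int b) (int d)" using eqv_onD(4)[OF r] by blast
   qed
   hence "r (int c) (int c')" using c unfolding merge_def by blast
   thus "c = c'" using f'(5) c by blast
  qed
  thus ?thesis using val by blast
 qed
 show ?thesis
 proof (cases "r (int a) (int b)")
  case True
  have rab: "r x (int a) \<and> r (int b) y ==> r x y" "r x (int b) \<and> r (int a) y ==> r x y" for x y
   using eqv_onD(5)[OF r eqv_onD(5)[OF r _ True], of x y] eqv_onD(5)[OF r eqv_onD(5)[OF r _ eqv_onD(4)[OF r True]], of x y] by blast+
  hence "?r = r" unfolding merge_def by (intro ext) blast
  thus ?thesis using f bot unfolding form_val_def mult.assoc by metis
 next
  case False
  show ?thesis
  proof (cases "(\<exists>c\<in>U. r (int c) (int a)) \<and> (\<exists>c\<in>U. r (int c) (int b))")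
   case True
   thus ?thesis using two False by blast
  next
   case no: False
   have prp: "\<exists>c\<in>U. r (int c) (int j)" if "r (- int x) (int j)" "x \<in> V" "j \<in> V" for x j using f'(4) that by blast
   have np: "\<not> (r (- int x) (int a) \<and> r (int b) (- int y))" "\<not> (r (- int x) (int b) \<and> r (int a) (- int y))"
    if "x \<in> V" "y \<in> V" for x y
    using no prp[OF _ that(1) a(1)] prp[OF _ that(1) a(2)] prp[OF eqv_onD(4)[OF r] that(2) a(1)] prp[OF eqv_onD(4)[OF r] that(2) a(2)] by blast+
   have top: "E (top_rel ?r) = E (top_rel r)"
    by (rule E_cong) (use np in \<open>unfold merge_def; blast\<close>)
   have "form ?r U \<sigma>"
   proof (rule formI[OF f'(1,2)])
    show "?r (- int (\<sigma> c)) (int c)" if "c \<in> U" for c using mr f'(3) that by blast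
   next
    fix x j assume x: "x \<in> V" "j \<in> V" "?r (- int x) (int j)"
    show "\<exists>c\<in>U. ?r (int c) (int j)"
     using x(3) unfolding merge_def[of a b r "- int x"]
    proof (elim disjE conjE)
     assume "r (- int x) (int j)"
     thus ?thesis using prp x mr by blast
    next
     assume "r (- int x) (int a)" "r (int b) (int j)"
     thus ?thesis using prp[OF _ x(1) a(1)] unfolding merge_def by blast
    next
     assume "r (- int x) (int b)" "r (int a) (int j)"
     thus ?thesis using prp[OF _ x(1) a(2)] unfolding merge_def by blast
    qed
   next
    fix c c' assume c: "c \<in> U" "c' \<in> U" "?r (int c) (int c')"
    have "\<not> (r (int c) (int a) \<and> r (int b) (int c'))" "\<not> (r (int c) (int b) \<and> r (int a) (int c'))"
     using no c(1,2) eqv_onD(4)[OF r, of "int b" "int c'"] eqv_onD(4)[OF r, of "int a" "int c'"] by blast+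
    hence "r (int c) (int c')" using c(3) unfolding merge_def by blast
    thus "c = c'" using f'(5) c by blast
   qed
   moreover have "form_val ?r U \<sigma> = form_val r U \<sigma> * Q a b"
    unfolding form_val_def top mult.assoc bot ..
   ultimately show ?thesis by blast
  qed
 qed
qed

text \<open>If \<open>i\<close> is alone in the bottom row of its block, the new cut simply joins
  the others, ending the propagation of that block if it had any. Otherwise the block keeps its
  other bottom points, and the cut must leave the middle of the normal form unchanged.\<close>

lemma form_val_detach:
 assumes r: "eqv_on k r" and f: "form r U \<sigma>" and i: "i \<in> V"
 shows "\<exists>U' \<sigma>'. form (detach i r) U' \<sigma>' \<and> form_val (detach i r) U' \<sigma>' = form_val r U \<sigma> * P i"
proof -
 let ?r = "detach i r"
 have neg: "- int x \<noteq> int i" for x using i by simp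
 have top: "E (top_rel ?r) = E (top_rel r)" unfolding detach_def by (simp only: neg simp_thms)
 have bP: "E (bot_rel ?r) * P i = P i * E (bot_rel ?r)"
  by (rule E_P[OF i]) (auto simp: detach_def)
 have new: "form ?r (U - {i}) \<sigma>'"
  if f: "form r U \<sigma>'" and keep: "i \<in> U ==> (\<And>j. j \<in> V ==> r (int i) (int j) ==> j = i)" for U \<sigma>'
 proof -
  note f = formD[OF f]
  show ?thesis
  proof (rule formI[OF _ f(2)])
   show "U - {i} \<subseteq> V" using f(1) by blast
   show "?r (- int (\<sigma>' c)) (int c)" if "c \<in> U - {i}" for c
    using f(3)[of c] that neg unfolding detach_def by simp
  next
   fix x j assume x: "x \<in> V" "j \<in> V" "?r (- int x) (int j)"
   hence j: "r (- int x) (int j)" "j \<noteq> i" unfolding detach_def using neg by auto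
   then obtain c where c: "c \<in> U" "r (int c) (int j)" using f(4) x by blast
   hence "c \<noteq> i" using keep[OF _ x(2)] j(2) by blast
   thus "\<exists>c\<in>U - {i}. ?r (int c) (int j)" using c j(2) unfolding detach_def by auto
  next
   fix c c' assume "c \<in> U - {i}" "c' \<in> U - {i}" "?r (int c) (int c')"
   thus "c = c'" using f(5) unfolding detach_def by blast
  qed
 qed
 show ?thesis
 proof (cases "\<exists>j\<in>V. j \<noteq> i \<and> r (int i) (int j)")
  case False
  have "form ?r (U - {i}) \<sigma>" by (rule new[OF f]) (use False in blast)
  moreover have "form_val ?r (U - {i}) \<sigma> = form_val r U \<sigma> * P i"
  proof -
   have bot: "E (bot_rel ?r) = E (bot_rel r)"
   proof (rule E_cong)
    fix x y assume xy: "x \<in> V" "y \<in> V"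
    have "x = i <-> y = i" if "r (int x) (int y)" using that False eqv_onD(4)[OF r that] xy by blast
    thus "?r (int x) (int y) = r (int x) (int y)" unfolding detach_def by auto
   qed
   have "insert i (V - U) = V - (U - {i})" using i by blast
   hence D: "PD (V - U) * P i = PD (V - (U - {i}))" using PD_insert[of "V - U" i] i by simp
   have "form_val r U \<sigma> * P i = E (top_rel r) * S \<sigma> * PD (V - U) * (E (bot_rel ?r) * P i)"
    unfolding form_val_def bot by (simp only: mult.assoc)
   also have "\<dots> = E (top_rel r) * S \<sigma> * (PD (V - U) * P i) * E (bot_rel ?r)"
    unfolding bP by (simp only: mult.assoc)
   finally show ?thesis unfolding form_val_def D top ..
  qed
  ultimately show ?thesis by blast
 next
  case True
  then obtain j where j: "j \<in> V" "j \<noteq> i" "r (int i) (int j)" by blast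
  \<comment> \<open>The representative is moved off \<open>i\<close>; then \<open>i\<close> is among
    the cut strands, and \<open>PD (V - U')\<close> provides a further factor \<open>P i\<close>
    whenever one is needed.\<close>
  obtain U' \<sigma>' where f': "form r U' \<sigma>'" "form_val r U' \<sigma>' = form_val r U \<sigma>" "i \<notin> U'"
  proof (cases "i \<in> U")
   case True
   have "j \<notin> U" using formD(5)[OF f True _ j(3)] j(2) by blast
   hence "i \<notin> transpose i j ` U" by (simp add: transpose_image_mem)
   thus ?thesis using that form_bot[OF r f j(3) i j(1)] by blast
  next
   case False
   thus ?thesis using that f by blast
  qed
  have U: "U' - {i} = U'" using f'(3) by blast
  have "form ?r (U' - {i}) \<sigma>'" by (rule new[OF f'(1)]) (use f'(3) in blast)
  moreover have "form_val ?r (U' - {i}) \<sigma>' = form_val r U \<sigma> * P i"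
  proof -
   let ?D = "PD (V - U')"
   \<comment> \<open>The old bottom factor is the new one with \<open>j\<close> and \<open>i\<close>
     merged again, so that P_i Q_{ij} P_i = P_i makes this merging disappear between two
     cuts.\<close>
   have bot: "E (bot_rel ?r) * Q i j = E (bot_rel r)"
   proof (rule E_merge[OF i j(1)])
    fix x y assume xy: "r (int x) (int y)" "x \<in> V" "y \<in> V"
    have ii: "r (int i) (int i)" using eqv_onD(3)[OF r] i V_pts(1) by blast
    have "r (int j) (int y)" if "x = i" using eqv_onD(5)[OF r eqv_onD(4)[OF r j(3)], of "int y"] xy that by blast
    moreover have "r (int x) (int j)" if "y = i" using eqv_onD(5)[OF r _ j(3), of "int x"] xy that by blast
    ultimately show "?r (int x) (int y) \<or> ?r (int x) (int i) \<and> ?r (int j) (int y) \<or> ?r (int x) (int j) \<and> ?r (int i) (int y)"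
     using xy j ii unfolding detach_def by (cases "x = i"; cases "y = i") simp_all
   qed (use j(3) in \<open>simp_all add: detach_def\<close>)
   have D: "?D * P i = ?D" using PD_insert[of "V - U'" i] i f'(3) by (simp add: insert_absorb)
   have "form_val r U' \<sigma>' * P i = E (top_rel r) * S \<sigma>' * (?D * P i) * (E (bot_rel ?r) * Q i j) * P i"
    unfolding form_val_def D bot by (simp only: mult.assoc)
   also have "\<dots> = E (top_rel r) * S \<sigma>' * ?D * (P i * E (bot_rel ?r)) * Q i j * P i" by (simp only: mult.assoc)
   also have "\<dots> = E (top_rel r) * S \<sigma>' * ?D * E (bot_rel ?r) * (P i * Q i j * P i)"
    unfolding bP[symmetric] by (simp only: mult.assoc)
   also have "\<dots> = E (top_rel r) * S \<sigma>' * ?D * (E (bot_rel ?r) * P i)"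
    unfolding PQP[OF i j(1) j(2)[symmetric]] by (simp only: mult.assoc)
   also have "\<dots> = E (top_rel r) * S \<sigma>' * (?D * P i) * E (bot_rel ?r)"
    unfolding bP by (simp only: mult.assoc)
   finally have "form_val r U' \<sigma>' * P i = form_val ?r (U' - {i}) \<sigma>'" unfolding D U form_val_def[of ?r] top .
   thus ?thesis unfolding f'(2) by (rule HOL.sym)
  qed
  ultimately show ?thesis by blast
 qed
qed

section \<open>Normal forms of words\<close>

lemma form_id: "form (id_rel k) V id" "form_val (id_rel k) V id = 1"
proof -
 show "form (id_rel k) V id" by (rule formI) (auto simp: id_rel_def pts_def permutes_id)
 have "E (top_rel (id_rel k)) = 1" "E (bot_rel (id_rel k)) = 1" by (rule E_id, simp add: id_rel_def)+
 thus "form_val (id_rel k) V id = 1" unfolding form_val_def by (simp add: S_id PD_def)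
qed

lemma swap_int_transpose: "swap_int i (int x) = int (transpose i (i + 1) x)" "1 \<le> i ==> swap_int i (- int x) = - int x"
proof -
 show "swap_int i (int x) = int (transpose i (i + 1) x)"
  by (cases "x = i"; cases "x = i + 1") (simp_all add: swap_int_def)
 show "1 \<le> i ==> swap_int i (- int x) = - int x" by (simp add: swap_int_def)
qed

text \<open>Letter by letter: right multiplication by each kind of generator was shown to turn a
  normal form of a diagram into one of the new diagram.\<close>

lemma form_word:
 assumes h: "\<And>i. 1 \<le> i ==> i < k ==> h (gen_s i) = S (transpose i (i + 1))"
  "\<And>i. 1 \<le> i ==> i \<le> k ==> h (gen_p i) = P i" "\<And>i. 1 \<le> i ==> i < k ==> h (gen_ph i) = Q i (i + 1)"
  and w: "w \<in> lists (A_gens k)"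
 shows "\<exists>U \<sigma>. form (act_word k w) U \<sigma> \<and> form_val (act_word k w) U \<sigma> = word_prod h w"
 using w
proof (induction w rule: rev_induct)
 case Nil
 thus ?case using form_id by (simp add: act_word_simps) blast
next
 case (snoc x w)
 have x: "x \<in> A_gens k" and w: "w \<in> lists (A_gens k)" using snoc.prems by auto
 have "A_gens k \<subseteq> Collect (valid_gen k)" by (auto simp: s_gens_def p_gens_def)
 hence "w \<in> lists (Collect (valid_gen k))" using w by auto
 hence r: "eqv_on k (act_word k w)" by (rule eqv_on_act_word)
 obtain U \<sigma> where f: "form (act_word k w) U \<sigma>" "form_val (act_word k w) U \<sigma> = word_prod h w" using snoc.IH w by blast
 have "\<exists>U' \<sigma>'. form (gen_act x (act_word k w)) U' \<sigma>' \<and> form_val (gen_act x (act_word k w)) U' \<sigma>' = word_prod h w * h x"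
 proof (cases x)
  case (gen_s i)
  hence i: "1 \<le> i" "i < k" using x by (auto simp: s_gens_def p_gens_def)
  have iV: "i \<in> V" "i + 1 \<in> V" using i by auto
  note t = swap_int_transpose(1)[of i] swap_int_transpose(2)[OF i(1)]
  have "form_val (gen_act x (act_word k w)) (transpose i (i + 1) ` U) (\<sigma> \<circ> transpose i (i + 1)) = word_prod h w * h x"
   unfolding gen_s gen_act.simps h(1)[OF i] f(2)[symmetric] by (rule form_transpose(2)[OF f(1) iV]) (simp_all only: t)
  moreover have "form (gen_act x (act_word k w)) (transpose i (i + 1) ` U) (\<sigma> \<circ> transpose i (i + 1))"
   unfolding gen_s gen_act.simps by (rule form_transpose(1)[OF f(1) iV]) (simp_all only: t)
  ultimately show ?thesis by blast
 next
  case (gen_p i)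
  hence i: "1 \<le> i" "i \<le> k" using x by (auto simp: s_gens_def p_gens_def)
  show ?thesis unfolding gen_p gen_act.simps h(2)[OF i] f(2)[symmetric]
   by (rule form_val_detach[OF r f(1)]) (use i in simp)
 next
  case (gen_ph i)
  hence i: "1 \<le> i" "i < k" using x by (auto simp: s_gens_def p_gens_def)
  show ?thesis unfolding gen_ph gen_act.simps h(3)[OF i] f(2)[symmetric]
   by (rule form_val_merge[OF r f(1)]) (use i in simp_all)
 next
  case (gen_e i)
  thus ?thesis using x by (auto simp: s_gens_def p_gens_def)
 qed
 thus ?case by (simp add: act_word_simps)
qed

lemma partition_complete:
 assumes h: "\<And>i. 1 \<le> i ==> i < k ==> h (gen_s i) = S (transpose i (i + 1))"
  "\<And>i. 1 \<le> i ==> i \<le> k ==> h (gen_p i) = P i" "\<And>i. 1 \<le> i ==> i < k ==> h (gen_ph i) = Q i (i + 1)"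
  and u: "u \<in> lists (A_gens k)" and v: "v \<in> lists (A_gens k)"
  and uv: "act_word k u = act_word k v"
 shows "word_prod h u = word_prod h v"
proof -
 have "A_gens k \<subseteq> Collect (valid_gen k)" by (auto simp: s_gens_def p_gens_def)
 hence "u \<in> lists (Collect (valid_gen k))" using u by auto
 hence r: "eqv_on k (act_word k u)" by (rule eqv_on_act_word)
 obtain U \<sigma> where f: "form (act_word k u) U \<sigma>" "form_val (act_word k u) U \<sigma> = word_prod h u"
  using form_word[of h, OF h u] by blast
 obtain U' \<sigma>' where f': "form (act_word k u) U' \<sigma>'" "form_val (act_word k u) U' \<sigma>' = word_prod h v"
  using form_word[of h, OF h v] uv by metis
 show ?thesis using form_val_unique[OF r f(1) f'(1)] f(2) f'(2) by simp
qed

end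

section \<open>Generation of the partition monoid\<close>

definition bot_map :: "(nat => nat) => int => int" where
 "bot_map \<sigma> a = (if a > 0 then int (\<sigma> (nat a)) else a)"

lemma bot_map_simps: "0 < i ==> bot_map \<sigma> (int i) = int (\<sigma> i)" "bot_map \<sigma> (- int i) = - int i"
 by (simp_all add: bot_map_def)

lemma bot_map_id [simp]: "bot_map id = id"
 by (simp add: bot_map_def fun_eq_iff)

lemma bot_map_comp:
 assumes "\<tau> permutes {1..k}"
 shows "bot_map (\<sigma> \<circ> \<tau>) = bot_map \<sigma> \<circ> bot_map \<tau>"
proof
 fix a :: int
 have "\<tau> (nat a) > 0" if "a > 0"
 proof (cases "nat a \<in> {1..k}")
  case True
  thus ?thesis using permutes_in_image[OF assms, of "nat a"] by simp
 next
  case False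
  thus ?thesis using permutes_not_in[OF assms, of "nat a"] that by simp
 qed
 thus "bot_map (\<sigma> \<circ> \<tau>) a = (bot_map \<sigma> \<circ> bot_map \<tau>) a" by (simp add: bot_map_def)
qed

lemma bot_map_pts:
 assumes "\<sigma> permutes {1..k}"
 shows "bot_map \<sigma> a \<in> pts k <-> a \<in> pts k"
proof (cases "a > 0")
 case True
 have "bot_map \<sigma> a \<in> pts k <-> \<sigma> (nat a) \<in> {1..k}" using True by (auto simp: bot_map_def pts_def)
 also have "\<dots> <-> nat a \<in> {1..k}" by (rule permutes_in_image[OF assms])
 also have "\<dots> <-> a \<in> pts k" using True by (auto simp: pts_def)
 finally show ?thesis .
qed (simp add: bot_map_def)

lemma swap_int_bot_map:
 assumes "1 \<le> i"
 shows "swap_int i = bot_map (transpose i (i + 1))"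
proof
 fix a
 consider "a = int i" | "a = int i + 1" | "a \<le> 0" | "a > 0" "a \<noteq> int i" "a \<noteq> int i + 1" by linarith
 thus "swap_int i a = bot_map (transpose i (i + 1)) a"
 proof cases
  case 1
  thus ?thesis using assms by (simp add: bot_map_def swap_int_def)
 next
  case 2
  hence "nat a = i + 1" by simp
  thus ?thesis using 2 by (simp add: bot_map_def swap_int_def)
 next
  case 3
  thus ?thesis using assms by (simp add: bot_map_def swap_int_def)
 next
  case 4
  hence "nat a \<noteq> i" "nat a \<noteq> i + 1" by auto
  thus ?thesis using 4 by (simp add: bot_map_def swap_int_def)
 qed
qed

text \<open>A value prescribed at one more point is arranged by a transposition of values, which by
  injectivity does not disturb the values already fixed.\<close>

lemma exists_permutation_extending:
 assumes "finite A" "A \<subseteq> U" "inj_on f A" "f ` A \<subseteq> U"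
 shows "\<exists>\<sigma>. \<sigma> permutes U \<and> (\<forall>x\<in>A. \<sigma> x = f x)"
 using assms
proof (induction A rule: finite_induct)
 case empty
 show ?case using permutes_id by blast
next
 case (insert a A)
 then obtain \<sigma> where s: "\<sigma> permutes U" "\<And>x. x \<in> A ==> \<sigma> x = f x" by auto
 let ?t = "transpose (\<sigma> a) (f a)"
 have "\<sigma> a \<in> U" "f a \<in> U" using insert.prems permutes_in_image[OF s(1)] by auto
 hence "?t \<circ> \<sigma> permutes U" by (intro permutes_compose[OF s(1)] permutes_swap_id)
 moreover have "(?t \<circ> \<sigma>) x = f x" if x: "x \<in> insert a A" for x
 proof (cases "x = a")
  case False
  hence "x \<in> A" using x by blast
  hence "f x \<noteq> f a" using insert.prems(2) insert.hyps(2) by (auto simp: inj_on_def)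
  moreover have "\<sigma> x \<noteq> \<sigma> a" using permutes_inj[OF s(1)] False by (simp add: inj_eq)
  ultimately show ?thesis using s(2)[OF \<open>x \<in> A\<close>] by simp
 qed simp
 ultimately show ?case by blast
qed

definition reachable :: "nat => (int => int => bool) => bool" where
 "reachable k r <-> r \<in> act_word k ` lists (A_gens k)"

lemma reachable_act:
 assumes "reachable k r" "x \<in> A_gens k"
 shows "reachable k (gen_act x r)"
proof -
 obtain w where w: "w \<in> lists (A_gens k)" "r = act_word k w" using assms(1) unfolding reachable_def by blast
 have "gen_act x r = act_word k (w @ [x])" using w(2) by simp
 moreover have "w @ [x] \<in> lists (A_gens k)" using w(1) assms(2) by simp
 ultimately show ?thesis unfolding reachable_def by blast
qed

lemma reachable_id: "reachable k (id_rel k)"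
proof -
 have "id_rel k = act_word k []" by simp
 thus ?thesis unfolding reachable_def by blast
qed

lemma reachable_perm:
 assumes "reachable k r" "\<sigma> permutes {1..k}"
 shows "reachable k (\<lambda>a b. r (bot_map \<sigma> a) (bot_map \<sigma> b))"
proof -
 obtain w where w: "set w \<subseteq> {1..<k}" "perm_word w = \<sigma>" using permutes_word[OF assms(2)] by blast
 have "reachable k (\<lambda>a b. r (bot_map (perm_word w) a) (bot_map (perm_word w) b))"
  using w(1)
 proof (induction w rule: rev_induct)
  case Nil
  show ?case unfolding perm_word_simps bot_map_id unfolding id_apply by (rule assms(1))
 next
  case (snoc i w)
  hence i: "1 \<le> i" "i < k" by auto
  have "transpose i (i + 1) permutes {1..k}" using i by (intro permutes_swap_id) auto
  note c = bot_map_comp[OF this, of "perm_word w"]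
  have "gen_s i \<in> A_gens k" using i by (simp add: s_gens_def)
  moreover have "reachable k (\<lambda>a b. r (bot_map (perm_word w) a) (bot_map (perm_word w) b))" using snoc by simp
  ultimately have "reachable k (gen_act (gen_s i) (\<lambda>a b. r (bot_map (perm_word w) a) (bot_map (perm_word w) b)))"
   by (rule reachable_act[rotated])
  thus ?case unfolding perm_word_simps c gen_act.simps swap_int_bot_map[OF i(1)] unfolding comp_apply .
 qed
 thus ?thesis using w(2) by simp
qed

lemma reachable_detach: "reachable k r ==> i \<in> {1..k} ==> reachable k (detach i r)"
 using reachable_act[of k r "gen_p i"] by (simp add: p_gens_def)

text \<open>The bottom points \<open>i\<close>, \<open>j\<close> are permuted to the places 1, 2,
  merged by p_{3/2}, and permuted back.\<close>

lemma reachable_merge: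
 assumes r: "reachable k r" and ij: "i \<in> {1..k}" "j \<in> {1..k}" "i \<noteq> j"
 shows "reachable k (merge i j r)"
proof -
 have k: "1 < k" using ij by auto
 have "inj_on (\<lambda>x. if x = 1 then i else j) {1, 2 :: nat}" using ij(3) by (auto simp: inj_on_def)
 moreover have "(\<lambda>x. if x = 1 then i else j) ` {1, 2 :: nat} \<subseteq> {1..k}" "{1, 2} \<subseteq> {1..k}" using ij k by auto
 ultimately obtain \<sigma> where s: "\<sigma> permutes {1..k}" "\<sigma> 1 = i" "\<sigma> 2 = j"
  using exists_permutation_extending[of "{1, 2}" "{1..k}" "\<lambda>x. if x = 1 then i else j"] by auto
 let ?s = "Hilbert_Choice.inv \<sigma>"
 have si: "?s permutes {1..k}" by (rule permutes_inv[OF s(1)])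
 have "\<sigma> \<circ> ?s = id" by (rule permutes_inv_o(1)[OF s(1)])
 hence inv: "bot_map \<sigma> (bot_map ?s a) = a" for a
  using bot_map_comp[OF si, of \<sigma>] by (metis bot_map_id comp_apply id_apply)
 have img: "bot_map \<sigma> 1 = int i" "bot_map \<sigma> 2 = int j" using s by (simp_all add: bot_map_def)
 have "gen_ph 1 \<in> A_gens k" using k by (simp add: p_gens_def)
 note act = reachable_perm[OF reachable_act[OF reachable_perm[OF r s(1)] this] si]
 have "(\<lambda>a b. gen_act (gen_ph 1) (\<lambda>a b. r (bot_map \<sigma> a) (bot_map \<sigma> b)) (bot_map ?s a) (bot_map ?s b)) = merge i j r"
  by (intro ext) (simp add: merge_def inv img)
 thus ?thesis using act by simp
qed

text \<open>The diagram whose blocks are the blocks of \<open>T\<close> together with their mirror images.\<close>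

lemma reachable_mirror:
 assumes "\<And>i j. T i j ==> i \<in> {1..k}" "\<And>i. i \<in> {1..k} ==> T i i" "\<And>i j. T i j ==> T j i"
  "\<And>i j l. T i j ==> T j l ==> T i l"
 shows "reachable k (\<lambda>a b. a \<in> pts k \<and> b \<in> pts k \<and> T (nat \<bar>a\<bar>) (nat \<bar>b\<bar>))"
 using assms
proof (induction "card {i \<in> {1..k}. \<exists>j. j \<noteq> i \<and> T i j}" arbitrary: T rule: less_induct)
 case less
 let ?r = "\<lambda>a b. a \<in> pts k \<and> b \<in> pts k \<and> T (nat \<bar>a\<bar>) (nat \<bar>b\<bar>)"
 have ip: "int i \<in> pts k" if "i \<in> {1..k}" for i using that by (auto simp: pts_def)
 have pi: "nat \<bar>a\<bar> \<in> {1..k}" if "a \<in> pts k" for a using that by (auto simp: pts_def)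
 show ?case
 proof (cases "\<exists>i j. i \<noteq> j \<and> T i j")
  case True
  then obtain i j where ij: "i \<noteq> j" "T i j" by blast
  have V: "i \<in> {1..k}" "j \<in> {1..k}" using less.prems(1)[OF ij(2)] less.prems(1)[OF less.prems(3)[OF ij(2)]] .
  \<comment> \<open>The point \<open>i\<close> is split off its block in both rows. A single merge
    of \<open>i\<close> with \<open>j\<close> in the bottom row restores both rows, since the mirror
    image of \<open>i\<close> is still joined to it.\<close>
  define T' where "T' a b <-> T a b \<and> (a = i <-> b = i)" for a b
  have "{a \<in> {1..k}. \<exists>b. b \<noteq> a \<and> T' a b} \<subset> {a \<in> {1..k}. \<exists>b. b \<noteq> a \<and> T a b}"
  proof (rule psubsetI)
   show "{a \<in> {1..k}. \<exists>b. b \<noteq> a \<and> T' a b} \<subseteq> {a \<in> {1..k}. \<exists>b. b \<noteq> a \<and> T a b}" unfolding T'_def by blast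
   have "i \<in> {a \<in> {1..k}. \<exists>b. b \<noteq> a \<and> T a b}" using ij V(1) by auto
   moreover have "i \<notin> {a \<in> {1..k}. \<exists>b. b \<noteq> a \<and> T' a b}" unfolding T'_def by blast
   ultimately show "{a \<in> {1..k}. \<exists>b. b \<noteq> a \<and> T' a b} \<noteq> {a \<in> {1..k}. \<exists>b. b \<noteq> a \<and> T a b}" by blast
  qed
  hence "card {a \<in> {1..k}. \<exists>b. b \<noteq> a \<and> T' a b} < card {a \<in> {1..k}. \<exists>b. b \<noteq> a \<and> T a b}"
   by (intro psubset_card_mono) simp_all
  hence "reachable k (\<lambda>a b. a \<in> pts k \<and> b \<in> pts k \<and> T' (nat \<bar>a\<bar>) (nat \<bar>b\<bar>))"
  proof (rule less.hyps)
   show "T' a b ==> a \<in> {1..k}" "T' a b ==> T' b a" for a b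
    using less.prems(1)[of a b] less.prems(3)[of a b] unfolding T'_def by blast+
   show "a \<in> {1..k} ==> T' a a" for a using less.prems(2)[of a] unfolding T'_def by blast
   show "T' a b ==> T' b c ==> T' a c" for a b c using less.prems(4)[of a b c] unfolding T'_def by blast
  qed
  from reachable_merge[OF this V ij(1)]
  have "reachable k (merge i j (\<lambda>a b. a \<in> pts k \<and> b \<in> pts k \<and> T' (nat \<bar>a\<bar>) (nat \<bar>b\<bar>)))" .
  moreover have "merge i j (\<lambda>a b. a \<in> pts k \<and> b \<in> pts k \<and> T' (nat \<bar>a\<bar>) (nat \<bar>b\<bar>)) = ?r"
  proof (intro ext)
   fix a b
   have gen: "T' x y \<or> T' x i \<and> T' j y \<or> T' x j \<and> T' i y <-> T x y" for x y
   proof -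
    have ji: "T j i" by (rule less.prems(3)[OF ij(2)])
    have t: "T i i" "T j j" using less.prems(2) V by blast+
    have ib: "T i y <-> T j y" using less.prems(4)[OF ji, of y] less.prems(4)[OF ij(2), of y] by blast
    have ia: "T x i <-> T x j" using less.prems(4)[OF _ ji, of x] less.prems(4)[OF _ ij(2), of x] by blast
    show ?thesis
    proof (cases "x = i")
     case True
     thus ?thesis unfolding T'_def using t ij ib by (cases "y = i") simp_all
    next
     case False
     thus ?thesis unfolding T'_def using t ij ia by (cases "y = i") auto
    qed
   qed
   thus "merge i j (\<lambda>a b. a \<in> pts k \<and> b \<in> pts k \<and> T' (nat \<bar>a\<bar>) (nat \<bar>b\<bar>)) a b = ?r a b"
    using ip[OF V(1)] ip[OF V(2)] gen[of "nat \<bar>a\<bar>" "nat \<bar>b\<bar>"] unfolding merge_def by (simp only: nat_int abs_of_nat) blast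
  qed
  ultimately show ?thesis by simp
 next
  case False
  have "?r = id_rel k"
  proof (intro ext)
   fix a b
   have "a \<in> pts k \<and> b \<in> pts k \<and> T (nat \<bar>a\<bar>) (nat \<bar>b\<bar>) <-> a \<in> pts k \<and> \<bar>a\<bar> = \<bar>b\<bar>"
   proof -
    have "T (nat \<bar>a\<bar>) (nat \<bar>b\<bar>) <-> \<bar>a\<bar> = \<bar>b\<bar>" if "a \<in> pts k"
    proof
     assume "T (nat \<bar>a\<bar>) (nat \<bar>b\<bar>)"
     hence "nat \<bar>a\<bar> = nat \<bar>b\<bar>" using False by blast
     thus "\<bar>a\<bar> = \<bar>b\<bar>" by simp
    next
     assume "\<bar>a\<bar> = \<bar>b\<bar>"
     thus "T (nat \<bar>a\<bar>) (nat \<bar>b\<bar>)" using less.prems(2)[OF pi[OF that]] by simp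
    qed
    thus ?thesis using pts_abs[of a k] pts_abs[of b k] by auto
   qed
   thus "?r a b = id_rel k a b" unfolding id_rel_abs .
  qed
  thus ?thesis using reachable_id by simp
 qed
qed

lemma reachable_detach_set:
 assumes "finite Z" "Z \<subseteq> {1..k}" "reachable k r"
 shows "reachable k (\<lambda>a b. r a b \<and> (\<forall>c\<in>Z. a = int c <-> b = int c))"
 using assms(1,2)
proof (induction Z rule: finite_induct)
 case (insert c Z)
 hence "reachable k (detach c (\<lambda>a b. r a b \<and> (\<forall>c\<in>Z. a = int c <-> b = int c)))"
  by (intro reachable_detach) auto
 moreover have "detach c (\<lambda>a b. r a b \<and> (\<forall>c\<in>Z. a = int c <-> b = int c)) =
   (\<lambda>a b. r a b \<and> (\<forall>c\<in>insert c Z. a = int c <-> b = int c))"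
  by (intro ext) (auto simp: detach_def)
 ultimately show ?case by simp
qed (use assms(3) in simp)

text \<open>Every bottom point lies below its own top point or is isolated.\<close>

lemma reachable_vertical:
 assumes r: "eqv_on k r" and v: "\<And>c b. c \<in> {1..k} ==> r (int c) b ==> b \<noteq> int c ==> r (- int c) (int c)"
 shows "reachable k r"
proof -
 note d = eqv_onD[OF r]
 let ?T = "\<lambda>i j. r (- int i) (- int j)"
 have V: "- int i \<in> pts k <-> i \<in> {1..k}" for i by (auto simp: pts_def)
 have m: "reachable k (\<lambda>a b. a \<in> pts k \<and> b \<in> pts k \<and> ?T (nat \<bar>a\<bar>) (nat \<bar>b\<bar>))"
 proof (rule reachable_mirror)
  show "?T i j ==> i \<in> {1..k}" for i j using d(1)[of "- int i" "- int j"] V by blast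
  show "i \<in> {1..k} ==> ?T i i" for i using d(3) V by blast
  show "?T i j ==> ?T j i" for i j by (rule d(4))
  show "?T i j ==> ?T j l ==> ?T i l" for i j l by (rule d(5))
 qed
 \<comment> \<open>The isolated bottom points; they are cut off from the diagram that mirrors the
   top partition.\<close>
 define Z where "Z = {c \<in> {1..k}. \<forall>b. r (int c) b \<longrightarrow> b = int c}"
 have "Z \<subseteq> {1..k}" "finite Z" unfolding Z_def by auto
 note rz = reachable_detach_set[OF this(2,1) m]
 have vert: "r a (- \<bar>a\<bar>)" "r (- \<bar>a\<bar>) a" if a: "a \<in> pts k" "\<And>c. c \<in> Z ==> a \<noteq> int c" for a
 proof -
  show "r (- \<bar>a\<bar>) a"
  proof (cases "a > 0")
   case True
   hence n: "nat a \<in> {1..k}" "int (nat a) = a" using a(1) by (auto simp: pts_def)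
   hence "nat a \<notin> Z" using a(2)[of "nat a"] by auto
   then obtain b where "r a b" "b \<noteq> a" unfolding Z_def using n by auto
   thus ?thesis using v[OF n(1), of b] n(2) True by simp
  next
   case False
   hence "- \<bar>a\<bar> = a" by simp
   thus ?thesis using d(3)[OF a(1)] by simp
  qed
  thus "r a (- \<bar>a\<bar>)" by (rule d(4))
 qed
 have "(\<lambda>a b. (a \<in> pts k \<and> b \<in> pts k \<and> ?T (nat \<bar>a\<bar>) (nat \<bar>b\<bar>)) \<and> (\<forall>c\<in>Z. a = int c <-> b = int c)) = r"
 proof (intro ext)
  fix a b
  have na: "- int (nat \<bar>a\<bar>) = - \<bar>a\<bar>" "- int (nat \<bar>b\<bar>) = - \<bar>b\<bar>" by simp_all
  have Zr: "r (int c) b <-> b = int c" if "c \<in> Z" for b c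
  proof
   assume "r (int c) b" thus "b = int c" using that unfolding Z_def by blast
  next
   assume "b = int c" thus "r (int c) b" using that d(3)[of "int c"] unfolding Z_def by (auto simp: pts_def)
  qed
  show "((a \<in> pts k \<and> b \<in> pts k \<and> ?T (nat \<bar>a\<bar>) (nat \<bar>b\<bar>)) \<and> (\<forall>c\<in>Z. a = int c <-> b = int c)) = r a b"
  proof (cases "\<exists>c\<in>Z. a = int c \<or> b = int c")
   case True
   then obtain c where c: "c \<in> Z" "a = int c \<or> b = int c" by blast
   have cp: "c \<in> {1..k}" "int c \<in> pts k" "?T c c" using c(1) d(3)[of "- int c"] unfolding Z_def by (auto simp: pts_def)
   have rab: "r a b <-> a = int c \<and> b = int c"
    using c(2) Zr[OF c(1), of b] Zr[OF c(1), of a] d(4)[of a b] d(4)[of b a] by blast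
   show ?thesis unfolding rab using c cp by auto
  next
   case False
   show ?thesis
   proof (cases "a \<in> pts k \<and> b \<in> pts k")
    case True
    hence ab: "r a (- \<bar>a\<bar>)" "r (- \<bar>a\<bar>) a" "r b (- \<bar>b\<bar>)" "r (- \<bar>b\<bar>) b" using vert[of a] vert[of b] False by blast+
    have "r (- \<bar>a\<bar>) (- \<bar>b\<bar>) <-> r a b"
     using d(5)[OF d(5)[OF ab(1)] ab(4)] d(5)[OF d(5)[OF ab(2)] ab(3)] by blast
    thus ?thesis unfolding na using True False by blast
   next
    case False
    thus ?thesis using d(1,2)[of a b] by blast
   qed
  qed
 qed
 thus ?thesis using rz by simp
qed

text \<open>Each propagating block has one bottom point here. A permutation of the bottom row moves
  it below a top point of its block, the situation of \<open>reachable_vertical\<close>.\<close>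

lemma reachable_bottom_free:
 assumes r: "eqv_on k r" and b: "\<And>i j. i \<in> {1..k} ==> j \<in> {1..k} ==> r (int i) (int j) ==> i = j"
 shows "reachable k r"
proof -
 note d = eqv_onD[OF r]
 have V: "int i \<in> pts k <-> i \<in> {1..k}" "- int i \<in> pts k <-> i \<in> {1..k}" for i by (auto simp: pts_def)
 define J where "J = {j \<in> {1..k}. \<exists>t\<in>{1..k}. r (- int t) (int j)}"
 define t where "t j = (SOME t. t \<in> {1..k} \<and> r (- int t) (int j))" for j
 have t: "t j \<in> {1..k} \<and> r (- int (t j)) (int j)" if "j \<in> J" for j
  unfolding t_def by (rule someI_ex) (use that in \<open>auto simp: J_def\<close>)
 have "inj_on t J"
 proof (rule inj_onI)
  fix i j assume ij: "i \<in> J" "j \<in> J" "t i = t j"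
  have "r (int i) (int j)" using d(5)[OF d(4)[OF conjunct2[OF t[OF ij(1)]]], of "int j"] t[OF ij(2)] ij(3) by simp
  thus "i = j" using b ij(1,2) unfolding J_def by blast
 qed
 moreover have "finite J" "J \<subseteq> {1..k}" unfolding J_def by auto
 moreover have "t ` J \<subseteq> {1..k}" using t by blast
 ultimately obtain \<sigma> where s: "\<sigma> permutes {1..k}" "\<And>j. j \<in> J ==> \<sigma> j = t j"
  using exists_permutation_extending[of J "{1..k}" t] by blast
 let ?s = "Hilbert_Choice.inv \<sigma>"
 have si: "?s permutes {1..k}" by (rule permutes_inv[OF s(1)])
 have inv: "bot_map ?s (bot_map \<sigma> a) = a" for a
  using bot_map_comp[OF s(1), of ?s] permutes_inv_o(2)[OF s(1)] by (metis bot_map_id comp_apply id_apply)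
 let ?r = "\<lambda>a b. r (bot_map ?s a) (bot_map ?s b)"
 have "reachable k ?r"
 proof (rule reachable_vertical)
  show "eqv_on k ?r"
  proof (rule eqv_onI)
   show "?r a b ==> a \<in> pts k" for a b using d(1) bot_map_pts[OF si] by blast
   show "a \<in> pts k ==> ?r a a" for a using d(3) bot_map_pts[OF si] by blast
  qed (rule d(4), assumption, rule d(5))
  fix c e assume c: "c \<in> {1..k}" "?r (int c) e" "e \<noteq> int c"
  let ?j = "?s c"
  have j: "?j \<in> {1..k}" using permutes_in_image[OF si] c(1) by blast
  have sj: "\<sigma> ?j = c" by (rule permutes_inverses(1)[OF s(1)])
  have bc: "bot_map ?s (int c) = int ?j" using c(1) bot_map_simps(1) by simp
  have "e \<in> pts k" using d(2)[OF c(2)] bot_map_pts[OF si] by blast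
  have "e < 0"
  proof (rule ccontr)
   assume "\<not> e < 0"
   hence e: "e > 0" "nat e \<in> {1..k}" using \<open>e \<in> pts k\<close> by (auto simp: pts_def)
   hence "bot_map ?s e = int (?s (nat e))" by (simp add: bot_map_def)
   hence "?j = ?s (nat e)" using b[OF j _, of "?s (nat e)"] c(2) bc permutes_in_image[OF si] e(2) by simp
   hence "c = nat e" using permutes_inj[OF si] by (simp add: inj_eq)
   thus False using c(3) e(1) by simp
  qed
  hence n: "nat (- e) \<in> {1..k}" "bot_map ?s e = - int (nat (- e))" using \<open>e \<in> pts k\<close> by (auto simp: pts_def bot_map_def)
  have "r (- int (nat (- e))) (int ?j)" using d(4)[OF c(2)] unfolding bc n(2) .
  hence "?j \<in> J" using n(1) j unfolding J_def by blast
  hence "r (- int c) (int ?j)" using t[of ?j] s(2)[of ?j] sj by simp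
  thus "?r (- int c) (int c)" unfolding bc bot_map_simps(2) .
 qed
 from reachable_perm[OF this s(1)] show ?thesis unfolding inv .
qed

text \<open>Bottom points in a common block are detached one by one, and
  \<open>merge i j (detach i r) = r\<close> undoes each step.\<close>

lemma reachable_eqv_on:
 assumes "eqv_on k r"
 shows "reachable k r"
 using assms
proof (induction "card {i \<in> {1..k}. \<exists>j\<in>{1..k}. j \<noteq> i \<and> r (int i) (int j)}" arbitrary: r rule: less_induct)
 case less
 note d = eqv_onD[OF less.prems]
 show ?case
 proof (cases "\<exists>i\<in>{1..k}. \<exists>j\<in>{1..k}. j \<noteq> i \<and> r (int i) (int j)")
  case True
  then obtain i j where ij: "i \<in> {1..k}" "j \<in> {1..k}" "j \<noteq> i" "r (int i) (int j)" by blast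
  let ?r = "detach i r"
  let ?A = "\<lambda>r. {i \<in> {1..k}. \<exists>j\<in>{1..k}. j \<noteq> i \<and> r (int i) (int j)}"
  have "?A ?r \<subset> ?A r"
  proof (rule psubsetI)
   show "?A ?r \<subseteq> ?A r" unfolding detach_def by blast
   have "i \<in> ?A r" using ij by blast
   moreover have "i \<notin> ?A ?r" unfolding detach_def by auto
   ultimately show "?A ?r \<noteq> ?A r" by blast
  qed
  hence "card (?A ?r) < card (?A r)" by (intro psubset_card_mono) simp_all
  hence "reachable k ?r" using less.hyps eqv_on_detach[OF less.prems] by blast
  hence "reachable k (merge i j ?r)" using reachable_merge ij by blast
  moreover have "merge i j ?r = r"
  proof (intro ext)
   fix a b
   have ji: "r (int j) (int i)" by (rule d(4)[OF ij(4)])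
   have rr: "r (int i) (int i)" "r (int j) (int j)" using d(3)[OF d(1)[OF ij(4)]] d(3)[OF d(2)[OF ij(4)]] .
   have 1: "r a (int i) <-> r a (int j)" "r (int i) b <-> r (int j) b"
    using d(5)[OF _ ij(4), of a] d(5)[OF _ ji, of a] d(5)[OF ij(4), of b] d(5)[OF ji, of b] by blast+
   have 2: "r a (int j) ==> r (int j) b ==> r a b" by (rule d(5))
   show "merge i j ?r a b = r a b"
   proof (cases "a = int i")
    case True
    thus ?thesis unfolding merge_def detach_def using 1(2) rr ij(3) by (cases "b = int i") simp_all
   next
    case False
    thus ?thesis unfolding merge_def detach_def using 1(1) 2 rr ij(3) by (cases "b = int i") auto
   qed
  qed
  ultimately show ?thesis by simp
 next
  case False
  have "i = j" if "i \<in> {1..k}" "j \<in> {1..k}" "r (int i) (int j)" for i j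
  proof (rule ccontr)
   assume "i \<noteq> j"
   hence "\<exists>i\<in>{1..k}. \<exists>j\<in>{1..k}. j \<noteq> i \<and> r (int i) (int j)" using that by metis
   thus False using False by contradiction
  qed
  thus ?thesis by (rule reachable_bottom_free[OF less.prems])
 qed
qed

lemma A_gens_valid: "A_gens k \<subseteq> Collect (valid_gen k)"
 using s_gens_valid p_gens_valid by blast

lemma A_set_eq: "A_set k = diag k ` act_word k ` lists (A_gens k)"
proof (intro equalityI subsetI)
 fix d assume d: "d \<in> A_set k"
 have "rel d \<in> act_word k ` lists (A_gens k)"
  using reachable_eqv_on[OF eqv_on_rel[OF d]] unfolding reachable_def .
 hence "diag k (rel d) \<in> diag k ` act_word k ` lists (A_gens k)" by (rule imageI)
 thus "d \<in> diag k ` act_word k ` lists (A_gens k)" using diag_rel[OF d] by simp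
next
 fix d assume "d \<in> diag k ` act_word k ` lists (A_gens k)"
 then obtain w where w: "w \<in> lists (A_gens k)" "d = diag k (act_word k w)" by blast
 have "w \<in> lists (Collect (valid_gen k))" using w(1) lists_mono[OF A_gens_valid[of k]] by blast
 thus "d \<in> A_set k" using diag_in_A_set[OF eqv_on_act_word] w(2) by blast
qed

section \<open>Validity of the relations of A_k\<close>

lemma detach_detach_swap:
 assumes "eqv_on k r" "1 \<le> i" "i < k"
 shows "detach (i + 1) (detach i (gen_act (gen_s i) r)) = detach (i + 1) (detach i r)"
  "gen_act (gen_s i) (detach (i + 1) (detach i r)) = detach (i + 1) (detach i r)"
proof -
 have "int i \<in> pts k" "int i + 1 \<in> pts k" using assms(2,3) by (auto simp: pts_def)
 hence rr: "r (int i) (int i)" "r (int i + 1) (int i + 1)" using eqv_onD(3)[OF assms(1)] by blast+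
 show "detach (i + 1) (detach i (gen_act (gen_s i) r)) = detach (i + 1) (detach i r)"
  "gen_act (gen_s i) (detach (i + 1) (detach i r)) = detach (i + 1) (detach i r)"
  by (intro ext; use rr in \<open>force simp: detach_def swap_int_def\<close>)+
qed

lemma merge_swap:
 assumes "eqv_on k r" "1 \<le> i" "i < k"
 shows "merge i (i + 1) (gen_act (gen_s i) r) = merge i (i + 1) r"
  "gen_act (gen_s i) (merge i (i + 1) r) = merge i (i + 1) r"
proof -
 let ?m = "merge i (i + 1) r"
 have p: "int i \<in> pts k" "int i + 1 \<in> pts k" using assms(2,3) by (auto simp: pts_def)
 hence rr: "r (int i) (int i)" "r (int i + 1) (int i + 1)" using eqv_onD(3)[OF assms(1)] by blast+
 have em: "eqv_on k ?m" using assms by (intro eqv_on_merge) auto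
 note d = eqv_onD[OF em]
 have m: "?m (int i) (int i + 1)" "?m (int i + 1) (int i)" using rr by (simp_all add: merge_def add.commute)
 have s: "?m a (swap_int i a)" "?m (swap_int i a) a" if "a \<in> pts k" for a
  using m d(3)[OF that] by (simp_all add: swap_int_def)
 have "?m (swap_int i a) (swap_int i b) <-> ?m a b" for a b
 proof (cases "a \<in> pts k \<and> b \<in> pts k")
  case True
  thus ?thesis
   using d(5)[OF d(5)[OF s(1), of a "swap_int i b"] s(2)[of b]] d(5)[OF d(5)[OF s(2), of a b] s(1)[of b]] by blast
 next
  case False
  thus ?thesis using d(1,2)[of a b] d(1,2)[of "swap_int i a" "swap_int i b"] swap_int_pts[OF assms(2,3)] by blast
 qed
 thus m2: "gen_act (gen_s i) ?m = ?m" by simp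
 have g: "swap_int i (int i) = int (i + 1)" "swap_int i (int (i + 1)) = int i" by (simp_all add: swap_int_def)
 have "merge i (i + 1) (gen_act (gen_s i) r) = gen_act (gen_s i) ?m"
  unfolding gen_act.simps merge_def g by (intro ext) blast
 thus "merge i (i + 1) (gen_act (gen_s i) r) = ?m" unfolding m2 .
qed

text \<open>Doubling turns the rational indices into integers, where parity excludes the values of
  the other kind of generator.\<close>

lemma half_index_mem:
 "index (gen_p j) \<in> {of_nat i - 1/2, of_nat i, of_nat i + 1/2, of_nat i + 1, of_nat i + 3/2} <-> j = i \<or> j = i + 1"
 "index (gen_ph j) \<in> {of_nat i - 1/2, of_nat i, of_nat i + 1/2, of_nat i + 1, of_nat i + 3/2} <->
  j + 1 = i \<or> j = i \<or> j = i + 1"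
proof -
 have half: "rat_of_int x / 2 \<in> {rat_of_int a / 2, rat_of_int b / 2, rat_of_int c / 2, rat_of_int d / 2, rat_of_int e / 2}
  <-> x \<in> {a, b, c, d, e}" for x a b c d e by simp
 have h: "rat_of_nat i - 1/2 = of_int (2 * int i - 1) / 2" "rat_of_nat i = of_int (2 * int i) / 2"
  "rat_of_nat i + 1/2 = of_int (2 * int i + 1) / 2" "rat_of_nat i + 1 = of_int (2 * int i + 2) / 2"
  "rat_of_nat i + 3/2 = of_int (2 * int i + 3) / 2" for i by (simp_all add: field_simps)
 show "index (gen_p j) \<in> {of_nat i - 1/2, of_nat i, of_nat i + 1/2, of_nat i + 1, of_nat i + 3/2} <-> j = i \<or> j = i + 1"
  unfolding index.simps h(1,3,4,5)[of i] unfolding h(2)[of i] h(2)[of j] half by (auto; presburger)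
 show "index (gen_ph j) \<in> {of_nat i - 1/2, of_nat i, of_nat i + 1/2, of_nat i + 1, of_nat i + 3/2} <->
  j + 1 = i \<or> j = i \<or> j = i + 1"
  unfolding index.simps h(1,3,4,5)[of i] h(3)[of j] unfolding h(2)[of i] half by (auto; presburger)
qed

lemma SP_rels_sound:
 assumes uv: "(u, v) \<in> SP_rels k"
 shows "act_word k u = act_word k v"
proof -
 have a: "act_word k [x] = gen_act x (id_rel k)" "act_word k [x, y] = gen_act y (gen_act x (id_rel k))"
  "act_word k [x, y, z] = gen_act z (gen_act y (gen_act x (id_rel k)))"
  "act_word k [x, y, z, x', y'] = gen_act y' (gen_act x' (gen_act z (gen_act y (gen_act x (id_rel k)))))" for x y z x' y'
  by (simp_all add: act_word_def)
 note e = eqv_on_id_rel[of k]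
 from uv show ?thesis unfolding SP_rels_def Un_iff mem_Collect_eq prod.inject conj_assoc
 proof (elim disjE exE conjE, goal_cases)
  case (1 i)
  thus ?thesis using detach_detach_swap(1)[OF e, of i] unfolding 1(1,2) a by simp
 next
  case (2 i)
  thus ?thesis using detach_detach_swap(2)[OF e, of i] unfolding 2(1,2) a by simp
 next
  case (3 i)
  thus ?thesis using merge_swap(1)[OF e, of i] unfolding 3(1,2) a by simp
 next
  case (4 i)
  thus ?thesis using merge_swap(2)[OF e, of i] unfolding 4(1,2) a by simp
 next
  case (5 i)
  have "swap_int i x = int i <-> x = int (i + 1)" for x by (auto simp: swap_int_def)
  thus ?thesis unfolding 5(1,2) a gen_act.simps by (intro ext) (simp add: detach_def)
 next
  case (6 i)
  have g: "swap_int i (swap_int (i + 1) (int i)) = int (i + 1)" "swap_int i (swap_int (i + 1) (int (i + 1))) = int (i + 1 + 1)"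
   by (simp_all add: swap_int_def)
  show ?thesis unfolding 6(1,2) a gen_act.simps by (intro ext) (simp only: merge_def swap_int_simps(1) g)
 next
  case (7 i x)
  have "(\<exists>j. x = gen_p j) \<or> (\<exists>j. x = gen_ph j)" using 7(4) unfolding p_gens_def by blast
  then consider j where "x = gen_p j" "j \<noteq> i" "j \<noteq> i + 1"
   | j where "x = gen_ph j" "j + 1 \<noteq> i" "j \<noteq> i" "j \<noteq> i + 1"
   using 7(5) half_index_mem(1)[of _ i] half_index_mem(2)[of _ i] by metis
  thus ?thesis
  proof cases
   case (1 j)
   hence "swap_int i x = int j <-> x = int j" for x by (auto simp: swap_int_def)
   thus ?thesis unfolding 7(1,2) 1(1) a gen_act.simps by (intro ext) (simp only: detach_def)
  next
   case (2 j)
   hence "swap_int i (int j) = int j" "swap_int i (int (j + 1)) = int (j + 1)" by (auto simp: swap_int_def)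
   thus ?thesis unfolding 7(1,2) 2(1) a gen_act.simps by (intro ext) (simp only: merge_def)
  qed
 qed
qed

lemma SP_rels_lists: "SP_rels k \<subseteq> lists (A_gens k) \<times> lists (A_gens k)"
proof -
 have "gen_s i \<in> s_gens k" "gen_p i \<in> p_gens k" "gen_p (i + 1) \<in> p_gens k" "gen_ph i \<in> p_gens k" if "i \<in> {1..<k}" for i
  using that by (simp_all add: s_gens_def p_gens_def)
 thus ?thesis unfolding SP_rels_def by (intro Un_least subsetI; elim CollectE exE conjE; simp)
qed

lemma A_rels_lists: "A_rels k \<subseteq> lists (A_gens k) \<times> lists (A_gens k)"
proof -
 have "lists (s_gens k) \<subseteq> lists (A_gens k)" "lists (p_gens k) \<subseteq> lists (A_gens k)"
  by (rule lists_mono, blast)+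
 thus ?thesis using S_rels_lists[of k] P_rels_lists[of k] SP_rels_lists[of k] unfolding A_rels_def by blast
qed

lemma A_rels_sound: "(u, v) \<in> A_rels k ==> act_word k u = act_word k v"
 unfolding A_rels_def using S_rels_sound P_rels_sound SP_rels_sound by blast

section \<open>Consequences of the relations of A_k\<close>

locale partition_presentation =
 fixes k :: nat and h :: "generator => 'm::monoid_mult"
 assumes rels: "\<And>u v. (u, v) \<in> A_rels k ==> word_prod h u = word_prod h v"
  and compat: "\<And>u v. u \<in> lists (A_gens k) ==> v \<in> lists (A_gens k) ==>
   word_prod h u = word_prod h v ==> act_word k u = act_word k v"
begin

lemma p_idem: "1 \<le> i ==> i \<le> k ==> h (gen_p i) * h (gen_p i) = h (gen_p i)"
proof -
 assume "1 \<le> i" "i \<le> k"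
 hence "gen_p i \<in> p_gens k" by (simp add: p_gens_def)
 hence "([gen_p i, gen_p i], [gen_p i]) \<in> A_rels k" unfolding A_rels_def P_rels_def by blast
 from rels[OF this] show ?thesis by simp
qed

lemma q_idem: "1 \<le> i ==> i < k ==> h (gen_ph i) * h (gen_ph i) = h (gen_ph i)"
proof -
 assume "1 \<le> i" "i < k"
 hence "gen_ph i \<in> p_gens k" by (simp add: p_gens_def)
 hence "([gen_ph i, gen_ph i], [gen_ph i]) \<in> A_rels k" unfolding A_rels_def P_rels_def by blast
 from rels[OF this] show ?thesis by simp
qed

lemma p_rel_commute:
 assumes "x \<in> p_gens k" "y \<in> p_gens k" "\<bar>index x - index y\<bar> > 1/2"
 shows "h x * h y = h y * h x"
proof -
 have "([x, y], [y, x]) \<in> A_rels k" unfolding A_rels_def P_rels_def using assms by blast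
 from rels[OF this] show ?thesis by simp
qed

lemma p_commute:
 assumes "1 \<le> i" "i < j" "j \<le> k"
 shows "h (gen_p i) * h (gen_p j) = h (gen_p j) * h (gen_p i)"
proof (rule p_rel_commute)
 have "of_nat j \<ge> (of_nat (i + 1) :: rat)" using assms by (intro of_nat_mono) simp
 thus "\<bar>index (gen_p i) - index (gen_p j)\<bar> > 1/2" by simp
qed (use assms in \<open>simp_all add: p_gens_def\<close>)

lemma q_commute:
 assumes "1 \<le> i" "i < j" "j < k"
 shows "h (gen_ph i) * h (gen_ph j) = h (gen_ph j) * h (gen_ph i)"
proof (rule p_rel_commute)
 have "of_nat j \<ge> (of_nat (i + 1) :: rat)" using assms by (intro of_nat_mono) simp
 thus "\<bar>index (gen_ph i) - index (gen_ph j)\<bar> > 1/2" by simp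
qed (use assms in \<open>simp_all add: p_gens_def\<close>)

text \<open>This and some of the following relations are extracted for the smallest indices only;
  conjugation by permutations spreads them to all points.\<close>

lemma q1_p3: "3 \<le> k ==> h (gen_ph 1) * h (gen_p 3) = h (gen_p 3) * h (gen_ph 1)"
 by (rule p_rel_commute) (simp_all add: p_gens_def)

lemma pqp: "2 \<le> k ==> h (gen_p 1) * h (gen_ph 1) * h (gen_p 1) = h (gen_p 1)"
 and qpq: "2 \<le> k ==> h (gen_ph 1) * h (gen_p 1) * h (gen_ph 1) = h (gen_ph 1)"
proof -
 assume k: "2 \<le> k"
 have g: "gen_p 1 \<in> p_gens k" "gen_ph 1 \<in> p_gens k" using k by (simp_all add: p_gens_def)
 have i: "\<bar>index (gen_p 1) - index (gen_ph 1)\<bar> = 1/2" "\<bar>index (gen_ph 1) - index (gen_p 1)\<bar> = 1/2" by simp_all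
 have "([gen_p 1, gen_ph 1, gen_p 1], [gen_p 1]) \<in> A_rels k" "([gen_ph 1, gen_p 1, gen_ph 1], [gen_ph 1]) \<in> A_rels k"
  unfolding A_rels_def P_rels_def using g i by blast+
 from rels[OF this(1)] rels[OF this(2)] show "h (gen_p 1) * h (gen_ph 1) * h (gen_p 1) = h (gen_p 1)"
  "h (gen_ph 1) * h (gen_p 1) * h (gen_ph 1) = h (gen_ph 1)" by (simp_all add: mult.assoc)
qed

lemma SP_relsI: "(u, v) \<in> SP_rels k ==> word_prod h u = word_prod h v"
 by (rule rels) (simp add: A_rels_def)

lemma pps: "2 \<le> k ==> h (gen_p 1) * h (gen_p 2) * h (gen_s 1) = h (gen_p 1) * h (gen_p 2)"
proof -
 assume "2 \<le> k"
 hence "1 \<in> {1..<k}" by simp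
 hence "([gen_p 1, gen_p (1+1), gen_s 1], [gen_p 1, gen_p (1+1)]) \<in> SP_rels k" unfolding SP_rels_def
  by blast
 from SP_relsI[OF this] show ?thesis by (simp add: mult.assoc numeral_2_eq_2)
qed

lemma s_q: "1 \<le> i ==> i < k ==> h (gen_s i) * h (gen_ph i) = h (gen_ph i)"
 and q_s: "1 \<le> i ==> i < k ==> h (gen_ph i) * h (gen_s i) = h (gen_ph i)"
 and sps: "1 \<le> i ==> i < k ==> h (gen_s i) * h (gen_p i) * h (gen_s i) = h (gen_p (i + 1))"
proof -
 assume "1 \<le> i" "i < k"
 hence "i \<in> {1..<k}" by simp
 hence "([gen_s i, gen_ph i], [gen_ph i]) \<in> SP_rels k" "([gen_ph i, gen_s i], [gen_ph i]) \<in> SP_rels k"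
  "([gen_s i, gen_p i, gen_s i], [gen_p (i+1)]) \<in> SP_rels k" unfolding SP_rels_def by blast+
 note this[THEN SP_relsI]
 thus "h (gen_s i) * h (gen_ph i) = h (gen_ph i)" "h (gen_ph i) * h (gen_s i) = h (gen_ph i)"
  "h (gen_s i) * h (gen_p i) * h (gen_s i) = h (gen_p (i + 1))" by (simp_all add: mult.assoc)
qed

lemma ssqss: "1 \<le> i ==> i + 1 < k ==>
  h (gen_s i) * h (gen_s (i + 1)) * h (gen_ph i) * h (gen_s (i + 1)) * h (gen_s i) = h (gen_ph (i + 1))"
proof -
 assume i: "1 \<le> i" "i + 1 < k"
 hence "i \<in> {1..<k} \<and> i + 1 \<in> {1..<k}" by simp
 hence "([gen_s i, gen_s (i+1), gen_ph i, gen_s (i+1), gen_s i], [gen_ph (i+1)]) \<in> SP_rels k" unfolding SP_rels_def by blast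
 from SP_relsI[OF this] show ?thesis by (simp add: mult.assoc)
qed

lemma s_commute:
 assumes i: "1 \<le> i" "i < k"
 shows "1 \<le> j ==> j \<le> k ==> j \<noteq> i ==> j \<noteq> i + 1 ==> h (gen_s i) * h (gen_p j) = h (gen_p j) * h (gen_s i)"
  "1 \<le> j ==> j + 1 < i \<or> i + 1 < j ==> j < k ==> h (gen_s i) * h (gen_ph j) = h (gen_ph j) * h (gen_s i)"
proof -
 have *: "h (gen_s i) * h x = h x * h (gen_s i)"
  if "x \<in> p_gens k" "index x \<notin> {of_nat i - 1/2, of_nat i, of_nat i + 1/2, of_nat i + 1, of_nat i + 3/2}" for x
 proof -
  have "([gen_s i, x], [x, gen_s i]) \<in> SP_rels k" unfolding SP_rels_def by (rule UnI2) (use i that in auto)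
  from SP_relsI[OF this] show ?thesis by simp
 qed
 show "1 \<le> j ==> j \<le> k ==> j \<noteq> i ==> j \<noteq> i + 1 ==> h (gen_s i) * h (gen_p j) = h (gen_p j) * h (gen_s i)"
  by (rule *) (simp add: p_gens_def, unfold half_index_mem, simp)
 show "1 \<le> j ==> j + 1 < i \<or> i + 1 < j ==> j < k ==> h (gen_s i) * h (gen_ph j) = h (gen_ph j) * h (gen_s i)"
  by (rule *) (simp add: p_gens_def, unfold half_index_mem, auto)
qed

section \<open>Permutations in the presented monoid\<close>

sublocale sym_relations "\<lambda>i. h (gen_s i)" k
 by (rule sym_relationsI) (rule rels, simp add: A_rels_def)

lemma W_eqI:
 assumes "set u \<subseteq> {1..<k}" "set v \<subseteq> {1..<k}" "perm_word u = perm_word v"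
 shows "W u = W v"
proof (rule sym_complete[OF _ assms])
 fix u v assume uv: "set u \<subseteq> {1..<k}" "set v \<subseteq> {1..<k}" "W u = W v"
 have l: "map gen_s w \<in> lists (A_gens k)" if "set w \<subseteq> {1..<k}" for w
  using map_in_lists[OF that, of gen_s] lists_mono[of "s_gens k" "A_gens k"] unfolding s_gens_def by blast
 have "word_prod h (map gen_s u) = word_prod h (map gen_s v)" using uv(3) by (simp add: comp_def)
 hence "act_word k (map gen_s u) = act_word k (map gen_s v)" by (rule compat[OF l[OF uv(1)] l[OF uv(2)]])
 thus "perm_word u = perm_word v" by (rule perm_word_eqI[OF uv(1,2)])
qed

text \<open>The value does not depend on the chosen word, by the completeness of the relations of
  the symmetric group (\<open>W_eqI\<close>).\<close>

definition S :: "(nat => nat) => 'm" where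
 "S \<sigma> = W (SOME w. set w \<subseteq> {1..<k} \<and> perm_word w = \<sigma>)"

lemma S_word:
 assumes "set w \<subseteq> {1..<k}"
 shows "S (perm_word w) = W w"
proof -
 have "set (SOME w'. set w' \<subseteq> {1..<k} \<and> perm_word w' = perm_word w) \<subseteq> {1..<k} \<and>
   perm_word (SOME w'. set w' \<subseteq> {1..<k} \<and> perm_word w' = perm_word w) = perm_word w"
  by (rule someI_ex) (use assms in blast)
 thus ?thesis unfolding S_def by (intro W_eqI assms) simp_all
qed

lemma S_id: "S id = 1"
 using S_word[of "[]"] by (simp only: perm_word_simps list.map prod_list.Nil) simp

lemma S_comp:
 assumes "\<sigma> permutes {1..k}" "\<tau> permutes {1..k}"
 shows "S (\<sigma> \<circ> \<tau>) = S \<sigma> * S \<tau>"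
proof -
 obtain u v where uv: "set u \<subseteq> {1..<k}" "perm_word u = \<sigma>" "set v \<subseteq> {1..<k}" "perm_word v = \<tau>"
  using permutes_word[OF assms(1)] permutes_word[OF assms(2)] by blast
 have "S (perm_word (u @ v)) = W (u @ v)" by (rule S_word) (use uv in simp)
 thus ?thesis using S_word[OF uv(1)] S_word[OF uv(3)] uv(2,4) by (simp only: perm_word_append map_append prod_list.append)
qed

lemma S_gen: "1 \<le> i ==> i < k ==> S (transpose i (i + 1)) = h (gen_s i)"
proof -
 assume i: "1 \<le> i" "i < k"
 have "perm_word [i] = transpose i (i + 1)" by (simp add: perm_word_def)
 thus ?thesis using S_word[of "[i]"] i by simp
qed

lemma S_inv:
 assumes "\<sigma> permutes {1..k}"
 shows "S \<sigma> * S (Hilbert_Choice.inv \<sigma>) = 1" "S (Hilbert_Choice.inv \<sigma>) * S \<sigma> = 1"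
 using S_comp[OF assms permutes_inv[OF assms]] S_comp[OF permutes_inv[OF assms] assms] permutes_inv_o[OF assms] S_id by simp_all

text \<open>Applied with \<open>c = 1\<close> to all permutations and with \<open>c = 3\<close> to
  those fixing 1 and 2.\<close>

lemma perm_induct [consumes 2, case_names id step]:
 assumes "\<sigma> permutes {c..k}" "1 \<le> c" and "Pr id"
  and "\<And>i \<tau>. c \<le> i ==> i < k ==> \<tau> permutes {c..k} ==> Pr \<tau> ==> Pr (\<tau> \<circ> transpose i (i + 1))"
 shows "Pr \<sigma>"
proof -
 obtain w where w: "set w \<subseteq> {c..<k}" "perm_word w = \<sigma>" using permutes_word[OF assms(1)] by blast
 have "Pr (perm_word w)" using w(1)
 proof (induction w rule: rev_induct)
  case Nil
  show ?case unfolding perm_word_simps by (rule assms(3))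
 next
  case (snoc i w)
  hence i: "c \<le> i" "i < k" and w: "set w \<subseteq> {c..<k}" by auto
  show ?case unfolding perm_word_simps by (rule assms(4)[OF i perm_word_permutes[OF w] snoc.IH[OF w]])
 qed
 thus ?thesis using w(2) by simp
qed

lemma s_p:
 assumes i: "1 \<le> i" "i < k" and a: "1 \<le> a" "a \<le> k"
 shows "h (gen_s i) * h (gen_p a) = h (gen_p (transpose i (i + 1) a)) * h (gen_s i)"
proof -
 have ss: "h (gen_s i) * h (gen_s i) = 1" by (rule sq[OF i])
 consider "a = i" | "a = i + 1" | "a \<noteq> i" "a \<noteq> i + 1" by blast
 thus ?thesis
 proof cases
  case 1
  have "h (gen_s i) * h (gen_p i) = h (gen_s i) * h (gen_p i) * (h (gen_s i) * h (gen_s i))" unfolding ss by simp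
  also have "\<dots> = h (gen_s i) * h (gen_p i) * h (gen_s i) * h (gen_s i)" by (simp only: mult.assoc)
  finally show ?thesis unfolding sps[OF i] 1 by simp
 next
  case 2
  have "h (gen_s i) * h (gen_p (i + 1)) = h (gen_s i) * (h (gen_s i) * h (gen_p i) * h (gen_s i))" using sps[OF i] by simp
  also have "\<dots> = h (gen_s i) * h (gen_s i) * h (gen_p i) * h (gen_s i)" by (simp only: mult.assoc)
  finally show ?thesis unfolding ss 2 by simp
 next
  case 3
  thus ?thesis using s_commute(1)[OF i a] by simp
 qed
qed

lemma S_P:
 assumes "\<sigma> permutes {1..k}" "a \<in> {1..k}"
 shows "S \<sigma> * h (gen_p a) = h (gen_p (\<sigma> a)) * S \<sigma>"
 using assms(1) HOL.refl[of "1::nat", THEN eq_refl] assms(2)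
proof (induction \<sigma> arbitrary: a rule: perm_induct)
 case id
 show ?case unfolding S_id by simp
next
 case (step i \<tau>)
 let ?t = "transpose i (i + 1)"
 have t: "?t permutes {1..k}" using step.hyps by (intro permutes_swap_id) auto
 have ta: "?t a \<in> {1..k}" using permutes_in_image[OF t] step.prems by blast
 have "S (\<tau> \<circ> ?t) * h (gen_p a) = S \<tau> * (h (gen_s i) * h (gen_p a))"
  unfolding S_comp[OF step.hyps(3) t] S_gen[OF step.hyps(1,2)] by (simp only: mult.assoc)
 also have "\<dots> = S \<tau> * h (gen_p (?t a)) * h (gen_s i)" using s_p[OF step.hyps(1,2), of a] step.prems by (simp add: mult.assoc)
 also have "\<dots> = h (gen_p ((\<tau> \<circ> ?t) a)) * S (\<tau> \<circ> ?t)"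
  unfolding step.IH[OF ta] S_comp[OF step.hyps(3) t] S_gen[OF step.hyps(1,2)] by (simp only: mult.assoc comp_apply)
 finally show ?case .
qed

text \<open>Permutations of \<open>{3..k}\<close> are products of s_i with \<open>i\<close> at least
  3, and each of these commutes with p_{3/2} by a defining relation.\<close>

lemma S_stab:
 assumes "\<sigma> permutes {3..k}"
 shows "S \<sigma> * h (gen_ph 1) = h (gen_ph 1) * S \<sigma>"
proof -
 have "1 \<le> (3::nat)" by simp
 with assms show ?thesis
proof (induction \<sigma> rule: perm_induct)
 case id
 thus ?case by (simp only: S_id mult_1_left mult_1_right)
next
 case (step i \<tau>)
 let ?t = "transpose i (i + 1)"
 have i: "1 \<le> i" "i < k" using step.hyps by auto
 have t: "?t permutes {1..k}" using i by (intro permutes_swap_id) auto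
 have u: "\<tau> permutes {1..k}" by (rule permutes_subset[OF step.hyps(3)]) auto
 have s: "h (gen_s i) * h (gen_ph 1) = h (gen_ph 1) * h (gen_s i)" by (rule s_commute(2)[OF i]) (use step.hyps in auto)
 have "S (\<tau> \<circ> ?t) * h (gen_ph 1) = S \<tau> * (h (gen_s i) * h (gen_ph 1))"
  unfolding S_comp[OF u t] S_gen[OF i] by (simp only: mult.assoc)
 also have "\<dots> = S \<tau> * h (gen_ph 1) * h (gen_s i)" unfolding s by (simp only: mult.assoc)
 also have "\<dots> = h (gen_ph 1) * S (\<tau> \<circ> ?t)" unfolding step.IH S_comp[OF u t] S_gen[OF i] by (simp only: mult.assoc)
 finally show ?case .
qed
qed

section \<open>Conjugation and the merging of arbitrary columns\<close>

definition conj :: "(nat => nat) => 'm => 'm" where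
 "conj \<sigma> x = S \<sigma> * x * S (Hilbert_Choice.inv \<sigma>)"

lemma conj_mult:
 assumes "\<sigma> permutes {1..k}"
 shows "conj \<sigma> (x * y) = conj \<sigma> x * conj \<sigma> y"
proof -
 have "conj \<sigma> x * conj \<sigma> y = S \<sigma> * x * (S (Hilbert_Choice.inv \<sigma>) * S \<sigma>) * y * S (Hilbert_Choice.inv \<sigma>)"
  unfolding conj_def by (simp only: mult.assoc)
 thus ?thesis unfolding S_inv(2)[OF assms] conj_def by (simp add: mult.assoc)
qed

lemma conj_comp:
 assumes "\<sigma> permutes {1..k}" "\<tau> permutes {1..k}"
 shows "conj (\<sigma> \<circ> \<tau>) x = conj \<sigma> (conj \<tau> x)"
proof -
 have "Hilbert_Choice.inv (\<sigma> \<circ> \<tau>) = Hilbert_Choice.inv \<tau> \<circ> Hilbert_Choice.inv \<sigma>"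
  using permutes_bij[OF assms(1)] permutes_bij[OF assms(2)] by (rule o_inv_distrib)
 thus ?thesis unfolding conj_def
  using S_comp[OF assms] S_comp[OF permutes_inv[OF assms(2)] permutes_inv[OF assms(1)]] by (simp only: mult.assoc)
qed

lemma conj_eqI:
 assumes "\<sigma> permutes {1..k}" "S \<sigma> * x = y * S \<sigma>"
 shows "conj \<sigma> x = y"
 unfolding conj_def assms(2) mult.assoc S_inv(1)[OF assms(1)] by simp

lemma conj_D:
 assumes "\<sigma> permutes {1..k}"
 shows "S \<sigma> * x = conj \<sigma> x * S \<sigma>"
 unfolding conj_def mult.assoc S_inv(2)[OF assms] by simp

lemma conj_P: "\<sigma> permutes {1..k} ==> a \<in> {1..k} ==> conj \<sigma> (h (gen_p a)) = h (gen_p (\<sigma> a))"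
 by (rule conj_eqI) (auto intro: S_P)

text \<open>Two permutations agreeing at 1 and 2 differ by one that fixes both points, so
  \<open>S_stab\<close> applies.\<close>

lemma conj_stab:
 assumes s: "\<sigma> permutes {1..k}" and t: "\<tau> permutes {1..k}" and e: "\<sigma> 1 = \<tau> 1" "\<sigma> 2 = \<tau> 2"
 shows "conj \<sigma> (h (gen_ph 1)) = conj \<tau> (h (gen_ph 1))"
proof -
 define \<pi> where "\<pi> = Hilbert_Choice.inv \<sigma> \<circ> \<tau>"
 have p: "\<pi> permutes {1..k}" unfolding \<pi>_def by (rule permutes_compose[OF t permutes_inv[OF s]])
 have fix12: "\<pi> 1 = 1" "\<pi> 2 = 2" unfolding \<pi>_def comp_apply e[symmetric] by (rule permutes_inverses(2)[OF s])+
 have "\<pi> x = x" if "x \<notin> {3..k}" for x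
 proof -
  have "x = 1 \<or> x = 2 \<or> x \<notin> {1..k}" using that by auto
  thus ?thesis using fix12 permutes_not_in[OF p] by blast
 qed
 hence "\<pi> permutes {3..k}" using p unfolding permutes_def by blast
 hence "conj \<pi> (h (gen_ph 1)) = h (gen_ph 1)" using S_stab by (intro conj_eqI[OF p])
 moreover have "\<tau> = \<sigma> \<circ> \<pi>" unfolding \<pi>_def using permutes_inv_o(1)[OF s] by (simp only: o_assoc id_o)
 ultimately show ?thesis using conj_comp[OF s p] by simp
qed

text \<open>The value 1 on the diagonal allows products over reflexive relations without exceptions.
  Off the diagonal \<open>conj_stab\<close> makes the choice of the permutation irrelevant.\<close>

definition Q :: "nat => nat => 'm" where
 "Q a b = (if a = b then 1 else
   conj (SOME \<sigma>. \<sigma> permutes {1..k} \<and> \<sigma> 1 = a \<and> \<sigma> 2 = b) (h (gen_ph 1)))"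

lemma Q_conj:
 assumes s: "\<sigma> permutes {1..k}"
 shows "Q (\<sigma> 1) (\<sigma> 2) = conj \<sigma> (h (gen_ph 1))"
proof -
 let ?P = "\<lambda>\<tau>. \<tau> permutes {1..k} \<and> \<tau> 1 = \<sigma> 1 \<and> \<tau> 2 = \<sigma> 2"
 have "\<sigma> 1 \<noteq> \<sigma> 2" using permutes_inj[OF s] by (simp add: inj_eq)
 hence Q: "Q (\<sigma> 1) (\<sigma> 2) = conj (SOME \<tau>. ?P \<tau>) (h (gen_ph 1))" by (simp only: Q_def if_False)
 have "?P (SOME \<tau>. ?P \<tau>)" by (rule someI[of ?P \<sigma>]) (use s in blast)
 thus ?thesis unfolding Q using conj_stab[OF _ s] by blast
qed

lemma exists_perm:
 assumes "distinct xs" "set xs \<subseteq> {1..k}"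
 shows "\<exists>\<sigma>. \<sigma> permutes {1..k} \<and> (\<forall>i<length xs. \<sigma> (i + 1) = xs ! i)"
proof -
 let ?A = "{1..length xs}" and ?f = "\<lambda>i. xs ! (i - 1)"
 have "length xs \<le> k" using distinct_card[OF assms(1)] card_mono[OF _ assms(2)] by simp
 hence "?A \<subseteq> {1..k}" by simp
 moreover have "inj_on ?f ?A"
 proof (rule inj_onI)
  fix i j assume "i \<in> ?A" "j \<in> ?A" "?f i = ?f j"
  hence "i - 1 = j - 1" using nth_eq_iff_index_eq[OF assms(1), of "i - 1" "j - 1"] by auto
  thus "i = j" using \<open>i \<in> ?A\<close> \<open>j \<in> ?A\<close> by auto
 qed
 moreover have "?f ` ?A \<subseteq> {1..k}"
 proof
  fix y assume "y \<in> ?f ` ?A"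
  then obtain i where "i - 1 < length xs" "y = xs ! (i - 1)" by force
  thus "y \<in> {1..k}" using nth_mem assms(2) by blast
 qed
 ultimately obtain \<sigma> where "\<sigma> permutes {1..k}" "\<forall>x\<in>?A. \<sigma> x = ?f x"
  using exists_permutation_extending[of ?A "{1..k}" ?f] by blast
 thus ?thesis by (intro exI[of _ \<sigma>]) simp
qed

lemma exists_perm2:
 assumes "a \<in> {1..k}" "b \<in> {1..k}" "a \<noteq> b"
 obtains \<sigma> where "\<sigma> permutes {1..k}" "\<sigma> 1 = a" "\<sigma> 2 = b" "2 \<le> k"
proof -
 obtain \<sigma> where s: "\<sigma> permutes {1..k}" "\<forall>i<length [a, b]. \<sigma> (i + 1) = [a, b] ! i"
  using exists_perm[of "[a, b]"] assms by auto
 moreover have "\<sigma> 1 = a" "\<sigma> 2 = b" using s(2)[rule_format, of 0] s(2)[rule_format, of 1] by (simp_all add: numeral_2_eq_2)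
 moreover have "2 \<le> k" using assms by auto
 ultimately show ?thesis using that by blast
qed

lemma exists_perm3:
 assumes "a \<in> {1..k}" "b \<in> {1..k}" "c \<in> {1..k}" "a \<noteq> b" "a \<noteq> c" "b \<noteq> c"
 obtains \<sigma> where "\<sigma> permutes {1..k}" "\<sigma> 1 = a" "\<sigma> 2 = b" "\<sigma> 3 = c" "3 \<le> k"
proof -
 obtain \<sigma> where s: "\<sigma> permutes {1..k}" "\<forall>i<length [a, b, c]. \<sigma> (i + 1) = [a, b, c] ! i"
  using exists_perm[of "[a, b, c]"] assms by auto
 moreover have "\<sigma> 1 = a" "\<sigma> 2 = b" "\<sigma> 3 = c" using s(2)[rule_format, of 0] s(2)[rule_format, of 1] s(2)[rule_format, of 2]
  by (simp_all add: numeral_2_eq_2 numeral_3_eq_3)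
 moreover have "3 \<le> k" using assms by auto
 ultimately show ?thesis using that by blast
qed

lemma exists_perm4:
 assumes "a \<in> {1..k}" "b \<in> {1..k}" "c \<in> {1..k}" "d \<in> {1..k}" "a \<noteq> b" "a \<noteq> c" "b \<noteq> c" "a \<noteq> d" "b \<noteq> d" "c \<noteq> d"
 obtains \<sigma> where "\<sigma> permutes {1..k}" "\<sigma> 1 = a" "\<sigma> 2 = b" "\<sigma> 3 = c" "\<sigma> 4 = d" "4 \<le> k"
proof -
 obtain \<sigma> where s: "\<sigma> permutes {1..k}" "\<forall>i<length [a, b, c, d]. \<sigma> (i + 1) = [a, b, c, d] ! i"
  using exists_perm[of "[a, b, c, d]"] assms by auto
 moreover have "\<sigma> 1 = a" "\<sigma> 2 = b" "\<sigma> 3 = c" "\<sigma> 4 = d"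
  using s(2)[rule_format, of 0] s(2)[rule_format, of 1] s(2)[rule_format, of 2] s(2)[rule_format, of 3]
  by (simp_all add: numeral_2_eq_2 numeral_3_eq_3 eval_nat_numeral)
 moreover have "4 \<le> k" using assms by auto
 ultimately show ?thesis using that by blast
qed

lemma conj_Q:
 assumes s: "\<sigma> permutes {1..k}" and ab: "a \<in> {1..k}" "b \<in> {1..k}"
 shows "conj \<sigma> (Q a b) = Q (\<sigma> a) (\<sigma> b)"
proof (cases "a = b")
 case True
 thus ?thesis using S_inv(1)[OF s] by (simp add: Q_def conj_def)
next
 case False
 obtain \<tau> where t: "\<tau> permutes {1..k}" "\<tau> 1 = a" "\<tau> 2 = b" using exists_perm2[OF ab False] by blast
 have "Q ((\<sigma> \<circ> \<tau>) 1) ((\<sigma> \<circ> \<tau>) 2) = conj (\<sigma> \<circ> \<tau>) (h (gen_ph 1))"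
  by (rule Q_conj[OF permutes_compose[OF t(1) s]])
 thus ?thesis using conj_comp[OF s t(1)] Q_conj[OF t(1)] t(2,3) by simp
qed

lemma conj_S_transpose:
 assumes s: "\<sigma> permutes {1..k}" and ab: "a \<in> {1..k}" "b \<in> {1..k}"
 shows "conj \<sigma> (S (transpose a b)) = S (transpose (\<sigma> a) (\<sigma> b))"
proof (rule conj_eqI[OF s])
 have "\<sigma> a \<in> {1..k}" "\<sigma> b \<in> {1..k}" using ab permutes_in_image[OF s] by blast+
 note t = permutes_swap_id[OF ab] permutes_swap_id[OF this]
 have "\<sigma> \<circ> transpose a b = transpose (\<sigma> a) (\<sigma> b) \<circ> \<sigma>"
 proof
  fix x
  have e: "\<sigma> x = \<sigma> a <-> x = a" "\<sigma> x = \<sigma> b <-> x = b" using permutes_inj[OF s] by (simp_all only: inj_eq)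
  show "(\<sigma> \<circ> transpose a b) x = (transpose (\<sigma> a) (\<sigma> b) \<circ> \<sigma>) x"
   unfolding comp_apply Transposition.transpose_def e by (simp only: if_distrib[of \<sigma>])
 qed
 thus "S \<sigma> * S (transpose a b) = S (transpose (\<sigma> a) (\<sigma> b)) * S \<sigma>"
  using S_comp[OF s t(1)] S_comp[OF t(2) s] by simp
qed

lemma Q_12: "Q 1 2 = h (gen_ph 1)"
 using Q_conj[OF permutes_id] by (simp only: id_apply conj_def inv_id S_id mult_1_left mult_1_right)

text \<open>The relation s_i s_{i+1} p_{i+1/2} s_{i+1} s_i = p_{i+3/2} is conjugation by the
  permutation that moves the pair \<open>i\<close>, \<open>i + 1\<close> to \<open>i + 1\<close>,
  \<open>i + 2\<close>.\<close>

lemma Q_gen: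
 assumes "1 \<le> i" "i < k"
 shows "Q i (i + 1) = h (gen_ph i)"
 using assms
proof (induction i rule: dec_induct)
 case base
 thus ?case using Q_12 by (simp add: numeral_2_eq_2)
next
 case (step i)
 let ?s = "transpose i (i + 1)" and ?t = "transpose (i + 1) (i + 2)"
 have i: "1 \<le> i" "i + 1 < k" using step by auto
 have st: "?s permutes {1..k}" "?t permutes {1..k}" using i by (auto intro!: permutes_swap_id)
 have S: "S ?s = h (gen_s i)" "S ?t = h (gen_s (i + 1))"
  using S_gen[of i] S_gen[of "i + 1"] i by (simp_all add: add.assoc)
 have "conj (?s \<circ> ?t) (Q i (i + 1)) = Q (i + 1) (i + 2)"
  using conj_Q[OF permutes_compose[OF st(2,1)], of i "i + 1"] i by simp
 moreover have "conj (?s \<circ> ?t) (Q i (i + 1)) = conj ?s (conj ?t (h (gen_ph i)))"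
  using conj_comp[OF st] step.IH i by simp
 moreover have "\<dots> = h (gen_s i) * h (gen_s (i + 1)) * h (gen_ph i) * h (gen_s (i + 1)) * h (gen_s i)"
  unfolding conj_def inv_transpose_eq S by (simp only: mult.assoc)
 ultimately show ?case using ssqss[OF i] by simp
qed

lemma Q_23: "3 \<le> k ==> Q 2 3 = h (gen_ph 2)" and Q_34: "4 \<le> k ==> Q 3 4 = h (gen_ph 3)"
 using Q_gen[of 2] Q_gen[of 3] by simp_all

lemma Q_sym:
 assumes "a \<in> {1..k}" "b \<in> {1..k}"
 shows "Q a b = Q b a"
proof (cases "a = b")
 case False
 obtain \<sigma> where s: "\<sigma> permutes {1..k}" "\<sigma> 1 = a" "\<sigma> 2 = b" "2 \<le> k" using exists_perm2[OF assms False] by blast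
 let ?t = "transpose 1 (2 :: nat)"
 have t: "?t permutes {1..k}" using s(4) by (intro permutes_swap_id) auto
 have S: "S ?t = h (gen_s 1)" using S_gen[of 1] s(4) by (simp add: numeral_2_eq_2)
 have "conj ?t (h (gen_ph 1)) = h (gen_ph 1)" unfolding conj_def inv_transpose_eq S using s_q[of 1] q_s[of 1] s(4) by simp
 moreover have "conj ?t (h (gen_ph 1)) = Q 2 1" using Q_conj[OF t] by simp
 ultimately have "Q 2 1 = Q 1 2" using Q_12 by simp
 hence "conj \<sigma> (Q 2 1) = conj \<sigma> (Q 1 2)" by simp
 thus ?thesis using conj_Q[OF s(1), of 2 1] conj_Q[OF s(1), of 1 2] s by simp
qed simp

lemma Q_idem:
 assumes "a \<in> {1..k}" "b \<in> {1..k}"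
 shows "Q a b * Q a b = Q a b"
proof (cases "a = b")
 case True
 thus ?thesis by (simp add: Q_def)
next
 case False
 obtain \<sigma> where s: "\<sigma> permutes {1..k}" "\<sigma> 1 = a" "\<sigma> 2 = b" "2 \<le> k" using exists_perm2[OF assms False] by blast
 have "conj \<sigma> (h (gen_ph 1) * h (gen_ph 1)) = conj \<sigma> (h (gen_ph 1))" using q_idem[of 1] s(4) by simp
 thus ?thesis unfolding conj_mult[OF s(1)] Q_conj[OF s(1), symmetric] s(2,3) .
qed

lemma Q_comm_share:
 assumes "a \<in> {1..k}" "b \<in> {1..k}" "c \<in> {1..k}"
 shows "Q a b * Q b c = Q b c * Q a b"
proof (cases "a = b \<or> b = c \<or> a = c")
 case True
 thus ?thesis using Q_sym[OF assms(1,2)] by (auto simp: Q_def)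
next
 case False
 obtain \<sigma> where s: "\<sigma> permutes {1..k}" "\<sigma> 1 = a" "\<sigma> 2 = b" "\<sigma> 3 = c" "3 \<le> k"
  using exists_perm3[OF assms] False by blast
 have "Q 1 2 * Q 2 3 = Q 2 3 * Q 1 2" unfolding Q_12 Q_23[OF s(5)] using q_commute[of 1 2] s(5) by simp
 hence "conj \<sigma> (Q 1 2 * Q 2 3) = conj \<sigma> (Q 2 3 * Q 1 2)" by simp
 thus ?thesis unfolding conj_mult[OF s(1)] using conj_Q[OF s(1), of 1 2] conj_Q[OF s(1), of 2 3] s by simp
qed

text \<open>Up to conjugation and symmetry, pairs with a common point reduce to p_{3/2} and p_{5/2},
  disjoint pairs to p_{3/2} and p_{7/2}.\<close>

lemma Q_comm:
 assumes "a \<in> {1..k}" "b \<in> {1..k}" "c \<in> {1..k}" "d \<in> {1..k}"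
 shows "Q a b * Q c d = Q c d * Q a b"
proof (cases "a = b \<or> c = d")
 case True
 thus ?thesis by (auto simp: Q_def)
next
 case ne: False
 consider "b = c" | "a = c" | "b = d" | "a = d" | "a \<noteq> c" "b \<noteq> c" "a \<noteq> d" "b \<noteq> d" by blast
 thus ?thesis
 proof cases
  case 1
  thus ?thesis using Q_comm_share[OF assms(1,2,4)] by simp
 next
  case 2
  thus ?thesis using Q_comm_share[OF assms(2,1,4)] Q_sym[OF assms(1,2)] by simp
 next
  case 3
  thus ?thesis using Q_comm_share[OF assms(1,2,3)] Q_sym[OF assms(3,4)] by simp
 next
  case 4
  thus ?thesis using Q_comm_share[OF assms(2,1,3)] Q_sym[OF assms(1,2)] Q_sym[OF assms(3,4)] by simp
 next
  case 5
  obtain \<sigma> where s: "\<sigma> permutes {1..k}" "\<sigma> 1 = a" "\<sigma> 2 = b" "\<sigma> 3 = c" "\<sigma> 4 = d" "4 \<le> k"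
   using exists_perm4[OF assms] 5 ne by blast
  have "Q 1 2 * Q 3 4 = Q 3 4 * Q 1 2" unfolding Q_12 Q_34[OF s(6)] using q_commute[of 1 3] s(6) by simp
  hence "conj \<sigma> (Q 1 2 * Q 3 4) = conj \<sigma> (Q 3 4 * Q 1 2)" by simp
  thus ?thesis unfolding conj_mult[OF s(1)] using conj_Q[OF s(1), of 1 2] conj_Q[OF s(1), of 3 4] s by simp
 qed
qed

text \<open>With q_i = p_{i+1/2}, the third factor is s_2 q_1 s_2. Since q_2 absorbs s_2 and
  commutes with q_1, the product becomes q_1 q_2 q_1 s_2 = q_1 q_1 q_2 s_2 = q_1 q_2.\<close>

lemma Q_trans:
 assumes "a \<in> {1..k}" "b \<in> {1..k}" "c \<in> {1..k}"
 shows "Q a b * Q b c * Q a c = Q a b * Q b c"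
proof (cases "a = b \<or> b = c \<or> a = c")
 case True
 thus ?thesis using Q_idem[OF assms(1,3)] by (auto simp: Q_def[of b b] Q_def[of c c] Q_def[of a a])
next
 case False
 obtain \<sigma> where s: "\<sigma> permutes {1..k}" "\<sigma> 1 = a" "\<sigma> 2 = b" "\<sigma> 3 = c" "3 \<le> k"
  using exists_perm3[OF assms] False by blast
 let ?t = "transpose 2 (3 :: nat)" and ?q = "\<lambda>i. h (gen_ph i)"
 have t: "?t permutes {1..k}" using s(5) by (intro permutes_swap_id) auto
 have S: "S ?t = h (gen_s 2)" using S_gen[of 2] s(5) by simp
 have "conj ?t (?q 1) = Q 1 3" using Q_conj[OF t] by simp
 hence q13: "Q 1 3 = h (gen_s 2) * ?q 1 * h (gen_s 2)" unfolding conj_def inv_transpose_eq S by simp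
 have c: "?q 2 * ?q 1 = ?q 1 * ?q 2" using q_commute[of 1 2] s(5) by simp
 have "Q 1 2 * Q 2 3 * Q 1 3 = ?q 1 * (?q 2 * h (gen_s 2)) * ?q 1 * h (gen_s 2)"
  unfolding Q_12 Q_23[OF s(5)] q13 by (simp only: mult.assoc)
 also have "?q 2 * h (gen_s 2) = ?q 2" using q_s[of 2] s(5) by simp
 also have "?q 1 * ?q 2 * ?q 1 * h (gen_s 2) = ?q 1 * (?q 2 * ?q 1) * h (gen_s 2)" by (simp only: mult.assoc)
 also have "\<dots> = ?q 1 * ?q 1 * (?q 2 * h (gen_s 2))" unfolding c by (simp only: mult.assoc)
 also have "\<dots> = Q 1 2 * Q 2 3" unfolding Q_12 Q_23[OF s(5)] using q_s[of 2] q_idem[of 1] s(5) by simp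
 finally have "conj \<sigma> (Q 1 2 * Q 2 3 * Q 1 3) = conj \<sigma> (Q 1 2 * Q 2 3)" by simp
 thus ?thesis unfolding conj_mult[OF s(1)]
  using conj_Q[OF s(1), of 1 2] conj_Q[OF s(1), of 2 3] conj_Q[OF s(1), of 1 3] s by simp
qed

text \<open>The identities mixing cuts, merges and transpositions are checked on the first two or
  three points and transported by a permutation carrying these to the given ones.\<close>

sublocale partition_relations k S "\<lambda>a. h (gen_p a)" Q
proof
 show "S \<sigma> * Q a b = Q (\<sigma> a) (\<sigma> b) * S \<sigma>" if "\<sigma> permutes {1..k}" "a \<in> {1..k}" "b \<in> {1..k}" for \<sigma> a b
  using conj_D[OF that(1), of "Q a b"] conj_Q[OF that] by simp
 show "h (gen_p a) * h (gen_p a) = h (gen_p a)" if "a \<in> {1..k}" for a using p_idem that by simp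
 show "h (gen_p a) * h (gen_p b) = h (gen_p b) * h (gen_p a)" if "a \<in> {1..k}" "b \<in> {1..k}" for a b
 proof -
  consider "a = b" | "a < b" | "b < a" by linarith
  thus ?thesis using p_commute[of a b] p_commute[of b a] that by cases simp_all
 qed
 show "Q a a = 1" for a by (simp add: Q_def)
 show "h (gen_p c) * Q a b = Q a b * h (gen_p c)"
  if ab: "a \<in> {1..k}" "b \<in> {1..k}" "c \<in> {1..k}" "c \<noteq> a" "c \<noteq> b" for a b c
 proof (cases "a = b")
  case True
  thus ?thesis by (simp add: Q_def)
 next
  case False
  obtain \<sigma> where s: "\<sigma> permutes {1..k}" "\<sigma> 1 = a" "\<sigma> 2 = b" "\<sigma> 3 = c" "3 \<le> k"
   using exists_perm3[OF ab(1-3) False] ab(4,5) by blast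
  have "conj \<sigma> (h (gen_p 3) * h (gen_ph 1)) = conj \<sigma> (h (gen_ph 1) * h (gen_p 3))" using q1_p3[OF s(5)] by simp
  thus ?thesis unfolding conj_mult[OF s(1)] Q_conj[OF s(1), symmetric] using conj_P[OF s(1), of 3] s by simp
 qed
 show "h (gen_p a) * Q a b * h (gen_p a) = h (gen_p a)" if ab: "a \<in> {1..k}" "b \<in> {1..k}" "a \<noteq> b" for a b
 proof -
  obtain \<sigma> where s: "\<sigma> permutes {1..k}" "\<sigma> 1 = a" "\<sigma> 2 = b" "2 \<le> k" using exists_perm2[OF ab] by blast
  have "conj \<sigma> (h (gen_p 1) * h (gen_ph 1) * h (gen_p 1)) = conj \<sigma> (h (gen_p 1))" using pqp[OF s(4)] by simp
  thus ?thesis unfolding conj_mult[OF s(1)] Q_conj[OF s(1), symmetric] using conj_P[OF s(1), of 1] s by simp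
 qed
 show "Q a b * h (gen_p a) * Q a b = Q a b" if ab: "a \<in> {1..k}" "b \<in> {1..k}" "a \<noteq> b" for a b
 proof -
  obtain \<sigma> where s: "\<sigma> permutes {1..k}" "\<sigma> 1 = a" "\<sigma> 2 = b" "2 \<le> k" using exists_perm2[OF ab] by blast
  have "conj \<sigma> (h (gen_ph 1) * h (gen_p 1) * h (gen_ph 1)) = conj \<sigma> (h (gen_ph 1))" using qpq[OF s(4)] by simp
  thus ?thesis unfolding conj_mult[OF s(1)] Q_conj[OF s(1), symmetric] using conj_P[OF s(1), of 1] s by simp
 qed
 have S12: "S (transpose 1 2) = h (gen_s 1)" if "2 \<le> k" using S_gen[of 1] that by (simp add: numeral_2_eq_2)
 have tr: "S (transpose a a) = 1" for a using S_id by (simp only: transpose_same)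
 show "Q a b * S (transpose a b) = Q a b" if ab: "a \<in> {1..k}" "b \<in> {1..k}" for a b
 proof (cases "a = b")
  case True
  thus ?thesis using tr by simp
 next
  case False
  obtain \<sigma> where s: "\<sigma> permutes {1..k}" "\<sigma> 1 = a" "\<sigma> 2 = b" "2 \<le> k" using exists_perm2[OF ab False] by blast
  have "conj \<sigma> (h (gen_ph 1) * S (transpose 1 2)) = conj \<sigma> (h (gen_ph 1))" unfolding S12[OF s(4)] using q_s[of 1] s(4) by simp
  thus ?thesis unfolding conj_mult[OF s(1)] Q_conj[OF s(1), symmetric]
   using conj_S_transpose[OF s(1), of 1 2] s by simp
 qed
 show "h (gen_p a) * h (gen_p b) * S (transpose a b) = h (gen_p a) * h (gen_p b)" if ab: "a \<in> {1..k}" "b \<in> {1..k}" for a b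
 proof (cases "a = b")
  case True
  thus ?thesis using tr by simp
 next
  case False
  obtain \<sigma> where s: "\<sigma> permutes {1..k}" "\<sigma> 1 = a" "\<sigma> 2 = b" "2 \<le> k" using exists_perm2[OF ab False] by blast
  have "conj \<sigma> (h (gen_p 1) * h (gen_p 2) * S (transpose 1 2)) = conj \<sigma> (h (gen_p 1) * h (gen_p 2))"
   unfolding S12[OF s(4)] using pps[OF s(4)] by simp
  thus ?thesis unfolding conj_mult[OF s(1)]
   using conj_S_transpose[OF s(1), of 1 2] conj_P[OF s(1), of 1] conj_P[OF s(1), of 2] s by simp
 qed
qed (rule S_id S_comp S_P Q_sym Q_idem Q_comm Q_trans; assumption)+

end

lemma A_presentation: "monoid_presented_by (A_monoid k) (A_gens k) (A_rels k) (gen_diagram k)"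
proof (rule monoid_presented_byI[OF A_gens_valid A_set_eq A_rels_lists A_rels_sound])
 fix h :: "generator => generator list set endo" and u v
 assume rels: "\<And>u v. (u, v) \<in> A_rels k ==> word_prod h u = word_prod h v"
  and compat: "\<And>u v. u \<in> lists (A_gens k) ==> v \<in> lists (A_gens k) ==>
   word_prod h u = word_prod h v ==> act_word k u = act_word k v"
  and uv: "u \<in> lists (A_gens k)" "v \<in> lists (A_gens k)" "act_word k u = act_word k v"
 interpret partition_presentation k h by unfold_locales (rule rels, assumption, rule compat)
 show "word_prod h u = word_prod h v"
  by (rule partition_complete[OF _ _ _ uv]) (simp_all add: S_gen[symmetric] Q_gen[symmetric])
qed

theorem theorem1p11:
  fixes k :: nat
  assumes "k \<ge> 1"
  shows "monoid_presented_by (T_monoid k) (e_gens k) (T_rels k) (gen_diagram k) \<and>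
         monoid_presented_by (P_monoid k) (p_gens k) (P_rels k) (gen_diagram k) \<and>
         group_presented_by (S_monoid k) (s_gens k) (S_rels k) (gen_diagram k) \<and>
         monoid_presented_by (A_monoid k) (s_gens k \<union> p_gens k) (A_rels k) (gen_diagram k)"
  using T_presentation P_presentation S_presentation A_presentation by blast

end
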